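(* Let $\xi$ be a vector-valued space-time white noise on $\mathbb{R}\times\mathbb{T}^2$ and let $X^n$, $(X^n)^{\diamondsuit2}$, $Y^n$, $L_t^\kappa$ be as in the context. Let $\mathcal{N}\subset\Omega$ be a $\mathbb{P}$-null set such that $L_t^\kappa(\omega)<\infty$ for all $\omega\in\Omega\setminus\mathcal{N}$, $t\ge0$, $\kappa>0$. Let $\omega\in\Omega\setminus\mathcal{N}$, $\alpha\in(0,1)$, $\Psi^{\mathrm{in}}\in\dot H^{-1+\alpha}(\mathbb{T}^2)$ with zero mean, and $T>0$. Then there is a constant $C<\infty$, independent of $n\in\mathbb{N}$, such that the smooth solution $w^n$ on $[0,T]$ of $$\partial_tw^n+\Delta^2w^n=\Delta\Big((w^n)^3+3w^n(Y^n)^2+3(w^n)^2Y^n+(Y^n)^3+3\big((w^n)^2+2w^nY^n+(Y^n)^2\big)X^n+3w^n(X^n)^{\diamondsuit2}\Big),$$ $$w^n(0)=\mathcal{L}_n\Psi^{\mathrm{in}},$$ satisfies $$\sup_{t\in[0,T]}\|w^n(t)\|_{\dot H^{-1+\alpha}}^2+\int_0^T\Big(\|w^n(t)\|_{\dot H^{1+\alpha}}^2+\|w^n(t)\|_{L^{\frac{4}{1-\alpha}}}^4\Big)dt\le C.$$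
   Context: $\mathbb{T}^2=(\mathbb{R}/\mathbb{Z})^2$. $\Lambda^\gamma=(-\Delta)^{\gamma/2}$ is the Fourier multiplier with symbol $|k|^\gamma$ (up to normalization of frequencies); $\dot H^s$ consists of zero-mean distributions with $\|f\|_{\dot H^s}=\|\Lambda^sf\|_{L^2}<\infty$. $B^s_{p,q}$ are the inhomogeneous Besov spaces defined by Littlewood-Paley blocks $\Delta_m$, $m\ge-1$, with norm $\|(2^{sm}\|\Delta_mf\|_{L^p})_m\|_{\ell^q}$; $\mathscr{C}^s=B^s_{\infty,\infty}$; $C_t\mathscr{C}^s=C([0,t];\mathscr{C}^s(\mathbb{T}^2))$. $\xi=(\xi_1,\xi_2)$, defined on a probability space $(\Omega,\mathcal{F},\mathbb{P})$, is a centered distribution-valued Gaussian field with $\mathbb{E}[\xi_i(\phi)\xi_j(\psi)]=1_{\{i=j\}}\int_{\mathbb{R}\times\mathbb{T}^2}\phi\psi\,dx\,dt$ for all test functions $\phi,\psi$. Fix a smooth $\mathfrak{h}:[0,\infty)\to[0,\infty)$ with $\mathfrak{h}(r)=1$ for $r\ge1$ and $\mathfrak{h}(r)=0$ for $r\le\frac12$; set $\mathfrak{l}=1-\mathfrak{h}$, and let $\mathcal{L}_n$ be the Fourier multiplier with symbol $\mathfrak{l}(|k|/n)$. $X(t)=\int_0^te^{-(t-s)\Delta^2}\operatorname{div}\xi(s)\,ds$. For $n\in\mathbb{N}$: $X^n=\mathcal{L}_nX$, $$(X^n)^{\diamondsuit2}=(X^n)^2-\mathbb{E}[(X^n)^2],\qquad(X^n)^{\diamondsuit3}=(X^n)^3-3\,\mathbb{E}[(X^n)^2]\,X^n$$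 (expectations pointwise in $(t,x)$), and $Y^n$ is the solution of $$\partial_tY^n+\Delta^2Y^n=\Delta\big(3Y^n(X^n)^{\diamondsuit2}+(X^n)^{\diamondsuit3}\big),\qquad Y^n(0)=0.$$ For $t\ge0$, $\kappa>0$: $$L_t^{\kappa,n}=1+\|X^n\|_{C_t\mathscr{C}^{-\kappa}}+\|(X^n)^{\diamondsuit2}\|_{C_t\mathscr{C}^{-2\kappa}}+\|Y^n\|_{C_t\mathscr{C}^{2-4\kappa}},\qquad L_t^\kappa=\sup_{n\in\mathbb{N}}L_t^{\kappa,n}.$$ *)

theory Defs
  imports "HOL-Probability.Probability"
begin

section \<open>Smooth functions\<close>

definition pderiv_dir :: "'a::euclidean_space \<Rightarrow> ('a \<Rightarrow> real) \<Rightarrow> 'a \<Rightarrow> real" where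
  "pderiv_dir v f x = frechet_derivative f (at x) v"

primrec Ck :: "nat \<Rightarrow> ('a::euclidean_space \<Rightarrow> real) \<Rightarrow> bool" where
  "Ck 0 f \<longleftrightarrow> continuous_on UNIV f"
| "Ck (Suc k) f \<longleftrightarrow> f differentiable_on UNIV \<and> (\<forall>v\<in>Basis. Ck k (pderiv_dir v f))"

definition smooth :: "('a::euclidean_space \<Rightarrow> real) \<Rightarrow> bool" where
  "smooth f \<longleftrightarrow> (\<forall>k. Ck k f)"

text \<open>The following is only used for smooth functions with bounded derivatives, for which the
  suprema are finite.\<close>

primrec Ck_norm :: "nat \<Rightarrow> ('a::euclidean_space \<Rightarrow> real) \<Rightarrow> real" where
  "Ck_norm 0 f = (SUP x. \<bar>f x\<bar>)"
| "Ck_norm (Suc k) f = (SUP x. \<bar>f x\<bar>) + (\<Sum>v\<in>Basis. Ck_norm k (pderiv_dir v f))"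

section \<open>The torus, its distributions and Fourier multipliers\<close>

text \<open>Functions on the torus are 1-periodic functions on the plane; integrals over the torus are
  integrals over the unit square. Distributions are functionals whose values matter only on test
  functions.\<close>

type_synonym torus_dist = "(real^2 \<Rightarrow> real) \<Rightarrow> real"

definition freq :: "int^2 \<Rightarrow> real^2" where
  "freq k = (\<chi> i. real_of_int (k $ i))"

definition periodic :: "(real^2 \<Rightarrow> real) \<Rightarrow> bool" where
  "periodic f \<longleftrightarrow> (\<forall>k x. f (x + freq k) = f x)"

definition torus_test :: "(real^2 \<Rightarrow> real) \<Rightarrow> bool" where
  "torus_test \<phi> \<longleftrightarrow> periodic \<phi> \<and> smooth \<phi>"

definition torus_distribution :: "torus_dist \<Rightarrow> bool" where
  "torus_distribution u \<longleftrightarrow>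
     (\<forall>a b \<phi> \<psi>. torus_test \<phi> \<longrightarrow> torus_test \<psi> \<longrightarrow>
        u (\<lambda>x. a * \<phi> x + b * \<psi> x) = a * u \<phi> + b * u \<psi>) \<and>
     (\<exists>C k. \<forall>\<phi>. torus_test \<phi> \<longrightarrow> \<bar>u \<phi>\<bar> \<le> C * Ck_norm k \<phi>)"

definition dist_of :: "(real^2 \<Rightarrow> real) \<Rightarrow> torus_dist" where
  "dist_of f \<phi> = (LINT x:cbox 0 1|lborel. f x * \<phi> x)"

definition fourier :: "torus_dist \<Rightarrow> int^2 \<Rightarrow> complex" where
  "fourier u k = Complex (u (\<lambda>x. cos (2 * pi * (freq k \<bullet> x)))) (- u (\<lambda>x. sin (2 * pi * (freq k \<bullet> x))))"

text \<open>Fourier multiplier with symbol \<open>\<sigma>\<close>, in the cases in which the resulting Fourier series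
  converges absolutely. All symbols below are even, so that the series is real for real \<open>u\<close> and
  taking the real part in \<open>fmult\<close> loses nothing.\<close>

definition fmult_complex :: "(int^2 \<Rightarrow> real) \<Rightarrow> torus_dist \<Rightarrow> real^2 \<Rightarrow> complex" where
  "fmult_complex \<sigma> u x =
     (\<Sum>\<^sub>\<infinity>k. complex_of_real (\<sigma> k) * fourier u k * cis (2 * pi * (freq k \<bullet> x)))"

definition fmult :: "(int^2 \<Rightarrow> real) \<Rightarrow> torus_dist \<Rightarrow> real^2 \<Rightarrow> real" where
  "fmult \<sigma> u x = Re (fmult_complex \<sigma> u x)"

text \<open>\<open>(- \<Delta>)\<^sup>\<gamma>\<^sup>/\<^sup>2\<close> on distributions is defined by duality. The symbol vanishes at frequency 0 for
  every \<open>\<gamma>\<close>, because \<open>0 powr \<gamma> = 0\<close>.\<close>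

definition Lambda :: "real \<Rightarrow> torus_dist \<Rightarrow> torus_dist" where
  "Lambda \<gamma> u \<phi> = u (fmult (\<lambda>k. (2 * pi * norm (freq k)) powr \<gamma>) (dist_of \<phi>))"

definition biharm_semigroup :: "real \<Rightarrow> (real^2 \<Rightarrow> real) \<Rightarrow> real^2 \<Rightarrow> real" where
  "biharm_semigroup \<tau> \<phi> = fmult (\<lambda>k. exp (- \<tau> * (2 * pi * norm (freq k)) ^ 4)) (dist_of \<phi>)"

section \<open>Norms\<close>

text \<open>Norms take the value \<open>\<infinity>\<close> outside of the respective space.\<close>

definition torus_Lp_norm :: "real \<Rightarrow> (real^2 \<Rightarrow> real) \<Rightarrow> ennreal" where
  "torus_Lp_norm p f =
     (let I = (\<integral>\<^sup>+x\<in>cbox 0 1. ennreal (\<bar>f x\<bar> powr p) \<partial>lborel)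
      in if I = \<infinity> then \<infinity> else ennreal (enn2real I powr (1 / p)))"

text \<open>\<open>L\<^sup>2\<close>-norm of a distribution: infinite unless the distribution is represented by a square
  integrable function.\<close>

definition dist_L2_norm :: "torus_dist \<Rightarrow> ennreal" where
  "dist_L2_norm u = (INF g\<in>{g \<in> borel_measurable lborel.
      \<forall>\<phi>. torus_test \<phi> \<longrightarrow> u \<phi> = dist_of g \<phi>}. torus_Lp_norm 2 g)"

definition Hdot_norm :: "real \<Rightarrow> torus_dist \<Rightarrow> ennreal" where
  "Hdot_norm s u = dist_L2_norm (Lambda s u)"

definition Hdot :: "real \<Rightarrow> torus_dist set" where
  "Hdot s = {u. torus_distribution u \<and> fourier u 0 = 0 \<and> Hdot_norm s u < \<infinity>}"

definition supp :: "(real^2 \<Rightarrow> real) \<Rightarrow> (real^2) set" where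
  "supp f = closure {z. f z \<noteq> 0}"

definition dyadic_partition :: "(real^2 \<Rightarrow> real) \<Rightarrow> (real^2 \<Rightarrow> real) \<Rightarrow> bool" where
  "dyadic_partition \<theta> \<rho> \<longleftrightarrow>
     smooth \<theta> \<and> smooth \<rho> \<and> (\<forall>z. 0 \<le> \<theta> z) \<and> (\<forall>z. 0 \<le> \<rho> z) \<and>
     (\<forall>y z. norm y = norm z \<longrightarrow> \<theta> y = \<theta> z \<and> \<rho> y = \<rho> z) \<and>
     (\<exists>R. supp \<theta> \<subseteq> cball 0 R) \<and>
     (\<exists>a b. 0 < a \<and> supp \<rho> \<subseteq> {z. a \<le> norm z \<and> norm z \<le> b}) \<and>
     (\<forall>z. (\<lambda>j. \<rho> (z /\<^sub>R 2 ^ j)) sums (1 - \<theta> z)) \<and>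
     (\<forall>j\<ge>1. supp \<theta> \<inter> supp (\<lambda>z. \<rho> (z /\<^sub>R 2 ^ j)) = {}) \<and>
     (\<forall>i j. i + 1 < j \<longrightarrow> supp (\<lambda>z. \<rho> (z /\<^sub>R 2 ^ i)) \<inter> supp (\<lambda>z. \<rho> (z /\<^sub>R 2 ^ j)) = {})"

definition LP_block ::
    "(real^2 \<Rightarrow> real) \<Rightarrow> (real^2 \<Rightarrow> real) \<Rightarrow> int \<Rightarrow> torus_dist \<Rightarrow> real^2 \<Rightarrow> real" where
  "LP_block \<theta> \<rho> m u =
     fmult (\<lambda>k. if m = -1 then \<theta> (freq k) else \<rho> (2 powr (- of_int m) *\<^sub>R freq k)) u"

text \<open>Norm of \<open>B\<^sup>s\<close> with both integrability indices infinite. The blocks are trigonometric polynomials,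
  so that their essential supremum is their supremum.\<close>

definition Cs_norm :: "(real^2 \<Rightarrow> real) \<Rightarrow> (real^2 \<Rightarrow> real) \<Rightarrow> real \<Rightarrow> torus_dist \<Rightarrow> ennreal" where
  "Cs_norm \<theta> \<rho> s u =
     (SUP m\<in>{-1..}. ennreal (2 powr (s * of_int m)) * (SUP x. ennreal \<bar>LP_block \<theta> \<rho> m u x\<bar>))"

definition CtCs_norm ::
    "(real^2 \<Rightarrow> real) \<Rightarrow> (real^2 \<Rightarrow> real) \<Rightarrow> real \<Rightarrow> real \<Rightarrow> (real \<Rightarrow> torus_dist) \<Rightarrow> ennreal" where
  "CtCs_norm \<theta> \<rho> t s f =
     (if \<forall>r\<in>{0..t}. ((\<lambda>q. Cs_norm \<theta> \<rho> s (\<lambda>\<phi>. f q \<phi> - f r \<phi>)) \<longlongrightarrow> 0) (at r within {0..t})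
      then SUP r\<in>{0..t}. Cs_norm \<theta> \<rho> s (f r) else \<infinity>)"

section \<open>White noise and the stochastic convolution\<close>

text \<open>Functions on \<open>\<real> \<times> T\<^sup>2\<close>, periodic in the second argument.\<close>

definition st_test :: "(real \<times> (real^2) \<Rightarrow> real) \<Rightarrow> bool" where
  "st_test \<phi> \<longleftrightarrow> smooth \<phi> \<and> (\<forall>t. periodic (\<lambda>x. \<phi> (t, x))) \<and>
     (\<exists>R. \<forall>t x. R < \<bar>t\<bar> \<longrightarrow> \<phi> (t, x) = 0)"

definition st_distribution :: "((real \<times> (real^2) \<Rightarrow> real) \<Rightarrow> real) \<Rightarrow> bool" where
  "st_distribution u \<longleftrightarrow>
     (\<forall>a b \<phi> \<psi>. st_test \<phi> \<longrightarrow> st_test \<psi> \<longrightarrow>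
        u (\<lambda>z. a * \<phi> z + b * \<psi> z) = a * u \<phi> + b * u \<psi>) \<and>
     (\<forall>R. \<exists>C k. \<forall>\<phi>. st_test \<phi> \<longrightarrow> (\<forall>t x. R < \<bar>t\<bar> \<longrightarrow> \<phi> (t, x) = 0) \<longrightarrow>
        \<bar>u \<phi>\<bar> \<le> C * Ck_norm k \<phi>)"

definition gaussian_rv :: "'w measure \<Rightarrow> ('w \<Rightarrow> real) \<Rightarrow> bool" where
  "gaussian_rv M Z \<longleftrightarrow> Z \<in> borel_measurable M \<and>
     ((\<exists>c. AE \<omega> in M. Z \<omega> = c) \<or>
      (\<exists>\<mu> \<sigma>. 0 < \<sigma> \<and> distributed M lborel Z (\<lambda>x. ennreal (normal_density \<mu> \<sigma> x))))"

text \<open>Jointly Gaussian families: all finite linear combinations are (possibly degenerate) Gaussian.\<close>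

definition gaussian_family :: "'w measure \<Rightarrow> 'j set \<Rightarrow> ('j \<Rightarrow> 'w \<Rightarrow> real) \<Rightarrow> bool" where
  "gaussian_family M J Z \<longleftrightarrow>
     (\<forall>F c. finite F \<longrightarrow> F \<subseteq> J \<longrightarrow> gaussian_rv M (\<lambda>\<omega>. \<Sum>j\<in>F. c j * Z j \<omega>))"

type_synonym 'w noise = "2 \<Rightarrow> 'w \<Rightarrow> (real \<times> (real^2) \<Rightarrow> real) \<Rightarrow> real"

definition white_noise :: "'w measure \<Rightarrow> 'w noise \<Rightarrow> bool" where
  "white_noise M \<xi> \<longleftrightarrow>
     (\<forall>\<omega>\<in>space M. \<forall>i. st_distribution (\<xi> i \<omega>)) \<and>
     gaussian_family M (UNIV \<times> Collect st_test) (\<lambda>(i, \<phi>) \<omega>. \<xi> i \<omega> \<phi>) \<and>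
     (\<forall>i \<phi>. st_test \<phi> \<longrightarrow> integral\<^sup>L M (\<lambda>\<omega>. \<xi> i \<omega> \<phi>) = 0) \<and>
     (\<forall>i j \<phi> \<psi>. st_test \<phi> \<longrightarrow> st_test \<psi> \<longrightarrow>
        integral\<^sup>L M (\<lambda>\<omega>. \<xi> i \<omega> \<phi> * \<xi> j \<omega> \<psi>) =
        (if i = j then (LINT z:UNIV \<times> cbox 0 1|lborel. \<phi> z * \<psi> z) else 0))"

text \<open>\<open>Z\<close> is a version of the value \<open>\<Sum>i. \<xi> i (f i)\<close> of the extension of the noise to square
  integrable \<open>f\<close>, obtained by approximating \<open>f\<close> by test functions.\<close>

definition wiener_integral ::
    "'w measure \<Rightarrow> 'w noise \<Rightarrow> (2 \<Rightarrow> real \<times> (real^2) \<Rightarrow> real) \<Rightarrow> ('w \<Rightarrow> real) \<Rightarrow> bool" where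
  "wiener_integral M \<xi> f Z \<longleftrightarrow> Z \<in> borel_measurable M \<and>
     (\<exists>\<phi>. (\<forall>m i. st_test (\<phi> m i)) \<and>
        (\<forall>i. (\<lambda>m. \<integral>\<^sup>+z\<in>UNIV \<times> cbox 0 1. ennreal ((\<phi> m i z - f i z)\<^sup>2) \<partial>lborel) \<longlonglongrightarrow> 0) \<and>
        (\<lambda>m. \<integral>\<^sup>+\<omega>. ennreal (((\<Sum>i\<in>UNIV. \<xi> i \<omega> (\<phi> m i)) - Z \<omega>)\<^sup>2) \<partial>M) \<longlonglongrightarrow> 0)"

text \<open>\<open>X(t) = \<integral>\<^sub>0\<^sup>t exp(-(t-s)\<Delta>\<^sup>2) div \<xi>(s) ds\<close>, tested against \<open>\<phi>\<close>: the semigroup is symmetric and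
  the divergence is moved onto the test function with a minus sign. This determines \<open>X t\<close> up to
  modification.\<close>

definition stochastic_convolution ::
    "'w measure \<Rightarrow> 'w noise \<Rightarrow> (real \<Rightarrow> 'w \<Rightarrow> torus_dist) \<Rightarrow> bool" where
  "stochastic_convolution M \<xi> X \<longleftrightarrow>
     (\<forall>t\<ge>0. (\<forall>\<omega>\<in>space M. torus_distribution (X t \<omega>)) \<and>
        (\<forall>\<phi>. torus_test \<phi> \<longrightarrow>
           wiener_integral M \<xi>
             (\<lambda>i (s, x). - indicator {0..t} s *
                pderiv_dir (axis i 1) (biharm_semigroup (t - s) \<phi>) x)
             (\<lambda>\<omega>. X t \<omega> \<phi>)))"

section \<open>Regularised objects\<close>

text \<open>A cut-off function on \<open>[0,\<infinity>)\<close> that vanishes on \<open>[0,1/2]\<close> is identified with its smooth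
  extension by 0 to the negative half line.\<close>

definition high_cutoff :: "(real \<Rightarrow> real) \<Rightarrow> bool" where
  "high_cutoff h \<longleftrightarrow> smooth h \<and> (\<forall>r. 0 \<le> h r) \<and> (\<forall>r\<ge>1. h r = 1) \<and> (\<forall>r\<le>1/2. h r = 0)"

definition low_pass :: "(real \<Rightarrow> real) \<Rightarrow> nat \<Rightarrow> torus_dist \<Rightarrow> real^2 \<Rightarrow> real" where
  "low_pass h n = fmult (\<lambda>k. 1 - h (norm (freq k) / real n))"

context
  fixes M :: "'w measure" and h :: "real \<Rightarrow> real" and X :: "real \<Rightarrow> 'w \<Rightarrow> torus_dist"
begin

definition Xn :: "nat \<Rightarrow> 'w \<Rightarrow> real \<Rightarrow> real^2 \<Rightarrow> real" where
  "Xn n \<omega> t x = low_pass h n (X t \<omega>) x"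

definition Xn_wick2 :: "nat \<Rightarrow> 'w \<Rightarrow> real \<Rightarrow> real^2 \<Rightarrow> real" where
  "Xn_wick2 n \<omega> t x = (Xn n \<omega> t x)\<^sup>2 - integral\<^sup>L M (\<lambda>\<omega>'. (Xn n \<omega>' t x)\<^sup>2)"

definition Xn_wick3 :: "nat \<Rightarrow> 'w \<Rightarrow> real \<Rightarrow> real^2 \<Rightarrow> real" where
  "Xn_wick3 n \<omega> t x =
     (Xn n \<omega> t x) ^ 3 - 3 * integral\<^sup>L M (\<lambda>\<omega>'. (Xn n \<omega>' t x)\<^sup>2) * Xn n \<omega> t x"

end

section \<open>Classical solutions\<close>

definition laplacian :: "(real^2 \<Rightarrow> real) \<Rightarrow> real^2 \<Rightarrow> real" where
  "laplacian f x = (\<Sum>v\<in>Basis. pderiv_dir v (pderiv_dir v f) x)"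

text \<open>All spatial derivatives up to order \<open>k\<close> exist and are jointly continuous on \<open>I \<times> T\<^sup>2\<close>.\<close>

primrec Ck_space :: "nat \<Rightarrow> real set \<Rightarrow> (real \<Rightarrow> real^2 \<Rightarrow> real) \<Rightarrow> bool" where
  "Ck_space 0 I w \<longleftrightarrow> continuous_on (I \<times> UNIV) (\<lambda>(t, x). w t x)"
| "Ck_space (Suc k) I w \<longleftrightarrow> continuous_on (I \<times> UNIV) (\<lambda>(t, x). w t x) \<and>
     (\<forall>t\<in>I. w t differentiable_on UNIV) \<and>
     (\<forall>v\<in>Basis. Ck_space k I (\<lambda>t. pderiv_dir v (w t)))"

text \<open>\<open>w\<close> is a smooth solution of \<open>\<partial>\<^sub>t w + \<Delta>\<^sup>2 w = \<Delta> F\<close> on the time interval \<open>I\<close>: smooth in space,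
  locally uniformly in time, and differentiable in time. As \<open>F\<close> involves the regularised noise, which
  is merely continuous in time, no higher regularity in time is available.\<close>

definition smooth_solution ::
    "real set \<Rightarrow> (real \<Rightarrow> real^2 \<Rightarrow> real) \<Rightarrow> (real \<Rightarrow> real^2 \<Rightarrow> real) \<Rightarrow> bool" where
  "smooth_solution I F w \<longleftrightarrow>
     (\<forall>t\<in>I. periodic (w t)) \<and> (\<forall>k. Ck_space k I w) \<and>
     (\<forall>t\<in>I. \<forall>x. ((\<lambda>s. w s x) has_real_derivative
        (laplacian (F t) x - laplacian (laplacian (w t)) x)) (at t within I))"

definition Y_solution ::
    "'w measure \<Rightarrow> (real \<Rightarrow> real) \<Rightarrow> (real \<Rightarrow> 'w \<Rightarrow> torus_dist) \<Rightarrow> nat \<Rightarrow> 'w \<Rightarrow>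
     (real \<Rightarrow> real^2 \<Rightarrow> real) \<Rightarrow> bool" where
  "Y_solution M h X n \<omega> Y \<longleftrightarrow>
     smooth_solution {0..}
       (\<lambda>t x. 3 * Y t x * Xn_wick2 M h X n \<omega> t x + Xn_wick3 M h X n \<omega> t x) Y \<and>
     (\<forall>x. Y 0 x = 0)"

definition L_n ::
    "'w measure \<Rightarrow> (real \<Rightarrow> real) \<Rightarrow> (real^2 \<Rightarrow> real) \<Rightarrow> (real^2 \<Rightarrow> real) \<Rightarrow>
     (real \<Rightarrow> 'w \<Rightarrow> torus_dist) \<Rightarrow> (nat \<Rightarrow> 'w \<Rightarrow> real \<Rightarrow> real^2 \<Rightarrow> real) \<Rightarrow>
     real \<Rightarrow> nat \<Rightarrow> real \<Rightarrow> 'w \<Rightarrow> ennreal" where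
  "L_n M h \<theta> \<rho> X Y \<kappa> n t \<omega> =
     1 + CtCs_norm \<theta> \<rho> t (- \<kappa>) (\<lambda>r. dist_of (Xn h X n \<omega> r))
       + CtCs_norm \<theta> \<rho> t (- 2 * \<kappa>) (\<lambda>r. dist_of (Xn_wick2 M h X n \<omega> r))
       + CtCs_norm \<theta> \<rho> t (2 - 4 * \<kappa>) (\<lambda>r. dist_of (Y n \<omega> r))"

definition L_sup ::
    "'w measure \<Rightarrow> (real \<Rightarrow> real) \<Rightarrow> (real^2 \<Rightarrow> real) \<Rightarrow> (real^2 \<Rightarrow> real) \<Rightarrow>
     (real \<Rightarrow> 'w \<Rightarrow> torus_dist) \<Rightarrow> (nat \<Rightarrow> 'w \<Rightarrow> real \<Rightarrow> real^2 \<Rightarrow> real) \<Rightarrow>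
     real \<Rightarrow> real \<Rightarrow> 'w \<Rightarrow> ennreal" where
  "L_sup M h \<theta> \<rho> X Y \<kappa> t \<omega> = (SUP n\<in>{1..}. L_n M h \<theta> \<rho> X Y \<kappa> n t \<omega>)"

definition w_solution ::
    "'w measure \<Rightarrow> (real \<Rightarrow> real) \<Rightarrow> (real \<Rightarrow> 'w \<Rightarrow> torus_dist) \<Rightarrow>
     (nat \<Rightarrow> 'w \<Rightarrow> real \<Rightarrow> real^2 \<Rightarrow> real) \<Rightarrow> real \<Rightarrow> torus_dist \<Rightarrow> nat \<Rightarrow> 'w \<Rightarrow>
     (real \<Rightarrow> real^2 \<Rightarrow> real) \<Rightarrow> bool" where
  "w_solution M h X Y T \<Psi> n \<omega> w \<longleftrightarrow>
     smooth_solution {0..T}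
       (\<lambda>t x. (w t x) ^ 3 + 3 * w t x * (Y n \<omega> t x)\<^sup>2 + 3 * (w t x)\<^sup>2 * Y n \<omega> t x + (Y n \<omega> t x) ^ 3
          + 3 * ((w t x)\<^sup>2 + 2 * w t x * Y n \<omega> t x + (Y n \<omega> t x)\<^sup>2) * Xn h X n \<omega> t x
          + 3 * w t x * Xn_wick2 M h X n \<omega> t x) w \<and>
     (\<forall>x. w 0 x = low_pass h n \<Psi> x)"

end

theory Submission
  imports Defs
begin

text \<open>
  The equation is tested against \<open>b(D) w\<close>, where \<open>(2 \<pi> |k|)\<^sup>2 b(k) = m(k)\<close> and
  \<open>m(k) = \<Sum>\<^sub>i\<^sub>,\<^sub>j 4\<^sup>\<alpha>\<^sup>j |exp (2 \<pi> \<i> k\<^sub>i / 2\<^sup>j) - 1|\<^sup>2\<close> is comparable to \<open>|k|\<^sup>2\<^sup>\<alpha>\<close>. By Parseval the leading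
  term becomes \<open>\<Sum>\<^sub>i\<^sub>,\<^sub>j 4\<^sup>\<alpha>\<^sup>j \<integral> D\<^sub>i\<^sub>j(w\<^sup>3) D\<^sub>i\<^sub>j w\<close> with the dyadic differences
  \<open>D\<^sub>i\<^sub>j f = f(\<cdot> + 2\<^sup>-\<^sup>j e\<^sub>i) - f\<close>. Since \<open>(a\<^sup>3 - b\<^sup>3) (a - b)\<close> dominates \<open>(a\<^sup>2 - b\<^sup>2)\<^sup>2\<close> up to a
  constant, it controls \<open>w\<^sup>2\<close> in \<open>H\<^sup>\<alpha>\<close>, and the critical Sobolev embedding then bounds \<open>w\<close> in
  \<open>L\<^sup>p\<close> with \<open>p = 4 / (1 - \<alpha>)\<close>. In the lower order terms, \<open>X\<^sup>n\<close> and its Wick square have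
  negative Besov norms bounded uniformly in \<open>n\<close>, while \<open>Y\<^sup>n\<close> is bounded in a weighted Wiener algebra;
  pairing Littlewood-Paley blocks with products of fractional Sobolev functions, these terms are
  absorbed into half of the good ones. The energy balance
  is taken over finitely many frequencies, so that no infinite sum has to be differentiated.
\<close>

section \<open>Characters and trigonometric polynomials\<close>

text \<open>Passing from |k|^(2 \<alpha>) to \<open>msym\<close> costs only constants but expresses
  the symbol through translations. The monotonicity of the cube compares two values of
  \<open>w\<close> pointwise and is invisible to a Fourier multiplier as such. Dyadic steps in the
  coordinate directions replace the usual integral over all shifts, so that Parseval has to exchange
  sums only.

  The auxiliary order \<open>s\<close> obeys two constraints. The good term controls
  \<open>w\<close> in order \<open>s\<close> only for 2 s < \<alpha>, because trading a square for a
  fourth power costs a factor that is geometric in the scale. The test function carries 2 \<alpha>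
  derivatives more than \<open>w\<close> after its Laplacian is taken, while the dissipation
  controls 1 + \<alpha>; measuring it in order \<open>s\<close> with a small coefficient needs s +
  \<alpha> < 1. The weight of the Wiener algebra is above \<open>s\<close>, and the embedding into
  it loses one derivative, half of the dimension.

  Final constants see the noise only through the bound for \<open>L_sup\<close>, uniform in
  \<open>n\<close>. Band limits and suprema of derivatives do depend on \<open>n\<close>; they
  justify exchanges of sums, integrals and derivatives and never reach the final bound.\<close>

definition echar :: "int^2 \<Rightarrow> real^2 \<Rightarrow> complex" where
  "echar k x = cis (2 * pi * (freq k \<bullet> x))"

lemma freq_add: "freq (k + l) = freq k + freq l"
  and freq_uminus: "freq (- k) = - freq k"
  and freq_diff: "freq (k - l) = freq k - freq l"
  and freq_0 [simp]: "freq 0 = 0"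
  by (simp_all add: freq_def vec_eq_iff)

lemma freq_nth [simp]: "freq k $ i = real_of_int (k $ i)"
  by (simp add: freq_def)

lemma freq_eq_0_iff [simp]: "freq k = 0 \<longleftrightarrow> k = 0"
  by (simp add: vec_eq_iff)

lemma inner_freq: "freq k \<bullet> freq l = real_of_int (\<Sum>i\<in>UNIV. k $ i * l $ i)"
  by (simp add: inner_vec_def)

lemma cis_2pi_int [simp]: "cis (2 * pi * real_of_int n) = 1"
  by (simp add: cis_multiple_2pi)

lemma echar_add_freq: "echar (k + l) x = echar k x * echar l x"
  by (simp add: echar_def freq_add inner_add_left distrib_left cis_mult)

lemma echar_add_point: "echar k (x + y) = echar k x * echar k y"
  by (simp add: echar_def inner_add_right distrib_left cis_mult)

lemma cnj_echar: "cnj (echar k x) = echar (- k) x"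
  by (simp add: echar_def cis_cnj freq_uminus)

lemma norm_echar [simp]: "cmod (echar k x) = 1"
  by (simp add: echar_def)

lemma echar_0 [simp]: "echar 0 x = 1" "echar k 0 = 1"
  by (simp_all add: echar_def)

lemma echar_freq [simp]: "echar k (freq l) = 1"
  by (simp only: echar_def inner_freq cis_2pi_int)

lemma continuous_on_cis [continuous_intros]:
  "continuous_on S f \<Longrightarrow> continuous_on S (\<lambda>x. cis (f x))"
  by (auto simp: cis_conv_exp intro!: continuous_intros)

lemma continuous_echar [continuous_intros]:
  "continuous_on S f \<Longrightarrow> continuous_on S (\<lambda>x. echar k (f x))"
  unfolding echar_def by (intro continuous_intros)

text \<open>Lebesgue measure is the image of a finite product of one-dimensional Lebesgue measures
  under the coordinate map, so the product formula applies. It reduces integrals of characters over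
  the square to one dimension.\<close>

lemma integral_lborel_prod:
  fixes f :: "'a::euclidean_space \<Rightarrow> real \<Rightarrow> complex"
  assumes f: "\<And>b. b \<in> Basis \<Longrightarrow> integrable lborel (f b)"
  shows "(\<integral>x. (\<Prod>b\<in>Basis. f b (x \<bullet> b)) \<partial>lborel) = (\<Prod>b\<in>Basis. \<integral>x. f b x \<partial>lborel)"
proof -
  interpret product_sigma_finite "\<lambda>_. lborel :: real measure" ..
  have [measurable]: "f b \<in> borel_measurable borel" if "b \<in> Basis" for b
    using borel_measurable_integrable[OF f[OF that]] by simp
  have "(\<integral>x. (\<Prod>b\<in>Basis. f b (x \<bullet> b)) \<partial>lborel) =
     (\<integral>x. (\<Prod>b\<in>Basis. f b ((\<Sum>c\<in>Basis. x c *\<^sub>R c) \<bullet> b)) \<partial>(\<Pi>\<^sub>M b\<in>Basis. lborel))"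
    by (subst lborel_eq, subst integral_distr) auto
  also have "\<dots> = (\<integral>x. (\<Prod>b\<in>Basis. f b (x b)) \<partial>(\<Pi>\<^sub>M b\<in>Basis. lborel))"
    by (intro Bochner_Integration.integral_cong prod.cong refl) simp
  also have "\<dots> = (\<Prod>b\<in>Basis. \<integral>x. f b x \<partial>lborel)"
    using f by (intro product_integral_prod) auto
  finally show ?thesis .
qed

lemma integral_cis_int:
  "(LINT x:{0..1}|lborel. cis (2 * pi * (real_of_int n * x))) = (if n = 0 then 1 else 0)"
proof -
  have int: "integral {0..1} (\<lambda>x. cis (2 * pi * (real_of_int n * x))) = (if n = 0 then 1 else 0)"
  proof (cases "n = 0")
    case False
    let ?F = "\<lambda>x. cis (2 * pi * (real_of_int n * x)) / (2 * pi * real_of_int n * \<i>)"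
    have "((\<lambda>x. cis (2 * pi * (real_of_int n * x))) has_integral (?F 1 - ?F 0)) {0..1}"
    proof (rule fundamental_theorem_of_calculus)
      show "(?F has_vector_derivative cis (2 * pi * (real_of_int n * x))) (at x within {0..1})" for x
        unfolding cis_conv_exp using False
        by (auto intro!: derivative_eq_intros has_vector_derivative_real_field)
    qed simp
    then have "integral {0..1} (\<lambda>x. cis (2 * pi * (real_of_int n * x))) = ?F 1 - ?F 0"
      by (rule integral_unique)
    then show ?thesis using False by simp
  qed simp
  show ?thesis
    by (subst set_borel_integral_eq_integral)
      (auto simp: int intro!: borel_integrable_compact continuous_intros simp: set_integrable_def)
qed

lemma set_integrable_cbox_continuous:
  fixes f :: "'a::euclidean_space \<Rightarrow> 'b::euclidean_space"
  assumes "continuous_on (cbox a b) f"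
  shows "set_integrable lborel (cbox a b) f"
  unfolding set_integrable_def using assms by (intro borel_integrable_compact) auto

lemma set_lborel_integral_cbox:
  fixes f :: "'a::euclidean_space \<Rightarrow> 'b::euclidean_space"
  assumes "continuous_on (cbox a b) f"
  shows "(LINT x:cbox a b|lborel. f x) = integral (cbox a b) f"
  by (intro set_borel_integral_eq_integral set_integrable_cbox_continuous assms)

lemma integral_echar: "integral (cbox 0 1) (echar k) = (if k = 0 then 1 else 0)"
proof -
  let ?f = "\<lambda>b x. indicator {0..1} x *\<^sub>R cis (2 * pi * ((freq k \<bullet> b) * x))"
  have b: "\<exists>n. freq k \<bullet> b = real_of_int n" if "b \<in> Basis" for b
    using that by (auto simp: Basis_vec_def inner_axis)
  have 1: "indicator (cbox 0 1) x *\<^sub>R echar k x = (\<Prod>b\<in>Basis. ?f b (x \<bullet> b))" for x :: "real^2"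
  proof -
    have "freq k \<bullet> x = (\<Sum>b\<in>Basis. (freq k \<bullet> b) * (x \<bullet> b))"
      by (rule euclidean_inner)
    then have "echar k x = (\<Prod>b\<in>Basis. cis (2 * pi * ((freq k \<bullet> b) * (x \<bullet> b))))"
      by (simp add: echar_def sum_distrib_left cis_conv_exp exp_sum sum_distrib_right)
    moreover have "indicator (cbox 0 1) x = (\<Prod>b\<in>Basis. indicator {0..1} (x \<bullet> b) :: real)"
    proof (cases "x \<in> cbox 0 1")
      case False
      then obtain i where "x $ i \<notin> {0..1}"
        by (auto simp: mem_box_cart)
      then show ?thesis using False
        by (auto intro!: prod_zero[symmetric] bexI[of _ "axis i 1"] exI[of _ i] simp: Basis_vec_def inner_axis)
    next
      case True
      then have "\<forall>b\<in>Basis. indicator {0..1} (x \<bullet> b) = (1 :: real)"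
        by (auto simp: mem_box_cart Basis_vec_def inner_axis)
      then show ?thesis using True by simp
    qed
    ultimately show ?thesis by (simp add: scaleR_conv_of_real prod.distrib)
  qed
  have "integral (cbox 0 1) (echar k) = (\<integral>x. indicator (cbox 0 1) x *\<^sub>R echar k x \<partial>lborel)"
    by (subst set_lborel_integral_cbox[symmetric])
       (auto intro!: continuous_intros simp: set_lebesgue_integral_def)
  also have "\<dots> = (\<Prod>b\<in>Basis. \<integral>x. ?f b x \<partial>lborel)"
    unfolding 1
    by (rule integral_lborel_prod) (auto intro!: borel_integrable_compact continuous_intros)
  also have "\<dots> = (\<Prod>b\<in>Basis. if freq k \<bullet> b = 0 then 1 else 0)"
  proof (rule prod.cong[OF refl])
    fix b :: "real^2" assume "b \<in> Basis"
    then obtain n where n: "freq k \<bullet> b = real_of_int n" using b by blast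
    show "(\<integral>x. ?f b x \<partial>lborel) = (if freq k \<bullet> b = 0 then 1 else 0)"
      using integral_cis_int[of n] unfolding n set_lebesgue_integral_def by simp
  qed
  also have "\<dots> = (if k = 0 then 1 else 0)"
  proof (cases "k = 0")
    case False
    then obtain i where "k $ i \<noteq> 0" by (auto simp: vec_eq_iff)
    then have "freq k \<bullet> axis i 1 \<noteq> 0" by (simp add: inner_axis)
    then show ?thesis using False by (auto intro!: prod_zero bexI[of _ "axis i 1"] simp: Basis_vec_def)
  qed simp
  finally show ?thesis .
qed


text \<open>The working class of functions: continuity makes every integral over the closed unit
  square exist, and periodicity makes these integrals invariant under translation.\<close>

definition cper :: "(real^2 \<Rightarrow> complex) \<Rightarrow> bool" where
  "cper f \<longleftrightarrow> continuous_on UNIV f \<and> (\<forall>k x. f (x + freq k) = f x)"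

lemma cperD:
  assumes "cper f"
  shows "continuous_on S f" "f (x + freq k) = f x"
  using assms continuous_on_subset[of UNIV f S] by (auto simp: cper_def)

lemma cper_const [intro]: "cper (\<lambda>x. c)"
  by (simp add: cper_def)

lemma cper_echar [intro]: "cper (echar k)" "cper (\<lambda>x. echar k x)"
  by (auto simp: cper_def echar_add_point intro!: continuous_intros)

lemma cper_add [intro]: "cper f \<Longrightarrow> cper g \<Longrightarrow> cper (\<lambda>x. f x + g x)"
  and cper_diff [intro]: "cper f \<Longrightarrow> cper g \<Longrightarrow> cper (\<lambda>x. f x - g x)"
  and cper_mult [intro]: "cper f \<Longrightarrow> cper g \<Longrightarrow> cper (\<lambda>x. f x * g x)"
  and cper_cnj [intro]: "cper f \<Longrightarrow> cper (\<lambda>x. cnj (f x))"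
  and cper_uminus [intro]: "cper f \<Longrightarrow> cper (\<lambda>x. - f x)"
  unfolding cper_def by (auto intro!: continuous_intros)

lemma cper_cmod: "cper f \<Longrightarrow> cper (\<lambda>x. complex_of_real ((cmod (f x))\<^sup>2))"
  unfolding cper_def by (auto intro!: continuous_intros)

lemma cper_sum [intro]: "(\<And>i. i \<in> I \<Longrightarrow> cper (f i)) \<Longrightarrow> cper (\<lambda>x. \<Sum>i\<in>I. f i x)"
  by (induction I rule: infinite_finite_induct) auto

lemma cper_translate [intro]: "cper f \<Longrightarrow> cper (\<lambda>x. f (x + z))"
proof -
  assume f: "cper f"
  have "f (x + freq k + z) = f (x + z)" for k x
    using cperD(2)[OF f, of "x + z" k] by (simp add: ac_simps)
  moreover have "continuous_on UNIV (\<lambda>x. f (x + z))"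
    by (intro continuous_on_compose2[OF cperD(1)[OF f, of UNIV]] continuous_intros) auto
  ultimately show ?thesis by (simp add: cper_def)
qed

definition trigpoly :: "(real^2 \<Rightarrow> complex) \<Rightarrow> bool" where
  "trigpoly f \<longleftrightarrow> (\<exists>S c. finite S \<and> f = (\<lambda>x. \<Sum>k\<in>S. c k * echar k x))"

lemma trigpoly_cper: "trigpoly f \<Longrightarrow> cper f"
  by (auto simp: trigpoly_def intro!: cper_sum cper_mult cper_const cper_echar)

lemma trigpoly_term: "trigpoly (\<lambda>x. c * echar k x)"
  unfolding trigpoly_def by (rule exI[of _ "{k}"], rule exI[of _ "\<lambda>_. c"]) simp

lemma trigpoly_const: "trigpoly (\<lambda>x. c)"
  using trigpoly_term[of c 0] by simp

lemma trigpoly_add: "trigpoly f \<Longrightarrow> trigpoly g \<Longrightarrow> trigpoly (\<lambda>x. f x + g x)"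
proof -
  assume "trigpoly f" "trigpoly g"
  then obtain S c T d where S: "finite S" "finite T"
    and fg: "f = (\<lambda>x. \<Sum>k\<in>S. c k * echar k x)" "g = (\<lambda>x. \<Sum>k\<in>T. d k * echar k x)"
    unfolding trigpoly_def by blast
  have f: "f x = (\<Sum>k\<in>S \<union> T. (if k \<in> S then c k else 0) * echar k x)" for x
    unfolding fg using S by (intro sum.mono_neutral_cong_left) auto
  have g: "g x = (\<Sum>k\<in>S \<union> T. (if k \<in> T then d k else 0) * echar k x)" for x
    unfolding fg using S by (intro sum.mono_neutral_cong_left) auto
  have "(\<lambda>x. f x + g x) =
      (\<lambda>x. \<Sum>k\<in>S \<union> T. ((if k \<in> S then c k else 0) + (if k \<in> T then d k else 0)) * echar k x)"
    unfolding f g sum.distrib[symmetric] distrib_right ..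
  then show ?thesis using S by (auto simp only: trigpoly_def intro!: exI[of _ "S \<union> T"] exI[of _ "\<lambda>k. (if k \<in> S then c k else 0) + (if k \<in> T then d k else 0)"])
qed

lemma trigpoly_sum: "(\<And>i. i \<in> I \<Longrightarrow> trigpoly (f i)) \<Longrightarrow> trigpoly (\<lambda>x. \<Sum>i\<in>I. f i x)"
  by (induction I rule: infinite_finite_induct) (auto intro: trigpoly_const trigpoly_add)

lemma trigpoly_mult: "trigpoly f \<Longrightarrow> trigpoly g \<Longrightarrow> trigpoly (\<lambda>x. f x * g x)"
proof -
  assume "trigpoly f" "trigpoly g"
  then obtain S c T d where S: "finite S" "finite T"
    and fg: "f = (\<lambda>x. \<Sum>k\<in>S. c k * echar k x)" "g = (\<lambda>x. \<Sum>k\<in>T. d k * echar k x)"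
    unfolding trigpoly_def by blast
  have "(\<lambda>x. f x * g x) = (\<lambda>x. \<Sum>k\<in>S. \<Sum>l\<in>T. (c k * d l) * echar (k + l) x)"
    unfolding fg sum_product by (simp add: echar_add_freq mult_ac)
  then show ?thesis by (auto intro!: trigpoly_sum trigpoly_term)
qed

lemma trigpoly_cmult: "trigpoly f \<Longrightarrow> trigpoly (\<lambda>x. c * f x)"
  by (intro trigpoly_mult trigpoly_const)

lemma trigpoly_cnj: "trigpoly f \<Longrightarrow> trigpoly (\<lambda>x. cnj (f x))"
proof -
  assume "trigpoly f"
  then obtain S c where S: "finite S"
    and f: "f = (\<lambda>x. \<Sum>k\<in>S. c k * echar k x)"
    unfolding trigpoly_def by blast
  show ?thesis unfolding f cnj_sum complex_cnj_mult cnj_echar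
    by (intro trigpoly_sum trigpoly_term)
qed

lemma trigpoly_Re: "trigpoly f \<Longrightarrow> trigpoly (\<lambda>x. complex_of_real (Re (f x)))"
  and trigpoly_Im: "trigpoly f \<Longrightarrow> trigpoly (\<lambda>x. complex_of_real (Im (f x)))"
proof -
  assume f: "trigpoly f"
  have "complex_of_real (Re z) = (1/2) * (z + cnj z)" "complex_of_real (Im z) = (- \<i>/2) * (z + (- 1) * cnj z)" for z
    by (auto simp: complex_eq_iff)
  then show "trigpoly (\<lambda>x. complex_of_real (Re (f x)))" "trigpoly (\<lambda>x. complex_of_real (Im (f x)))"
    using f by (auto intro!: trigpoly_cmult trigpoly_add trigpoly_cnj simp only:)
qed

text \<open>A continuous periodic function is a continuous function on the product of two circles, to which
  the Stone-Weierstrass theorem applies.\<close>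

lemma trigpoly_dense_real:
  fixes u :: "real^2 \<Rightarrow> real"
  assumes u: "continuous_on UNIV u" "\<And>k x. u (x + freq k) = u x" and e: "e > 0"
  obtains p where "trigpoly p" "\<And>x. cmod (complex_of_real (u x) - p x) < e"
proof -
  define q :: "real^2 \<Rightarrow> complex \<times> complex" where "q x = (cis (2 * pi * x $ 1), cis (2 * pi * x $ 2))" for x
  define S where "S = q ` cbox 0 1"
  have contq: "continuous_on A q" for A
    unfolding q_def by (intro continuous_intros)
  \<comment> \<open>Points with the same image under \<open>q\<close> differ by a lattice vector, so
    \<open>u\<close> descends to the image of \<open>q\<close>.\<close>
  have eq: "u x = u y" if "q x = q y" for x y
  proof -
    have "\<exists>n. x $ i - y $ i = real_of_int n" for i
    proof -
      have "cis (2 * pi * x $ i) = cis (2 * pi * y $ i)"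
        using that exhaust_2[of i] by (auto simp: q_def)
      then have "cis (2 * pi * (x $ i - y $ i)) = 1"
        by (simp add: right_diff_distrib cis_divide[symmetric])
      then have "cos (2 * pi * (x $ i - y $ i)) = 1" by (simp add: complex_eq_iff)
      then obtain n :: int where "2 * pi * (x $ i - y $ i) = n * 2 * pi"
        by (auto simp: cos_one_2pi_int)
      then show ?thesis by auto
    qed
    then obtain n where n: "\<And>i. x $ i - y $ i = real_of_int (n i)" by metis
    have "x = y + freq (\<chi> i. n i)" using n by (simp add: vec_eq_iff algebra_simps)
    then show ?thesis using u(2) by simp
  qed
  have surj: "\<exists>y\<in>cbox 0 1. q y = q x" for x
  proof -
    let ?y = "\<chi> i. frac (x $ i)"
    have "x = ?y + freq (\<chi> i. \<lfloor>x $ i\<rfloor>)" by (simp add: vec_eq_iff frac_def)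
    then have "q x = q (?y + freq (\<chi> i. \<lfloor>x $ i\<rfloor>))" by simp
    also have "\<dots> = q ?y"
      by (simp add: q_def distrib_left cis_mult[symmetric])
    finally have "q ?y = q x" ..
    moreover have "?y \<in> cbox 0 1" by (auto simp: mem_box_cart frac_ge_0 frac_lt_1 less_imp_le)
    ultimately show ?thesis by blast
  qed
  define F where "F z = u (inv_into (cbox 0 1) q z)" for z
  have F: "F (q x) = u x" for x
  proof -
    obtain y where "y \<in> cbox 0 1" "q y = q x" using surj by blast
    then have "q (inv_into (cbox 0 1) q (q x)) = q x"
      by (metis f_inv_into_f imageI)
    then show ?thesis unfolding F_def by (rule eq)
  qed
  have comp: "compact S" unfolding S_def by (intro compact_continuous_image contq compact_cbox)
  \<comment> \<open>Compactness of the square replaces a discussion of the quotient topology: the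
    preimage of a closed set under \<open>F\<close> is the image under \<open>q\<close> of a compact
    set, hence closed.\<close>
  have contF: "continuous_on S F"
  proof (subst continuous_on_closed_vimage[OF compact_imp_closed[OF comp]], intro allI impI)
    fix B :: "real set" assume B: "closed B"
    have "F -` B \<inter> S = q ` (u -` B \<inter> cbox 0 1)"
      unfolding S_def using F by (auto 4 3)
    moreover have "compact (u -` B \<inter> cbox 0 1)"
      using continuous_closed_vimage[OF B, of u] u(1)
      by (auto intro!: closed_Int_compact compact_cbox simp: continuous_on_eq_continuous_at)
    ultimately show "closed (F -` B \<inter> S)"
      by (simp add: compact_continuous_image contq compact_imp_closed)
  qed
  obtain g where g: "real_polynomial_function g" "\<And>z. z \<in> S \<Longrightarrow> \<bar>F z - g z\<bar> < e"
    using Stone_Weierstrass_real_polynomial_function[OF comp contF e] by blast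
  have cis_nth: "trigpoly (\<lambda>x. cis (2 * pi * x $ i))" for i
  proof -
    have "cis (2 * pi * x $ i) = 1 * echar (axis i 1) x" for x
    proof -
      have "freq (axis i 1) = axis i 1" by (auto simp: vec_eq_iff axis_def)
      then show ?thesis by (simp add: echar_def inner_axis')
    qed
    then show ?thesis by (simp only: trigpoly_term)
  qed
  have "trigpoly (\<lambda>x. complex_of_real (g (q x)))"
    using g(1)
  proof induction
    case (linear f)
    \<comment> \<open>A real-linear functional on pairs of complex numbers is fixed by its values at
      four basis vectors, so only real and imaginary parts of the two basic characters
      occur.\<close>
    have "f (q x) = Re (cis (2 * pi * x $ 1)) * f (1, 0) + Im (cis (2 * pi * x $ 1)) * f (\<i>, 0)
       + Re (cis (2 * pi * x $ 2)) * f (0, 1) + Im (cis (2 * pi * x $ 2)) * f (0, \<i>)" for x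
    proof -
      have "q x = Re (cis (2 * pi * x $ 1)) *\<^sub>R (1, 0) + Im (cis (2 * pi * x $ 1)) *\<^sub>R (\<i>, 0)
       + Re (cis (2 * pi * x $ 2)) *\<^sub>R (0, 1) + Im (cis (2 * pi * x $ 2)) *\<^sub>R (0, \<i>)"
        by (simp add: q_def complex_eq_iff)
      then show ?thesis
        by (simp only: bounded_linear.linear[OF linear, THEN linear_add] bounded_linear.linear[OF linear, THEN linear_scale] real_scaleR_def)
    qed
    then show ?case
      unfolding of_real_add of_real_mult
      by (auto simp only: of_real_add of_real_mult intro!: trigpoly_add trigpoly_mult trigpoly_const trigpoly_Re trigpoly_Im cis_nth)
  qed (auto simp only: of_real_add of_real_mult intro!: trigpoly_const trigpoly_add trigpoly_mult)
  moreover have "cmod (complex_of_real (u x) - complex_of_real (g (q x))) < e" for x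
  proof -
    have "q x \<in> S" using surj[of x] unfolding S_def by (metis imageI)
    then show ?thesis using g(2)[of "q x"] F[of x]
      by (metis norm_of_real of_real_diff)
  qed
  ultimately show thesis by (rule that)
qed

lemma trigpoly_dense:
  assumes f: "cper f" and e: "e > 0"
  obtains p where "trigpoly p" "\<And>x. cmod (f x - p x) < e"
proof -
  have c: "continuous_on UNIV (\<lambda>x. Re (f x))" "continuous_on UNIV (\<lambda>x. Im (f x))"
    using cperD(1)[OF f] by (auto intro!: continuous_intros)
  obtain p where p: "trigpoly p" "\<And>x. cmod (complex_of_real (Re (f x)) - p x) < e / 2"
    using trigpoly_dense_real[OF c(1), of "e/2"] e cperD(2)[OF f] by auto
  obtain q where q: "trigpoly q" "\<And>x. cmod (complex_of_real (Im (f x)) - q x) < e / 2"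
    using trigpoly_dense_real[OF c(2), of "e/2"] e cperD(2)[OF f] by auto
  show thesis
  proof
    show "trigpoly (\<lambda>x. p x + \<i> * q x)" by (intro trigpoly_add trigpoly_cmult p q)
    fix x
    have "f x - (p x + \<i> * q x) = (Re (f x) - p x) + \<i> * (Im (f x) - q x)"
      by (subst complex_eq[of "f x"]) (simp add: algebra_simps)
    also have "cmod \<dots> \<le> cmod (Re (f x) - p x) + cmod (\<i> * (Im (f x) - q x))"
      by (rule norm_triangle_ineq)
    also have "\<dots> < e" using p(2)[of x] q(2)[of x] by (simp add: norm_mult)
    finally show "cmod (f x - (p x + \<i> * q x)) < e" .
  qed
qed

lemma cper_integrable: "cper f \<Longrightarrow> f integrable_on cbox 0 1"
  by (intro integrable_continuous cperD)

lemma content_unit_square [simp]: "Henstock_Kurzweil_Integration.content (cbox 0 (1 :: real^2)) = 1"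
proof -
  have "integral (cbox 0 (1::real^2)) (\<lambda>x. 1 :: complex) = 1"
    using integral_echar[of 0] unfolding echar_0(1)[abs_def] by simp
  then have "Re (integral (cbox 0 (1::real^2)) (\<lambda>x. 1 :: complex)) = 1" by simp
  then show ?thesis unfolding Henstock_Kurzweil_Integration.integral_const by simp
qed

section \<open>Fourier coefficients\<close>

definition ip :: "(real^2 \<Rightarrow> complex) \<Rightarrow> (real^2 \<Rightarrow> complex) \<Rightarrow> complex" where
  "ip f g = integral (cbox 0 1) (\<lambda>x. f x * cnj (g x))"

definition fc :: "(real^2 \<Rightarrow> complex) \<Rightarrow> int^2 \<Rightarrow> complex" where
  "fc f k = ip f (echar k)"

definition nsq :: "(real^2 \<Rightarrow> complex) \<Rightarrow> real" where
  "nsq f = integral (cbox 0 1) (\<lambda>x. (cmod (f x))\<^sup>2)"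

lemma integral_of_real_complex:
  fixes u :: "'a::euclidean_space \<Rightarrow> real"
  assumes "continuous_on (cbox a b) u"
  shows "integral (cbox a b) (\<lambda>x. complex_of_real (u x)) = complex_of_real (integral (cbox a b) u)"
  using integral_linear[OF integrable_continuous[OF assms] bounded_linear_of_real]
  by (simp add: o_def)

lemma integral_cnj_cbox: "integral (cbox a b) (\<lambda>x. cnj (f x)) = cnj (integral (cbox a b) f)"
  by (rule Henstock_Kurzweil_Integration.integral_cnj[symmetric])

lemma ip_self: "cper f \<Longrightarrow> ip f f = complex_of_real (nsq f)"
  unfolding ip_def nsq_def complex_norm_square[symmetric]
  by (rule integral_of_real_complex) (intro continuous_intros cperD)

lemma ip_commute: "ip g f = cnj (ip f g)"
  unfolding ip_def integral_cnj_cbox[symmetric] by (simp add: mult.commute)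

lemma ip_add_left: "cper f \<Longrightarrow> cper g \<Longrightarrow> cper h \<Longrightarrow> ip (\<lambda>x. f x + g x) h = ip f h + ip g h"
  and ip_diff_left: "cper f \<Longrightarrow> cper g \<Longrightarrow> cper h \<Longrightarrow> ip (\<lambda>x. f x - g x) h = ip f h - ip g h"
  unfolding ip_def distrib_right left_diff_distrib
  by (auto intro!: Henstock_Kurzweil_Integration.integral_add Henstock_Kurzweil_Integration.integral_diff cper_integrable)

lemma ip_cmult_left: "ip (\<lambda>x. c * f x) h = c * ip f h"
  unfolding ip_def by (simp add: mult.assoc integral_mult_right)

lemma ip_cmult_right: "ip f (\<lambda>x. c * h x) = cnj c * ip f h"
  using ip_commute[of f "\<lambda>x. c * h x"] ip_commute[of f h] ip_cmult_left[of c h f] by simp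

lemma ip_diff_right: "cper f \<Longrightarrow> cper g \<Longrightarrow> cper h \<Longrightarrow> ip h (\<lambda>x. f x - g x) = ip h f - ip h g"
  using ip_commute[of h "\<lambda>x. f x - g x"] ip_commute[of h f] ip_commute[of h g] ip_diff_left[of f g h] by simp

lemma ip_add_right: "cper f \<Longrightarrow> cper g \<Longrightarrow> cper h \<Longrightarrow> ip h (\<lambda>x. f x + g x) = ip h f + ip h g"
  using ip_commute[of h "\<lambda>x. f x + g x"] ip_commute[of h f] ip_commute[of h g] ip_add_left[of f g h] by simp

lemma ip_sum_left:
  "(\<And>i. i \<in> I \<Longrightarrow> cper (f i)) \<Longrightarrow> cper h \<Longrightarrow> ip (\<lambda>x. \<Sum>i\<in>I. f i x) h = (\<Sum>i\<in>I. ip (f i) h)"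
proof (induction I rule: infinite_finite_induct)
  case (insert i I)
  then show ?case by (simp add: ip_add_left cper_sum)
qed (simp_all add: ip_def)

lemma ip_sum_right:
  "(\<And>i. i \<in> I \<Longrightarrow> cper (f i)) \<Longrightarrow> cper h \<Longrightarrow> ip h (\<lambda>x. \<Sum>i\<in>I. f i x) = (\<Sum>i\<in>I. ip h (f i))"
proof -
  assume *: "\<And>i. i \<in> I \<Longrightarrow> cper (f i)" "cper h"
  have "ip h (\<lambda>x. \<Sum>i\<in>I. f i x) = cnj (\<Sum>i\<in>I. ip (f i) h)"
    using ip_commute[of h "\<lambda>x. \<Sum>i\<in>I. f i x"] ip_sum_left[of I f h] * by simp
  then show ?thesis by (simp add: ip_commute[of h])
qed

lemma fc_add: "cper f \<Longrightarrow> cper g \<Longrightarrow> fc (\<lambda>x. f x + g x) k = fc f k + fc g k"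
  and fc_diff: "cper f \<Longrightarrow> cper g \<Longrightarrow> fc (\<lambda>x. f x - g x) k = fc f k - fc g k"
  and fc_cmult: "fc (\<lambda>x. c * f x) k = c * fc f k"
  and fc_sum: "(\<And>i. i \<in> I \<Longrightarrow> cper (h i)) \<Longrightarrow> fc (\<lambda>x. \<Sum>i\<in>I. h i x) k = (\<Sum>i\<in>I. fc (h i) k)"
  by (auto simp: fc_def ip_add_left ip_diff_left ip_cmult_left ip_sum_left cper_echar)

lemma fc_echar: "fc (echar k) l = (if k = l then 1 else 0)"
proof -
  have "(\<lambda>x. echar k x * cnj (echar l x)) = echar (k - l)"
    using echar_add_freq[of k "-l"] by (auto simp: cnj_echar fun_eq_iff)
  then show ?thesis by (simp add: fc_def ip_def integral_echar)
qed

lemma fc_trig: "finite S \<Longrightarrow> fc (\<lambda>x. \<Sum>k\<in>S. c k * echar k x) l = (if l \<in> S then c l else 0)"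
proof -
  assume "finite S"
  then have "(\<Sum>k\<in>S. c k * fc (echar k) l) = (if l \<in> S then c l else 0)"
    by (simp add: fc_echar mult_if_delta if_distrib[of "\<lambda>x. _ * x"] cong: if_cong)
  then show ?thesis
    by (subst fc_sum) (auto intro!: cper_mult cper_const cper_echar simp: fc_cmult)
qed

lemma fc_cnj: "fc (\<lambda>x. cnj (f x)) k = cnj (fc f (- k))"
  unfolding fc_def ip_def integral_cnj_cbox[symmetric] by (simp add: cnj_echar)

lemma nsq_nonneg [simp]: "nsq f \<ge> 0"
  unfolding nsq_def
  by (cases "(\<lambda>x. (cmod (f x))\<^sup>2) integrable_on cbox 0 1")
    (auto intro: Henstock_Kurzweil_Integration.integral_nonneg simp: not_integrable_integral)

lemma nsq_le:
  assumes "cper f" "\<And>x. cmod (f x) \<le> M"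
  shows "nsq f \<le> M\<^sup>2"
proof -
  have M: "0 \<le> M" using assms(2)[of 0] norm_ge_zero order_trans by blast
  have "nsq f \<le> integral (cbox 0 (1::real^2)) (\<lambda>x. M\<^sup>2)"
    unfolding nsq_def
    by (intro integral_le integrable_continuous continuous_intros cperD assms power_mono) auto
  then show ?thesis by simp
qed

text \<open>Expand the square and complete it coefficient by coefficient. With
  \<open>c = fc f\<close> this gives Bessel's inequality; for general \<open>c\<close> it shows that
  the Fourier partial sum over \<open>S\<close> is the best approximation with frequencies in
  \<open>S\<close>, which is how density leads to Parseval.\<close>

lemma nsq_diff_trig:
  assumes f: "cper f" and S: "finite S"
  shows "nsq (\<lambda>x. f x - (\<Sum>k\<in>S. c k * echar k x)) =
    nsq f - (\<Sum>k\<in>S. (cmod (fc f k))\<^sup>2) + (\<Sum>k\<in>S. (cmod (fc f k - c k))\<^sup>2)"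
proof -
  let ?p = "\<lambda>x. \<Sum>k\<in>S. c k * echar k x"
  have p: "cper ?p" by (intro cper_sum cper_mult cper_const cper_echar)
  have fp: "ip f ?p = (\<Sum>k\<in>S. cnj (c k) * fc f k)"
    using f by (subst ip_sum_right) (auto simp: ip_cmult_right fc_def intro!: cper_mult cper_const cper_echar)
  have pp: "ip ?p ?p = (\<Sum>k\<in>S. cnj (c k) * c k)"
    using p S by (subst ip_sum_right[where h="?p"])
      (auto simp: ip_cmult_right fc_trig fc_def[symmetric] intro!: cper_mult cper_const cper_echar)
  have "complex_of_real (nsq (\<lambda>x. f x - ?p x)) = ip f f - ip f ?p - cnj (ip f ?p) + ip ?p ?p"
    using f p ip_commute[of ?p f]
    by (simp add: ip_self[symmetric] cper_diff ip_diff_left ip_diff_right del: cnj_sum)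
  also have "\<dots> = complex_of_real (nsq f) - (\<Sum>k\<in>S. fc f k * cnj (fc f k))
      + (\<Sum>k\<in>S. (fc f k - c k) * cnj (fc f k - c k))"
    unfolding fp pp by (simp add: ip_self f algebra_simps sum.distrib sum_subtractf)
  also have "\<dots> = complex_of_real (nsq f - (\<Sum>k\<in>S. (cmod (fc f k))\<^sup>2) + (\<Sum>k\<in>S. (cmod (fc f k - c k))\<^sup>2))"
    by (simp add: complex_norm_square del: of_real_power)
  finally show ?thesis using of_real_eq_iff by blast
qed

lemma Bessel_cper: "cper f \<Longrightarrow> finite S \<Longrightarrow> (\<Sum>k\<in>S. (cmod (fc f k))\<^sup>2) \<le> nsq f"
  using nsq_diff_trig[of f S "fc f"] nsq_nonneg[of "\<lambda>x. f x - (\<Sum>k\<in>S. fc f k * echar k x)"] by simp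

lemma norm_fc_le:
  assumes "cper f" "\<And>x. cmod (f x) \<le> M"
  shows "cmod (fc f k) \<le> M"
proof -
  have "(cmod (fc f k))\<^sup>2 \<le> M\<^sup>2"
    using Bessel_cper[of f "{k}"] nsq_le[OF assms] assms(1) by simp
  moreover have "0 \<le> M" using assms(2)[of 0] norm_ge_zero order_trans by blast
  ultimately show ?thesis by (rule power2_le_imp_le)
qed

lemma Parseval_nsq:
  assumes f: "cper f"
  shows "((\<lambda>k. (cmod (fc f k))\<^sup>2) has_sum nsq f) UNIV"
  unfolding has_sum_def tendsto_iff eventually_finite_subsets_at_top
proof (intro allI impI)
  fix e :: real assume e: "e > 0"
  \<comment> \<open>A uniform error below sqrt(e/2) leaves at most e/2 for the squared norm, so that
    the bound by \<open>e\<close> is strict.\<close>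
  obtain p where p: "trigpoly p" "\<And>x. cmod (f x - p x) < sqrt (e/2)"
    using trigpoly_dense[OF f, of "sqrt (e/2)"] e by auto
  obtain S c where S: "finite S" and pS: "p = (\<lambda>x. \<Sum>k\<in>S. c k * echar k x)"
    using p(1) unfolding trigpoly_def by blast
  have "nsq (\<lambda>x. f x - p x) \<le> (sqrt (e/2))\<^sup>2"
    using f p trigpoly_cper[OF p(1)] by (intro nsq_le cper_diff less_imp_le) auto
  also have "\<dots> < e" using e by simp
  finally have "nsq (\<lambda>x. f x - p x) < e" .
  then have 1: "nsq f - (\<Sum>k\<in>S. (cmod (fc f k))\<^sup>2) < e"
    unfolding pS nsq_diff_trig[OF f S]
    using sum_nonneg[of S "\<lambda>k. (cmod (fc f k - c k))\<^sup>2"] by force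
  have "dist (\<Sum>k\<in>Y. (cmod (fc f k))\<^sup>2) (nsq f) < e" if Y: "finite Y" "S \<subseteq> Y" for Y
  proof -
    have "(\<Sum>k\<in>S. (cmod (fc f k))\<^sup>2) \<le> (\<Sum>k\<in>Y. (cmod (fc f k))\<^sup>2)"
      using Y by (intro sum_mono2) auto
    with 1 Bessel_cper[OF f Y(1)] show ?thesis by (simp add: dist_real_def)
  qed
  with S show "\<exists>X. finite X \<and> X \<subseteq> UNIV \<and>
      (\<forall>Y. finite Y \<and> X \<subseteq> Y \<and> Y \<subseteq> UNIV \<longrightarrow> dist (\<Sum>k\<in>Y. (cmod (fc f k))\<^sup>2) (nsq f) < e)"
    by blast
qed

lemma has_sum_diff:
  fixes f g :: "'a \<Rightarrow> 'b::topological_ab_group_add"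
  shows "(f has_sum a) A \<Longrightarrow> (g has_sum b) A \<Longrightarrow> ((\<lambda>x. f x - g x) has_sum (a - b)) A"
  using has_sum_add[where f=f and g="\<lambda>x. - g x" and b="- b"] by (simp add: has_sum_uminus)

lemma polarization:
  fixes a b :: complex
  shows "a * cnj b = (1/4) * (complex_of_real ((cmod (a + b))\<^sup>2) - complex_of_real ((cmod (a - b))\<^sup>2)
    + \<i> * complex_of_real ((cmod (a + \<i> * b))\<^sup>2) - \<i> * complex_of_real ((cmod (a - \<i> * b))\<^sup>2))"
  unfolding complex_norm_square by (simp add: algebra_simps)

text \<open>Polarization of \<open>Parseval_nsq\<close>: it is applied to f + g, f - g, f + \<i> g
  and f - \<i> g, and the four sums are combined.\<close>

lemma Parseval:
  assumes f: "cper f" and g: "cper g"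
  shows "((\<lambda>k. fc f k * cnj (fc g k)) has_sum ip f g) UNIV"
proof -
  have ig: "cper (\<lambda>x. \<i> * g x)" using g by (intro cper_mult cper_const)
  have *: "((\<lambda>k. complex_of_real ((cmod (fc h k))\<^sup>2)) has_sum complex_of_real (nsq h)) UNIV" if "cper h" for h
    by (intro has_sum_of_real Parseval_nsq that)
  have 1: "fc (\<lambda>x. f x + \<i> * g x) k = fc f k + \<i> * fc g k" "fc (\<lambda>x. f x - \<i> * g x) k = fc f k - \<i> * fc g k" for k
    using f g ig fc_add[OF f ig] fc_diff[OF f ig] by (auto simp: fc_cmult)
  have H: "((\<lambda>k. (1/4) * (complex_of_real ((cmod (fc f k + fc g k))\<^sup>2) - complex_of_real ((cmod (fc f k - fc g k))\<^sup>2)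
    + \<i> * complex_of_real ((cmod (fc f k + \<i> * fc g k))\<^sup>2) - \<i> * complex_of_real ((cmod (fc f k - \<i> * fc g k))\<^sup>2)))
    has_sum (1/4) * (complex_of_real (nsq (\<lambda>x. f x + g x)) - complex_of_real (nsq (\<lambda>x. f x - g x))
     + \<i> * complex_of_real (nsq (\<lambda>x. f x + \<i> * g x)) - \<i> * complex_of_real (nsq (\<lambda>x. f x - \<i> * g x)))) UNIV"
    using *[OF cper_add[OF f g]] *[OF cper_diff[OF f g]] *[OF cper_add[OF f ig]] *[OF cper_diff[OF f ig]]
    unfolding 1 fc_add[OF f g] fc_diff[OF f g]
    by (intro has_sum_cmult_right has_sum_diff has_sum_add)
  have "(1/4) * (complex_of_real (nsq (\<lambda>x. f x + g x)) - complex_of_real (nsq (\<lambda>x. f x - g x))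
     + \<i> * complex_of_real (nsq (\<lambda>x. f x + \<i> * g x)) - \<i> * complex_of_real (nsq (\<lambda>x. f x - \<i> * g x))) = ip f g"
    using f g ig
    by (simp add: ip_self[symmetric] cper_add cper_diff ip_add_left ip_add_right ip_diff_left ip_diff_right
          ip_cmult_left ip_cmult_right ip_commute[of g f] algebra_simps)
  with H show ?thesis unfolding polarization[symmetric] by simp
qed

text \<open>For a trigonometric polynomial only the zero frequency contributes to the integral, and
  a shift leaves its coefficient unchanged; uniform approximation does the rest.\<close>

lemma integral_translate:
  assumes f: "cper f"
  shows "integral (cbox 0 1) (\<lambda>x. f (x + z)) = integral (cbox 0 1) f"
proof -
  have trig: "integral (cbox 0 1) (\<lambda>x. p (x + z)) = integral (cbox 0 1) p" if "trigpoly p" for p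
  proof -
    obtain S c where S: "finite S" and pS: "p = (\<lambda>x. \<Sum>k\<in>S. c k * echar k x)"
      using \<open>trigpoly p\<close> unfolding trigpoly_def by blast
    have 1: "integral (cbox 0 1) (\<lambda>x. \<Sum>k\<in>S. d k * echar k x) = (\<Sum>k\<in>S. d k * (if k = 0 then 1 else 0))" for d
      using S by (subst Henstock_Kurzweil_Integration.integral_sum)
        (auto intro!: cper_integrable cper_mult cper_const cper_echar simp: integral_mult_right integral_echar intro!: sum.cong)
    have 2: "(\<lambda>x. p (x + z)) = (\<lambda>x. \<Sum>k\<in>S. (c k * echar k z) * echar k x)"
      by (simp add: pS echar_add_point mult_ac)
    show ?thesis unfolding 2 unfolding pS 1 by (auto intro!: sum.cong)
  qed
  have le: "cmod (integral (cbox 0 1) (\<lambda>x. f (x + z)) - integral (cbox 0 1) f) \<le> e" if e: "e > 0" for e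
  proof -
    obtain p where p: "trigpoly p" "\<And>x. cmod (f x - p x) < e/2"
      using trigpoly_dense[OF f, of "e/2"] e by auto
    have i: "cper p" by (rule trigpoly_cper[OF p(1)])
    have *: "cmod (integral (cbox 0 (1::real^2)) (\<lambda>x. f (x + y) - p (x + y))) \<le> e / 2" for y
    proof -
      have "cmod (integral (cbox 0 (1::real^2)) (\<lambda>x. f (x + y) - p (x + y)))
          \<le> integral (cbox 0 (1::real^2)) (\<lambda>x. e / 2)"
        by (intro integral_norm_bound_integral cper_integrable cper_diff cper_translate f i less_imp_le p) auto
      then show ?thesis by simp
    qed
    have "cmod (integral (cbox 0 1) (\<lambda>x. f (x + z)) - integral (cbox 0 1) f) =
       cmod (integral (cbox 0 1) (\<lambda>x. f (x + z) - p (x + z)) - integral (cbox 0 1) (\<lambda>x. f (x + 0) - p (x + 0)))"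
      using f i trig[OF p(1)]
      by (simp add: Henstock_Kurzweil_Integration.integral_diff cper_integrable cper_translate)
    also have "\<dots> \<le> e/2 + e/2"
      by (rule order_trans[OF norm_triangle_ineq4 add_mono[OF * *]])
    finally show ?thesis by simp
  qed
  then have "cmod (integral (cbox 0 1) (\<lambda>x. f (x + z)) - integral (cbox 0 1) f) \<le> 0"
    by (rule field_le_epsilon) simp
  then show ?thesis by simp
qed

lemma fc_translate:
  assumes f: "cper f"
  shows "fc (\<lambda>x. f (x + z)) k = echar k z * fc f k"
proof -
  let ?h = "\<lambda>x. f x * cnj (echar k x)"
  have "f (x + z) * cnj (echar k x) = echar k z * ?h (x + z)" for x
  proof -
    have "echar k z * cnj (echar k z) = 1" by (simp add: complex_norm_square[symmetric])
    then show ?thesis by (simp add: echar_add_point mult_ac)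
  qed
  then have "fc (\<lambda>x. f (x + z)) k = echar k z * integral (cbox 0 1) (\<lambda>x. ?h (x + z))"
    by (simp only: fc_def ip_def integral_mult_right)
  also have "integral (cbox 0 1) (\<lambda>x. ?h (x + z)) = integral (cbox 0 1) ?h"
    using f by (intro integral_translate cper_mult cper_cnj cper_echar)
  finally show ?thesis by (simp add: fc_def ip_def)
qed

lemma nsq_eq_0_imp:
  assumes f: "cper f" and 0: "nsq f = 0"
  shows "f x = 0"
proof -
  have "continuous_on (cbox 0 1) (\<lambda>x. (cmod (f x))\<^sup>2)" by (intro continuous_intros cperD f)
  then have *: "((\<lambda>x. (cmod (f x))\<^sup>2) has_integral 0) (cbox 0 1)"
    using 0 integrable_integral[OF integrable_continuous] unfolding nsq_def by metis
  have **: "(cmod (f y))\<^sup>2 = 0" if "y \<in> cbox 0 1" for y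
  proof (rule has_integral_0_cbox_imp_0[of 0 1 "\<lambda>x. (cmod (f x))\<^sup>2", OF _ _ _ _ that])
    show "box 0 (1::real^2) \<noteq> {}" by (simp add: interval_ne_empty_cart)
  qed (use * in \<open>auto intro!: continuous_intros cperD f\<close>)
  let ?y = "\<chi> i. frac (x $ i)"
  have "x = ?y + freq (\<chi> i. \<lfloor>x $ i\<rfloor>)" by (simp add: vec_eq_iff frac_def)
  then have "f x = f ?y" using cperD(2)[OF f] by metis
  moreover have "?y \<in> cbox 0 1" by (auto simp: mem_box_cart frac_ge_0 frac_lt_1 less_imp_le)
  ultimately show ?thesis using **[of ?y] by simp
qed

text \<open>Completeness of the characters, from Parseval and continuity. Later it identifies a
  function with the sum of its Fourier series and computes multipliers by comparing
  coefficients.\<close>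

lemma fc_inject:
  assumes f: "cper f" and g: "cper g" and eq: "\<And>k. fc f k = fc g k"
  shows "f = g"
proof
  fix x
  have "((\<lambda>k. (cmod (fc (\<lambda>x. f x - g x) k))\<^sup>2) has_sum nsq (\<lambda>x. f x - g x)) UNIV"
    by (intro Parseval_nsq cper_diff f g)
  then have "((\<lambda>k. 0) has_sum nsq (\<lambda>x. f x - g x)) (UNIV :: (int^2) set)"
    by (simp add: fc_diff f g eq)
  then have "nsq (\<lambda>x. f x - g x) = 0"
    using has_sum_0 has_sum_unique by (metis (mono_tags, lifting))
  then show "f x = g x" using nsq_eq_0_imp[OF cper_diff[OF f g]] by simp
qed

section \<open>Lattice sums and the multiplier built from dyadic differences\<close>

definition nk :: "int^2 \<Rightarrow> real" where "nk k = norm (freq k)"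

lemma nk_nonneg [simp]: "0 \<le> nk k" and nk_0 [simp]: "nk 0 = 0" and nk_uminus [simp]: "nk (- k) = nk k"
  by (simp_all add: nk_def freq_uminus)

lemma nk_triangle: "nk (k + l) \<le> nk k + nk l"
  by (simp add: nk_def freq_add norm_triangle_ineq)

lemma abs_nth_le_nk: "\<bar>real_of_int (k $ i)\<bar> \<le> nk k"
  using component_le_norm_cart[of "freq k" i] by (simp add: nk_def)

lemma nk_sq: "(nk k)\<^sup>2 = (real_of_int (k $ 1))\<^sup>2 + (real_of_int (k $ 2))\<^sup>2"
  unfolding nk_def norm_vec_def L2_set_def by (simp add: sum_2)

lemma nk_ge_1: "k \<noteq> 0 \<Longrightarrow> 1 \<le> nk k"
proof -
  assume "k \<noteq> 0"
  then obtain i where "k $ i \<noteq> 0" by (auto simp: vec_eq_iff)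
  then have "1 \<le> \<bar>real_of_int (k $ i)\<bar>" by linarith
  with abs_nth_le_nk[of k i] show ?thesis by linarith
qed

lemma nk_eq_0_iff [simp]: "nk k = 0 \<longleftrightarrow> k = 0"
  by (simp add: nk_def)

text \<open>The coordinates inject these frequencies into a square of integer points with 2
  \<lfloor>R\<rfloor> + 1 points per side. This quadratic count is where dimension two enters the
  later estimates.\<close>

lemma
  fixes R :: real
  assumes "0 \<le> R"
  shows finite_nk_le: "finite {k. nk k \<le> R}"
    and card_nk_le: "real (card {k. nk k \<le> R}) \<le> (2 * R + 1)\<^sup>2"
proof -
  let ?g = "\<lambda>k::int^2. (k $ 1, k $ 2)"
  let ?B = "{- \<lfloor>R\<rfloor>..\<lfloor>R\<rfloor>} \<times> {- \<lfloor>R\<rfloor>..\<lfloor>R\<rfloor>}"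
  have inj: "inj_on ?g {k. nk k \<le> R}"
    by (auto simp: inj_on_def vec_eq_iff forall_2)
  have sub: "?g ` {k. nk k \<le> R} \<subseteq> ?B"
  proof -
    have "\<bar>k $ i\<bar> \<le> \<lfloor>R\<rfloor>" if "nk k \<le> R" for k i
      using abs_nth_le_nk[of k i] that by (simp add: le_floor_iff)
    then have "- \<lfloor>R\<rfloor> \<le> k $ i \<and> k $ i \<le> \<lfloor>R\<rfloor>" if "nk k \<le> R" for k i
      using that by (meson abs_le_iff minus_le_iff)
    then show ?thesis by auto
  qed
  show "finite {k. nk k \<le> R}"
    by (rule finite_imageD[OF finite_subset[OF sub] inj]) auto
  have "card {k. nk k \<le> R} \<le> card ?B"
    using card_mono[OF _ sub] card_image[OF inj] by auto
  also have "card ?B = nat (2 * \<lfloor>R\<rfloor> + 1) ^ 2"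
    by (simp add: card_cartesian_product power2_eq_square algebra_simps)
  finally have "real (card {k. nk k \<le> R}) \<le> (real (nat (2 * \<lfloor>R\<rfloor> + 1)))\<^sup>2"
    by (metis of_nat_le_iff of_nat_power)
  also have "\<dots> \<le> (2 * R + 1)\<^sup>2"
  proof (rule power_mono)
    show "real (nat (2 * \<lfloor>R\<rfloor> + 1)) \<le> 2 * R + 1" using assms by linarith
  qed simp
  finally show "real (card {k. nk k \<le> R}) \<le> (2 * R + 1)\<^sup>2" .
qed

lemma summable_inverse_int_sq: "(\<lambda>n::int. 1 / (1 + (real_of_int n)\<^sup>2)) summable_on UNIV"
proof -
  have "summable (\<lambda>n::nat. 1 / (1 + (real n)\<^sup>2))"
  proof (rule summable_comparison_test_ev)
    show "summable (\<lambda>n::nat. 1 / (real n)\<^sup>2)"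
      using inverse_power_summable[of 2, where 'a=real] by (simp add: inverse_eq_divide)
    show "\<forall>\<^sub>F n in sequentially. norm (1 / (1 + (real n)\<^sup>2)) \<le> 1 / (real n)\<^sup>2"
      by (rule eventually_sequentiallyI[of 1]) (auto simp: add_nonneg_nonneg intro!: frac_le)
  qed
  then have 1: "(\<lambda>n::nat. 1 / (1 + (real n)\<^sup>2)) summable_on UNIV"
    by (rule summable_nonneg_imp_summable_on) simp
  have 2: "(\<lambda>n::int. 1 / (1 + (real_of_int n)\<^sup>2)) summable_on range int"
    using 1 by (subst summable_on_reindex) (auto simp: o_def)
  have 3: "(\<lambda>n::int. 1 / (1 + (real_of_int n)\<^sup>2)) summable_on range (\<lambda>n. - int n)"
    using 1 by (subst summable_on_reindex) (auto simp: o_def inj_on_def)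
  have "range int \<union> range (\<lambda>n. - int n) = UNIV"
    by (auto, metis int_cases2 rangeI)
  with summable_on_union[OF 2 3] show ?thesis by simp
qed

text \<open>With A and B the squares of the two coordinates, (1 + A)(1 + B) \<le> (1 + A + B)^2, so
  every finite sum is dominated by a product of two one-dimensional sums.\<close>

lemma summable_lattice: "(\<lambda>k. 1 / (1 + (nk k)\<^sup>2)\<^sup>2) summable_on UNIV"
proof -
  let ?g = "\<lambda>n::int. 1 / (1 + (real_of_int n)\<^sup>2)"
  define A where "A = infsum ?g UNIV"
  have A: "sum ?g F \<le> A" if "finite F" for F
    unfolding A_def using that by (intro finite_sum_le_infsum summable_inverse_int_sq) auto
  have "sum (\<lambda>k. 1 / (1 + (nk k)\<^sup>2)\<^sup>2) F \<le> A * A" if F: "finite F" for F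
  proof -
    let ?p = "\<lambda>k::int^2. (k $ 1, k $ 2)"
    have inj: "inj_on ?p F" by (auto simp: inj_on_def vec_eq_iff forall_2)
    have "sum (\<lambda>k. 1 / (1 + (nk k)\<^sup>2)\<^sup>2) F \<le> (\<Sum>k\<in>F. ?g (k $ 1) * ?g (k $ 2))"
    proof (rule sum_mono)
      fix k :: "int^2"
      let ?a = "(real_of_int (k $ 1))\<^sup>2" and ?b = "(real_of_int (k $ 2))\<^sup>2"
      have "(1 + A) * (1 + B) \<le> (1 + (A + B))\<^sup>2" if "0 \<le> A" "0 \<le> B" for A B :: real
        using that by (simp add: power2_eq_square algebra_simps)
      then have "(1 + ?a) * (1 + ?b) \<le> (1 + (?a + ?b))\<^sup>2" by simp
      moreover have "0 < (1 + ?a) * (1 + ?b)" by (intro mult_pos_pos add_pos_nonneg) auto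
      ultimately show "1 / (1 + (nk k)\<^sup>2)\<^sup>2 \<le> ?g (k $ 1) * ?g (k $ 2)"
        unfolding nk_sq by (simp add: frac_le)
    qed
    also have "\<dots> = (\<Sum>(a, b)\<in>?p ` F. ?g a * ?g b)"
      by (subst sum.reindex[OF inj]) simp
    also have "\<dots> \<le> (\<Sum>(a, b)\<in>(fst ` ?p ` F) \<times> (snd ` ?p ` F). ?g a * ?g b)"
      using F by (intro sum_mono2) force+
    also have "\<dots> = sum ?g (fst ` ?p ` F) * sum ?g (snd ` ?p ` F)"
      unfolding sum_product sum.cartesian_product ..
    also have "\<dots> \<le> A * A"
      using F A[of "{}"] by (intro mult_mono A finite_imageI sum_nonneg) auto
    finally show ?thesis .
  qed
  then show ?thesis
    by (intro nonneg_bdd_above_summable_on bdd_aboveI2[where M="A * A"]) auto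
qed

section \<open>Symbols of dyadic differences and their weighted sum\<close>

definition sd :: "int \<Rightarrow> nat \<Rightarrow> real" where
  "sd n j = (cmod (cis (2 * pi * (real_of_int n / 2 ^ j)) - 1))\<^sup>2"

lemma cmod_cis_minus_1_sq: "(cmod (cis \<theta> - 1))\<^sup>2 = 4 * (sin (\<theta> / 2))\<^sup>2"
proof -
  have "(cmod (cis \<theta> - 1))\<^sup>2 = (cos \<theta> - 1)\<^sup>2 + (sin \<theta>)\<^sup>2"
    by (simp add: cmod_power2)
  also have "\<dots> = 2 - 2 * cos \<theta>"
    using sin_cos_squared_add[of \<theta>] by (simp add: power2_eq_square algebra_simps)
  also have "\<dots> = 4 * (sin (\<theta> / 2))\<^sup>2"
    using cos_double_sin[of "\<theta> / 2"] by simp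
  finally show ?thesis .
qed

lemma sd_nonneg [simp]: "0 \<le> sd n j" by (simp add: sd_def)

lemma sd_le_4: "sd n j \<le> 4"
  unfolding sd_def cmod_cis_minus_1_sq using sin_squared_eq[of "2 * pi * (real_of_int n / 2 ^ j) / 2"] by simp

lemma sd_le_quad: "sd n j \<le> 4 * pi\<^sup>2 * (real_of_int n)\<^sup>2 * (1 / 4) ^ j"
proof -
  let ?t = "pi * (real_of_int n / 2 ^ j)"
  have "(sin ?t)\<^sup>2 \<le> ?t\<^sup>2" using abs_sin_x_le_abs_x[of ?t] unfolding abs_le_square_iff .
  moreover have "?t\<^sup>2 = pi\<^sup>2 * (real_of_int n)\<^sup>2 * (1 / 4) ^ j"
  proof -
    have "((2::real) ^ j)\<^sup>2 = 4 ^ j" by (simp add: power2_eq_square flip: power_mult_distrib)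
    then show ?thesis by (simp add: power_mult_distrib power_divide)
  qed
  moreover have "2 * pi * (real_of_int n / 2 ^ j) / 2 = ?t" by simp
  ultimately show ?thesis unfolding sd_def cmod_cis_minus_1_sq by (simp only: mult.assoc mult_left_mono)
qed

lemma ex_dyadic:
  fixes x :: real
  assumes "1 \<le> x"
  obtains J :: nat where "x \<le> 2 ^ J" "2 ^ J < 2 * x"
proof -
  define J where "J = (LEAST J::nat. x \<le> 2 ^ J)"
  have ex: "\<exists>J::nat. x \<le> 2 ^ J" using real_arch_pow[of 2 x] by (auto intro: less_imp_le)
  have 1: "x \<le> 2 ^ J" unfolding J_def by (rule LeastI_ex[OF ex])
  have 2: "2 ^ J < 2 * x"
  proof (cases J)
    case 0 then show ?thesis using assms by simp
  next
    case (Suc j)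
    then have "\<not> x \<le> 2 ^ j" unfolding J_def by (intro not_less_Least) auto
    then show ?thesis using Suc by simp
  qed
  show thesis by (rule that[OF 1 2])
qed

lemma four_powr: "4 powr x = (2::real) powr (2 * x)"
  using powr_powr[of "2::real" 2 x] by simp

text \<open>A single scale suffices. If 2^J is the least power of two that is at least |n|, then the
  step 2^-(J+1) gives a half phase between pi/4 and pi/2, where the squared sine is at least 1/2 and
  hence \<open>sd\<close> at least 2.\<close>

lemma sd_lower:
  assumes "n \<noteq> 0" "0 \<le> a"
  shows "\<exists>j. 2 * \<bar>real_of_int n\<bar> powr (2 * a) \<le> 4 powr (a * real j) * sd n j"
proof -
  have n1: "1 \<le> \<bar>real_of_int n\<bar>" using assms by linarith
  obtain J where J: "\<bar>real_of_int n\<bar> \<le> 2 ^ J" "2 ^ J < 2 * \<bar>real_of_int n\<bar>"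
    using ex_dyadic[OF n1] by blast
  let ?t = "pi * (\<bar>real_of_int n\<bar> / 2 ^ Suc J)"
  have t: "pi / 4 \<le> ?t" "?t \<le> pi / 2" using J by (auto simp: field_simps)
  have "sin (pi / 4) \<le> sin ?t" by (rule sin_monotone_2pi_le) (use t pi_gt_zero in linarith)+
  then have "(sqrt 2 / 2)\<^sup>2 \<le> (sin ?t)\<^sup>2" unfolding sin_45 by (intro power_mono) auto
  then have "1 / 2 \<le> (sin ?t)\<^sup>2" by (simp add: power_divide)
  moreover have "(sin ?t)\<^sup>2 = (sin (pi * (real_of_int n / 2 ^ Suc J)))\<^sup>2"
    by (cases "n \<ge> 0") (auto simp: abs_if)
  ultimately have "2 \<le> 4 * (sin (pi * (real_of_int n / 2 ^ Suc J)))\<^sup>2" by linarith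
  moreover have "2 * pi * (real_of_int n / 2 ^ Suc J) / 2 = pi * (real_of_int n / 2 ^ Suc J)" by simp
  ultimately have s: "2 \<le> sd n (Suc J)" unfolding sd_def cmod_cis_minus_1_sq by metis
  have "\<bar>real_of_int n\<bar> powr (2 * a) \<le> (2 ^ Suc J) powr (2 * a)"
    using J(1) assms(2) by (intro powr_mono2) auto
  also have "\<dots> = 4 powr (a * real (Suc J))"
    unfolding four_powr by (simp only: powr_realpow[symmetric] powr_powr zero_less_numeral mult_ac)
  finally have "2 * \<bar>real_of_int n\<bar> powr (2 * a) \<le> 4 powr (a * real (Suc J)) * 2" by simp
  also have "\<dots> \<le> 4 powr (a * real (Suc J)) * sd n (Suc J)"
    using s by (intro mult_left_mono) auto
  finally show ?thesis by blast
qed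

lemma powr_dyadic: "4 powr (a * real j) = (4 powr a) ^ j"
  by (simp add: powr_powr[symmetric] powr_realpow)

text \<open>The quadratic bound for \<open>sd\<close> turns the weighted terms into a geometric
  sequence of ratio 4^(a-1), which is below 1 for a < 1: first differences reach orders below
  one.\<close>

lemma sd_weighted_le: "4 powr (a * real j) * sd n j \<le> 4 * pi\<^sup>2 * (real_of_int n)\<^sup>2 * (4 powr (a - 1)) ^ j"
proof -
  have "4 powr (a * real j) * sd n j \<le> (4 powr a) ^ j * (4 * pi\<^sup>2 * (real_of_int n)\<^sup>2 * (1 / 4) ^ j)"
    unfolding powr_dyadic by (intro mult_left_mono sd_le_quad) auto
  also have "\<dots> = 4 * pi\<^sup>2 * (real_of_int n)\<^sup>2 * (4 powr a * (1 / 4)) ^ j"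
    by (simp only: power_mult_distrib mult_ac)
  also have "4 powr a * (1 / 4) = (4 :: real) powr (a - 1)"
    by (simp add: powr_diff)
  finally show ?thesis .
qed

lemma powr_4_less_1: "a < 1 \<Longrightarrow> 4 powr (a - 1) < (1 :: real)"
  by (rule powr_less_one) auto

lemma summable_sd: "a < 1 \<Longrightarrow> summable (\<lambda>j. 4 powr (a * real j) * sd n j)"
  by (rule summable_comparison_test'[of "\<lambda>j. 4 * pi\<^sup>2 * (real_of_int n)\<^sup>2 * (4 powr (a - 1)) ^ j" 0])
     (auto intro!: summable_mult summable_geometric simp: powr_4_less_1 sd_weighted_le)

text \<open>Split at the scale 2^J of size |n|. Coarser scales use the trivial bound 4 against the
  growing weight 4^(a j), finer ones the quadratic bound against a decaying geometric sequence. Both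
  geometric sums are dominated by their terms near J and are multiples of |n|^(2 a).\<close>

lemma suminf_sd_upper:
  assumes a: "0 < a" "a < 1"
  shows "\<exists>C. \<forall>n. (\<Sum>j. 4 powr (a * real j) * sd n j) \<le> C * \<bar>real_of_int n\<bar> powr (2 * a)"
proof -
  define r where "r = (4::real) powr (a - 1)"
  define q where "q = (4::real) powr a"
  have r: "0 < r" "r < 1" and q: "1 < q" using a powr_4_less_1[of a] by (auto simp: r_def q_def)
  define C where "C = 4 * q / (q - 1) + 4 * pi\<^sup>2 / (1 - r)"
  have "(\<Sum>j. 4 powr (a * real j) * sd n j) \<le> C * \<bar>real_of_int n\<bar> powr (2 * a)" for n
  proof (cases "n = 0")
    case True then show ?thesis by (simp add: sd_def)
  next
    case False
    define x where "x = \<bar>real_of_int n\<bar>"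
    have x: "1 \<le> x" using False by (auto simp: x_def)
    obtain J where J: "x \<le> 2 ^ J" "2 ^ J < 2 * x" using ex_dyadic[OF x] by blast
    have s: "summable (\<lambda>j. 4 powr (a * real j) * sd n j)" by (rule summable_sd[OF a(2)])
    have J2: "(2 ^ J) powr (2 * b) = ((4::real) powr b) ^ J" for b
      unfolding four_powr
      by (simp only: powr_realpow[symmetric] powr_powr zero_less_numeral powr_gt_zero mult_ac)
    have "(\<Sum>j<J. 4 powr (a * real j) * sd n j) \<le> (\<Sum>j<J. q ^ j * 4)"
      unfolding powr_dyadic q_def by (intro sum_mono mult_left_mono sd_le_4) auto
    also have "\<dots> = (q ^ J - 1) / (q - 1) * 4"
      using q by (simp add: sum_distrib_right[symmetric] geometric_sum)
    also have "\<dots> \<le> q ^ J / (q - 1) * 4" using q by (intro mult_right_mono divide_right_mono) auto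
    also have "\<dots> \<le> (q * x powr (2 * a)) / (q - 1) * 4"
    proof -
      have "q ^ J = (2 ^ J) powr (2 * a)" by (simp add: J2 q_def)
      also have "\<dots> \<le> (2 * x) powr (2 * a)" using J a by (intro powr_mono2) auto
      also have "\<dots> = q * x powr (2 * a)"
        using x by (simp add: powr_mult q_def four_powr)
      finally show ?thesis using q by (intro mult_right_mono divide_right_mono) auto
    qed
    finally have 1: "(\<Sum>j<J. 4 powr (a * real j) * sd n j) \<le> 4 * q / (q - 1) * x powr (2 * a)"
      by (simp add: mult_ac)
    have "(\<Sum>j. 4 powr (a * real (j + J)) * sd n (j + J)) \<le> (\<Sum>j. 4 * pi\<^sup>2 * x\<^sup>2 * r ^ J * r ^ j)"
    proof (rule suminf_le)
      show "4 powr (a * real (j + J)) * sd n (j + J) \<le> 4 * pi\<^sup>2 * x\<^sup>2 * r ^ J * r ^ j" for j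
        using sd_weighted_le[of a "j + J" n] by (simp add: r_def x_def power_add mult_ac)
      show "summable (\<lambda>j. 4 powr (a * real (j + J)) * sd n (j + J))"
        using s by (rule summable_ignore_initial_segment)
      show "summable (\<lambda>j. 4 * pi\<^sup>2 * x\<^sup>2 * r ^ J * r ^ j)"
        using r by (intro summable_mult summable_geometric) auto
    qed
    also have "\<dots> = 4 * pi\<^sup>2 * (x\<^sup>2 * r ^ J) / (1 - r)"
      using r by (simp add: suminf_mult suminf_geometric summable_geometric)
    also have "\<dots> \<le> 4 * pi\<^sup>2 * x powr (2 * a) / (1 - r)"
    proof -
      have "r ^ J = (2 ^ J) powr (2 * (a - 1))" by (simp only: J2 r_def)
      also have "\<dots> \<le> x powr (2 * (a - 1))" using J x a by (intro powr_mono2') auto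
      finally have "x\<^sup>2 * r ^ J \<le> x powr 2 * x powr (2 * (a - 1))"
        using x by (simp add: mult_left_mono)
      also have "\<dots> = x powr (2 * a)" by (simp add: powr_add[symmetric])
      finally show ?thesis using r by (intro divide_right_mono mult_left_mono) auto
    qed
    finally have 2: "(\<Sum>j. 4 powr (a * real (j + J)) * sd n (j + J)) \<le> 4 * pi\<^sup>2 * x powr (2 * a) / (1 - r)" .
    show ?thesis
      using 1 2 suminf_split_initial_segment[OF s, of J] unfolding C_def x_def by (simp add: algebra_simps)
  qed
  then show ?thesis by blast
qed

definition msym :: "real \<Rightarrow> int^2 \<Rightarrow> real" where
  "msym a k = (\<Sum>i\<in>UNIV. \<Sum>j. 4 powr (a * real j) * sd (k $ i) j)"

lemma msym_0 [simp]: "msym a 0 = 0" by (simp add: msym_def sd_def)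

lemma msym_has_sum:
  assumes "a < 1"
  shows "((\<lambda>(i, j). 4 powr (a * real j) * sd (k $ i) j) has_sum msym a k) (UNIV \<times> UNIV)"
proof (rule has_sum_SigmaI)
  show "((\<lambda>j. case (i, j) of (i, j) \<Rightarrow> 4 powr (a * real j) * sd (k $ i) j) has_sum
     (\<Sum>j. 4 powr (a * real j) * sd (k $ i) j)) UNIV" for i
    using summable_sd[OF assms, of "k $ i"] by (auto intro!: sums_nonneg_imp_has_sum summable_sums)
  then show "(\<lambda>(i, j). 4 powr (a * real j) * sd (k $ i) j) summable_on UNIV \<times> UNIV"
    by (intro summable_on_SigmaI[where g="\<lambda>i. \<Sum>j. 4 powr (a * real j) * sd (k $ i) j"]) auto
qed (simp add: msym_def)

text \<open>The larger coordinate carries at least half of |k|^2, and one scale from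
  \<open>sd_lower\<close> already suffices for it; the factor 2 there absorbs the 2^a lost in
  passing to that coordinate.\<close>

lemma msym_lower:
  assumes a: "0 < a" "a < 1"
  shows "nk k powr (2 * a) \<le> msym a k"
proof (cases "k = 0")
  case False
  have "\<exists>i. (nk k)\<^sup>2 \<le> 2 * (real_of_int (k $ i))\<^sup>2"
    using nk_sq[of k] 
    by (cases "(real_of_int (k $ 1))\<^sup>2 \<le> (real_of_int (k $ 2))\<^sup>2") (auto intro: exI[of _ 1] exI[of _ 2])
  then obtain i where i: "(nk k)\<^sup>2 \<le> 2 * (real_of_int (k $ i))\<^sup>2" ..
  then have i0: "k $ i \<noteq> 0" using nk_ge_1[OF False] by auto
  obtain j where j: "2 * \<bar>real_of_int (k $ i)\<bar> powr (2 * a) \<le> 4 powr (a * real j) * sd (k $ i) j"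
    using sd_lower[OF i0, of a] a by auto
  have "nk k powr (2 * a) = ((nk k)\<^sup>2) powr a"
    using nk_ge_1[OF False] by (simp add: powr_powr[symmetric])
  also have "\<dots> \<le> (2 * (real_of_int (k $ i))\<^sup>2) powr a" using i a by (intro powr_mono2) auto
  also have "\<dots> = 2 powr a * ((\<bar>real_of_int (k $ i)\<bar>)\<^sup>2) powr a" by (simp add: powr_mult)
  also have "((\<bar>real_of_int (k $ i)\<bar>)\<^sup>2) powr a = \<bar>real_of_int (k $ i)\<bar> powr (2 * a)"
    using i0 by (subst powr_powr[symmetric]) (simp_all add: powr_powr[symmetric])
  also have "2 powr a * \<bar>real_of_int (k $ i)\<bar> powr (2 * a) \<le> 2 * \<bar>real_of_int (k $ i)\<bar> powr (2 * a)"
    using a powr_mono[of a 1 2] by (intro mult_right_mono) auto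
  also note j
  also have "4 powr (a * real j) * sd (k $ i) j \<le> (\<Sum>j. 4 powr (a * real j) * sd (k $ i) j)"
    using summable_sd[OF a(2), of "k $ i"] sum_le_suminf[of _ "{j}"] by force
  also have "\<dots> \<le> msym a k"
    unfolding msym_def
    by (rule member_le_sum) (auto intro!: suminf_nonneg summable_sd a)
  finally show ?thesis .
qed simp

lemma msym_nonneg: "a < 1 \<Longrightarrow> 0 \<le> msym a k"
  unfolding msym_def by (intro sum_nonneg suminf_nonneg summable_sd) auto

lemma msym_upper:
  assumes a: "0 < a" "a < 1"
  obtains C where "C > 0" "\<And>k. msym a k \<le> C * nk k powr (2 * a)"
proof -
  obtain C where C: "\<And>n. (\<Sum>j. 4 powr (a * real j) * sd n j) \<le> C * \<bar>real_of_int n\<bar> powr (2 * a)"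
    using suminf_sd_upper[OF a] by blast
  have "msym a k \<le> 2 * (\<bar>C\<bar> + 1) * nk k powr (2 * a)" for k
  proof -
    have "msym a k \<le> (\<Sum>i\<in>(UNIV::2 set). (\<bar>C\<bar> + 1) * nk k powr (2 * a))"
      unfolding msym_def
    proof (rule sum_mono)
      fix i
      have "(\<Sum>j. 4 powr (a * real j) * sd (k $ i) j) \<le> C * \<bar>real_of_int (k $ i)\<bar> powr (2 * a)" by (rule C)
      also have "\<dots> \<le> (\<bar>C\<bar> + 1) * nk k powr (2 * a)"
        using a abs_nth_le_nk[of k i] by (intro mult_mono powr_mono2) auto
      finally show "(\<Sum>j. 4 powr (a * real j) * sd (k $ i) j) \<le> (\<bar>C\<bar> + 1) * nk k powr (2 * a)" .
    qed
    then show ?thesis by (simp add: algebra_simps)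
  qed
  then show thesis by (intro that[of "2 * (\<bar>C\<bar> + 1)"]) auto
qed

section \<open>Real periodic functions, their integrals and the Cauchy-Schwarz inequality\<close>

abbreviation cx :: "(real^2 \<Rightarrow> real) \<Rightarrow> real^2 \<Rightarrow> complex" where
  "cx u \<equiv> (\<lambda>x. complex_of_real (u x))"

definition tint :: "(real^2 \<Rightarrow> real) \<Rightarrow> real" where "tint u = integral (cbox 0 1) u"

lemma cper_cx_iff: "cper (cx u) \<longleftrightarrow> continuous_on UNIV u \<and> periodic u"
proof -
  have "continuous_on UNIV u" if "continuous_on UNIV (cx u)"
    using continuous_on_Re[OF that] by simp
  moreover have "continuous_on UNIV (cx u)" if "continuous_on UNIV u"
    using that by (intro continuous_intros)
  ultimately show ?thesis by (auto simp: cper_def periodic_def)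
qed

lemma cper_cxD: "cper (cx u) \<Longrightarrow> continuous_on S u"
  by (auto simp: cper_cx_iff intro: continuous_on_subset)

lemma cper_cx_add: "cper (cx u) \<Longrightarrow> cper (cx v) \<Longrightarrow> cper (cx (\<lambda>x. u x + v x))"
  and cper_cx_diff: "cper (cx u) \<Longrightarrow> cper (cx v) \<Longrightarrow> cper (cx (\<lambda>x. u x - v x))"
  and cper_cx_mult: "cper (cx u) \<Longrightarrow> cper (cx v) \<Longrightarrow> cper (cx (\<lambda>x. u x * v x))"
  and cper_cx_power: "cper (cx u) \<Longrightarrow> cper (cx (\<lambda>x. u x ^ n))"
  and cper_cx_const: "cper (cx (\<lambda>x. c))"
  and cper_cx_abs: "cper (cx u) \<Longrightarrow> cper (cx (\<lambda>x. \<bar>u x\<bar>))"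
  unfolding cper_cx_iff periodic_def by (auto intro!: continuous_intros)

lemmas cper_cx_intros = cper_cx_add cper_cx_diff cper_cx_mult cper_cx_power cper_cx_const cper_cx_abs

lemma unit_square_rep:
  obtains y k where "y \<in> cbox 0 1" "x = y + freq k"
proof
  show "x = (\<chi> i. frac (x $ i)) + freq (\<chi> i. \<lfloor>x $ i\<rfloor>)" by (simp add: vec_eq_iff frac_def)
  show "(\<chi> i. frac (x $ i)) \<in> cbox 0 1" by (auto simp: mem_box_cart frac_ge_0 frac_lt_1 less_imp_le)
qed

lemma cper_bounded:
  assumes "cper f"
  obtains M where "0 \<le> M" "\<And>x. cmod (f x) \<le> M"
proof -
  have "bounded (f ` cbox 0 1)"
    by (rule compact_imp_bounded[OF compact_continuous_image[OF cperD(1)[OF assms] compact_cbox]])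
  then obtain M where M: "\<And>x. x \<in> cbox 0 1 \<Longrightarrow> cmod (f x) \<le> M"
    unfolding bounded_iff by (meson imageI)
  have le: "cmod (f x) \<le> M" for x
  proof -
    obtain y k where "y \<in> cbox 0 1" "x = y + freq k" by (rule unit_square_rep)
    then show ?thesis using M[of y] cperD(2)[OF assms, of y k] by simp
  qed
  have "0 \<le> M" using le[of 0] norm_ge_zero[of "f 0"] by linarith
  then show thesis using le that by blast
qed

lemma tint_integrable: "cper (cx u) \<Longrightarrow> u integrable_on cbox 0 1"
  by (intro integrable_continuous cper_cxD)

lemma tint_add: "cper (cx u) \<Longrightarrow> cper (cx v) \<Longrightarrow> tint (\<lambda>x. u x + v x) = tint u + tint v"
  and tint_diff: "cper (cx u) \<Longrightarrow> cper (cx v) \<Longrightarrow> tint (\<lambda>x. u x - v x) = tint u - tint v"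
  and tint_cmult: "tint (\<lambda>x. c * u x) = c * tint u"
  and tint_const: "tint (\<lambda>x. c) = c"
  by (auto simp: tint_def Henstock_Kurzweil_Integration.integral_add Henstock_Kurzweil_Integration.integral_diff
    tint_integrable)

lemma tint_mono: "cper (cx u) \<Longrightarrow> cper (cx v) \<Longrightarrow> (\<And>x. u x \<le> v x) \<Longrightarrow> tint u \<le> tint v"
  unfolding tint_def by (intro integral_le tint_integrable) auto

lemma tint_nonneg: "cper (cx u) \<Longrightarrow> (\<And>x. 0 \<le> u x) \<Longrightarrow> 0 \<le> tint u"
  using tint_mono[OF cper_cx_const[of 0], of u] by (simp add: tint_const)

lemma tint_of_real: "cper (cx u) \<Longrightarrow> integral (cbox 0 1) (cx u) = complex_of_real (tint u)"
  unfolding tint_def by (intro integral_of_real_complex cper_cxD)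

lemma ip_cx: "cper (cx u) \<Longrightarrow> cper (cx v) \<Longrightarrow> ip (cx u) (cx v) = complex_of_real (tint (\<lambda>x. u x * v x))"
  using tint_of_real[OF cper_cx_mult] by (simp add: ip_def)

lemma nsq_cx: "nsq (cx u) = tint (\<lambda>x. (u x)\<^sup>2)"
  by (simp add: nsq_def tint_def)

lemma fc_cx_0: "cper (cx u) \<Longrightarrow> fc (cx u) 0 = complex_of_real (tint u)"
  using tint_of_real[of u] by (simp add: fc_def ip_def)

text \<open>The minimising parameter is l = sqrt(b / a). If a or b vanishes, it is sent to infinity
  or to zero instead, with b + 1 or a + 1 in its formula so that it stays positive and
  finite.\<close>

lemma sqrt_balance:
  fixes a b x :: real
  assumes "0 \<le> a" "0 \<le> b" and le: "\<And>l. 0 < l \<Longrightarrow> x \<le> l * a + b / l"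
  shows "x \<le> 2 * sqrt (a * b)"
proof (cases "a = 0 \<or> b = 0")
  case True
  then consider "a = 0" | "b = 0" by blast
  then have "x \<le> 0"
  proof cases
    case 1
    show ?thesis
    proof (rule field_le_epsilon)
      fix e :: real assume e: "0 < e"
      have "x \<le> ((b + 1) / e) * a + b / ((b + 1) / e)" using assms(2) e by (intro le) auto
      also have "\<dots> = e * (b / (b + 1))" using 1 by simp
      also have "\<dots> \<le> e * 1" using assms(2) e by (intro mult_left_mono) (auto simp: divide_simps)
      finally show "x \<le> 0 + e" by simp
    qed
  next
    case 2
    show ?thesis
    proof (rule field_le_epsilon)
      fix e :: real assume e: "0 < e"
      have "x \<le> (e / (a + 1)) * a + b / (e / (a + 1))" using assms(1) e by (intro le) auto
      also have "\<dots> = e * (a / (a + 1))" using 2 by simp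
      also have "\<dots> \<le> e * 1" using assms(1) e by (intro mult_left_mono) (auto simp: divide_simps)
      finally show "x \<le> 0 + e" by simp
    qed
  qed
  then show ?thesis using assms by (meson mult_nonneg_nonneg order_trans real_sqrt_ge_zero zero_le_numeral)
next
  case False
  then have ab: "0 < a" "0 < b" using assms by auto
  define p q where "p = sqrt a" and "q = sqrt b"
  have pq: "0 < p" "0 < q" "a = p * p" "b = q * q" using ab by (auto simp: p_def q_def)
  have "x \<le> (q / p) * a + b / (q / p)" using pq by (intro le) auto
  also have "\<dots> = 2 * (p * q)" using pq by simp
  also have "p * q = sqrt (a * b)" by (simp add: p_def q_def real_sqrt_mult)
  finally show ?thesis .
qed

text \<open>Young's inequality with weight \<open>l\<close> holds pointwise and survives
  integration; \<open>sqrt_balance\<close> then optimises over \<open>l\<close>.\<close>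

lemma tint_Cauchy_Schwarz:
  assumes f: "cper f" and g: "cper g" and u: "cper (cx u)" and le: "\<And>x. \<bar>u x\<bar> \<le> cmod (f x) * cmod (g x)"
  shows "\<bar>tint u\<bar> \<le> sqrt (nsq f * nsq g)"
proof -
  have F: "cper (cx (\<lambda>x. (cmod (f x))\<^sup>2))" "cper (cx (\<lambda>x. (cmod (g x))\<^sup>2))"
    by (rule cper_cmod[OF f], rule cper_cmod[OF g])
  have b: "2 * \<bar>tint u\<bar> \<le> l * nsq f + nsq g / l" if "0 < l" for l
  proof -
    have *: "\<bar>u x\<bar> \<le> (l/2) * (cmod (f x))\<^sup>2 + (1 / (2 * l)) * (cmod (g x))\<^sup>2" for x
    proof -
      have "0 \<le> (l * cmod (f x) - cmod (g x))\<^sup>2" by simp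
      then have "2 * l * (cmod (f x) * cmod (g x)) \<le> l\<^sup>2 * (cmod (f x))\<^sup>2 + (cmod (g x))\<^sup>2"
        by (simp add: power2_eq_square algebra_simps)
      then have "cmod (f x) * cmod (g x) \<le> (l/2) * (cmod (f x))\<^sup>2 + (1 / (2 * l)) * (cmod (g x))\<^sup>2"
        using that by (simp add: field_simps power2_eq_square)
      with le[of x] show ?thesis by linarith
    qed
    have "\<bar>tint u\<bar> \<le> tint (\<lambda>x. (l/2) * (cmod (f x))\<^sup>2 + (1 / (2 * l)) * (cmod (g x))\<^sup>2)"
    proof -
      have "tint u \<le> tint (\<lambda>x. (l/2) * (cmod (f x))\<^sup>2 + (1 / (2 * l)) * (cmod (g x))\<^sup>2)"
        using * by (intro tint_mono u cper_cx_add cper_cx_mult F cper_cx_const) (auto simp: abs_le_iff)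
      moreover have "- tint u \<le> tint (\<lambda>x. (l/2) * (cmod (f x))\<^sup>2 + (1 / (2 * l)) * (cmod (g x))\<^sup>2)"
      proof -
        have "tint (\<lambda>x. (- 1) * u x) \<le> tint (\<lambda>x. (l/2) * (cmod (f x))\<^sup>2 + (1 / (2 * l)) * (cmod (g x))\<^sup>2)"
        proof (rule tint_mono)
          show "- 1 * u x \<le> (l/2) * (cmod (f x))\<^sup>2 + (1 / (2 * l)) * (cmod (g x))\<^sup>2" for x
            using *[of x] by linarith
        qed (intro u cper_cx_add cper_cx_mult F cper_cx_const)+
        then show ?thesis by (simp only: tint_cmult)
      qed
      ultimately show ?thesis by linarith
    qed
    also have "\<dots> = (l/2) * nsq f + (1 / (2 * l)) * nsq g"
      by (simp only: tint_add[OF cper_cx_mult[OF cper_cx_const F(1)] cper_cx_mult[OF cper_cx_const F(2)]] tint_cmult)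
        (simp add: nsq_def tint_def)
    finally show ?thesis using that by (simp add: field_simps)
  qed
  have "2 * \<bar>tint u\<bar> \<le> 2 * sqrt (nsq f * nsq g)"
    by (rule sqrt_balance) (use b in auto)
  then show ?thesis by simp
qed

section \<open>Dyadic differences and the bilinear form that they generate\<close>

definition dd :: "2 \<Rightarrow> nat \<Rightarrow> (real^2 \<Rightarrow> 'a::real_vector) \<Rightarrow> real^2 \<Rightarrow> 'a" where
  "dd i j f x = f (x + axis i (1 / 2 ^ j)) - f x"

lemma dd_cx: "dd i j (cx u) = cx (dd i j u)"
  by (simp add: dd_def fun_eq_iff)

lemma cper_dd: "cper f \<Longrightarrow> cper (dd i j f)"
  using cper_diff[OF cper_translate[of f "axis i (1 / 2 ^ j)"], of f] by (simp add: dd_def[abs_def])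

lemma cper_cx_dd: "cper (cx u) \<Longrightarrow> cper (cx (dd i j u))"
  using cper_dd[of "cx u"] by (simp add: dd_cx)

lemma echar_axis: "echar k (axis i t) = cis (2 * pi * (real_of_int (k $ i) * t))"
  by (simp add: echar_def inner_axis)

lemma fc_dd: "cper f \<Longrightarrow> fc (dd i j f) k = (echar k (axis i (1 / 2 ^ j)) - 1) * fc f k"
  using fc_diff[OF cper_translate[of f "axis i (1 / 2 ^ j)"], of f k] fc_translate[of f "axis i (1 / 2 ^ j)" k]
  by (simp add: dd_def[abs_def] algebra_simps)

lemma fc_dd_mult:
  assumes "cper f" "cper g"
  shows "fc (dd i j f) k * cnj (fc (dd i j g) k) = complex_of_real (sd (k $ i) j) * (fc f k * cnj (fc g k))"
proof -
  let ?e = "echar k (axis i (1 / 2 ^ j)) - 1"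
  have "?e * cnj ?e = complex_of_real (sd (k $ i) j)"
    unfolding complex_norm_square[symmetric] by (simp add: sd_def echar_axis)
  moreover have "(?e * a) * cnj (?e * b) = (?e * cnj ?e) * (a * cnj b)" for a b
    by (simp only: complex_cnj_mult mult_ac)
  ultimately show ?thesis unfolding fc_dd[OF assms(1)] fc_dd[OF assms(2)] by metis
qed

text \<open>Finiteness of the first order Sobolev seminorm, which dominates every weight
  \<open>msym a\<close> with 0 < a < 1 and so makes the double sums over frequencies and
  translations converge.\<close>

definition H1 :: "(real^2 \<Rightarrow> complex) \<Rightarrow> bool" where
  "H1 f \<longleftrightarrow> (\<lambda>k. (nk k)\<^sup>2 * (cmod (fc f k))\<^sup>2) summable_on UNIV"

lemma powr_nk_le: "0 < b \<Longrightarrow> b \<le> 2 \<Longrightarrow> nk k powr b \<le> (nk k)\<^sup>2"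
proof (cases "k = 0")
  case False
  assume "0 < b" "b \<le> 2"
  then have "nk k powr b \<le> nk k powr 2" using nk_ge_1[OF False] by (intro powr_mono) auto
  then show ?thesis using nk_ge_1[OF False] by simp
qed simp

lemma msym_summable:
  assumes a: "0 < a" "a < 1" and f: "H1 f" and g: "H1 g"
  shows "(\<lambda>k. msym a k * (cmod (fc f k) * cmod (fc g k))) summable_on UNIV"
proof -
  obtain C where C: "C > 0" "\<And>k. msym a k \<le> C * nk k powr (2 * a)" using msym_upper[OF a] by blast
  have "(\<lambda>k. C * ((nk k)\<^sup>2 * (cmod (fc f k))\<^sup>2 + (nk k)\<^sup>2 * (cmod (fc g k))\<^sup>2)) summable_on UNIV"
    using f g unfolding H1_def by (intro summable_on_cmult_right summable_on_add)
  then show ?thesis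
  proof (rule summable_on_comparison_test)
    fix k
    have "cmod (fc f k) * cmod (fc g k) \<le> (cmod (fc f k))\<^sup>2 + (cmod (fc g k))\<^sup>2"
      using sum_squares_bound[of "cmod (fc f k)" "cmod (fc g k)"]
        mult_nonneg_nonneg[of "cmod (fc f k)" "cmod (fc g k)"] norm_ge_zero[of "fc f k"] norm_ge_zero[of "fc g k"]
      by linarith
    moreover have "msym a k \<le> C * (nk k)\<^sup>2"
    proof -
      have "nk k powr (2 * a) \<le> (nk k)\<^sup>2" using a by (intro powr_nk_le) auto
      then have "C * nk k powr (2 * a) \<le> C * (nk k)\<^sup>2" using C(1) by simp
      with C(2)[of k] show ?thesis by linarith
    qed
    ultimately have "msym a k * (cmod (fc f k) * cmod (fc g k)) \<le> (C * (nk k)\<^sup>2) * ((cmod (fc f k))\<^sup>2 + (cmod (fc g k))\<^sup>2)"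
      using C(1) by (intro mult_mono) auto
    then show "msym a k * (cmod (fc f k) * cmod (fc g k)) \<le> C * ((nk k)\<^sup>2 * (cmod (fc f k))\<^sup>2 + (nk k)\<^sup>2 * (cmod (fc g k))\<^sup>2)"
      by (simp add: algebra_simps)
  qed (use a in \<open>auto simp: msym_nonneg\<close>)
qed

text \<open>Parseval's identity turns the Fourier multiplier \<open>msym\<close> into a sum over translations.\<close>

lemma msym_Parseval:
  assumes a: "0 < a" "a < 1" and f: "cper f" "H1 f" and g: "cper g" "H1 g"
  shows "\<exists>S. ((\<lambda>(i, j). complex_of_real (4 powr (a * real j)) * ip (dd i j f) (dd i j g)) has_sum S) (UNIV \<times> UNIV) \<and>
    ((\<lambda>k. complex_of_real (msym a k) * (fc f k * cnj (fc g k))) has_sum S) UNIV"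
proof -
  let ?c = "\<lambda>k. fc f k * cnj (fc g k)"
  define s where "s p k = 4 powr (a * real (snd p)) * sd (k $ fst p) (snd p)" for p :: "2 \<times> nat" and k :: "int^2"
  define h where "h k p = complex_of_real (s p k) * ?c k" for p k
  have s0: "0 \<le> s p k" for p k by (simp add: s_def)
  have s: "((\<lambda>p. s p k) has_sum msym a k) UNIV" for k
    using msym_has_sum[OF a(2), of k] by (simp add: s_def case_prod_unfold)
  have hk: "((\<lambda>p. h k p) has_sum (complex_of_real (msym a k) * ?c k)) UNIV" for k
    unfolding h_def by (intro has_sum_cmult_left has_sum_of_real s)
  have nh: "((\<lambda>p. norm (h k p)) has_sum (msym a k * cmod (?c k))) UNIV" for k
  proof -
    have "norm (h k p) = s p k * cmod (?c k)" for p using s0 by (simp add: h_def norm_mult)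
    then show ?thesis using has_sum_cmult_left[OF s[of k], of "cmod (?c k)"] by simp
  qed
  \<comment> \<open>Absolute summability over frequencies and translations jointly permits summation
    in either order. The inner sum over translations is \<open>msym a k\<close> times the moduli of
    the two coefficients, summable in \<open>k\<close> by \<open>msym_summable\<close>.\<close>
  have "(\<lambda>x. norm (case x of (k, p) \<Rightarrow> h k p)) summable_on (UNIV \<times> UNIV)"
    unfolding Infinite_Sum.abs_summable_on_Sigma_iff
  proof (intro conjI ballI)
    show "(\<lambda>p. norm (case (k, p) of (k, p) \<Rightarrow> h k p)) summable_on UNIV" for k
      using has_sum_imp_summable[OF nh[of k]] by simp
    have "infsum (\<lambda>p. norm (h k p)) UNIV = msym a k * (cmod (fc f k) * cmod (fc g k))" for k
      using infsumI[OF nh[of k]] by (simp add: norm_mult)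
    moreover have "norm (msym a k * (cmod (fc f k) * cmod (fc g k))) = msym a k * (cmod (fc f k) * cmod (fc g k))" for k
      using a by (simp add: msym_nonneg)
    ultimately show "(\<lambda>x. norm (\<Sum>\<^sub>\<infinity>y\<in>UNIV. norm (case (x, y) of (k, p) \<Rightarrow> h k p))) summable_on UNIV"
      using msym_summable[OF a f(2) g(2)] by (simp only: case_prod_conv)
  qed
  then have sm: "(\<lambda>(k, p). h k p) summable_on (UNIV \<times> UNIV)" by (rule Infinite_Sum.abs_summable_summable)
  then obtain S where S: "((\<lambda>(k, p). h k p) has_sum S) (UNIV \<times> UNIV)" unfolding summable_on_def by blast
  have 1: "((\<lambda>k. complex_of_real (msym a k) * ?c k) has_sum S) UNIV"
    using has_sum_SigmaD[OF S] hk by auto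
  have 2: "((\<lambda>(p, k). h k p) has_sum S) (UNIV \<times> UNIV)"
    using S by (subst (asm) has_sum_swap) (simp only: case_prod_conv)
  have 3: "((\<lambda>k. h k p) has_sum (complex_of_real (4 powr (a * real (snd p))) * ip (dd (fst p) (snd p) f) (dd (fst p) (snd p) g))) UNIV" for p
  proof -
    have "(\<lambda>k. h k p) = (\<lambda>k. complex_of_real (4 powr (a * real (snd p))) * (fc (dd (fst p) (snd p) f) k * cnj (fc (dd (fst p) (snd p) g) k)))"
      unfolding fc_dd_mult[OF f(1) g(1)] by (simp add: h_def s_def fun_eq_iff)
    moreover have "((\<lambda>k. fc (dd (fst p) (snd p) f) k * cnj (fc (dd (fst p) (snd p) g) k)) has_sum ip (dd (fst p) (snd p) f) (dd (fst p) (snd p) g)) UNIV"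
      by (rule Parseval[OF cper_dd[OF f(1)] cper_dd[OF g(1)]])
    ultimately show ?thesis by (simp only: has_sum_cmult_right)
  qed
  have "((\<lambda>p. complex_of_real (4 powr (a * real (snd p))) * ip (dd (fst p) (snd p) f) (dd (fst p) (snd p) g)) has_sum S) UNIV"
    by (rule has_sum_SigmaD[OF 2]) (simp only: case_prod_conv 3)
  then have "((\<lambda>(i, j). complex_of_real (4 powr (a * real j)) * ip (dd i j f) (dd i j g)) has_sum S) (UNIV \<times> UNIV)"
    by (simp only: case_prod_unfold UNIV_Times_UNIV)
  with 1 show ?thesis by blast
qed

text \<open>The bilinear form of the homogeneous Sobolev space of order \<open>a\<close>, with
  |k|^(2 a) replaced by \<open>msym a\<close>. \<open>Qf_fc\<close> and \<open>Qf_dd\<close> are its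
  two faces: a sum over frequencies for linear estimates, a sum over differences for pointwise
  inequalities.\<close>

definition Qf :: "real \<Rightarrow> (real^2 \<Rightarrow> real) \<Rightarrow> (real^2 \<Rightarrow> real) \<Rightarrow> real" where
  "Qf a u v = (\<Sum>\<^sub>\<infinity>k. msym a k * Re (fc (cx u) k * cnj (fc (cx v) k)))"

lemma
  assumes a: "0 < a" "a < 1" and u: "cper (cx u)" "H1 (cx u)" and v: "cper (cx v)" "H1 (cx v)"
  shows Qf_dd: "((\<lambda>(i, j). 4 powr (a * real j) * tint (\<lambda>x. dd i j u x * dd i j v x)) has_sum Qf a u v) UNIV"
    and Qf_fc: "((\<lambda>k. msym a k * Re (fc (cx u) k * cnj (fc (cx v) k))) has_sum Qf a u v) UNIV"
proof -
  obtain S where S: "((\<lambda>(i, j). complex_of_real (4 powr (a * real j)) * ip (dd i j (cx u)) (dd i j (cx v))) has_sum S) (UNIV \<times> UNIV)"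
    "((\<lambda>k. complex_of_real (msym a k) * (fc (cx u) k * cnj (fc (cx v) k))) has_sum S) UNIV"
    using msym_Parseval[OF a u v] by blast
  from has_sum_Re[OF S(2)] have 2: "((\<lambda>k. msym a k * Re (fc (cx u) k * cnj (fc (cx v) k))) has_sum Re S) UNIV"
    by (simp only: Re_complex_of_real Im_complex_of_real times_complex.sel mult_zero_left diff_zero)
  then have eq: "Qf a u v = Re S" unfolding Qf_def by (rule infsumI)
  show "((\<lambda>k. msym a k * Re (fc (cx u) k * cnj (fc (cx v) k))) has_sum Qf a u v) UNIV"
    unfolding eq by (rule 2)
  have *: "ip (dd i j (cx u)) (dd i j (cx v)) = complex_of_real (tint (\<lambda>x. dd i j u x * dd i j v x))" for i j
    unfolding dd_cx using u v by (intro ip_cx cper_cx_dd)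
  show "((\<lambda>(i, j). 4 powr (a * real j) * tint (\<lambda>x. dd i j u x * dd i j v x)) has_sum Qf a u v) UNIV"
    using has_sum_Re[OF S(1)] unfolding eq by (simp add: * case_prod_unfold)
qed

lemma Qf_self:
  assumes a: "0 < a" "a < 1" and u: "cper (cx u)" "H1 (cx u)"
  shows "((\<lambda>k. msym a k * (cmod (fc (cx u) k))\<^sup>2) has_sum Qf a u u) UNIV"
  using Qf_fc[OF a u u] unfolding complex_norm_square[symmetric] by (simp only: Re_complex_of_real)

section \<open>Smooth functions and their Fourier coefficients\<close>

lemma pderiv_dir_eqI: "(f has_derivative D) (at x) \<Longrightarrow> pderiv_dir v f x = D v"
  unfolding pderiv_dir_def by (simp add: frechet_derivative_at[symmetric])

lemma differentiable_onD_UNIV: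
  "f differentiable_on UNIV \<Longrightarrow> (f has_derivative frechet_derivative f (at x)) (at x)"
  by (simp add: differentiable_on_def frechet_derivative_works)

lemma pderiv_dir_add:
  assumes "f differentiable_on UNIV" "g differentiable_on UNIV"
  shows "pderiv_dir v (\<lambda>x. f x + g x) = (\<lambda>x. pderiv_dir v f x + pderiv_dir v g x)"
proof
  fix x
  show "pderiv_dir v (\<lambda>x. f x + g x) x = pderiv_dir v f x + pderiv_dir v g x"
    using has_derivative_add[OF assms[THEN differentiable_onD_UNIV, of x]]
    by (subst pderiv_dir_eqI) (auto simp: pderiv_dir_def)
qed

lemma pderiv_dir_mult:
  fixes f g :: "'a::euclidean_space \<Rightarrow> real"
  assumes "f differentiable_on UNIV" "g differentiable_on UNIV"
  shows "pderiv_dir v (\<lambda>x. f x * g x) = (\<lambda>x. f x * pderiv_dir v g x + pderiv_dir v f x * g x)"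
proof
  fix x
  show "pderiv_dir v (\<lambda>x. f x * g x) x = f x * pderiv_dir v g x + pderiv_dir v f x * g x"
    using has_derivative_mult[OF assms[THEN differentiable_onD_UNIV, of x]]
    by (subst pderiv_dir_eqI) (auto simp: pderiv_dir_def)
qed

section \<open>Regularity jointly in time and space, and test functions\<close>

lemma Ck_space_cong: "(\<And>t. t \<in> I \<Longrightarrow> w t = w' t) \<Longrightarrow> Ck_space k I w \<longleftrightarrow> Ck_space k I w'"
proof (induction k arbitrary: w w')
  case 0
  then show ?case by (auto intro!: continuous_on_cong)
next
  case (Suc k)
  have "Ck_space k I (\<lambda>t. pderiv_dir v (w t)) \<longleftrightarrow> Ck_space k I (\<lambda>t. pderiv_dir v (w' t))" for v
    using Suc.prems by (intro Suc.IH) simp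
  moreover have "continuous_on (I \<times> UNIV) (\<lambda>(t, x). w t x) \<longleftrightarrow> continuous_on (I \<times> UNIV) (\<lambda>(t, x). w' t x)"
    using Suc.prems by (intro continuous_on_cong) auto
  ultimately show ?case using Suc.prems by simp
qed

lemma Ck_space_Suc: "Ck_space (Suc k) I w \<Longrightarrow> Ck_space k I w"
  by (induction k arbitrary: w) auto

lemma Ck_space_cont: "Ck_space k I w \<Longrightarrow> continuous_on (I \<times> UNIV) (\<lambda>(t, x). w t x)"
  by (cases k) auto

lemma Ck_space_const: "continuous_on I a \<Longrightarrow> Ck_space k I (\<lambda>t x. a t)"
proof (induction k arbitrary: a)
  case 0
  then show ?case by (auto simp: case_prod_unfold intro!: continuous_on_compose2[of I a] continuous_intros)
next
  case (Suc k)
  have "pderiv_dir v (\<lambda>x::real^2. a t) = (\<lambda>x. 0)" for v t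
    by (rule ext, rule pderiv_dir_eqI) (rule has_derivative_const)
  moreover have "continuous_on (I \<times> UNIV) (\<lambda>(t, x::real^2). a t)"
    using Suc.prems by (auto simp: case_prod_unfold intro!: continuous_on_compose2[of I a] continuous_intros)
  ultimately show ?case using Suc.IH[of "\<lambda>_. 0"] by simp
qed

lemma Ck_space_add: "Ck_space k I w \<Longrightarrow> Ck_space k I v \<Longrightarrow> Ck_space k I (\<lambda>t x. w t x + v t x)"
proof (induction k arbitrary: w v)
  case 0
  then show ?case using continuous_on_add[of "I \<times> UNIV" "\<lambda>(t, x). w t x" "\<lambda>(t, x). v t x"]
    by (simp add: case_prod_unfold)
next
  case (Suc k)
  have "Ck_space k I (\<lambda>t. pderiv_dir b (\<lambda>x. w t x + v t x))" if b: "b \<in> Basis" for b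
    using Suc.prems b
    by (subst Ck_space_cong[where w'="\<lambda>t x. pderiv_dir b (w t) x + pderiv_dir b (v t) x"])
      (auto simp: pderiv_dir_add intro!: Suc.IH)
  then show ?case using Suc.prems continuous_on_add[of "I \<times> UNIV" "\<lambda>(t, x). w t x" "\<lambda>(t, x). v t x"]
    by (auto simp: case_prod_unfold intro!: derivative_intros)
qed

lemma Ck_space_mult: "Ck_space k I w \<Longrightarrow> Ck_space k I v \<Longrightarrow> Ck_space k I (\<lambda>t x. w t x * v t x)"
proof (induction k arbitrary: w v)
  case 0
  then show ?case using continuous_on_mult[of "I \<times> UNIV" "\<lambda>(t, x). w t x" "\<lambda>(t, x). v t x"]
    by (simp add: case_prod_unfold)
next
  case (Suc k)
  have "Ck_space k I (\<lambda>t. pderiv_dir b (\<lambda>x. w t x * v t x))" if b: "b \<in> Basis" for b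
    using Suc.prems b Ck_space_Suc[OF Suc.prems(1)] Ck_space_Suc[OF Suc.prems(2)]
    by (subst Ck_space_cong[where w'="\<lambda>t x. w t x * pderiv_dir b (v t) x + pderiv_dir b (w t) x * v t x"])
      (auto simp: pderiv_dir_mult intro!: Suc.IH Ck_space_add)
  then show ?case using Suc.prems continuous_on_mult[of "I \<times> UNIV" "\<lambda>(t, x). w t x" "\<lambda>(t, x). v t x"]
    by (auto simp: case_prod_unfold intro!: derivative_intros)
qed

lemma Ck_space_cmult: "Ck_space k I w \<Longrightarrow> Ck_space k I (\<lambda>t x. c * w t x)"
  by (rule Ck_space_mult[OF Ck_space_const]) simp_all

lemma Ck_space_power: "Ck_space k I w \<Longrightarrow> Ck_space k I (\<lambda>t x. w t x ^ n)"
  by (induction n) (auto intro!: Ck_space_mult Ck_space_const continuous_intros)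

lemma Ck_space_sum: "(\<And>i. i \<in> A \<Longrightarrow> Ck_space k I (w i)) \<Longrightarrow> Ck_space k I (\<lambda>t x. \<Sum>i\<in>A. w i t x)"
  by (induction A rule: infinite_finite_induct) (auto intro!: Ck_space_add Ck_space_const)

lemma Ck_space_trig:
  "continuous_on I a \<Longrightarrow> continuous_on I b \<Longrightarrow>
   Ck_space k I (\<lambda>t x. a t * cos (2 * pi * (freq l \<bullet> x)) + b t * sin (2 * pi * (freq l \<bullet> x)))"
proof (induction k arbitrary: a b)
  case 0
  then show ?case
    by (auto simp: case_prod_unfold intro!: continuous_intros continuous_on_compose2[of I a] continuous_on_compose2[of I b])
next
  case (Suc k)
  have d: "((\<lambda>x. a t * cos (2 * pi * (freq l \<bullet> x)) + b t * sin (2 * pi * (freq l \<bullet> x))) has_derivative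
     (\<lambda>v. (b t * (2 * pi * (freq l \<bullet> v))) * cos (2 * pi * (freq l \<bullet> x)) + (- (a t * (2 * pi * (freq l \<bullet> v)))) * sin (2 * pi * (freq l \<bullet> x)))) (at x)" for t x
    by (auto intro!: derivative_eq_intros simp: algebra_simps)
  then have "pderiv_dir v (\<lambda>x. a t * cos (2 * pi * (freq l \<bullet> x)) + b t * sin (2 * pi * (freq l \<bullet> x))) =
     (\<lambda>x. (b t * (2 * pi * (freq l \<bullet> v))) * cos (2 * pi * (freq l \<bullet> x)) + (- (a t * (2 * pi * (freq l \<bullet> v)))) * sin (2 * pi * (freq l \<bullet> x)))" for v t
    by (intro ext pderiv_dir_eqI)
  moreover have "Ck_space k I (\<lambda>t x. (b t * (2 * pi * (freq l \<bullet> v))) * cos (2 * pi * (freq l \<bullet> x)) + (- (a t * (2 * pi * (freq l \<bullet> v)))) * sin (2 * pi * (freq l \<bullet> x)))" for v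
    using Suc.prems by (intro Suc.IH continuous_intros)
  moreover have "continuous_on (I \<times> UNIV) (\<lambda>(t, x). a t * cos (2 * pi * (freq l \<bullet> x)) + b t * sin (2 * pi * (freq l \<bullet> x)))"
    using Suc.prems
    by (auto simp: case_prod_unfold intro!: continuous_intros continuous_on_compose2[of I a] continuous_on_compose2[of I b])
  ultimately show ?case
    using differentiableI[OF d] by (simp add: differentiable_on_def)
qed

lemma Ck_space_Ck: "Ck_space k I w \<Longrightarrow> t \<in> I \<Longrightarrow> Ck k (w t)"
proof (induction k arbitrary: w)
  case 0
  then show ?case
  proof -
    have "continuous_on UNIV (\<lambda>x::real^2. (t, x))" by (intro continuous_intros)
    then show ?thesis using 0 continuous_on_compose2[of "I \<times> UNIV" "\<lambda>(t, x). w t x" UNIV "\<lambda>x. (t, x)"]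
      by auto
  qed
qed auto

lemma Ck_space_torus_test: "(\<And>k. Ck_space k I w) \<Longrightarrow> periodic (w t) \<Longrightarrow> t \<in> I \<Longrightarrow> torus_test (w t)"
  unfolding torus_test_def smooth_def using Ck_space_Ck by blast

text \<open>A single function is viewed as a family over the one-point time set, so that closure
  under sums, products and powers has to be proved only once, for \<open>Ck_space\<close>.\<close>

lemma Ck_Ck_space: "Ck k f \<Longrightarrow> Ck_space k {0} (\<lambda>_. f)"
proof (induction k arbitrary: f)
  case 0
  then show ?case by (auto simp: case_prod_unfold intro!: continuous_on_compose2[of UNIV f] continuous_intros)
next
  case (Suc k)
  then have "continuous_on UNIV f" by (auto intro: differentiable_imp_continuous_on)
  then show ?case using Suc
    by (auto simp: case_prod_unfold intro!: continuous_on_compose2[of UNIV f] continuous_intros)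
qed

lemma torus_test_iff: "torus_test u \<longleftrightarrow> periodic u \<and> (\<forall>k. Ck_space k {0} (\<lambda>_. u))"
  unfolding torus_test_def smooth_def using Ck_Ck_space Ck_space_Ck[of _ "{0}" "\<lambda>_. u" 0] by blast

lemma torus_test_add: "torus_test u \<Longrightarrow> torus_test v \<Longrightarrow> torus_test (\<lambda>x. u x + v x)"
  and torus_test_mult: "torus_test u \<Longrightarrow> torus_test v \<Longrightarrow> torus_test (\<lambda>x. u x * v x)"
  and torus_test_power: "torus_test u \<Longrightarrow> torus_test (\<lambda>x. u x ^ n)"
  and torus_test_cmult: "torus_test u \<Longrightarrow> torus_test (\<lambda>x. c * u x)"
  and torus_test_const: "torus_test (\<lambda>x. c)"
  by (auto simp: torus_test_iff periodic_def intro: Ck_space_add Ck_space_mult Ck_space_power Ck_space_cmult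
        Ck_space_const continuous_on_const)

lemmas torus_test_intros = torus_test_add torus_test_mult torus_test_power torus_test_cmult torus_test_const

lemma torus_test_cos: "torus_test (\<lambda>x. cos (2 * pi * (freq l \<bullet> x)))"
  and torus_test_sin: "torus_test (\<lambda>x. sin (2 * pi * (freq l \<bullet> x)))"
proof -
  have "Re (echar l (x + freq k)) = Re (echar l x)" "Im (echar l (x + freq k)) = Im (echar l x)" for k x
    by (simp_all add: echar_add_point)
  then have p: "periodic (\<lambda>x. cos (2 * pi * (freq l \<bullet> x)))" "periodic (\<lambda>x. sin (2 * pi * (freq l \<bullet> x)))"
    by (simp_all add: periodic_def echar_def)
  show "torus_test (\<lambda>x. cos (2 * pi * (freq l \<bullet> x)))" "torus_test (\<lambda>x. sin (2 * pi * (freq l \<bullet> x)))"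
    using p Ck_space_trig[of "{0}" "\<lambda>_. 1" "\<lambda>_. 0" _ l] Ck_space_trig[of "{0}" "\<lambda>_. 0" "\<lambda>_. 1" _ l]
    by (auto simp: torus_test_iff)
qed

lemma torus_test_diff_UNIV: "torus_test u \<Longrightarrow> u differentiable_on UNIV"
  unfolding torus_test_def smooth_def by (metis Ck.simps(2))

lemma torus_test_cper: "torus_test u \<Longrightarrow> cper (cx u)"
  unfolding cper_cx_iff torus_test_def smooth_def by (metis Ck.simps(1))

lemma periodic_pderiv_dir:
  assumes "periodic u" "u differentiable_on UNIV"
  shows "periodic (pderiv_dir v u)"
  unfolding periodic_def
proof (intro allI)
  fix k x
  have "((\<lambda>y. u (y + freq k)) has_derivative frechet_derivative u (at (x + freq k))) (at x)"
  proof -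
    have "((\<lambda>y. y + freq k) has_derivative (\<lambda>y. y)) (at x)" by (auto intro!: derivative_eq_intros)
    from has_derivative_compose[OF this, of u "frechet_derivative u (at (x + freq k))"]
    show ?thesis using differentiable_onD_UNIV[OF assms(2), of "x + freq k"] by simp
  qed
  moreover have "(\<lambda>y. u (y + freq k)) = u" using assms(1) by (simp add: periodic_def)
  ultimately have "(u has_derivative frechet_derivative u (at (x + freq k))) (at x)" by simp
  from pderiv_dir_eqI[OF this, of v] show "pderiv_dir v u (x + freq k) = pderiv_dir v u x"
    by (simp add: pderiv_dir_def)
qed

lemma torus_test_pderiv_dir: "torus_test u \<Longrightarrow> v \<in> Basis \<Longrightarrow> torus_test (pderiv_dir v u)"
  using periodic_pderiv_dir[of u v] torus_test_diff_UNIV[of u]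
  unfolding torus_test_def smooth_def by (metis Ck.simps(2))

lemma torus_test_sum: "(\<And>i. i \<in> A \<Longrightarrow> torus_test (f i)) \<Longrightarrow> torus_test (\<lambda>x. \<Sum>i\<in>A. f i x)"
  by (induction A rule: infinite_finite_induct) (auto intro: torus_test_const torus_test_add)

lemma torus_test_laplacian: "torus_test u \<Longrightarrow> torus_test (laplacian u)"
  unfolding laplacian_def[abs_def] by (intro torus_test_sum torus_test_pderiv_dir)

lemma Ck_space_laplacian: "Ck_space (Suc (Suc k)) I w \<Longrightarrow> Ck_space k I (\<lambda>t. laplacian (w t))"
  unfolding laplacian_def[abs_def] by (intro Ck_space_sum) auto

text \<open>In place of an integration by parts, the Fourier coefficient of the translate by t v is
  differentiated at t = 0 in two ways: under the integral sign, and from the explicit phase factor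
  of \<open>fc_translate\<close>.\<close>

lemma fc_pderiv_dir:
  assumes u: "torus_test u" and v: "v \<in> Basis"
  shows "fc (cx (pderiv_dir v u)) k = (2 * pi * (freq k \<bullet> v)) * \<i> * fc (cx u) k"
proof -
  have cu: "cper (cx u)" by (rule torus_test_cper[OF u])
  have cpu: "cper (cx (pderiv_dir v u))" by (intro torus_test_cper torus_test_pderiv_dir u v)
  let ?F = "\<lambda>t::real. integral (cbox 0 1) (\<lambda>x. complex_of_real (u (x + t *\<^sub>R v)) * cnj (echar k x))"
  have F: "?F t = cis (2 * pi * (freq k \<bullet> v) * t) * fc (cx u) k" for t
    using fc_translate[OF cu, of "t *\<^sub>R v" k] by (simp add: fc_def ip_def echar_def mult_ac)
  have "(?F has_vector_derivative integral (cbox 0 1) (\<lambda>x. complex_of_real (pderiv_dir v u (x + 0 *\<^sub>R v)) * cnj (echar k x)))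
      (at 0 within UNIV)"
  proof (rule leibniz_rule_vector_derivative)
    fix t x
    have "((\<lambda>t. x + t *\<^sub>R v) has_derivative (\<lambda>t. t *\<^sub>R v)) (at t)"
      by (auto intro!: derivative_eq_intros)
    from has_derivative_compose[OF this differentiable_onD_UNIV[OF torus_test_diff_UNIV[OF u]]]
    have "((\<lambda>t. u (x + t *\<^sub>R v)) has_derivative (\<lambda>s. frechet_derivative u (at (x + t *\<^sub>R v)) (s *\<^sub>R v))) (at t)" .
    moreover have "frechet_derivative u (at (x + t *\<^sub>R v)) (s *\<^sub>R v) = s * pderiv_dir v u (x + t *\<^sub>R v)" for s
      unfolding pderiv_dir_def
      using linear_scale[OF has_derivative_linear[OF differentiable_onD_UNIV[OF torus_test_diff_UNIV[OF u]]]]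
      by simp
    ultimately have "((\<lambda>t. u (x + t *\<^sub>R v)) has_vector_derivative pderiv_dir v u (x + t *\<^sub>R v)) (at t)"
      by (simp add: has_vector_derivative_def)
    then have "((\<lambda>t. complex_of_real (u (x + t *\<^sub>R v)) * cnj (echar k x)) has_vector_derivative
       complex_of_real (pderiv_dir v u (x + t *\<^sub>R v)) * cnj (echar k x)) (at t)"
      by (intro has_vector_derivative_mult_left bounded_linear.has_vector_derivative[OF bounded_linear_of_real])
    then show "((\<lambda>t. complex_of_real (u (x + t *\<^sub>R v)) * cnj (echar k x)) has_vector_derivative
       complex_of_real (pderiv_dir v u (x + t *\<^sub>R v)) * cnj (echar k x)) (at t within UNIV)" by simp
  next
    show "(\<lambda>x. complex_of_real (u (x + t *\<^sub>R v)) * cnj (echar k x)) integrable_on cbox 0 1" for t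
      by (intro cper_integrable cper_mult cper_cnj cper_echar cper_translate[of "cx u"] cu)
  next
    show "continuous_on (UNIV \<times> cbox 0 1) (\<lambda>(t, x). complex_of_real (pderiv_dir v u (x + t *\<^sub>R v)) * cnj (echar k x))"
      unfolding case_prod_unfold
      by (intro continuous_intros continuous_on_compose2[OF cper_cxD[OF cpu, of UNIV]]) auto
  qed auto
  then have 1: "(?F has_vector_derivative fc (cx (pderiv_dir v u)) k) (at 0)"
    by (simp add: fc_def ip_def)
  have 2: "(?F has_vector_derivative (2 * pi * (freq k \<bullet> v)) * \<i> * fc (cx u) k) (at 0)"
    unfolding F cis_conv_exp
    by (auto intro!: derivative_eq_intros has_vector_derivative_real_field)
  show ?thesis by (rule vector_derivative_unique_at[OF 1 2])
qed

lemma fc_laplacian: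
  assumes u: "torus_test u"
  shows "fc (cx (laplacian u)) k = - complex_of_real ((2 * pi * nk k)\<^sup>2) * fc (cx u) k"
proof -
  have "cx (laplacian u) = (\<lambda>x. \<Sum>v\<in>Basis. cx (pderiv_dir v (pderiv_dir v u)) x)"
    by (simp add: laplacian_def fun_eq_iff)
  then have "fc (cx (laplacian u)) k = (\<Sum>v\<in>Basis. fc (cx (pderiv_dir v (pderiv_dir v u))) k)"
    by (simp only: fc_sum torus_test_cper torus_test_pderiv_dir u)
  also have "\<dots> = (\<Sum>v\<in>Basis. - (2 * pi)\<^sup>2 * (freq k \<bullet> v)\<^sup>2 * fc (cx u) k)"
    by (intro sum.cong refl) (simp add: fc_pderiv_dir torus_test_pderiv_dir u power2_eq_square)
  also have "\<dots> = - complex_of_real ((2 * pi)\<^sup>2 * (\<Sum>v\<in>Basis. (freq k \<bullet> v)\<^sup>2)) * fc (cx u) k"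
    by (simp add: sum_distrib_left sum_distrib_right sum_negf)
  also have "(\<Sum>v\<in>Basis. (freq k \<bullet> v)\<^sup>2) = (nk k)\<^sup>2"
    unfolding nk_def norm_eq_sqrt_inner by (subst (2) euclidean_inner) (simp add: power2_eq_square sum_nonneg)
  finally show ?thesis by (simp add: power_mult_distrib)
qed

lemma fc_laplacian_iter:
  assumes u: "torus_test u"
  shows "torus_test ((laplacian ^^ p) u) \<and> cmod (fc (cx ((laplacian ^^ p) u)) k) = (2 * pi * nk k) ^ (2 * p) * cmod (fc (cx u) k)"
proof (induction p)
  case (Suc p)
  then show ?case
    by (simp add: torus_test_laplacian fc_laplacian norm_mult power_add power2_eq_square norm_power mult_ac)
qed (use u in simp)

text \<open>For k \<noteq> 0 the weight 1 + |k|^2 is at most 2 (2 pi |k|)^2, and powers of (2 pi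
  |k|)^2 are produced by iterated Laplacians. The constant involves \<open>u\<close> only through
  \<open>M\<close>, so that a bound uniform in time gives decay uniform in time.\<close>

lemma fc_decay:
  assumes u: "torus_test u" and M: "\<And>x. \<bar>u x\<bar> \<le> M" "\<And>x. \<bar>(laplacian ^^ p) u x\<bar> \<le> M"
  shows "(1 + (nk k)\<^sup>2) ^ p * cmod (fc (cx u) k) \<le> 2 ^ p * M"
proof (cases "k = 0")
  case True
  have "0 \<le> M" using M(1)[of 0] by linarith
  then have "1 * M \<le> 2 ^ p * M" by (intro mult_right_mono) auto
  then show ?thesis using True norm_fc_le[OF torus_test_cper[OF u], of M 0] M by simp
next
  case False
  have "1 + (nk k)\<^sup>2 \<le> 2 * (nk k)\<^sup>2" using nk_ge_1[OF False] by simp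
  then have "(1 + (nk k)\<^sup>2) ^ p \<le> (2 * (nk k)\<^sup>2) ^ p" by (intro power_mono) auto
  also have "\<dots> = 2 ^ p * nk k ^ (2 * p)" by (simp add: power_mult_distrib power_mult)
  also have "\<dots> \<le> 2 ^ p * (2 * pi * nk k) ^ (2 * p)"
    using nk_ge_1[OF False] pi_gt3 by (intro mult_left_mono power_mono) (auto simp: mult_ge1_I)
  finally have "(1 + (nk k)\<^sup>2) ^ p * cmod (fc (cx u) k) \<le> 2 ^ p * ((2 * pi * nk k) ^ (2 * p) * cmod (fc (cx u) k))"
    by (simp add: mult_right_mono mult.assoc[symmetric])
  also have "(2 * pi * nk k) ^ (2 * p) * cmod (fc (cx u) k) \<le> M"
    using fc_laplacian_iter[OF u, of p k] norm_fc_le[of "cx ((laplacian ^^ p) u)" M k] M(2) torus_test_cper by fastforce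
  finally show ?thesis by simp
qed

lemma torus_test_bounded:
  assumes "torus_test u" obtains M where "\<And>x. \<bar>u x\<bar> \<le> M"
  using cper_bounded[OF torus_test_cper[OF assms]] by (metis norm_of_real)

lemma torus_test_decay:
  assumes u: "torus_test u"
  obtains M where "0 \<le> M" "\<And>k. (1 + (nk k)\<^sup>2) ^ p * cmod (fc (cx u) k) \<le> M"
proof -
  obtain M1 where M1: "\<And>x. \<bar>u x\<bar> \<le> M1" using torus_test_bounded[OF u] by blast
  obtain M2 where M2: "\<And>x. \<bar>(laplacian ^^ p) u x\<bar> \<le> M2"
    using torus_test_bounded fc_laplacian_iter[OF u] by blast
  have *: "(1 + (nk k)\<^sup>2) ^ p * cmod (fc (cx u) k) \<le> 2 ^ p * max M1 M2" for k
    using M1 M2 by (intro fc_decay u) (auto simp: le_max_iff_disj)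
  moreover have "0 \<le> 2 ^ p * max M1 M2" using M1[of 0] by auto
  ultimately show thesis using that by blast
qed

lemma torus_test_H1: "torus_test u \<Longrightarrow> H1 (cx u)"
proof -
  assume u: "torus_test u"
  obtain M where M: "0 \<le> M" "\<And>k. (1 + (nk k)\<^sup>2) ^ 2 * cmod (fc (cx u) k) \<le> M"
    using torus_test_decay[OF u] by blast
  have "(\<lambda>k. M\<^sup>2 * (1 / (1 + (nk k)\<^sup>2)\<^sup>2)) summable_on UNIV" by (intro summable_on_cmult_right summable_lattice)
  then show ?thesis unfolding H1_def
  proof (rule summable_on_comparison_test)
    fix k
    let ?x = "1 + (nk k)\<^sup>2"
    have x: "1 \<le> ?x" by simp
    have "(nk k)\<^sup>2 \<le> ?x\<^sup>2" using mult_mono[of 1 ?x ?x ?x] by (simp add: power2_eq_square)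
    then have "(nk k)\<^sup>2 * (cmod (fc (cx u) k))\<^sup>2 * ?x\<^sup>2 \<le> ?x\<^sup>2 * (cmod (fc (cx u) k))\<^sup>2 * ?x\<^sup>2"
      by (intro mult_right_mono) auto
    also have "\<dots> = (?x\<^sup>2 * cmod (fc (cx u) k))\<^sup>2" by (simp add: power2_eq_square)
    also have "\<dots> \<le> M\<^sup>2" using M x by (intro power_mono) auto
    finally have "(nk k)\<^sup>2 * (cmod (fc (cx u) k))\<^sup>2 * ?x\<^sup>2 \<le> M\<^sup>2" .
    moreover have "0 < ?x\<^sup>2" by (rule zero_less_power) (use x in linarith)
    ultimately show "(nk k)\<^sup>2 * (cmod (fc (cx u) k))\<^sup>2 \<le> M\<^sup>2 * (1 / ?x\<^sup>2)"
      by (simp only: pos_le_divide_eq times_divide_eq_right mult_1_right)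
  qed auto
qed

text \<open>Turns the equation into an ordinary differential equation for each Fourier coefficient.
  Joint continuity of the right hand side in time and space justifies differentiation under the
  integral.\<close>

lemma fc_time_derivative:
  assumes sol: "smooth_solution {0..T} F w" and F: "\<And>k. Ck_space k {0..T} F" "\<And>t. t \<in> {0..T} \<Longrightarrow> periodic (F t)"
    and t: "t \<in> {0..T}"
  shows "((\<lambda>s. fc (cx (w s)) k) has_vector_derivative
    - complex_of_real ((2 * pi * nk k) ^ 4) * fc (cx (w t)) k - complex_of_real ((2 * pi * nk k)\<^sup>2) * fc (cx (F t)) k)
    (at t within {0..T})"
proof -
  have w: "\<And>k. Ck_space k {0..T} w" "\<And>s. s \<in> {0..T} \<Longrightarrow> periodic (w s)"
    and dw: "\<And>s x. s \<in> {0..T} \<Longrightarrow> ((\<lambda>s. w s x) has_real_derivative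
        (laplacian (F s) x - laplacian (laplacian (w s)) x)) (at s within {0..T})"
    using sol by (auto simp: smooth_solution_def)
  have tw: "torus_test (w s)" and tF: "torus_test (F s)" if "s \<in> {0..T}" for s
    using Ck_space_torus_test[OF w(1)] Ck_space_torus_test[OF F(1)] w(2) F(2) that by blast+
  let ?R = "\<lambda>s x. laplacian (F s) x - laplacian (laplacian (w s)) x"
  have cR: "continuous_on ({0..T} \<times> UNIV) (\<lambda>(s, x). ?R s x)"
  proof -
    have "continuous_on ({0..T} \<times> UNIV) (\<lambda>(s, x). laplacian (F s) x)"
      by (rule Ck_space_cont[OF Ck_space_laplacian[OF F(1)]])
    moreover have "continuous_on ({0..T} \<times> UNIV) (\<lambda>(s, x). laplacian (laplacian (w s)) x)"
      by (rule Ck_space_cont[OF Ck_space_laplacian[OF Ck_space_laplacian[OF w(1)]]])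
    ultimately show ?thesis unfolding case_prod_unfold by (intro continuous_intros)
  qed
  have "((\<lambda>s. integral (cbox 0 1) (\<lambda>x. complex_of_real (w s x) * cnj (echar k x))) has_vector_derivative
      integral (cbox 0 1) (\<lambda>x. complex_of_real (?R t x) * cnj (echar k x))) (at t within {0..T})"
  proof (rule leibniz_rule_vector_derivative)
    fix s x assume s: "s \<in> {0..T}"
    show "((\<lambda>s. complex_of_real (w s x) * cnj (echar k x)) has_vector_derivative complex_of_real (?R s x) * cnj (echar k x))
      (at s within {0..T})"
      using dw[OF s, of x]
      by (intro has_vector_derivative_mult_left bounded_linear.has_vector_derivative[OF bounded_linear_of_real])
         (simp add: has_real_derivative_iff_has_vector_derivative)
  next
    show "(\<lambda>x. complex_of_real (w s x) * cnj (echar k x)) integrable_on cbox 0 1" if "s \<in> {0..T}" for s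
      by (intro cper_integrable cper_mult cper_cnj cper_echar torus_test_cper tw that)
  next
    have "continuous_on ({0..T} \<times> cbox 0 1) (\<lambda>(s, x). ?R s x)"
      by (rule continuous_on_subset[OF cR]) auto
    then show "continuous_on ({0..T} \<times> cbox 0 1) (\<lambda>(s, x). complex_of_real (?R s x) * cnj (echar k x))"
      unfolding case_prod_unfold
      by (intro continuous_on_mult continuous_on_of_real continuous_on_cnj continuous_echar continuous_on_snd continuous_on_id)
  qed (use t in auto)
  also have "integral (cbox 0 1) (\<lambda>x. complex_of_real (?R t x) * cnj (echar k x)) =
     fc (cx (laplacian (F t))) k - fc (cx (laplacian (laplacian (w t)))) k"
    using fc_diff[of "cx (laplacian (F t))" "cx (laplacian (laplacian (w t)))" k] tw[OF t] tF[OF t]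
    by (simp add: fc_def ip_def torus_test_cper torus_test_laplacian)
  also have "\<dots> = - complex_of_real ((2 * pi * nk k) ^ 4) * fc (cx (w t)) k - complex_of_real ((2 * pi * nk k)\<^sup>2) * fc (cx (F t)) k"
    using tw[OF t] tF[OF t]
    by (simp add: fc_laplacian torus_test_laplacian power2_eq_square power4_eq_xxxx algebra_simps)
  finally show ?thesis by (simp only: fc_def ip_def)
qed

text \<open>Continuity on the compact product of the time interval with the unit square gives the
  bound, and periodicity extends it to the plane.\<close>

lemma Ck_space_bounded:
  assumes "\<And>k. Ck_space k {0..T} w" "\<And>t. t \<in> {0..T} \<Longrightarrow> periodic (w t)"
  obtains M where "\<And>t x. t \<in> {0..T} \<Longrightarrow> \<bar>(laplacian ^^ p) (w t) x\<bar> \<le> M"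
proof -
  have tw: "torus_test (w s)" if "s \<in> {0..T}" for s
    using Ck_space_torus_test[OF assms(1)] assms(2) that by blast
  have "Ck_space k {0..T} (\<lambda>t. (laplacian ^^ p) (w t))" for k
  proof (induction p arbitrary: k)
    case (Suc p)
    then show ?case using Ck_space_laplacian[OF Suc.IH[of "Suc (Suc k)"]] by simp
  qed (use assms in simp)
  then have "continuous_on ({0..T} \<times> UNIV) (\<lambda>(t, x). (laplacian ^^ p) (w t) x)"
    by (rule Ck_space_cont)
  then have "continuous_on ({0..T} \<times> cbox 0 1) (\<lambda>(t, x). (laplacian ^^ p) (w t) x)"
    by (rule continuous_on_subset) auto
  then have "bounded ((\<lambda>(t, x). (laplacian ^^ p) (w t) x) ` ({0..T} \<times> cbox 0 1))"
    by (intro compact_imp_bounded compact_continuous_image compact_Times) auto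
  then obtain M where M: "\<And>t x. t \<in> {0..T} \<Longrightarrow> x \<in> cbox 0 1 \<Longrightarrow> \<bar>(laplacian ^^ p) (w t) x\<bar> \<le> M"
    unfolding bounded_iff by fastforce
  have "\<bar>(laplacian ^^ p) (w t) x\<bar> \<le> M" if t: "t \<in> {0..T}" for t x
  proof -
    obtain y k where y: "y \<in> cbox 0 1" "x = y + freq k" by (rule unit_square_rep)
    have "periodic ((laplacian ^^ p) (w t))"
      using fc_laplacian_iter[OF tw[OF t]] by (simp add: torus_test_def)
    then show ?thesis using M[OF t y(1)] y(2) by (simp add: periodic_def)
  qed
  then show thesis by (rule that)
qed

section \<open>Absolutely convergent Fourier series\<close>

lemma fc_series:
  assumes c: "(\<lambda>k. cmod (c k)) summable_on UNIV"
  shows fc_series_cper: "cper (\<lambda>x. \<Sum>\<^sub>\<infinity>k. c k * echar k x)"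
    and fc_series_fc: "fc (\<lambda>x. \<Sum>\<^sub>\<infinity>k. c k * echar k x) l = c l"
    and fc_series_has_sum: "((\<lambda>k. c k * echar k x) has_sum (\<Sum>\<^sub>\<infinity>k. c k * echar k x)) UNIV"
proof -
  let ?S = "\<lambda>x. \<Sum>\<^sub>\<infinity>k. c k * echar k x"
  have lim: "uniform_limit UNIV (\<lambda>X x. \<Sum>k\<in>X. c k * echar k x) ?S (finite_subsets_at_top UNIV)"
    by (rule Weierstrass_m_test_general[where M="\<lambda>k. cmod (c k)"])
       (use c in \<open>auto simp: norm_mult\<close>)
  have per: "?S (x + freq k) = ?S x" for k x
    by (simp add: echar_add_point)
  have "continuous_on UNIV ?S"
    by (rule uniform_limit_theorem[OF always_eventually lim]) (simp_all add: continuous_on_sum continuous_on_mult continuous_echar)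
  with per show S: "cper ?S" by (simp add: cper_def)
  show "((\<lambda>k. c k * echar k x) has_sum ?S x) UNIV"
    using tendsto_uniform_limitI[OF lim, of x] by (simp add: has_sum_def)
  have "cmod (fc ?S l - c l) \<le> e" if e: "e > 0" for e
  proof -
    obtain X0 where X0: "finite X0" "\<And>Y. finite Y \<Longrightarrow> X0 \<subseteq> Y \<Longrightarrow> (\<forall>x. dist (\<Sum>k\<in>Y. c k * echar k x) (?S x) < e)"
      using uniform_limitD[OF lim e] unfolding eventually_finite_subsets_at_top by auto
    \<comment> \<open>With \<open>l\<close> adjoined, the partial sum already has the coefficient
      \<open>c l\<close>, and the uniform error of the remainder bounds the discrepancy.\<close>
    define X where "X = insert l X0"
    have X: "finite X" "l \<in> X" "\<And>x. dist (\<Sum>k\<in>X. c k * echar k x) (?S x) < e"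
      using X0(1) X0(2)[of X] by (auto simp: X_def)
    let ?p = "\<lambda>x. \<Sum>k\<in>X. c k * echar k x"
    have p: "cper ?p" by (intro cper_sum cper_mult cper_const cper_echar)
    have "cmod (fc (\<lambda>x. ?S x - ?p x) l) \<le> e"
      using X(3) by (intro norm_fc_le cper_diff S p) (simp add: dist_norm norm_minus_commute less_imp_le)
    then show ?thesis using X(1,2) by (simp add: fc_diff S p fc_trig)
  qed
  then have "cmod (fc ?S l - c l) \<le> 0" by (rule field_le_epsilon) simp
  then show "fc ?S l = c l" by simp
qed

lemma fc_inversion:
  assumes f: "cper f" and s: "(\<lambda>k. cmod (fc f k)) summable_on UNIV"
  shows "((\<lambda>k. fc f k * echar k x) has_sum f x) UNIV"
proof -
  have "(\<lambda>x. \<Sum>\<^sub>\<infinity>k. fc f k * echar k x) = f"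
    by (rule fc_inject[OF fc_series_cper[OF s] f fc_series_fc[OF s]])
  then show ?thesis using fc_series_has_sum[OF s, of x] by metis
qed

section \<open>The good term\<close>

text \<open>All three rest on the factorization (a^3 - b^3)(a - b) = (a - b)^2 (a^2 + a b + b^2).
  The second factor dominates (a + b)^2, which gives control of squares, and also (a - b)^2, which
  gives control of fourth powers of differences.\<close>

lemma cube_diff_nonneg: "0 \<le> (a ^ 3 - b ^ 3) * (a - b)"
  and square_diff_le: "(a\<^sup>2 - b\<^sup>2)\<^sup>2 \<le> 4 / 3 * ((a ^ 3 - b ^ 3) * (a - b))"
  and fourth_power_diff_le: "(a - b) ^ 4 \<le> 4 * ((a ^ 3 - b ^ 3) * (a - b))" for a b :: real
proof -
  have *: "(a ^ 3 - b ^ 3) * (a - b) = (a - b)\<^sup>2 * (a\<^sup>2 + a * b + b\<^sup>2)"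
    by (simp add: power2_eq_square power3_eq_cube algebra_simps)
  have 1: "(a + b)\<^sup>2 \<le> 4 / 3 * (a\<^sup>2 + a * b + b\<^sup>2)"
  proof -
    have "3 * (a + b)\<^sup>2 \<le> 4 * (a\<^sup>2 + a * b + b\<^sup>2)"
      using zero_le_power2[of "a - b"] by (simp add: power2_eq_square algebra_simps)
    then show ?thesis by linarith
  qed
  have 2: "(a - b)\<^sup>2 \<le> 4 * (a\<^sup>2 + a * b + b\<^sup>2)"
    using zero_le_power2[of "a + b"] by (simp add: power2_eq_square algebra_simps)
  have "a\<^sup>2 + a * b + b\<^sup>2 = (a + b / 2)\<^sup>2 + 3 / 4 * b\<^sup>2"
    by (simp add: power2_eq_square algebra_simps)
  then have "0 \<le> a\<^sup>2 + a * b + b\<^sup>2" by simp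
  then show "0 \<le> (a ^ 3 - b ^ 3) * (a - b)" unfolding * by simp
  have "(a\<^sup>2 - b\<^sup>2)\<^sup>2 = (a - b)\<^sup>2 * (a + b)\<^sup>2" by (simp add: power2_eq_square algebra_simps)
  also have "\<dots> \<le> (a - b)\<^sup>2 * (4 / 3 * (a\<^sup>2 + a * b + b\<^sup>2))" using 1 by (intro mult_left_mono) auto
  also have "\<dots> = 4 / 3 * ((a - b)\<^sup>2 * (a\<^sup>2 + a * b + b\<^sup>2))" by (rule mult.left_commute)
  finally show "(a\<^sup>2 - b\<^sup>2)\<^sup>2 \<le> 4 / 3 * ((a ^ 3 - b ^ 3) * (a - b))" unfolding * .
  have "(a - b) ^ 4 = (a - b)\<^sup>2 * (a - b)\<^sup>2" by (simp add: power4_eq_xxxx power2_eq_square)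
  also have "\<dots> \<le> (a - b)\<^sup>2 * (4 * (a\<^sup>2 + a * b + b\<^sup>2))" using 2 by (intro mult_left_mono) auto
  also have "\<dots> = 4 * ((a - b)\<^sup>2 * (a\<^sup>2 + a * b + b\<^sup>2))" by (rule mult.left_commute)
  finally show "(a - b) ^ 4 \<le> 4 * ((a ^ 3 - b ^ 3) * (a - b))" unfolding * .
qed

lemma Qf_dd_torus:
  assumes "0 < a" "a < 1" "torus_test u" "torus_test v"
  shows "((\<lambda>p. 4 powr (a * real (snd p)) * tint (\<lambda>x. dd (fst p) (snd p) u x * dd (fst p) (snd p) v x)) has_sum Qf a u v) UNIV"
  using Qf_dd[OF assms(1,2), of u v] assms by (simp add: torus_test_cper torus_test_H1 case_prod_unfold)

lemma cper_dd_mult: "torus_test u \<Longrightarrow> torus_test v \<Longrightarrow> cper (cx (\<lambda>x. dd i j u x * dd i j v x))"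
  by (intro cper_cx_mult cper_cx_dd torus_test_cper)

lemma cube_dd_nonneg: "torus_test w \<Longrightarrow> 0 \<le> tint (\<lambda>x. dd i j (\<lambda>x. w x ^ 3) x * dd i j w x)"
  by (rule tint_nonneg[OF cper_dd_mult]) (auto simp: dd_def cube_diff_nonneg intro: torus_test_power)

lemma Qf_cube_nonneg:
  assumes "0 < a" "a < 1" "torus_test w"
  shows "0 \<le> Qf a (\<lambda>x. w x ^ 3) w"
  using Qf_dd_torus[OF assms(1,2) torus_test_power[OF assms(3), of 3] assms(3)]
  by (rule has_sum_nonneg) (auto intro!: mult_nonneg_nonneg cube_dd_nonneg assms)

lemma Qf_self_nonneg:
  assumes "0 < a" "a < 1" "torus_test w"
  shows "0 \<le> Qf a w w"
  using Qf_dd_torus[OF assms(1,2) assms(3) assms(3)]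
  by (rule has_sum_nonneg) (simp add: tint_nonneg[OF cper_dd_mult[OF assms(3) assms(3)]])

text \<open>The pointwise inequality is applied in every translation term of \<open>Qf_dd\<close>,
  where the two values compared are those of \<open>w\<close> at a point and at its shift.\<close>

lemma Qf_square_le:
  assumes a: "0 < a" "a < 1" and w: "torus_test w"
  shows "Qf a (\<lambda>x. (w x)\<^sup>2) (\<lambda>x. (w x)\<^sup>2) \<le> 4 / 3 * Qf a (\<lambda>x. w x ^ 3) w"
proof -
  have w2: "torus_test (\<lambda>x. (w x)\<^sup>2)" "torus_test (\<lambda>x. w x ^ 3)" using w by (auto intro: torus_test_power)
  have "((\<lambda>p. 4 / 3 * (4 powr (a * real (snd p)) * tint (\<lambda>x. dd (fst p) (snd p) (\<lambda>x. w x ^ 3) x * dd (fst p) (snd p) w x)))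
      has_sum (4 / 3 * Qf a (\<lambda>x. w x ^ 3) w)) UNIV"
    by (intro has_sum_cmult_right Qf_dd_torus a w2 w)
  with Qf_dd_torus[OF a w2(1) w2(1)] show ?thesis
  proof (rule has_sum_mono)
    fix p :: "2 \<times> nat"
    have "tint (\<lambda>x. dd (fst p) (snd p) (\<lambda>x. (w x)\<^sup>2) x * dd (fst p) (snd p) (\<lambda>x. (w x)\<^sup>2) x)
      \<le> tint (\<lambda>x. 4 / 3 * (dd (fst p) (snd p) (\<lambda>x. w x ^ 3) x * dd (fst p) (snd p) w x))"
      using square_diff_le
      by (intro tint_mono cper_dd_mult cper_cx_mult cper_cx_const w w2 cper_cx_dd torus_test_cper)
         (auto simp: dd_def power2_eq_square[of "_ - _"])
    then have "4 powr (a * real (snd p)) * tint (\<lambda>x. dd (fst p) (snd p) (\<lambda>x. (w x)\<^sup>2) x * dd (fst p) (snd p) (\<lambda>x. (w x)\<^sup>2) x)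
      \<le> 4 powr (a * real (snd p)) * (4 / 3 * tint (\<lambda>x. dd (fst p) (snd p) (\<lambda>x. w x ^ 3) x * dd (fst p) (snd p) w x))"
      unfolding tint_cmult by (intro mult_left_mono) auto
    then show "4 powr (a * real (snd p)) * tint (\<lambda>x. dd (fst p) (snd p) (\<lambda>x. (w x)\<^sup>2) x * dd (fst p) (snd p) (\<lambda>x. (w x)\<^sup>2) x)
      \<le> 4 / 3 * (4 powr (a * real (snd p)) * tint (\<lambda>x. dd (fst p) (snd p) (\<lambda>x. w x ^ 3) x * dd (fst p) (snd p) w x))"
      by simp
  qed
qed

text \<open>The numerator 2 counts the coordinate directions. These sums measure the loss when a
  bound does not decay by itself in the scale.\<close>

lemma has_sum_geometric_pairs:
  assumes "b < 0"
  shows "((\<lambda>p. 4 powr (b * real (snd p))) has_sum (2 / (1 - 4 powr b))) (UNIV :: (2 \<times> nat) set)"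
proof -
  let ?r = "(4::real) powr b"
  have r: "0 < ?r" "?r < 1" using assms by (auto intro: powr_less_one)
  have "(\<lambda>j. 4 powr (b * real j)) sums (1 / (1 - ?r))"
    unfolding powr_dyadic using r by (intro geometric_sums) auto
  then have *: "((\<lambda>j. 4 powr (b * real j)) has_sum (1 / (1 - ?r))) UNIV"
    by (simp add: sums_nonneg_imp_has_sum)
  have sm: "(\<lambda>p. 4 powr (b * real (snd p))) summable_on (UNIV :: 2 set) \<times> UNIV"
    by (rule summable_on_SigmaI[where g="\<lambda>_. 1 / (1 - ?r)"]) (use * in auto)
  have "((\<lambda>p. 4 powr (b * real (snd p))) has_sum (\<Sum>i\<in>(UNIV::2 set). 1 / (1 - ?r))) ((UNIV :: 2 set) \<times> UNIV)"
  proof (rule has_sum_SigmaI[where g="\<lambda>_. 1 / (1 - ?r)", OF _ _ sm])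
    show "((\<lambda>_. 1 / (1 - ?r)) has_sum (\<Sum>i\<in>(UNIV::2 set). 1 / (1 - ?r))) (UNIV :: 2 set)"
      by (rule has_sum_finite) simp
  qed (use * in simp)
  then show ?thesis by simp
qed

text \<open>The good term controls a fractional seminorm of \<open>w\<close> itself: in every translation term, Young's
  inequality trades a square for a fourth power.\<close>

lemma Qf_lower_order_le:
  assumes s: "0 < s" "2 * s < a" and a: "a < 1" and w: "torus_test w"
  shows "Qf s w w \<le> 2 * sqrt (2 / (1 - 4 powr (2 * s - a)) * Qf a (\<lambda>x. w x ^ 3) w)"
proof -
  let ?C = "2 / (1 - 4 powr (2 * s - a)) :: real"
  have w3: "torus_test (\<lambda>x. w x ^ 3)" using w by (rule torus_test_power)
  have a0: "0 < a" and s1: "s < 1" using s a by auto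
  have C: "0 \<le> ?C" using s powr_less_one[of 4 "2 * s - a"] by simp
  show ?thesis
  proof (rule sqrt_balance[OF C Qf_cube_nonneg[OF a0 a w]])
    fix l :: real assume l: "0 < l"
    have h: "((\<lambda>p. l * 4 powr ((2 * s - a) * real (snd p)) + (1 / l) * (4 powr (a * real (snd p)) *
          tint (\<lambda>x. dd (fst p) (snd p) (\<lambda>x. w x ^ 3) x * dd (fst p) (snd p) w x)))
        has_sum (l * ?C + (1 / l) * Qf a (\<lambda>x. w x ^ 3) w)) UNIV"
      using s by (intro has_sum_add has_sum_cmult_right has_sum_geometric_pairs Qf_dd_torus a0 a w w3) auto
    have "Qf s w w \<le> l * ?C + (1 / l) * Qf a (\<lambda>x. w x ^ 3) w"
    proof (rule has_sum_mono[OF Qf_dd_torus[OF s(1) s1 w w] h])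
      fix p :: "2 \<times> nat"
      let ?d = "dd (fst p) (snd p) w" and ?d3 = "dd (fst p) (snd p) (\<lambda>x. w x ^ 3)"
      define S A where "S = 4 powr (s * real (snd p))" and "A = 4 powr (a * real (snd p))"
      have pos: "0 < S" "0 < A" by (auto simp: S_def A_def)
      \<comment> \<open>The ratio is the weight that Young's inequality leaves on the constant term.
        Its sum over the scales converges because 2 s < a.\<close>
      have SA: "4 powr ((2 * s - a) * real (snd p)) = S\<^sup>2 / A"
        by (simp add: S_def A_def left_diff_distrib powr_diff power2_eq_square powr_add[symmetric] mult.assoc)
      have pt: "S * (?d x * ?d x) \<le> l * (S\<^sup>2 / A) + (1 / l) * A * (?d3 x * ?d x)" for x
      proof -
        let ?y = "?d x * ?d x"
        \<comment> \<open>Weighted Young inequality by completing the square. With y the square of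
          the difference of \<open>w\<close>, the term with y^2 / 4 is a quarter of a fourth power,
          which the cubic difference dominates.\<close>
        have "l * (S\<^sup>2 / A) + (1 / l) * A * (y\<^sup>2 / 4) - S * y = (2 * l * S - A * y)\<^sup>2 / (4 * l * A)" for y
          using l pos by (simp add: field_simps power2_eq_square)
        moreover have "0 \<le> (2 * l * S - A * y)\<^sup>2 / (4 * l * A)" for y using l pos by simp
        ultimately have 1: "0 \<le> l * (S\<^sup>2 / A) + (1 / l) * A * (y\<^sup>2 / 4) - S * y" for y by simp
        have "?y\<^sup>2 / 4 \<le> ?d3 x * ?d x"
          using fourth_power_diff_le[of "w (x + axis (fst p) (1 / 2 ^ snd p))" "w x"]
          by (simp add: dd_def power4_eq_xxxx power2_eq_square)
        then have "(1 / l) * A * (?y\<^sup>2 / 4) \<le> (1 / l) * A * (?d3 x * ?d x)"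
          using l pos by (intro mult_left_mono) auto
        with 1[of ?y] show ?thesis by linarith
      qed
      have c: "cper (cx (\<lambda>x. ?d x * ?d x))" "cper (cx (\<lambda>x. ?d3 x * ?d x))"
        using w w3 by (auto intro!: cper_dd_mult simp del: of_real_mult)
      have "tint (\<lambda>x. S * (?d x * ?d x)) \<le> tint (\<lambda>x. l * (S\<^sup>2 / A) + (1 / l) * A * (?d3 x * ?d x))"
        by (rule tint_mono[OF cper_cx_mult[OF cper_cx_const c(1)] cper_cx_add[OF cper_cx_const cper_cx_mult[OF cper_cx_const c(2)]] pt])
      then show "4 powr (s * real (snd p)) * tint (\<lambda>x. ?d x * ?d x) \<le>
          l * 4 powr ((2 * s - a) * real (snd p)) + (1 / l) * (4 powr (a * real (snd p)) * tint (\<lambda>x. ?d3 x * ?d x))"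
        unfolding SA S_def[symmetric] A_def[symmetric]
        unfolding tint_add[OF cper_cx_const cper_cx_mult[OF cper_cx_const c(2)]] tint_cmult tint_const
        by (simp only: mult.assoc)
    qed
    then show "Qf s w w \<le> l * ?C + Qf a (\<lambda>x. w x ^ 3) w / l" by simp
  qed
qed

text \<open>Mean zero removes the zero frequency; all others have |k| \<ge> 1, where
  \<open>msym\<close> is at least 1.\<close>

lemma Poincare_Qf:
  assumes s: "0 < s" "s < 1" and w: "torus_test w" and 0: "tint w = 0"
  shows "nsq (cx w) \<le> Qf s w w"
proof (rule has_sum_mono[OF Parseval_nsq[OF torus_test_cper[OF w]] Qf_self[OF s torus_test_cper[OF w] torus_test_H1[OF w]]])
  fix k :: "int^2"
  show "(cmod (fc (cx w) k))\<^sup>2 \<le> msym s k * (cmod (fc (cx w) k))\<^sup>2"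
  proof (cases "k = 0")
    case True then show ?thesis using 0 fc_cx_0[OF torus_test_cper[OF w]] by simp
  next
    case False
    have "1 \<le> nk k powr (2 * s)" using nk_ge_1[OF False] s by (simp add: ge_one_powr_ge_zero)
    also have "\<dots> \<le> msym s k" by (rule msym_lower[OF s])
    finally have "1 * (cmod (fc (cx w) k))\<^sup>2 \<le> msym s k * (cmod (fc (cx w) k))\<^sup>2" by (rule mult_right_mono) simp
    then show ?thesis by simp
  qed
qed

section \<open>Inhomogeneous fractional norms and multiplication\<close>

definition Nf :: "real \<Rightarrow> (real^2 \<Rightarrow> real) \<Rightarrow> real" where "Nf s u = nsq (cx u) + Qf s u u"

lemma Nf_nonneg: "0 < s \<Longrightarrow> s < 1 \<Longrightarrow> torus_test u \<Longrightarrow> 0 \<le> Nf s u"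
  unfolding Nf_def by (intro add_nonneg_nonneg Qf_self_nonneg) auto

text \<open>Interpolation between the bound |t|, used for |t| \<le> 1, and the bound 2 for larger
  arguments.\<close>

lemma cmod_cis_minus_1_le:
  assumes "0 \<le> s" "s \<le> 1"
  shows "cmod (cis t - 1) \<le> 2 * \<bar>t\<bar> powr s"
proof (cases "t = 0")
  case False
  have le: "cmod (cis t - 1) \<le> \<bar>t\<bar>" "cmod (cis t - 1) \<le> 2"
  proof -
    have eq: "cmod (cis t - 1) = 2 * \<bar>sin (t / 2)\<bar>"
      by (rule power2_eq_imp_eq) (simp_all add: cmod_cis_minus_1_sq power_mult_distrib)
    show "cmod (cis t - 1) \<le> \<bar>t\<bar>" unfolding eq using abs_sin_x_le_abs_x[of "t / 2"] by simp
    show "cmod (cis t - 1) \<le> 2" unfolding eq using abs_sin_le_one[of "t / 2"] by simp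
  qed
  show ?thesis
  proof (cases "\<bar>t\<bar> \<le> 1")
    case True
    then have "\<bar>t\<bar> powr 1 \<le> \<bar>t\<bar> powr s" using assms False by (intro powr_mono') auto
    then show ?thesis using le(1) False powr_ge_zero[of "\<bar>t\<bar>" s] by simp
  next
    case False
    then have "1 \<le> \<bar>t\<bar> powr s" using assms by (simp add: ge_one_powr_ge_zero)
    then show ?thesis using le(2) by linarith
  qed
qed simp

text \<open>A weighted Wiener algebra: multiplication by its elements preserves fractional Sobolev norms.\<close>

definition wiener :: "real \<Rightarrow> real \<Rightarrow> (real^2 \<Rightarrow> real) \<Rightarrow> bool" where
  "wiener s A u \<longleftrightarrow> torus_test u \<and> 0 \<le> A \<and> (\<forall>F. finite F \<longrightarrow> (\<Sum>k\<in>F. (1 + nk k) powr s * cmod (fc (cx u) k)) \<le> A)"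

lemma wienerD:
  assumes "wiener s A u" and s: "0 \<le> s"
  shows wiener_summable: "(\<lambda>k. (1 + nk k) powr s * cmod (fc (cx u) k)) summable_on UNIV"
    and wiener_summable1: "(\<lambda>k. cmod (fc (cx u) k)) summable_on UNIV"
    and wiener_infsum: "(\<Sum>\<^sub>\<infinity>k. (1 + nk k) powr s * cmod (fc (cx u) k)) \<le> A"
proof -
  show 1: "(\<lambda>k. (1 + nk k) powr s * cmod (fc (cx u) k)) summable_on UNIV"
    using assms unfolding wiener_def
    by (intro nonneg_bdd_above_summable_on bdd_aboveI2[where M=A]) auto
  show "(\<lambda>k. cmod (fc (cx u) k)) summable_on UNIV"
  proof (rule summable_on_comparison_test[OF 1])
    fix k
    have "1 \<le> (1 + nk k) powr s" using s by (intro ge_one_powr_ge_zero) auto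
    then have "1 * cmod (fc (cx u) k) \<le> (1 + nk k) powr s * cmod (fc (cx u) k)" by (rule mult_right_mono) simp
    then show "cmod (fc (cx u) k) \<le> (1 + nk k) powr s * cmod (fc (cx u) k)" by simp
  qed auto
  show "(\<Sum>\<^sub>\<infinity>k. (1 + nk k) powr s * cmod (fc (cx u) k)) \<le> A"
    using assms(1) unfolding wiener_def by (intro infsum_le_finite_sums 1) auto
qed

lemma has_sum_norm_le:
  fixes f :: "'a \<Rightarrow> complex"
  assumes "(f has_sum S) A" "(g has_sum T) A" "\<And>x. x \<in> A \<Longrightarrow> norm (f x) \<le> g x"
  shows "norm S \<le> T"
proof -
  have sm: "(\<lambda>x. norm (f x)) summable_on A"
    by (rule summable_on_comparison_test[OF has_sum_imp_summable[OF assms(2)]]) (use assms(3) in auto)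
  have "norm S \<le> infsum (\<lambda>x. norm (f x)) A"
    by (rule norm_has_sum_bound[OF has_sum_infsum[OF sm] assms(1)])
  also have "\<dots> \<le> T"
    by (rule has_sum_mono[OF has_sum_infsum[OF sm] assms(2)]) (use assms(3) in auto)
  finally show ?thesis .
qed

lemma wiener_sup:
  assumes u: "wiener s A u" and s: "0 \<le> s"
  shows "\<bar>u x\<bar> \<le> A"
proof -
  have "cmod (cx u x) \<le> (\<Sum>\<^sub>\<infinity>k. (1 + nk k) powr s * cmod (fc (cx u) k))"
  proof (rule has_sum_norm_le[OF fc_inversion has_sum_infsum[OF wiener_summable[OF u s]]])
    show "cper (cx u)" using u by (simp add: wiener_def torus_test_cper)
    show "(\<lambda>k. cmod (fc (cx u) k)) summable_on UNIV" by (rule wiener_summable1[OF u s])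
    fix k
    have "1 \<le> (1 + nk k) powr s" using s by (intro ge_one_powr_ge_zero) auto
    then have "1 * cmod (fc (cx u) k) \<le> (1 + nk k) powr s * cmod (fc (cx u) k)" by (rule mult_right_mono) simp
    then show "cmod (fc (cx u) k * echar k x) \<le> (1 + nk k) powr s * cmod (fc (cx u) k)" by (simp add: norm_mult)
  qed
  also have "\<dots> \<le> A" by (rule wiener_infsum[OF u s])
  finally show ?thesis by simp
qed

text \<open>Each term of the Fourier series changes by at most 2 |t|^s with t = 2 pi k_i 2^(-j), so
  the weight absorbs |k|^s and 2^(-s j) remains. The factor 16 is 2 times 8, where 8 bounds 2 pi and
  also dominates 8^s.\<close>

lemma wiener_dd:
  assumes u: "wiener s A u" and s: "0 \<le> s" "s \<le> 1"
  shows "\<bar>dd i j u x\<bar> \<le> 16 * A * 2 powr (- s * real j)"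
proof -
  have cu: "cper (cx u)" using u by (simp add: wiener_def torus_test_cper)
  have sm: "(\<lambda>k. cmod (fc (cx u) k)) summable_on UNIV" by (rule wiener_summable1[OF u s(1)])
  have h: "((\<lambda>k. fc (cx u) k * echar k (x + axis i (1 / 2 ^ j)) - fc (cx u) k * echar k x) has_sum
      (cx u (x + axis i (1 / 2 ^ j)) - cx u x)) UNIV"
    by (intro has_sum_diff fc_inversion cu sm)
  have "cmod (cx u (x + axis i (1 / 2 ^ j)) - cx u x) \<le>
      (16 * 2 powr (- s * real j)) * (\<Sum>\<^sub>\<infinity>k. (1 + nk k) powr s * cmod (fc (cx u) k))"
  proof (rule has_sum_norm_le[OF h has_sum_cmult_right[OF has_sum_infsum[OF wiener_summable[OF u s(1)]]]])
    fix k
    let ?t = "2 * pi * (real_of_int (k $ i) * (1 / 2 ^ j))"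
    have "cmod (echar k (axis i (1 / 2 ^ j)) - 1) \<le> 2 * \<bar>?t\<bar> powr s"
      unfolding echar_axis by (rule cmod_cis_minus_1_le[OF s])
    also have "\<bar>?t\<bar> powr s \<le> (8 * (1 + nk k) * (1 / 2 ^ j)) powr s"
    proof (rule powr_mono2)
      have "\<bar>real_of_int (k $ i)\<bar> \<le> 1 + nk k" using abs_nth_le_nk[of k i] by simp
      moreover have "2 * pi \<le> 8" using pi_less_4 by simp
      ultimately have "(2 * pi) * \<bar>real_of_int (k $ i)\<bar> * (1 / 2 ^ j) \<le> 8 * (1 + nk k) * (1 / 2 ^ j)"
        by (intro mult_mono) auto
      then show "\<bar>?t\<bar> \<le> 8 * (1 + nk k) * (1 / 2 ^ j)" by (simp add: abs_mult)
    qed (use s in auto)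
    also have "\<dots> = 8 powr s * (1 + nk k) powr s * 2 powr (- s * real j)"
    proof -
      have "(1 / 2 ^ j) powr s = (2::real) powr (- s * real j)"
        by (simp add: powr_divide powr_realpow[symmetric] powr_powr powr_minus divide_simps mult_ac)
      then show ?thesis by (subst powr_mult; simp add: powr_mult del: distrib_left_numeral)
    qed
    also have "\<dots> \<le> 8 * (1 + nk k) powr s * 2 powr (- s * real j)"
      using s powr_mono[of s 1 "8::real"] by (intro mult_right_mono) auto
    finally have *: "cmod (echar k (axis i (1 / 2 ^ j)) - 1) \<le> 16 * 2 powr (- s * real j) * (1 + nk k) powr s"
      by (simp add: mult_ac)
    have "cmod (fc (cx u) k * echar k (x + axis i (1 / 2 ^ j)) - fc (cx u) k * echar k x)
       = cmod (echar k (axis i (1 / 2 ^ j)) - 1) * cmod (fc (cx u) k)"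
    proof -
      have "fc (cx u) k * echar k (x + axis i (1 / 2 ^ j)) - fc (cx u) k * echar k x
          = (echar k (axis i (1 / 2 ^ j)) - 1) * fc (cx u) k * echar k x"
        by (simp add: echar_add_point algebra_simps)
      then show ?thesis by (simp add: norm_mult)
    qed
    also have "\<dots> \<le> 16 * 2 powr (- s * real j) * (1 + nk k) powr s * cmod (fc (cx u) k)"
      by (rule mult_right_mono[OF *]) simp
    finally show "cmod (fc (cx u) k * echar k (x + axis i (1 / 2 ^ j)) - fc (cx u) k * echar k x)
       \<le> 16 * 2 powr (- s * real j) * ((1 + nk k) powr s * cmod (fc (cx u) k))" by (simp add: mult_ac)
  qed
  also have "\<dots> \<le> (16 * 2 powr (- s * real j)) * A"
    by (intro mult_left_mono wiener_infsum[OF u s(1)]) auto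
  also have "cmod (cx u (x + axis i (1 / 2 ^ j)) - cx u x) = \<bar>dd i j u x\<bar>"
    by (simp add: dd_def flip: of_real_diff)
  finally show ?thesis by (simp add: mult_ac)
qed

text \<open>Discrete product rule: the difference of u Y is the difference of \<open>u\<close> times
  a shifted \<open>Y\<close>, plus \<open>u\<close> times the difference of \<open>Y\<close>. The
  first part keeps the seminorm of \<open>u\<close>. The second is of size A 2^(-s' j), so the
  weights sum like 4^((s - s') j), convergent since s < s'. The factor 512 is 2 times 16^2.\<close>

lemma Nf_mult_wiener:
  assumes s: "0 < s" "s < s'" "s' \<le> 1"
  obtains C where "0 \<le> C" "\<And>A Y u. wiener s' A Y \<Longrightarrow> torus_test u \<Longrightarrow> Nf s (\<lambda>x. u x * Y x) \<le> C * A\<^sup>2 * Nf s u"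
proof -
  define K where "K = 2 / (1 - 4 powr (s - s')) * (512 :: real)"
  define C where "C = 2 + K + 1"
  have K: "0 \<le> K" using s powr_less_one[of 4 "s - s'"] by (simp add: K_def)
  have s1: "s < 1" using s by auto
  have main: "Nf s (\<lambda>x. u x * Y x) \<le> C * A\<^sup>2 * Nf s u" if Y: "wiener s' A Y" and u: "torus_test u" for A Y u
  proof -
    have tY: "torus_test Y" and A: "0 \<le> A" using Y by (auto simp: wiener_def)
    have tuY: "torus_test (\<lambda>x. u x * Y x)" by (intro torus_test_mult u tY)
    have supY: "\<bar>Y x\<bar> \<le> A" for x by (rule wiener_sup[OF Y]) (use s in auto)
    have n: "nsq (cx (\<lambda>x. u x * Y x)) \<le> A\<^sup>2 * nsq (cx u)"
    proof -
      have "tint (\<lambda>x. (u x * Y x)\<^sup>2) \<le> tint (\<lambda>x. A\<^sup>2 * (u x)\<^sup>2)"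
      proof (rule tint_mono)
        fix x
        have "(Y x)\<^sup>2 \<le> A\<^sup>2" using supY[of x] A by (simp add: abs_le_square_iff[symmetric])
        then show "(u x * Y x)\<^sup>2 \<le> A\<^sup>2 * (u x)\<^sup>2"
          using mult_right_mono[of "(Y x)\<^sup>2" "A\<^sup>2" "(u x)\<^sup>2"] by (simp add: power_mult_distrib mult_ac)
      qed (intro cper_cx_intros torus_test_cper u tY)+
      then show ?thesis by (simp only: nsq_cx tint_cmult)
    qed
    have h: "((\<lambda>p. 2 * A\<^sup>2 * (4 powr (s * real (snd p)) * tint (\<lambda>x. dd (fst p) (snd p) u x * dd (fst p) (snd p) u x))
         + (512 * A\<^sup>2 * nsq (cx u)) * 4 powr ((s - s') * real (snd p))) has_sum
        (2 * A\<^sup>2 * Qf s u u + (512 * A\<^sup>2 * nsq (cx u)) * (2 / (1 - 4 powr (s - s'))))) UNIV"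
      using s by (intro has_sum_add has_sum_cmult_right has_sum_geometric_pairs Qf_dd_torus u) auto
    have q: "Qf s (\<lambda>x. u x * Y x) (\<lambda>x. u x * Y x) \<le> 2 * A\<^sup>2 * Qf s u u + (512 * A\<^sup>2 * nsq (cx u)) * (2 / (1 - 4 powr (s - s')))"
    proof (rule has_sum_mono[OF Qf_dd_torus[OF s(1) s1 tuY tuY] h])
      fix p :: "2 \<times> nat"
      let ?h = "axis (fst p) (1 / 2 ^ snd p) :: real^2"
      let ?du = "dd (fst p) (snd p) u" and ?dY = "dd (fst p) (snd p) Y" and ?duY = "dd (fst p) (snd p) (\<lambda>x. u x * Y x)"
      define D where "D = 4 powr (- s' * real (snd p))"
      have pt: "?duY x * ?duY x \<le> 2 * A\<^sup>2 * (?du x * ?du x) + (512 * A\<^sup>2 * D) * (u x)\<^sup>2" for x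
      proof -
        have "?duY x = ?du x * Y (x + ?h) + u x * ?dY x" by (simp add: dd_def algebra_simps)
        then have "?duY x * ?duY x \<le> 2 * (?du x * Y (x + ?h))\<^sup>2 + 2 * (u x * ?dY x)\<^sup>2"
          using sum_squares_bound[of "?du x * Y (x + ?h)" "u x * ?dY x"] by (simp add: power2_eq_square algebra_simps)
        moreover have "(?du x * Y (x + ?h))\<^sup>2 \<le> A\<^sup>2 * (?du x * ?du x)"
        proof -
          have "(Y (x + ?h))\<^sup>2 \<le> A\<^sup>2" using supY[of "x + ?h"] A by (simp add: abs_le_square_iff[symmetric])
          then show ?thesis using mult_right_mono[of "(Y (x + ?h))\<^sup>2" "A\<^sup>2" "(?du x)\<^sup>2"] by (simp add: power2_eq_square mult_ac)
        qed
        moreover have "(u x * ?dY x)\<^sup>2 \<le> (256 * A\<^sup>2 * D) * (u x)\<^sup>2"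
        proof -
          have "\<bar>?dY x\<bar> \<le> 16 * A * 2 powr (- s' * real (snd p))" using s by (intro wiener_dd[OF Y]) auto
          then have "\<bar>?dY x\<bar>\<^sup>2 \<le> (16 * A * 2 powr (- s' * real (snd p)))\<^sup>2" by (intro power_mono) auto
          also have "\<dots> = 256 * A\<^sup>2 * D"
            by (simp add: D_def power_mult_distrib four_powr power2_eq_square[of "2 powr _"] powr_add[symmetric])
          finally show ?thesis using mult_right_mono[of "(?dY x)\<^sup>2" "256 * A\<^sup>2 * D" "(u x)\<^sup>2"] by (simp add: power_mult_distrib mult_ac)
        qed
        ultimately show ?thesis by simp
      qed
      have c: "cper (cx (\<lambda>x. ?du x * ?du x))" "cper (cx (\<lambda>x. (u x)\<^sup>2))" "cper (cx (\<lambda>x. ?duY x * ?duY x))"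
        using cper_dd_mult[OF u u] cper_dd_mult[OF tuY tuY] cper_cx_power[OF torus_test_cper[OF u], of 2] by auto
      have "tint (\<lambda>x. ?duY x * ?duY x) \<le> tint (\<lambda>x. 2 * A\<^sup>2 * (?du x * ?du x) + (512 * A\<^sup>2 * D) * (u x)\<^sup>2)"
        by (rule tint_mono[OF c(3) cper_cx_add[OF cper_cx_mult[OF cper_cx_const c(1)] cper_cx_mult[OF cper_cx_const c(2)]] pt])
      also have "\<dots> = 2 * A\<^sup>2 * tint (\<lambda>x. ?du x * ?du x) + (512 * A\<^sup>2 * D) * nsq (cx u)"
        by (simp only: tint_add[OF cper_cx_mult[OF cper_cx_const c(1)] cper_cx_mult[OF cper_cx_const c(2)]] tint_cmult nsq_cx)
      finally have "4 powr (s * real (snd p)) * tint (\<lambda>x. ?duY x * ?duY x) \<le>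
          4 powr (s * real (snd p)) * (2 * A\<^sup>2 * tint (\<lambda>x. ?du x * ?du x) + (512 * A\<^sup>2 * D) * nsq (cx u))"
        by (rule mult_left_mono) simp
      also have "\<dots> = 2 * A\<^sup>2 * (4 powr (s * real (snd p)) * tint (\<lambda>x. ?du x * ?du x))
          + (512 * A\<^sup>2 * nsq (cx u)) * (4 powr (s * real (snd p)) * D)" by (simp add: algebra_simps)
      also have "4 powr (s * real (snd p)) * D = 4 powr ((s - s') * real (snd p))"
        by (simp add: D_def powr_add[symmetric] algebra_simps)
      finally show "4 powr (s * real (snd p)) * tint (\<lambda>x. ?duY x * ?duY x) \<le>
         2 * A\<^sup>2 * (4 powr (s * real (snd p)) * tint (\<lambda>x. ?du x * ?du x))
         + (512 * A\<^sup>2 * nsq (cx u)) * 4 powr ((s - s') * real (snd p))" .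
    qed
    have "Nf s (\<lambda>x. u x * Y x) \<le> A\<^sup>2 * nsq (cx u) + (2 * A\<^sup>2 * Qf s u u + K * A\<^sup>2 * nsq (cx u))"
      unfolding Nf_def K_def using n q by (simp add: mult_ac)
    also have "\<dots> = A\<^sup>2 * ((1 + K) * nsq (cx u) + 2 * Qf s u u)" by (simp add: algebra_simps)
    also have "\<dots> \<le> A\<^sup>2 * (C * nsq (cx u) + C * Qf s u u)"
      using K Qf_self_nonneg[OF s(1) s1 u] by (intro mult_left_mono add_mono mult_right_mono) (auto simp: C_def)
    finally show ?thesis by (simp add: Nf_def algebra_simps)
  qed
  show thesis by (rule that[of C]) (use K main in \<open>auto simp: C_def\<close>)
qed

section \<open>Pairing Littlewood-Paley blocks with products\<close>

definition proj :: "real \<Rightarrow> (real^2 \<Rightarrow> complex) \<Rightarrow> real^2 \<Rightarrow> complex" where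
  "proj R f x = (\<Sum>k\<in>{k. nk k < R}. fc f k * echar k x)"

lemma finite_nk_less: "finite {k. nk k < R}"
proof (cases "0 \<le> R")
  case True
  show ?thesis by (rule finite_subset[OF _ finite_nk_le[OF True]]) auto
next
  case False
  have "\<not> nk k < R" for k using nk_nonneg[of k] False by linarith
  then show ?thesis by simp
qed

lemma cper_proj: "cper (proj R f)"
  unfolding proj_def[abs_def] by (intro cper_sum cper_mult cper_const cper_echar)

lemma fc_proj: "fc (proj R f) k = (if nk k < R then fc f k else 0)"
  unfolding proj_def[abs_def] fc_trig[OF finite_nk_less] by simp

lemma nsq_proj_le: "cper f \<Longrightarrow> nsq (proj R f) \<le> nsq f"
proof (rule has_sum_mono[OF Parseval_nsq[OF cper_proj] Parseval_nsq])
  show "(cmod (fc (proj R f) k))\<^sup>2 \<le> (cmod (fc f k))\<^sup>2" for k by (simp add: fc_proj)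
qed

text \<open>A Sobolev bound of order \<open>s\<close> reduced to what the pairing with a
  Littlewood-Paley block uses: the L2 size and the decay of the high frequency remainder beyond
  every radius. It is stated for complex functions because one of the factors below is given by a
  complex Fourier series.\<close>

definition sob :: "real \<Rightarrow> real \<Rightarrow> (real^2 \<Rightarrow> complex) \<Rightarrow> bool" where
  "sob s A f \<longleftrightarrow> cper f \<and> 0 \<le> A \<and> nsq f \<le> A\<^sup>2 \<and>
     (\<forall>R>0. nsq (\<lambda>x. f x - proj R f x) \<le> (A * R powr (- s))\<^sup>2)"

lemma sobI:
  assumes s: "0 < s" "s < 1" and f: "cper f" and B: "((\<lambda>k. msym s k * (cmod (fc f k))\<^sup>2) has_sum B) UNIV"
    and A: "0 \<le> A" "nsq f + B \<le> A\<^sup>2"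
  shows "sob s A f"
proof -
  have B0: "0 \<le> B" by (rule has_sum_nonneg[OF B]) (simp add: msym_nonneg s)
  have "nsq (\<lambda>x. f x - proj R f x) \<le> (A * R powr (- s))\<^sup>2" if R: "0 < R" for R
  proof -
    let ?g = "\<lambda>x. f x - proj R f x"
    have g: "cper ?g" by (intro cper_diff f cper_proj)
    have "R powr (2 * s) * nsq ?g \<le> B"
    proof (rule has_sum_mono[OF has_sum_cmult_right[OF Parseval_nsq[OF g]] B])
      fix k
      show "R powr (2 * s) * (cmod (fc ?g k))\<^sup>2 \<le> msym s k * (cmod (fc f k))\<^sup>2"
      proof (cases "nk k < R")
        case False
        then have "R powr (2 * s) \<le> nk k powr (2 * s)" using R s by (intro powr_mono2) auto
        also have "\<dots> \<le> msym s k" by (rule msym_lower[OF s])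
        finally show ?thesis using False by (simp add: fc_diff f cper_proj fc_proj mult_right_mono)
      qed (simp add: fc_diff f cper_proj fc_proj msym_nonneg s)
    qed
    also have "B \<le> A\<^sup>2" using A(2) nsq_nonneg[of f] by linarith
    finally have le: "R powr (2 * s) * nsq ?g \<le> A\<^sup>2" .
    have "nsq ?g = R powr (- (2 * s)) * (R powr (2 * s) * nsq ?g)"
      using R by (simp add: mult.assoc[symmetric] powr_add[symmetric])
    also have "\<dots> \<le> R powr (- (2 * s)) * A\<^sup>2" by (rule mult_left_mono[OF le]) simp
    also have "R powr (- (2 * s)) = (R powr (- s))\<^sup>2"
      by (simp add: power2_eq_square powr_add[symmetric])
    finally show ?thesis by (simp add: power_mult_distrib mult.commute)
  qed
  then show ?thesis using f A B0 by (simp add: sob_def)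
qed

lemma sob_Nf: "0 < s \<Longrightarrow> s < 1 \<Longrightarrow> torus_test u \<Longrightarrow> sob s (sqrt (Nf s u)) (cx u)"
  using Nf_nonneg[of s u]
  by (intro sobI[where B="Qf s u u"] Qf_self torus_test_cper torus_test_H1) (auto simp: Nf_def)

lemma nsq_mult_le:
  assumes "cper D" "cper f" "\<And>x. cmod (D x) \<le> M"
  shows "nsq (\<lambda>x. D x * f x) \<le> M\<^sup>2 * nsq f"
proof -
  have "tint (\<lambda>x. (cmod (D x * f x))\<^sup>2) \<le> tint (\<lambda>x. M\<^sup>2 * (cmod (f x))\<^sup>2)"
  proof (rule tint_mono)
    show "(cmod (D x * f x))\<^sup>2 \<le> M\<^sup>2 * (cmod (f x))\<^sup>2" for x
      unfolding norm_mult power_mult_distrib using assms(3)[of x] by (intro mult_right_mono power_mono) auto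
    show "cper (cx (\<lambda>x. (cmod (D x * f x))\<^sup>2))" by (intro cper_cmod cper_mult assms)
    show "cper (cx (\<lambda>x. M\<^sup>2 * (cmod (f x))\<^sup>2))" by (intro cper_cx_mult[OF cper_cx_const cper_cmod] assms)
  qed
  then show ?thesis unfolding tint_cmult by (simp add: nsq_def tint_def)
qed

text \<open>Multiplication by a constant phase makes the inner product real and nonnegative, so that
  the real Cauchy-Schwarz inequality applies to the real part of the integrand.\<close>

lemma ip_Cauchy_Schwarz:
  assumes f: "cper f" and g: "cper g"
  shows "cmod (ip f g) \<le> sqrt (nsq f) * sqrt (nsq g)"
proof -
  define c where "c = cnj (sgn (ip f g))"
  have c: "cmod c \<le> 1" by (simp add: c_def norm_sgn)
  have cip: "c * ip f g = complex_of_real (cmod (ip f g))"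
  proof (cases "ip f g = 0")
    case False
    have "cnj (ip f g) * ip f g = complex_of_real (cmod (ip f g)) * complex_of_real (cmod (ip f g))"
      using complex_norm_square[of "ip f g"] by (simp add: mult.commute power2_eq_square)
    then show ?thesis using False by (simp add: c_def sgn_div_norm scaleR_conv_of_real field_simps)
  qed (simp add: c_def)
  let ?u = "\<lambda>x. Re (c * f x * cnj (g x))"
  have F: "cper (\<lambda>x. c * f x * cnj (g x))" by (intro cper_mult cper_cnj cper_const f g)
  have u: "cper (cx ?u)"
  proof -
    have "Re (c * f (x + freq k) * cnj (g (x + freq k))) = Re (c * f x * cnj (g x))" for x k
      by (simp only: cperD(2)[OF F, of x k])
    then show ?thesis
      unfolding cper_cx_iff periodic_def using continuous_on_Re[OF cperD(1)[OF F, of UNIV]] by blast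
  qed
  have "tint ?u = Re (integral (cbox 0 1) (\<lambda>x. c * f x * cnj (g x)))"
    using integral_linear[OF cper_integrable[OF F] bounded_linear_Re] by (simp add: tint_def o_def)
  also have "integral (cbox 0 1) (\<lambda>x. c * f x * cnj (g x)) = c * ip f g"
    using ip_cmult_left[of c f g] by (simp add: ip_def)
  finally have "cmod (ip f g) = tint ?u" unfolding cip by simp
  also have "\<dots> \<le> \<bar>tint ?u\<bar>" by simp
  also have "\<dots> \<le> sqrt (nsq f * nsq g)"
  proof (rule tint_Cauchy_Schwarz[OF f g u])
    fix x
    have "\<bar>?u x\<bar> \<le> cmod (c * f x * cnj (g x))" by (rule abs_Re_le_cmod)
    also have "\<dots> = cmod c * (cmod (f x) * cmod (g x))" by (simp add: norm_mult)
    also have "\<dots> \<le> 1 * (cmod (f x) * cmod (g x))" using c by (intro mult_right_mono) auto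
    finally show "\<bar>?u x\<bar> \<le> cmod (f x) * cmod (g x)" by simp
  qed
  finally show ?thesis by (simp add: real_sqrt_mult)
qed

lemma ip_mult_bound:
  assumes D: "cper D" "\<And>x. cmod (D x) \<le> M" and f: "cper f" "nsq f \<le> A\<^sup>2" "0 \<le> A" and g: "cper g" "nsq g \<le> B\<^sup>2" "0 \<le> B"
  shows "cmod (ip (\<lambda>x. D x * f x) g) \<le> M * A * B"
proof -
  have M: "0 \<le> M" using D(2)[of 0] norm_ge_zero[of "D 0"] by linarith
  have "nsq (\<lambda>x. D x * f x) \<le> M\<^sup>2 * A\<^sup>2"
    using nsq_mult_le[OF D(1) f(1) D(2)] mult_left_mono[OF f(2), of "M\<^sup>2"] by simp
  then have "sqrt (nsq (\<lambda>x. D x * f x)) \<le> M * A" using M f(3) by (intro real_le_lsqrt) (simp_all add: power_mult_distrib)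
  moreover have "sqrt (nsq g) \<le> B" using g by (intro real_le_lsqrt) auto
  ultimately have "sqrt (nsq (\<lambda>x. D x * f x)) * sqrt (nsq g) \<le> (M * A) * B"
    using M f(3) by (intro mult_mono) auto
  then show ?thesis using ip_Cauchy_Schwarz[OF cper_mult[OF D(1) f(1)] g(1)] by linarith
qed

text \<open>A block \<open>D\<close> at frequencies at least \<open>R\<close> is orthogonal to products of two functions at
  frequencies below \<open>R / 2\<close>, so one of the two factors may be replaced by its high frequency part.\<close>

lemma block_bound:
  assumes D: "cper D" "\<And>x. cmod (D x) \<le> M" and D0: "\<And>k. nk k < R \<Longrightarrow> fc D k = 0" and R: "0 < R"
    and f: "sob s A f" and g: "sob s B g"
  shows "cmod (ip (\<lambda>x. D x * f x) g) \<le> 2 * M * A * B * (R / 2) powr (- s)"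
proof -
  let ?f1 = "proj (R / 2) f" and ?g1 = "proj (R / 2) g"
  let ?f2 = "\<lambda>x. f x - ?f1 x" and ?g2 = "\<lambda>x. g x - ?g1 x"
  let ?q = "(R / 2) powr (- s)"
  have cf: "cper f" "cper g" and AB: "0 \<le> A" "0 \<le> B" "nsq f \<le> A\<^sup>2" "nsq g \<le> B\<^sup>2"
    and f2: "nsq ?f2 \<le> (A * ?q)\<^sup>2" and g2: "nsq ?g2 \<le> (B * ?q)\<^sup>2"
    using f g R by (auto simp: sob_def)
  have f1: "nsq ?f1 \<le> A\<^sup>2" using nsq_proj_le[OF cf(1), of "R/2"] AB by linarith
  have zero: "ip (\<lambda>x. D x * ?f1 x) ?g1 = 0"
  proof -
    let ?S = "{k. nk k < R / 2}"
    \<comment> \<open>Pairing \<open>D\<close> with two characters reads off its coefficient at l -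
      k, a frequency of length below R, where \<open>D\<close> has none.\<close>
    have t: "ip (\<lambda>x. D x * echar k x) (echar l) = 0" if kl: "k \<in> ?S" "l \<in> ?S" for k l
    proof -
      have "ip (\<lambda>x. D x * echar k x) (echar l) = fc D (l - k)"
        unfolding fc_def ip_def using echar_add_freq[of l "- k"]
        by (simp add: cnj_echar[symmetric] mult_ac)
      moreover have "nk (l - k) < R" using nk_triangle[of l "- k"] kl by simp
      ultimately show ?thesis by (simp add: D0)
    qed
    have "ip (\<lambda>x. D x * ?f1 x) ?g1 = ip (\<lambda>x. \<Sum>k\<in>?S. fc f k * (D x * echar k x)) (\<lambda>x. \<Sum>l\<in>?S. fc g l * echar l x)"
      by (simp add: proj_def[abs_def] sum_distrib_left mult_ac)
    also have "\<dots> = (\<Sum>k\<in>?S. \<Sum>l\<in>?S. fc f k * (cnj (fc g l) * ip (\<lambda>x. D x * echar k x) (echar l)))"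
    proof -
      have g1: "cper (\<lambda>x. \<Sum>l\<in>?S. fc g l * echar l x)" by (intro cper_sum cper_mult cper_const cper_echar)
      have De: "cper (\<lambda>x. D x * echar k x)" for k by (intro cper_mult D cper_echar)
      have "ip (\<lambda>x. \<Sum>k\<in>?S. fc f k * (D x * echar k x)) (\<lambda>x. \<Sum>l\<in>?S. fc g l * echar l x)
         = (\<Sum>k\<in>?S. ip (\<lambda>x. fc f k * (D x * echar k x)) (\<lambda>x. \<Sum>l\<in>?S. fc g l * echar l x))"
        by (rule ip_sum_left[OF cper_mult[OF cper_const De] g1])
      also have "\<dots> = (\<Sum>k\<in>?S. fc f k * (\<Sum>l\<in>?S. ip (\<lambda>x. D x * echar k x) (\<lambda>x. fc g l * echar l x)))"
        unfolding ip_cmult_left by (subst ip_sum_right[OF cper_mult[OF cper_const cper_echar(2)] De]) simp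
      finally show ?thesis unfolding ip_cmult_right sum_distrib_left .
    qed
    also have "\<dots> = 0" using t by (intro sum.neutral ballI) simp
    finally show ?thesis .
  qed
  \<comment> \<open>Either \<open>f\<close> is replaced by its high part, or \<open>f\<close> is low
    and then \<open>g\<close> may be replaced by its high part. The two surviving terms give the
    factor 2 in the bound.\<close>
  have split: "ip (\<lambda>x. D x * f x) g = ip (\<lambda>x. D x * ?f2 x) g + (ip (\<lambda>x. D x * ?f1 x) ?g2 + ip (\<lambda>x. D x * ?f1 x) ?g1)"
  proof -
    have c: "cper (\<lambda>x. D x * ?f2 x)" "cper (\<lambda>x. D x * ?f1 x)" "cper ?g2" "cper ?g1" "cper ?f2"
      using D cf by (auto intro!: cper_mult cper_diff cper_proj)
    have "ip (\<lambda>x. D x * f x) g = ip (\<lambda>x. D x * ?f2 x + D x * ?f1 x) g"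
      by (simp add: algebra_simps)
    also have "\<dots> = ip (\<lambda>x. D x * ?f2 x) g + ip (\<lambda>x. D x * ?f1 x) g"
      by (rule ip_add_left[OF c(1,2) cf(2)])
    also have "ip (\<lambda>x. D x * ?f1 x) g = ip (\<lambda>x. D x * ?f1 x) (\<lambda>x. ?g2 x + ?g1 x)" by simp
    also have "\<dots> = ip (\<lambda>x. D x * ?f1 x) ?g2 + ip (\<lambda>x. D x * ?f1 x) ?g1"
      by (rule ip_add_right[OF c(3,4,2)])
    finally show ?thesis .
  qed
  have 1: "cmod (ip (\<lambda>x. D x * ?f2 x) g) \<le> M * (A * ?q) * B"
    using D cf AB f2 by (intro ip_mult_bound cper_diff cper_proj) auto
  have 2: "cmod (ip (\<lambda>x. D x * ?f1 x) ?g2) \<le> M * A * (B * ?q)"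
    using D cf AB f1 g2 by (intro ip_mult_bound cper_diff cper_proj) auto
  have "cmod (ip (\<lambda>x. D x * f x) g) \<le> M * (A * ?q) * B + M * A * (B * ?q)"
    unfolding split zero add_0_right
    by (rule order_trans[OF norm_triangle_ineq add_mono[OF 1 2]])
  then show ?thesis by (simp add: algebra_simps)
qed

text \<open>Only the finitely many frequencies of \<open>P\<close> matter in the pairing with the
  continuous function made of \<open>f\<close> and \<open>g\<close>. The resolution of the identity
  by the \<sigma> is therefore summed in finitely many coefficients, and no convergence of the block
  decomposition in a function space is involved.\<close>

lemma duality_series:
  assumes P: "trigpoly P" and f: "cper f" and g: "cper g"
    and D: "\<And>m. cper (D m)" "\<And>m k. fc (D m) k = complex_of_real (\<sigma> m k) * fc P k"
    and \<sigma>: "\<And>k. (\<lambda>m. \<sigma> m k) sums 1"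
    and b: "\<And>m. cmod (ip (\<lambda>x. D m x * f x) g) \<le> b m" "summable b"
  shows "cmod (ip (\<lambda>x. P x * f x) g) \<le> suminf b"
proof -
  let ?h = "\<lambda>x. cnj (f x) * g x"
  have h: "cper ?h" by (intro cper_mult cper_cnj f g)
  have eq: "ip (\<lambda>x. Q x * f x) g = ip Q ?h" for Q by (simp add: ip_def mult_ac)
  obtain S c where S: "finite S" "P = (\<lambda>x. \<Sum>k\<in>S. c k * echar k x)" using P unfolding trigpoly_def by blast
  have P0: "fc P k = 0" if "k \<notin> S" for k using that S by (simp add: fc_trig)
  have fin: "ip Q ?h = (\<Sum>k\<in>S. fc Q k * cnj (fc ?h k))" if "cper Q" "\<And>k. k \<notin> S \<Longrightarrow> fc Q k = 0" for Q
  proof -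
    have "((\<lambda>k. fc Q k * cnj (fc ?h k)) has_sum (\<Sum>k\<in>S. fc Q k * cnj (fc ?h k))) UNIV"
      using S that by (intro has_sum_finite_neutralI[of S]) auto
    with Parseval[OF that(1) h] show ?thesis by (rule has_sum_unique)
  qed
  have "(\<lambda>m. \<Sum>k\<in>S. complex_of_real (\<sigma> m k) * (fc P k * cnj (fc ?h k))) sums (\<Sum>k\<in>S. complex_of_real 1 * (fc P k * cnj (fc ?h k)))"
    by (intro sums_sum sums_mult2 sums_of_real \<sigma>)
  moreover have "ip (D m) ?h = (\<Sum>k\<in>S. complex_of_real (\<sigma> m k) * (fc P k * cnj (fc ?h k)))" for m
    using fin[OF D(1)[of m]] P0 by (simp add: D(2) mult.assoc)
  moreover have "ip P ?h = (\<Sum>k\<in>S. fc P k * cnj (fc ?h k))"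
    by (rule fin[OF trigpoly_cper[OF P] P0])
  ultimately have "(\<lambda>m. ip (D m) ?h) sums ip P ?h" by simp
  then have "ip P ?h = (\<Sum>m. ip (D m) ?h)" by (rule sums_unique)
  moreover have "cmod (\<Sum>m. ip (D m) ?h) \<le> suminf b"
    using b by (intro norm_suminf_le) (auto simp: eq)
  ultimately show ?thesis by (simp add: eq)
qed

section \<open>Fourier multipliers on distributions given by functions\<close>

lemma fourier_dist_of:
  assumes P: "cper (cx P)"
  shows "fourier (dist_of P) k = fc (cx P) k"
proof -
  have F: "cper (\<lambda>x. cx P x * cnj (echar k x))" by (intro cper_mult cper_cnj cper_echar P)
  have 1: "dist_of P \<phi> = integral (cbox 0 1) (\<lambda>x. P x * \<phi> x)" if "continuous_on UNIV \<phi>" for \<phi>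
    unfolding dist_of_def
    by (rule set_lborel_integral_cbox) (intro continuous_intros cper_cxD[OF P] continuous_on_subset[OF that] subset_UNIV)
  have Re: "integral (cbox 0 1) (\<lambda>x. Re (cx P x * cnj (echar k x))) = Re (fc (cx P) k)"
    using integral_linear[OF cper_integrable[OF F] bounded_linear_Re] by (simp add: fc_def ip_def o_def)
  have Im: "integral (cbox 0 1) (\<lambda>x. Im (cx P x * cnj (echar k x))) = Im (fc (cx P) k)"
    using integral_linear[OF cper_integrable[OF F] bounded_linear_Im] by (simp add: fc_def ip_def o_def)
  have "dist_of P (\<lambda>x. cos (2 * pi * (freq k \<bullet> x))) = Re (fc (cx P) k)"
    unfolding Re[symmetric] by (subst 1) (intro continuous_intros, simp add: echar_def)
  moreover have "- dist_of P (\<lambda>x. sin (2 * pi * (freq k \<bullet> x))) = Im (fc (cx P) k)"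
    unfolding Im[symmetric] by (subst 1) (intro continuous_intros, simp add: echar_def)
  ultimately show ?thesis by (simp add: fourier_def complex_eq_iff)
qed

lemma fc_cx_uminus: "fc (cx u) (- k) = cnj (fc (cx u) k)"
  using fc_cnj[of "cx u" "-k"] by simp

lemma fmult_finite:
  assumes S: "finite {k. \<sigma> k \<noteq> 0}"
  shows "fmult \<sigma> u = (\<lambda>x. Re (\<Sum>k\<in>{k. \<sigma> k \<noteq> 0}. (complex_of_real (\<sigma> k) * fourier u k) * echar k x))"
proof
  fix x
  have "(\<Sum>\<^sub>\<infinity>k. complex_of_real (\<sigma> k) * fourier u k * cis (2 * pi * (freq k \<bullet> x))) =
     (\<Sum>\<^sub>\<infinity>k\<in>{k. \<sigma> k \<noteq> 0}. complex_of_real (\<sigma> k) * fourier u k * cis (2 * pi * (freq k \<bullet> x)))"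
    by (rule infsum_cong_neutral) auto
  then show "fmult \<sigma> u x = Re (\<Sum>k\<in>{k. \<sigma> k \<noteq> 0}. (complex_of_real (\<sigma> k) * fourier u k) * echar k x)"
    using S by (simp add: fmult_def fmult_complex_def echar_def)
qed

lemma trigpoly_fmult:
  assumes S: "finite {k. \<sigma> k \<noteq> 0}"
  shows "trigpoly (cx (fmult \<sigma> u))"
  unfolding fmult_finite[OF S]
  by (rule trigpoly_Re) (unfold trigpoly_def, rule exI[of _ "{k. \<sigma> k \<noteq> 0}"],
      rule exI[of _ "\<lambda>k. complex_of_real (\<sigma> k) * fourier u k"], simp add: S)

text \<open>The hypothesis is the conjugation symmetry at \<open>k\<close>, under which the real
  part has the same coefficient there. It makes the real part taken in \<open>fmult\<close> harmless
  for even symbols.\<close>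

lemma fc_Re:
  assumes p: "cper p" and c: "cnj (fc p (- k)) = fc p k"
  shows "fc (cx (\<lambda>x. Re (p x))) k = fc p k"
proof -
  have eq: "cx (\<lambda>x. Re (p x)) = (\<lambda>x. (1/2) * (p x + cnj (p x)))"
    by (rule ext, subst complex_add_cnj) simp
  have "fc (\<lambda>x. (1/2) * (p x + cnj (p x))) k = (1/2) * fc (\<lambda>x. p x + cnj (p x)) k"
    by (rule fc_cmult)
  also have "fc (\<lambda>x. p x + cnj (p x)) k = fc p k + fc (\<lambda>x. cnj (p x)) k"
    by (rule fc_add[OF p cper_cnj[OF p]])
  also have "fc (\<lambda>x. cnj (p x)) k = fc p k"
    unfolding fc_cnj by (rule c)
  finally have "fc (\<lambda>x. (1/2) * (p x + cnj (p x))) k = fc p k" by simp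
  then show ?thesis unfolding eq .
qed

lemma fc_fmult:
  assumes S: "finite {k. \<sigma> k \<noteq> 0}" and even: "\<And>k. \<sigma> (- k) = \<sigma> k" and u: "\<And>k. fourier u (- k) = cnj (fourier u k)"
  shows "fc (cx (fmult \<sigma> u)) k = complex_of_real (\<sigma> k) * fourier u k"
proof -
  define p where "p = (\<lambda>x. \<Sum>k\<in>{k. \<sigma> k \<noteq> 0}. (complex_of_real (\<sigma> k) * fourier u k) * echar k x)"
  have p: "cper p" unfolding p_def by (intro cper_sum cper_mult cper_const cper_echar)
  have fp: "fc p k = complex_of_real (\<sigma> k) * fourier u k" for k
    unfolding p_def fc_trig[OF S] by simp
  have "cx (fmult \<sigma> u) = cx (\<lambda>x. Re (p x))" unfolding fmult_finite[OF S] p_def ..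
  then show ?thesis using fc_Re[OF p, of k] by (simp add: fp even u)
qed

lemma fc_fmult_dist_of:
  assumes S: "finite {k. \<sigma> k \<noteq> 0}" and even: "\<And>k. \<sigma> (- k) = \<sigma> k" and P: "cper (cx P)"
  shows "fc (cx (fmult \<sigma> (dist_of P))) k = complex_of_real (\<sigma> k) * fc (cx P) k"
proof -
  have "fourier (dist_of P) (- k) = cnj (fourier (dist_of P) k)" for k
    unfolding fourier_dist_of[OF P] by (rule fc_cx_uminus)
  from fc_fmult[OF S even this] show ?thesis unfolding fourier_dist_of[OF P] .
qed

section \<open>Littlewood-Paley symbols, duality and the embedding into the Wiener algebra\<close>

definition LP_symbol :: "(real^2 \<Rightarrow> real) \<Rightarrow> (real^2 \<Rightarrow> real) \<Rightarrow> nat \<Rightarrow> int^2 \<Rightarrow> real" where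
  "LP_symbol \<theta> \<rho> m k = (case m of 0 \<Rightarrow> \<theta> (freq k) | Suc j \<Rightarrow> \<rho> (freq k /\<^sub>R 2 ^ j))"

text \<open>The index is shifted by one: 0 stands for the low frequency block -1 and
  \<open>Suc j\<close> for block j, so that the blocks form a sequence indexed by the natural
  numbers. The shift explains the exponents m - 1 below.\<close>

lemma LP_block_symbol: "LP_block \<theta> \<rho> (int m - 1) u = fmult (LP_symbol \<theta> \<rho> m) u"
proof (cases m)
  case (Suc j)
  then have "2 powr (- of_int (int m - 1)) = inverse ((2::real) ^ j)" by (simp add: powr_minus powr_realpow)
  then show ?thesis using Suc by (simp add: LP_block_def LP_symbol_def[abs_def])
qed (simp add: LP_block_def LP_symbol_def[abs_def])

lemma in_supp: "f z \<noteq> 0 \<Longrightarrow> z \<in> supp f"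
  unfolding supp_def by (rule subsetD[OF closure_subset]) simp

lemma LP_symbol_facts:
  assumes "dyadic_partition \<theta> \<rho>"
  obtains a b where "0 < a" "1 \<le> b"
    "\<And>m k. 0 \<le> LP_symbol \<theta> \<rho> m k" "\<And>m k. LP_symbol \<theta> \<rho> m (- k) = LP_symbol \<theta> \<rho> m k"
    "\<And>k. (\<lambda>m. LP_symbol \<theta> \<rho> m k) sums 1"
    "\<And>k. LP_symbol \<theta> \<rho> 0 k \<noteq> 0 \<Longrightarrow> nk k \<le> b"
    "\<And>j k. LP_symbol \<theta> \<rho> (Suc j) k \<noteq> 0 \<Longrightarrow> a * 2 ^ j \<le> nk k \<and> nk k \<le> b * 2 ^ j"
    "\<And>m. finite {k. LP_symbol \<theta> \<rho> m k \<noteq> 0}"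
proof -
  note dp = assms[unfolded dyadic_partition_def]
  note d3 = dp[THEN conjunct2, THEN conjunct2]
  note d4 = d3[THEN conjunct2]
  note d5 = d4[THEN conjunct2]
  note d6 = d5[THEN conjunct2]
  note d7 = d6[THEN conjunct2]
  note d8 = d7[THEN conjunct2]
  have "\<exists>R. supp \<theta> \<subseteq> cball 0 R" by (rule d6[THEN conjunct1])
  then obtain R where R: "supp \<theta> \<subseteq> cball 0 R" ..
  have "\<exists>a b. 0 < a \<and> supp \<rho> \<subseteq> {z. a \<le> norm z \<and> norm z \<le> b}" by (rule d7[THEN conjunct1])
  then obtain a b where ab: "0 < a" "supp \<rho> \<subseteq> {z. a \<le> norm z \<and> norm z \<le> b}" by (elim exE conjE)
  note nn = d3[THEN conjunct1, rule_format] d4[THEN conjunct1, rule_format]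
  note rad = d5[THEN conjunct1, rule_format]
  note sm = d8[THEN conjunct1, rule_format]
  \<comment> \<open>One outer radius serves both the low block and the annuli; it is at least 1 so
    that its powers are monotone in the exponent.\<close>
  define b' where "b' = max 1 (max R b)"
  have b': "1 \<le> b'" "R \<le> b'" "b \<le> b'" by (auto simp: b'_def)
  have s0: "nk k \<le> b'" if "LP_symbol \<theta> \<rho> 0 k \<noteq> 0" for k
  proof -
    have "freq k \<in> cball 0 R" using in_supp[of \<theta> "freq k"] R that by (auto simp: LP_symbol_def)
    then show ?thesis using b' by (simp add: nk_def)
  qed
  have s1: "a * 2 ^ j \<le> nk k \<and> nk k \<le> b' * 2 ^ j" if "LP_symbol \<theta> \<rho> (Suc j) k \<noteq> 0" for j k
  proof -
    have "freq k /\<^sub>R 2 ^ j \<in> supp \<rho>" using that by (intro in_supp) (simp add: LP_symbol_def)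
    then have "freq k /\<^sub>R 2 ^ j \<in> {z. a \<le> norm z \<and> norm z \<le> b}" using ab(2) by (rule subsetD[rotated])
    then have "a \<le> nk k / 2 ^ j" "nk k / 2 ^ j \<le> b'" using b'(3) by (simp_all add: nk_def divide_inverse mult.commute)
    then show ?thesis by (simp add: field_simps)
  qed
  show thesis
  proof (rule that[OF ab(1) b'(1)])
    show "0 \<le> LP_symbol \<theta> \<rho> m k" for m k by (cases m) (simp_all add: LP_symbol_def nn)
    show "LP_symbol \<theta> \<rho> m (- k) = LP_symbol \<theta> \<rho> m k" for m k
    proof (cases m)
      case 0
      then show ?thesis using rad[of "- freq k" "freq k"] by (simp add: LP_symbol_def freq_uminus)
    next
      case (Suc j)
      have "norm ((- freq k) /\<^sub>R 2 ^ j) = norm (freq k /\<^sub>R 2 ^ j)" by simp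
      then have "\<rho> ((- freq k) /\<^sub>R 2 ^ j) = \<rho> (freq k /\<^sub>R 2 ^ j)" using rad by blast
      then show ?thesis using Suc by (simp add: LP_symbol_def freq_uminus)
    qed
    show "(\<lambda>m. LP_symbol \<theta> \<rho> m k) sums 1" for k
    proof -
      have "(\<lambda>m. LP_symbol \<theta> \<rho> (Suc m) k) sums (1 - LP_symbol \<theta> \<rho> 0 k)"
        using sm[of "freq k"] by (simp add: LP_symbol_def)
      from sums_Suc[OF this] show ?thesis by simp
    qed
    show "finite {k. LP_symbol \<theta> \<rho> m k \<noteq> 0}" for m
    proof (cases m)
      case 0
      show ?thesis by (rule finite_subset[OF _ finite_nk_le[of b']]) (use s0 0 b' in auto)
    next
      case (Suc j)
      show ?thesis by (rule finite_subset[OF _ finite_nk_le[of "b' * 2 ^ j"]]) (use s1 Suc b' in auto)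
    qed
  qed (rule s0 s1; assumption)+
qed

lemma Cs_norm_block:
  assumes "Cs_norm \<theta> \<rho> s u \<le> ennreal K" "0 \<le> K"
  shows "\<bar>fmult (LP_symbol \<theta> \<rho> m) u x\<bar> \<le> K * 2 powr (- s * (real m - 1))"
proof -
  let ?L = "LP_block \<theta> \<rho> (int m - 1) u"
  have "ennreal (2 powr (s * of_int (int m - 1))) * ennreal \<bar>?L x\<bar> \<le>
     ennreal (2 powr (s * of_int (int m - 1))) * (SUP x. ennreal \<bar>?L x\<bar>)"
    by (intro mult_left_mono SUP_upper) auto
  also have "\<dots> \<le> Cs_norm \<theta> \<rho> s u" unfolding Cs_norm_def
    by (rule SUP_upper[of "int m - 1" "{-1..}" "\<lambda>m. ennreal (2 powr (s * of_int m)) * (SUP x. ennreal \<bar>LP_block \<theta> \<rho> m u x\<bar>)"]) simp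
  also note assms(1)
  finally have "2 powr (s * (real m - 1)) * \<bar>?L x\<bar> \<le> K"
    using assms(2) by (simp add: ennreal_mult[symmetric] ennreal_le_iff)
  note le = this
  have "\<bar>?L x\<bar> = 2 powr (- (s * (real m - 1))) * (2 powr (s * (real m - 1)) * \<bar>?L x\<bar>)"
    by (simp add: mult.assoc[symmetric] powr_add[symmetric])
  also have "\<dots> \<le> 2 powr (- (s * (real m - 1))) * K" by (rule mult_left_mono[OF le]) simp
  finally show ?thesis by (simp add: LP_block_symbol mult.commute)
qed

text \<open>Block j is at most K 2^(\<kappa> j) in supremum, while its spectral gap gains a factor
  of order 2^(-s j) from the two Sobolev functions. The product is geometric with ratio 2^(\<kappa>
  - s) < 1. The low block has no spectral gap and is estimated by its supremum.\<close>

lemma duality_Cs: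
  assumes dp: "dyadic_partition \<theta> \<rho>" and \<kappa>: "0 < \<kappa>" "\<kappa> < s"
  obtains C where "0 \<le> C"
    "\<And>P K A B f g. trigpoly (cx P) \<Longrightarrow> Cs_norm \<theta> \<rho> (- \<kappa>) (dist_of P) \<le> ennreal K \<Longrightarrow> 0 \<le> K \<Longrightarrow>
      sob s A f \<Longrightarrow> sob s B g \<Longrightarrow> cmod (ip (\<lambda>x. cx P x * f x) g) \<le> C * K * A * B"
proof -
  obtain a b where ab: "0 < a" "1 \<le> b" and
    L: "\<And>m k. 0 \<le> LP_symbol \<theta> \<rho> m k" "\<And>m k. LP_symbol \<theta> \<rho> m (- k) = LP_symbol \<theta> \<rho> m k"
    "\<And>k. (\<lambda>m. LP_symbol \<theta> \<rho> m k) sums 1"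
    "\<And>k. LP_symbol \<theta> \<rho> 0 k \<noteq> 0 \<Longrightarrow> nk k \<le> b"
    "\<And>j k. LP_symbol \<theta> \<rho> (Suc j) k \<noteq> 0 \<Longrightarrow> a * 2 ^ j \<le> nk k \<and> nk k \<le> b * 2 ^ j"
    "\<And>m. finite {k. LP_symbol \<theta> \<rho> m k \<noteq> 0}"
    by (rule LP_symbol_facts[OF dp], rule that)
  define r where "r = (2::real) powr (\<kappa> - s)"
  have r: "0 < r" "r < 1" using \<kappa> by (auto simp: r_def intro: powr_less_one)
  define e where "e = 2 * (a / 2) powr (- s)"
  have e: "0 \<le> e" by (simp add: e_def)
  define c where "c m = (case m of 0 \<Rightarrow> 1 | Suc j \<Rightarrow> e * r ^ j)" for m
  have sc: "summable c"
  proof -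
    have "summable (\<lambda>j. c (Suc j))" using r by (simp add: c_def summable_mult summable_geometric)
    then show ?thesis using summable_Suc_iff by blast
  qed
  have c0: "0 \<le> c m" for m using r e by (auto simp: c_def split: nat.split)
  have "cmod (ip (\<lambda>x. cx P x * f x) g) \<le> suminf c * K * A * B"
    if P: "trigpoly (cx P)" and K: "Cs_norm \<theta> \<rho> (- \<kappa>) (dist_of P) \<le> ennreal K" "0 \<le> K"
      and f: "sob s A f" and g: "sob s B g" for P K A B f g
  proof -
    let ?D = "\<lambda>m. cx (fmult (LP_symbol \<theta> \<rho> m) (dist_of P))"
    have cP: "cper (cx P)" by (rule trigpoly_cper[OF P])
    have AB: "0 \<le> A" "0 \<le> B" using f g by (auto simp: sob_def)
    have cD: "cper (?D m)" for m by (intro trigpoly_cper trigpoly_fmult L)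
    have fD: "fc (?D m) k = complex_of_real (LP_symbol \<theta> \<rho> m k) * fc (cx P) k" for m k
      by (rule fc_fmult_dist_of[OF L(6) L(2) cP])
    have b: "cmod (ip (\<lambda>x. ?D m x * f x) g) \<le> c m * (K * A * B)" for m
    proof (cases m)
      case 0
      have "cmod (?D 0 x) \<le> K" for x
      proof -
        have "\<bar>fmult (LP_symbol \<theta> \<rho> 0) (dist_of P) x\<bar> \<le> K * 2 powr (- \<kappa>)"
          using Cs_norm_block[OF K, of 0 x] by simp
        also have "\<dots> \<le> K * 1" using K(2) \<kappa> powr_mono[of "- \<kappa>" 0 "2::real"] by (intro mult_left_mono) auto
        finally show ?thesis by simp
      qed
      then have "cmod (ip (\<lambda>x. ?D 0 x * f x) g) \<le> K * A * B"
        using f g by (intro ip_mult_bound cD) (auto simp: sob_def)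
      then show ?thesis using 0 by (simp add: c_def)
    next
      case (Suc j)
      have "cmod (ip (\<lambda>x. ?D (Suc j) x * f x) g) \<le> 2 * (K * 2 powr (\<kappa> * real j)) * A * B * (a * 2 ^ j / 2) powr (- s)"
      proof (rule block_bound[OF cD _ _ _ f g])
        show "cmod (?D (Suc j) x) \<le> K * 2 powr (\<kappa> * real j)" for x
          using Cs_norm_block[OF K, of "Suc j" x] by simp
        show "fc (?D (Suc j)) k = 0" if "nk k < a * 2 ^ j" for k
          using L(5)[of j k] that unfolding fD by fastforce
        show "0 < a * 2 ^ j" using ab by simp
      qed
      also have "(a * 2 ^ j / 2) powr (- s) = (a / 2) powr (- s) * 2 powr (- s * real j)"
      proof -
        have "(a * 2 ^ j / 2) powr (- s) = (a / 2 * 2 ^ j) powr (- s)" by (simp add: field_simps)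
        also have "\<dots> = (a / 2) powr (- s) * (2 ^ j) powr (- s)" by (rule powr_mult)
        also have "((2::real) ^ j) powr (- s) = 2 powr (- s * real j)"
          by (simp add: powr_realpow[symmetric] powr_powr mult.commute)
        finally show ?thesis .
      qed
      also have "2 * (K * 2 powr (\<kappa> * real j)) * A * B * ((a / 2) powr (- s) * 2 powr (- s * real j)) =
        (e * (2 powr (\<kappa> * real j) * 2 powr (- s * real j))) * (K * A * B)" by (simp add: e_def mult_ac)
      also have "2 powr (\<kappa> * real j) * 2 powr (- s * real j) = r ^ j"
        by (simp add: r_def powr_add[symmetric] powr_realpow[symmetric] powr_powr algebra_simps)
      finally show ?thesis using Suc by (simp add: c_def)
    qed
    have "cmod (ip (\<lambda>x. cx P x * f x) g) \<le> (\<Sum>m. c m * (K * A * B))"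
      by (rule duality_series[OF P _ _ cD fD L(3) b summable_mult2[OF sc]]) (use f g in \<open>auto simp: sob_def\<close>)
    also have "\<dots> = suminf c * (K * A * B)" by (rule suminf_mult2[OF sc, symmetric])
    finally show ?thesis by (simp add: mult_ac)
  qed
  moreover have "0 \<le> suminf c" by (rule suminf_nonneg[OF sc c0])
  ultimately show thesis using that by blast
qed

text \<open>Cauchy-Schwarz over the frequencies in a disc: their number is at most (2 r + 1)^2,
  whose square root appears.\<close>

lemma sum_fc_le:
  assumes D: "cper D" "nsq D \<le> M\<^sup>2" "0 \<le> M" and S: "finite S" "\<And>k. k \<in> S \<Longrightarrow> nk k \<le> r" and r: "0 \<le> r"
  shows "(\<Sum>k\<in>S. cmod (fc D k)) \<le> (2 * r + 1) * M"
proof -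
  have card: "real (card S) \<le> (2 * r + 1)\<^sup>2"
    using card_mono[OF finite_nk_le[OF r], of S] S(2) card_nk_le[OF r] by fastforce
  have "(\<Sum>k\<in>S. 1 * cmod (fc D k))\<^sup>2 \<le> (\<Sum>k\<in>S. 1\<^sup>2) * (\<Sum>k\<in>S. (cmod (fc D k))\<^sup>2)"
    by (rule Cauchy_Schwarz_ineq_sum)
  also have "\<dots> \<le> (2 * r + 1)\<^sup>2 * M\<^sup>2"
    using card Bessel_cper[OF D(1) S(1)] D(2) by (intro mult_mono) (auto intro: sum_nonneg)
  also have "\<dots> = ((2 * r + 1) * M)\<^sup>2" by (simp add: power_mult_distrib)
  finally have "(\<Sum>k\<in>S. cmod (fc D k))\<^sup>2 \<le> ((2 * r + 1) * M)\<^sup>2" by simp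
  then show ?thesis by (rule power2_le_imp_le) (use r D in simp)
qed

text \<open>In block m the weight costs 2^(s m) and the passage from the supremum to a sum of
  coefficients costs 2^m, against the gain 2^(-\<beta> m). The sum converges because 1 + s <
  \<beta>. Since the symbols sum to 1, the block bounds add up to the full weighted coefficient
  sum.\<close>

lemma wiener_Cs:
  assumes dp: "dyadic_partition \<theta> \<rho>" and s: "0 \<le> s" "s \<le> 1" "1 + s < \<beta>"
  obtains C where "0 \<le> C"
    "\<And>Y K. torus_test Y \<Longrightarrow> Cs_norm \<theta> \<rho> \<beta> (dist_of Y) \<le> ennreal K \<Longrightarrow> 0 \<le> K \<Longrightarrow> wiener s (C * K) Y"
proof -
  obtain a b where ab: "0 < a" "1 \<le> b" and
    L: "\<And>m k. 0 \<le> LP_symbol \<theta> \<rho> m k" "\<And>m k. LP_symbol \<theta> \<rho> m (- k) = LP_symbol \<theta> \<rho> m k"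
    "\<And>k. (\<lambda>m. LP_symbol \<theta> \<rho> m k) sums 1"
    "\<And>k. LP_symbol \<theta> \<rho> 0 k \<noteq> 0 \<Longrightarrow> nk k \<le> b"
    "\<And>j k. LP_symbol \<theta> \<rho> (Suc j) k \<noteq> 0 \<Longrightarrow> a * 2 ^ j \<le> nk k \<and> nk k \<le> b * 2 ^ j"
    "\<And>m. finite {k. LP_symbol \<theta> \<rho> m k \<noteq> 0}"
    by (rule LP_symbol_facts[OF dp], rule that)
  define r where "r = (2::real) powr (1 + s - \<beta>)"
  have r: "0 < r" "r < 1" using s by (auto simp: r_def intro: powr_less_one)
  define c where "c m = (1 + b * 2 ^ m) powr s * (2 * (b * 2 ^ m) + 1) * 2 powr (- \<beta> * (real m - 1))" for m :: nat
  have c0: "0 \<le> c m" for m using ab by (simp add: c_def)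
  have sc: "summable c"
  proof (rule summable_comparison_test'[of "\<lambda>m. (6 * b\<^sup>2 * 2 powr \<beta>) * r ^ m" 0])
    show "summable (\<lambda>m. (6 * b\<^sup>2 * 2 powr \<beta>) * r ^ m)" using r by (intro summable_mult summable_geometric) auto
    fix m :: nat
    let ?x = "b * 2 ^ m"
    have x1: "1 \<le> ?x" using ab mult_mono[of 1 b 1 "2 ^ m"] by simp
    have "(1 + ?x) powr s \<le> (2 * ?x) powr s" using x1 s by (intro powr_mono2) auto
    also have "\<dots> = 2 powr s * b powr s * (2 ^ m) powr s" using ab by (simp add: powr_mult)
    also have "\<dots> \<le> 2 * b * (2 ^ m) powr s"
      using ab s powr_mono[of s 1 "2::real"] powr_mono[of s 1 b] by (intro mult_right_mono mult_mono) auto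
    finally have 1: "(1 + ?x) powr s \<le> 2 * b * 2 powr (s * real m)"
      by (simp add: powr_realpow[symmetric] powr_powr mult.commute)
    have 2: "2 * ?x + 1 \<le> 3 * b * 2 powr (real m)" using x1 by (simp add: powr_realpow)
    have "c m \<le> (2 * b * 2 powr (s * real m)) * (3 * b * 2 powr (real m)) * 2 powr (- \<beta> * (real m - 1))"
      unfolding c_def using 1 2 ab by (intro mult_right_mono mult_mono) auto
    also have "\<dots> = (6 * b\<^sup>2) * (2 powr (s * real m) * 2 powr (real m) * 2 powr (- \<beta> * (real m - 1)))"
      by (simp add: power2_eq_square mult_ac)
    also have "2 powr (s * real m) * 2 powr (real m) * 2 powr (- \<beta> * (real m - 1)) = 2 powr \<beta> * r ^ m"
      by (simp add: r_def powr_add[symmetric] powr_realpow[symmetric] powr_powr algebra_simps)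
    finally show "norm (c m) \<le> (6 * b\<^sup>2 * 2 powr \<beta>) * r ^ m" using c0[of m] by simp
  qed
  have "wiener s (suminf c * K) Y" if Y: "torus_test Y" and K: "Cs_norm \<theta> \<rho> \<beta> (dist_of Y) \<le> ennreal K" "0 \<le> K" for Y K
    unfolding wiener_def
  proof (intro conjI allI impI Y)
    show "0 \<le> suminf c * K" using K(2) suminf_nonneg[OF sc c0] by simp
    fix F :: "(int^2) set" assume F: "finite F"
    let ?D = "\<lambda>m. cx (fmult (LP_symbol \<theta> \<rho> m) (dist_of Y))"
    have cY: "cper (cx Y)" by (rule torus_test_cper[OF Y])
    have cD: "cper (?D m)" for m by (intro trigpoly_cper trigpoly_fmult L)
    have fD: "fc (?D m) k = complex_of_real (LP_symbol \<theta> \<rho> m k) * fc (cx Y) k" for m k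
      by (rule fc_fmult_dist_of[OF L(6) L(2) cY])
    have b: "(\<Sum>k\<in>F. LP_symbol \<theta> \<rho> m k * ((1 + nk k) powr s * cmod (fc (cx Y) k))) \<le> c m * K" for m
    proof -
      let ?x = "b * 2 ^ m" and ?S = "F \<inter> {k. LP_symbol \<theta> \<rho> m k \<noteq> 0}"
      have x: "0 \<le> ?x" using ab by simp
      have S: "nk k \<le> ?x" if "k \<in> ?S" for k
      proof (cases m)
        case 0 then show ?thesis using L(4)[of k] that by simp
      next
        case (Suc j)
        then have "nk k \<le> b * 2 ^ j" using L(5)[of j k] that by simp
        also have "\<dots> \<le> b * 2 ^ m" using ab Suc by simp
        finally show ?thesis .
      qed
      let ?M = "K * 2 powr (- \<beta> * (real m - 1))"
      have "(\<Sum>k\<in>F. LP_symbol \<theta> \<rho> m k * ((1 + nk k) powr s * cmod (fc (cx Y) k)))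
         = (\<Sum>k\<in>?S. (1 + nk k) powr s * cmod (fc (?D m) k))"
        using F L(1) by (intro sum.mono_neutral_cong_right) (auto simp: fD norm_mult)
      also have "\<dots> \<le> (\<Sum>k\<in>?S. (1 + ?x) powr s * cmod (fc (?D m) k))"
        using S s by (intro sum_mono mult_right_mono powr_mono2) auto
      also have "\<dots> = (1 + ?x) powr s * (\<Sum>k\<in>?S. cmod (fc (?D m) k))" by (simp add: sum_distrib_left)
      also have "\<dots> \<le> (1 + ?x) powr s * ((2 * ?x + 1) * ?M)"
        using F S x K(2) Cs_norm_block[OF K]
        by (intro mult_left_mono sum_fc_le[OF cD] nsq_le cD) auto
      also have "\<dots> = c m * K" by (simp add: c_def mult_ac)
      finally show ?thesis .
    qed
    have s1: "(\<lambda>m. \<Sum>k\<in>F. LP_symbol \<theta> \<rho> m k * ((1 + nk k) powr s * cmod (fc (cx Y) k))) sums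
        (\<Sum>k\<in>F. 1 * ((1 + nk k) powr s * cmod (fc (cx Y) k)))"
      by (intro sums_sum sums_mult2 L(3))
    have s2: "(\<lambda>m. c m * K) sums (suminf c * K)" by (intro sums_mult2 summable_sums sc)
    show "(\<Sum>k\<in>F. (1 + nk k) powr s * cmod (fc (cx Y) k)) \<le> suminf c * K"
      using sums_le[OF b s1 s2] by simp
  qed
  moreover have "0 \<le> suminf c" by (rule suminf_nonneg[OF sc c0])
  ultimately show thesis using that by blast
qed

lemma tint_sum: "(\<And>i. i \<in> I \<Longrightarrow> cper (cx (u i))) \<Longrightarrow> tint (\<lambda>x. \<Sum>i\<in>I. u i x) = (\<Sum>i\<in>I. tint (u i))"
  and cper_cx_sum: "(\<And>i. i \<in> I \<Longrightarrow> cper (cx (u i))) \<Longrightarrow> cper (cx (\<lambda>x. \<Sum>i\<in>I. u i x))"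
proof -
  have "(\<forall>i\<in>I. cper (cx (u i))) \<longrightarrow> tint (\<lambda>x. \<Sum>i\<in>I. u i x) = (\<Sum>i\<in>I. tint (u i)) \<and> cper (cx (\<lambda>x. \<Sum>i\<in>I. u i x))"
  proof (induction I rule: infinite_finite_induct)
    case (insert i I)
    then show ?case using tint_add[of "u i" "\<lambda>x. \<Sum>i\<in>I. u i x"] cper_cx_add[of "u i" "\<lambda>x. \<Sum>i\<in>I. u i x"] by simp
  qed (simp_all add: tint_const cper_const)
  then show "(\<And>i. i \<in> I \<Longrightarrow> cper (cx (u i))) \<Longrightarrow> tint (\<lambda>x. \<Sum>i\<in>I. u i x) = (\<Sum>i\<in>I. tint (u i))"
    "(\<And>i. i \<in> I \<Longrightarrow> cper (cx (u i))) \<Longrightarrow> cper (cx (\<lambda>x. \<Sum>i\<in>I. u i x))" by blast+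
qed

lemma has_sum_sum:
  fixes f :: "'i \<Rightarrow> 'a \<Rightarrow> 'b::topological_comm_monoid_add"
  shows "(\<And>i. i \<in> I \<Longrightarrow> (f i has_sum S i) A) \<Longrightarrow> ((\<lambda>x. \<Sum>i\<in>I. f i x) has_sum (\<Sum>i\<in>I. S i)) A"
  by (induction I rule: infinite_finite_induct) (auto intro: has_sum_add)

lemma cper_cx_powr: "cper (cx u) \<Longrightarrow> 0 < q \<Longrightarrow> cper (cx (\<lambda>x. \<bar>u x\<bar> powr q))"
proof -
  assume u: "cper (cx u)" and q: "0 < q"
  have "continuous_on UNIV (\<lambda>x. \<bar>u x\<bar> powr q)"
    by (rule continuous_on_powr') (use q in \<open>auto intro!: continuous_intros cper_cxD[OF u]\<close>)
  then show ?thesis using u by (simp add: cper_cx_iff periodic_def)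
qed

section \<open>The critical Sobolev embedding\<close>

text \<open>Only levels with 2^m \<le> x contribute, and a geometric sum with ratio above 1 is
  comparable to its last term.\<close>

lemma dyadic_geometric_sum:
  fixes a x :: real
  assumes a: "0 < a" and x: "1 \<le> x"
  shows "(\<Sum>m<M. (4 powr a) ^ m * (if x < 2 ^ m then 0 else 1)) \<le> (4 powr a)\<^sup>2 / (4 powr a - 1) * x powr (2 * a)"
proof -
  define Q where "Q = (4::real) powr a"
  have Q: "1 < Q" using a by (simp add: Q_def)
  obtain J where J: "x \<le> 2 ^ J" "2 ^ J < 2 * x"
    by (rule ex_dyadic[OF x], rule that)
  have "(\<Sum>m<M. Q ^ m * (if x < 2 ^ m then 0 else 1)) = (\<Sum>m\<in>{m. m < M \<and> \<not> x < 2 ^ m}. Q ^ m)"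
    by (rule sum.mono_neutral_cong_right) auto
  also have "\<dots> \<le> (\<Sum>m<Suc J. Q ^ m)"
  proof (rule sum_mono2)
    show "{m. m < M \<and> \<not> x < 2 ^ m} \<subseteq> {..<Suc J}"
    proof
      fix m assume "m \<in> {m. m < M \<and> \<not> x < 2 ^ m}"
      then have "(2::real) ^ m \<le> x" by simp
      then have "(2::real) ^ m \<le> 2 ^ J" using J by linarith
      then show "m \<in> {..<Suc J}" by (simp add: less_Suc_eq_le)
    qed
  qed (use Q in auto)
  also have "\<dots> = (Q ^ Suc J - 1) / (Q - 1)" using Q by (intro geometric_sum) auto
  also have "\<dots> \<le> Q ^ Suc J / (Q - 1)" using Q by (intro divide_right_mono) auto
  also have "\<dots> \<le> Q * (Q * x powr (2 * a)) / (Q - 1)"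
  proof -
    have "Q ^ J = (2 ^ J) powr (2 * a)"
      unfolding Q_def four_powr by (simp only: powr_realpow[symmetric] powr_powr zero_less_numeral powr_gt_zero mult_ac)
    also have "\<dots> \<le> (2 * x) powr (2 * a)" using J a by (intro powr_mono2) auto
    also have "\<dots> = Q * x powr (2 * a)" using x by (simp add: powr_mult Q_def four_powr)
    finally show ?thesis using Q by (intro divide_right_mono) (auto intro: mult_left_mono)
  qed
  also have "\<dots> = Q\<^sup>2 / (Q - 1) * x powr (2 * a)" by (simp add: power2_eq_square)
  finally show ?thesis unfolding Q_def .
qed

text \<open>Telescoping over dyadic shells. A shell costs 2 * 2^(m+1) + 1 \<le> 5 * 2^m from the
  count of its frequencies and gains 2^(-a m) from the remainder bound in \<open>sob\<close>. The
  shells grow with ratio 2^(1-a) > 1, so the last one dominates; the summand 1 covers the zero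
  frequency.\<close>

lemma proj_sup_bound:
  assumes a: "0 < a" "a < 1" and f: "sob a N f"
  shows "cmod (proj (2 ^ m) f x) \<le> (1 + 5 / (2 powr (1 - a) - 1)) * (2 powr (1 - a)) ^ m * N"
proof -
  define r where "r = (2::real) powr (1 - a)"
  have r: "1 < r" using a by (simp add: r_def)
  have cf: "cper f" and N: "0 \<le> N" "nsq f \<le> N\<^sup>2" using f by (simp_all add: sob_def)
  have step: "cmod (proj (2 ^ Suc m) f x - proj (2 ^ m) f x) \<le> 5 * r ^ m * N" for m
  proof -
    let ?g = "\<lambda>x. f x - proj (2 ^ m) f x" and ?S = "{k. nk k < 2 ^ Suc m}"
    have g: "cper ?g" by (intro cper_diff cf cper_proj)
    have less: "nk k < 2 ^ Suc m" if "nk k < 2 ^ m" for k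
      using that by (rule order.strict_trans2) simp
    have "proj (2 ^ m) f x = (\<Sum>k\<in>?S. fc (proj (2 ^ m) f) k * echar k x)"
      unfolding proj_def[of _ _ x]
      by (rule sum.mono_neutral_cong_left[OF finite_nk_less]) (auto simp: fc_proj simp del: power_Suc dest: less)
    then have "proj (2 ^ Suc m) f x - proj (2 ^ m) f x = (\<Sum>k\<in>?S. fc ?g k * echar k x)"
      unfolding fc_diff[OF cf cper_proj] left_diff_distrib sum_subtractf
      by (simp only: proj_def[of "2 ^ Suc m"])
    then have "cmod (proj (2 ^ Suc m) f x - proj (2 ^ m) f x) \<le> (\<Sum>k\<in>?S. cmod (fc ?g k))"
      by (simp only:) (rule order_trans[OF norm_sum], simp add: norm_mult)
    also have "\<dots> \<le> (2 * 2 ^ Suc m + 1) * (N * (2 ^ m) powr (- a))"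
      by (rule sum_fc_le[OF g _ _ finite_nk_less]) (use f in \<open>auto simp: sob_def\<close>)
    also have "\<dots> \<le> (5 * 2 ^ m) * (N * (2 ^ m) powr (- a))"
      using N one_le_power[of "2::real" m] by (intro mult_right_mono) auto
    also have "\<dots> = 5 * (2 ^ m * (2 ^ m) powr (- a)) * N" by simp
    also have "2 ^ m * (2 ^ m) powr (- a) = r ^ m"
      by (simp only: r_def powr_realpow[symmetric] powr_powr zero_less_numeral powr_gt_zero powr_add[symmetric])
         (simp add: algebra_simps)
    finally show ?thesis .
  qed
  have "cmod (proj (2 ^ m) f x) \<le> (1 + 5 * ((r ^ m - 1) / (r - 1))) * N"
  proof (induction m)
    case 0
    have "cmod (proj 1 f x) \<le> (\<Sum>k\<in>{k. nk k < 1}. cmod (fc f k))"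
      unfolding proj_def by (rule order_trans[OF norm_sum]) (simp add: norm_mult)
    also have "\<dots> \<le> (2 * 0 + 1) * N"
    proof (rule sum_fc_le[OF cf N(2,1) finite_nk_less])
      show "nk k \<le> 0" if "k \<in> {k. nk k < 1}" for k using nk_ge_1[of k] that by (cases "k = 0") auto
    qed simp
    finally show ?case by simp
  next
    case (Suc m)
    have "cmod (proj (2 ^ Suc m) f x) \<le> cmod (proj (2 ^ m) f x) + cmod (proj (2 ^ Suc m) f x - proj (2 ^ m) f x)"
      using norm_triangle_ineq[of "proj (2 ^ m) f x" "proj (2 ^ Suc m) f x - proj (2 ^ m) f x"] by simp
    also have "\<dots> \<le> (1 + 5 * ((r ^ m - 1) / (r - 1))) * N + 5 * r ^ m * N"
      by (rule add_mono[OF Suc step])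
    also have "\<dots> = (1 + 5 * ((r ^ m - 1) / (r - 1) + r ^ m)) * N" by (simp add: algebra_simps)
    also have "(r ^ m - 1) / (r - 1) + r ^ m = (r ^ Suc m - 1) / (r - 1)" using r by (simp add: field_simps)
    finally show ?case .
  qed
  also have "\<dots> \<le> ((1 + 5 / (r - 1)) * r ^ m) * N"
  proof (rule mult_right_mono[OF _ N(1)])
    have "1 \<le> r ^ m" using r by (intro one_le_power) auto
    moreover have "5 * ((r ^ m - 1) / (r - 1)) \<le> 5 / (r - 1) * r ^ m" using r by (simp add: divide_simps)
    ultimately show "1 + 5 * ((r ^ m - 1) / (r - 1)) \<le> (1 + 5 / (r - 1)) * r ^ m" by (simp add: algebra_simps)
  qed
  finally show ?thesis unfolding r_def .
qed

text \<open>The critical Sobolev embedding after Chemin and Xu: at height \<open>\<lambda>\<close> the frequencies whose sum is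
  at most \<open>\<lambda> / 2\<close> are removed, and the remainder is estimated in \<open>L\<^sup>2\<close>.\<close>

lemma sobolev_embedding:
  assumes a: "0 < a" "a < 1" and q: "q = 2 / (1 - a)"
  obtains C where "0 \<le> C" "\<And>v. torus_test v \<Longrightarrow> tint (\<lambda>x. \<bar>v x\<bar> powr q) \<le> C * sqrt (Nf a v) powr q"
proof -
  define r where "r = (2::real) powr (1 - a)"
  define Q where "Q = (4::real) powr a"
  define C0 where "C0 = 1 + 5 / (r - 1)"
  define C1 where "C1 = Q\<^sup>2 / (Q - 1)"
  define C where "C = (2 * C0) powr q + 4 * (2 * C0 * r) powr (q - 2) * C1"
  have r: "1 < r" and Q: "1 < Q" using a by (simp_all add: r_def Q_def)
  have C0: "0 < C0" and C1: "0 \<le> C1" using r Q by (simp_all add: C0_def C1_def add_pos_nonneg)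
  have q2: "2 < q" using a by (simp add: q field_simps)
  \<comment> \<open>Criticality of the exponent: with q = 2 / (1 - a) the growth of the heights
    raised to q - 2 is exactly the weight 4^a of order \<open>a\<close>.\<close>
  have rq: "r powr (q - 2) = Q"
  proof -
    have "(1 - a) * (q - 2) = 2 * a" using a by (simp add: q field_simps)
    then show ?thesis by (simp add: r_def Q_def powr_powr four_powr)
  qed
  have main: "tint (\<lambda>x. \<bar>v x\<bar> powr q) \<le> C * sqrt (Nf a v) powr q" if v: "torus_test v" for v
  proof -
    define N where "N = sqrt (Nf a v)"
    have cv: "cper (cx v)" by (rule torus_test_cper[OF v])
    have sv: "sob a N (cx v)" unfolding N_def by (rule sob_Nf[OF a v])
    have N0: "0 \<le> N" using sv by (simp add: sob_def)
    show ?thesis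
    proof (cases "N = 0")
      case True
      then have "nsq (cx v) = 0" using sv nsq_nonneg[of "cx v"] by (simp add: sob_def)
      then have "v x = 0" for x using nsq_eq_0_imp[OF cv, of x] by simp
      then show ?thesis using True by (simp add: tint_const N_def[symmetric])
    next
      case False
      then have N: "0 < N" using N0 by simp
      define S where "S m = proj (2 ^ m) (cx v)" for m
      \<comment> \<open>Twice the supremum bound of \<open>proj_sup_bound\<close> at radius 2^m, so
        that the low part never exceeds half of the height.\<close>
      define l where "l m = 2 * C0 * N * r ^ m" for m
      have l0: "0 < l m" for m using C0 N r by (simp add: l_def)
      have S_le: "cmod (S m x) \<le> l m / 2" for m x
      proof -
      have "l m / 2 = C0 * r ^ m * N" by (simp add: l_def)
      then show ?thesis using proj_sup_bound[OF a sv, of m x] by (simp only: S_def C0_def r_def)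
    qed
      obtain V where V: "\<And>x. \<bar>v x\<bar> \<le> V"
    by (rule torus_test_bounded[OF v], rule that)
      obtain M where M: "V \<le> l M"
      proof -
        obtain M where "V / (2 * C0 * N) < r ^ M" using real_arch_pow[OF r] by blast
        then have "V \<le> l M" using C0 N by (simp add: l_def field_simps)
        then show thesis by (rule that)
      qed
      let ?e = "\<lambda>m x. 4 * l (Suc m) powr (q - 2) * (cmod (cx v x - S m x))\<^sup>2"
      have e0: "0 \<le> ?e m x" for m x by simp
      have pt: "\<bar>v x\<bar> powr q \<le> l 0 powr q + (\<Sum>m<M. ?e m x)" for x
      proof (cases "\<bar>v x\<bar> \<le> l 0")
        case True
        then have "\<bar>v x\<bar> powr q \<le> l 0 powr q" using q2 by (intro powr_mono2) auto
        moreover have "0 \<le> (\<Sum>m<M. ?e m x)" using e0 by (intro sum_nonneg) auto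
        ultimately show ?thesis by linarith
      next
        case False
        \<comment> \<open>The first height not below |v x|. At the preceding height the low part is
          less than half of |v x|, so the remainder carries at least half of it, while |v x|^(q-2)
          is bounded by the height just reached.\<close>
        define j where "j = (LEAST j. \<bar>v x\<bar> \<le> l j)"
        have VM: "\<bar>v x\<bar> \<le> l M" using V[of x] M by linarith
        have j: "\<bar>v x\<bar> \<le> l j" unfolding j_def by (rule LeastI[of "\<lambda>j. \<bar>v x\<bar> \<le> l j", OF VM])
        have jM: "j \<le> M" unfolding j_def by (rule Least_le[of "\<lambda>j. \<bar>v x\<bar> \<le> l j", OF VM])
        obtain m where m: "j = Suc m" using j False by (cases j) auto
        have lm: "l m < \<bar>v x\<bar>"
          using not_less_Least[of m "\<lambda>j. \<bar>v x\<bar> \<le> l j"] m unfolding j_def[symmetric] by simp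
        have "\<bar>v x\<bar> \<le> cmod (cx v x - S m x) + cmod (S m x)"
          using norm_triangle_ineq[of "cx v x - S m x" "S m x"] by simp
        then have "\<bar>v x\<bar> \<le> 2 * cmod (cx v x - S m x)" using S_le[of m x] lm by linarith
        then have "\<bar>v x\<bar>\<^sup>2 \<le> (2 * cmod (cx v x - S m x))\<^sup>2" by (intro power_mono) auto
        then have v2: "\<bar>v x\<bar>\<^sup>2 \<le> 4 * (cmod (cx v x - S m x))\<^sup>2" by (simp add: power_mult_distrib)
        have v0: "0 < \<bar>v x\<bar>" using lm l0[of m] by linarith
        have "\<bar>v x\<bar> powr q = \<bar>v x\<bar> powr (q - 2) * \<bar>v x\<bar> powr 2"
          by (simp only: powr_add[symmetric]) simp
        also have "\<bar>v x\<bar> powr 2 = \<bar>v x\<bar>\<^sup>2" using v0 by simp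
        also have "\<bar>v x\<bar> powr (q - 2) * \<bar>v x\<bar>\<^sup>2 \<le> l (Suc m) powr (q - 2) * (4 * (cmod (cx v x - S m x))\<^sup>2)"
          using j m q2 by (intro mult_mono v2 powr_mono2) auto
        also have "\<dots> = ?e m x" by simp
        also have "\<dots> \<le> (\<Sum>m<M. ?e m x)"
          by (rule member_le_sum) (use jM m e0 in auto)
        also have "\<dots> \<le> l 0 powr q + (\<Sum>m<M. ?e m x)" by simp
        finally show ?thesis .
      qed
      have cS: "cper (\<lambda>x. cx v x - S m x)" for m unfolding S_def by (intro cper_diff cv cper_proj)
      have ce: "cper (cx (\<lambda>x. ?e m x))" for m by (rule cper_cx_mult[OF cper_cx_const cper_cmod[OF cS]])
      have te: "tint (?e m) = 4 * l (Suc m) powr (q - 2) * nsq (\<lambda>x. cx v x - S m x)" for m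
        unfolding tint_cmult by (simp add: nsq_def tint_def)
      have "tint (\<lambda>x. \<bar>v x\<bar> powr q) \<le> tint (\<lambda>x. l 0 powr q + (\<Sum>m<M. ?e m x))"
        using q2 by (intro tint_mono pt cper_cx_powr cv cper_cx_add cper_cx_const cper_cx_sum ce) auto
      also have "\<dots> = l 0 powr q + (\<Sum>m<M. 4 * l (Suc m) powr (q - 2) * nsq (\<lambda>x. cx v x - S m x))"
        unfolding tint_add[OF cper_cx_const cper_cx_sum[OF ce]] tint_const tint_sum[OF ce] te ..
      also have "(\<Sum>m<M. 4 * l (Suc m) powr (q - 2) * nsq (\<lambda>x. cx v x - S m x))
         = 4 * (2 * C0 * r * N) powr (q - 2) * (\<Sum>m<M. Q ^ m * nsq (\<lambda>x. cx v x - S m x))"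
      proof -
        have "l (Suc m) powr (q - 2) = (2 * C0 * r * N) powr (q - 2) * Q ^ m" for m
        proof -
          have "l (Suc m) = (2 * C0 * r * N) * r ^ m" by (simp add: l_def)
          then have "l (Suc m) powr (q - 2) = (2 * C0 * r * N) powr (q - 2) * (r ^ m) powr (q - 2)"
            by (simp only: powr_mult)
          also have "(r ^ m) powr (q - 2) = (r powr (q - 2)) ^ m"
            using r by (simp add: powr_realpow[symmetric] powr_powr mult.commute)
          finally show ?thesis unfolding rq .
        qed
        then show ?thesis by (simp add: sum_distrib_left mult.assoc)
      qed
      \<comment> \<open>After Parseval the sum over levels is done at fixed frequency:
        \<open>k\<close> occurs in the remainder at level m only if 2^m \<le> |k|, so the weights
        add up to a multiple of |k|^(2 a).\<close>
      also have "(\<Sum>m<M. Q ^ m * nsq (\<lambda>x. cx v x - S m x)) \<le> C1 * N\<^sup>2"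
      proof -
        have h1: "((\<lambda>k. \<Sum>m<M. Q ^ m * (cmod (fc (\<lambda>x. cx v x - S m x) k))\<^sup>2) has_sum
          (\<Sum>m<M. Q ^ m * nsq (\<lambda>x. cx v x - S m x))) UNIV"
          by (intro has_sum_sum has_sum_cmult_right Parseval_nsq cS)
        have h2: "((\<lambda>k. C1 * (msym a k * (cmod (fc (cx v) k))\<^sup>2)) has_sum (C1 * Qf a v v)) UNIV"
          by (intro has_sum_cmult_right Qf_self a cv torus_test_H1 v)
        have "(\<Sum>m<M. Q ^ m * nsq (\<lambda>x. cx v x - S m x)) \<le> C1 * Qf a v v"
        proof (rule has_sum_mono[OF h1 h2])
          fix k
          have "(\<Sum>m<M. Q ^ m * (cmod (fc (\<lambda>x. cx v x - S m x) k))\<^sup>2)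
             = (\<Sum>m<M. Q ^ m * (if nk k < 2 ^ m then 0 else 1)) * (cmod (fc (cx v) k))\<^sup>2"
            unfolding sum_distrib_right
            by (intro sum.cong refl) (simp add: S_def fc_diff[OF cv cper_proj] fc_proj)
          also have "\<dots> \<le> (C1 * msym a k) * (cmod (fc (cx v) k))\<^sup>2"
          proof (rule mult_right_mono)
            show "(\<Sum>m<M. Q ^ m * (if nk k < 2 ^ m then 0 else 1)) \<le> C1 * msym a k"
            proof (cases "k = 0")
              case False
              have "(\<Sum>m<M. Q ^ m * (if nk k < 2 ^ m then 0 else 1)) \<le> C1 * nk k powr (2 * a)"
                unfolding Q_def C1_def by (rule dyadic_geometric_sum[OF a(1) nk_ge_1[OF False]])
              also have "\<dots> \<le> C1 * msym a k" by (intro mult_left_mono msym_lower a C1)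
              finally show ?thesis .
            qed simp
          qed simp
          finally show "(\<Sum>m<M. Q ^ m * (cmod (fc (\<lambda>x. cx v x - S m x) k))\<^sup>2) \<le> C1 * (msym a k * (cmod (fc (cx v) k))\<^sup>2)"
            by (simp only: mult.assoc)
        qed
        also have "\<dots> \<le> C1 * N\<^sup>2"
          using Nf_nonneg[OF a v] by (intro mult_left_mono C1) (simp add: N_def Nf_def)
        finally show ?thesis .
      qed
      finally have "tint (\<lambda>x. \<bar>v x\<bar> powr q) \<le> l 0 powr q + 4 * (2 * C0 * r * N) powr (q - 2) * (C1 * N\<^sup>2)"
        by (simp add: mult_left_mono)
      also have "l 0 powr q = (2 * C0) powr q * N powr q" by (simp add: l_def powr_mult)
      also have "4 * (2 * C0 * r * N) powr (q - 2) * (C1 * N\<^sup>2) = 4 * (2 * C0 * r) powr (q - 2) * C1 * (N powr (q - 2) * N powr 2)"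
        using N by (simp add: powr_mult mult_ac)
      also have "N powr (q - 2) * N powr 2 = N powr q" by (simp only: powr_add[symmetric]) simp
      finally show ?thesis by (simp add: C_def N_def algebra_simps)
    qed
  qed
  have "0 \<le> C" using C1 by (simp add: C_def)
  then show thesis using main by (rule that)
qed

section \<open>The lower order terms\<close>

text \<open>The good term: what the cubic nonlinearity contributes to the energy balance.\<close>

definition Gf :: "real \<Rightarrow> (real^2 \<Rightarrow> real) \<Rightarrow> real" where "Gf a w = Qf a (\<lambda>x. w x ^ 3) w"

text \<open>The dissipation: what the biharmonic term contributes to the energy balance. It is
  comparable to the square of the homogeneous norm of order 1 + a.\<close>

definition Df :: "real \<Rightarrow> (real^2 \<Rightarrow> real) \<Rightarrow> real" where
  "Df a w = (\<Sum>\<^sub>\<infinity>k. msym a k * (2 * pi * nk k)\<^sup>2 * (cmod (fc (cx w) k))\<^sup>2)"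

lemma torus_test_summable:
  assumes u: "torus_test u"
  shows "(\<lambda>k. (1 + (nk k)\<^sup>2) ^ p * cmod (fc (cx u) k)) summable_on UNIV"
proof -
  obtain M where M: "0 \<le> M" "\<And>k. (1 + (nk k)\<^sup>2) ^ (p + 2) * cmod (fc (cx u) k) \<le> M"
    by (rule torus_test_decay[OF u, of "p + 2"], rule that)
  show ?thesis
  proof (rule summable_on_comparison_test[OF summable_on_cmult_right[OF summable_lattice, of M]])
    fix k
    have x: "0 < (1 + (nk k)\<^sup>2)\<^sup>2" by (intro zero_less_power add_pos_nonneg) auto
    have "(1 + (nk k)\<^sup>2) ^ p * cmod (fc (cx u) k) * (1 + (nk k)\<^sup>2)\<^sup>2 \<le> M"
      using M(2)[of k] by (simp only: power_add mult_ac)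
    then show "(1 + (nk k)\<^sup>2) ^ p * cmod (fc (cx u) k) \<le> M * (1 / (1 + (nk k)\<^sup>2)\<^sup>2)"
      using x by (simp only: pos_le_divide_eq times_divide_eq_right mult_1_right)
  qed auto
qed

lemma msym_poly_bound:
  assumes a: "0 < a" "a < 1"
  obtains C where "0 < C" "\<And>k. msym a k \<le> C * (1 + (nk k)\<^sup>2)"
proof -
  obtain C where C: "0 < C" "\<And>k. msym a k \<le> C * nk k powr (2 * a)"
    by (rule msym_upper[OF a], rule that)
  have "msym a k \<le> C * (1 + (nk k)\<^sup>2)" for k
  proof -
    have "nk k powr (2 * a) \<le> (nk k)\<^sup>2" using a by (intro powr_nk_le) auto
    then have "C * nk k powr (2 * a) \<le> C * (1 + (nk k)\<^sup>2)" using C(1) by (intro mult_left_mono) auto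
    with C(2)[of k] show ?thesis by linarith
  qed
  with C(1) show thesis by (rule that)
qed

lemma fc_bounded:
  assumes u: "torus_test u"
  obtains M where "0 \<le> M" "\<And>k. cmod (fc (cx u) k) \<le> M"
proof -
  obtain M where "0 \<le> M" "\<And>k. (1 + (nk k)\<^sup>2) ^ 0 * cmod (fc (cx u) k) \<le> M"
    by (rule torus_test_decay[OF u, of 0], rule that)
  then show thesis by (intro that) auto
qed

lemma poly_fc_sq_summable:
  assumes u: "torus_test u" and C: "\<And>k. 0 \<le> c k" "\<And>k. c k \<le> C * (1 + (nk k)\<^sup>2) ^ p"
  shows "(\<lambda>k. c k * (cmod (fc (cx u) k))\<^sup>2) summable_on UNIV"
proof -
  obtain M where M: "0 \<le> M" "\<And>k. cmod (fc (cx u) k) \<le> M"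
    by (rule fc_bounded[OF u], rule that)
  show ?thesis
  proof (rule summable_on_comparison_test[OF summable_on_cmult_right[OF torus_test_summable[OF u, of p], of "C * M"]])
    fix k
    have "c k * (cmod (fc (cx u) k))\<^sup>2 = c k * cmod (fc (cx u) k) * cmod (fc (cx u) k)" by (simp add: power2_eq_square)
    also have "\<dots> \<le> (C * (1 + (nk k)\<^sup>2) ^ p * M) * cmod (fc (cx u) k)"
      using C[of k] M by (intro mult_right_mono mult_mono) (auto intro: order_trans)
    finally show "c k * (cmod (fc (cx u) k))\<^sup>2 \<le> C * M * ((1 + (nk k)\<^sup>2) ^ p * cmod (fc (cx u) k))"
      by (simp only: mult_ac)
  qed (simp add: C)
qed

lemma Df_has_sum:
  assumes a: "0 < a" "a < 1" and w: "torus_test w"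
  shows "((\<lambda>k. msym a k * (2 * pi * nk k)\<^sup>2 * (cmod (fc (cx w) k))\<^sup>2) has_sum Df a w) UNIV"
proof -
  obtain C where C: "0 < C" "\<And>k. msym a k \<le> C * (1 + (nk k)\<^sup>2)"
    by (rule msym_poly_bound[OF a], rule that)
  have "msym a k * (2 * pi * nk k)\<^sup>2 \<le> (C * (2 * pi)\<^sup>2) * (1 + (nk k)\<^sup>2) ^ 2" for k
  proof -
    have "msym a k * (2 * pi * nk k)\<^sup>2 \<le> (C * (1 + (nk k)\<^sup>2)) * ((2 * pi)\<^sup>2 * (1 + (nk k)\<^sup>2))"
      using C a by (intro mult_mono) (auto simp: power_mult_distrib)
    then show ?thesis by (simp only: power2_eq_square mult_ac)
  qed
  then show ?thesis unfolding Df_def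
    by (intro has_sum_infsum poly_fc_sq_summable[OF w]) (simp add: msym_nonneg a)
qed

lemma Df_nonneg: "0 < a \<Longrightarrow> a < 1 \<Longrightarrow> torus_test w \<Longrightarrow> 0 \<le> Df a w"
  by (rule has_sum_nonneg[OF Df_has_sum]) (auto simp: msym_nonneg)

lemma Gf_nonneg: "0 < a \<Longrightarrow> a < 1 \<Longrightarrow> torus_test w \<Longrightarrow> 0 \<le> Gf a w"
  unfolding Gf_def by (rule Qf_cube_nonneg)

lemma Qf_mono_exponent:
  assumes s: "0 < s" "s \<le> a" "a < 1"
  obtains C where "0 < C" "\<And>u. torus_test u \<Longrightarrow> Qf s u u \<le> C * Qf a u u"
proof -
  obtain C where C: "0 < C" "\<And>k. msym s k \<le> C * nk k powr (2 * s)" by (rule msym_upper[of s]) (use s that in auto)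
  have "Qf s u u \<le> C * Qf a u u" if u: "torus_test u" for u
  proof (rule has_sum_mono[OF Qf_self has_sum_cmult_right[OF Qf_self]])
    fix k
    have "msym s k \<le> C * msym a k"
    proof (cases "k = 0")
      case False
      have "nk k powr (2 * s) \<le> nk k powr (2 * a)" using nk_ge_1[OF False] s by (intro powr_mono) auto
      also have "\<dots> \<le> msym a k" using s by (intro msym_lower) auto
      finally have "C * nk k powr (2 * s) \<le> C * msym a k" using C(1) by (intro mult_left_mono) auto
      with C(2)[of k] show ?thesis by linarith
    qed simp
    then show "msym s k * (cmod (fc (cx u) k))\<^sup>2 \<le> C * (msym a k * (cmod (fc (cx u) k))\<^sup>2)"
      using mult_right_mono[of "msym s k" "C * msym a k" "(cmod (fc (cx u) k))\<^sup>2"] by (simp only: mult.assoc zero_le_power2)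
  qed (use s u in \<open>auto simp: torus_test_cper torus_test_H1\<close>)
  with C(1) show thesis by (rule that)
qed

text \<open>The square of \<open>w\<close> does not have mean zero; its mean is
  \<open>nsq (cx w)\<close>, which is the zero frequency term. All other frequencies are covered as
  in the Poincare inequality.\<close>

lemma nsq_square_le:
  assumes a: "0 < a" "a < 1" and w: "torus_test w"
  shows "nsq (cx (\<lambda>x. (w x)\<^sup>2)) \<le> (nsq (cx w))\<^sup>2 + Qf a (\<lambda>x. (w x)\<^sup>2) (\<lambda>x. (w x)\<^sup>2)"
proof -
  let ?v = "\<lambda>x. (w x)\<^sup>2"
  have v: "torus_test ?v" by (rule torus_test_power[OF w])
  have h: "((\<lambda>k. (if k = 0 then (nsq (cx w))\<^sup>2 else 0) + msym a k * (cmod (fc (cx ?v) k))\<^sup>2) has_sum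
     ((nsq (cx w))\<^sup>2 + Qf a ?v ?v)) UNIV"
    by (intro has_sum_add Qf_self a torus_test_cper torus_test_H1 v has_sum_finite_neutralI[of "{0}"]) auto
  show ?thesis
  proof (rule has_sum_mono[OF Parseval_nsq[OF torus_test_cper[OF v]] h])
    fix k
    show "(cmod (fc (cx ?v) k))\<^sup>2 \<le> (if k = 0 then (nsq (cx w))\<^sup>2 else 0) + msym a k * (cmod (fc (cx ?v) k))\<^sup>2"
    proof (cases "k = 0")
      case True
      then show ?thesis using fc_cx_0[OF torus_test_cper[OF v]] by (simp add: nsq_cx del: of_real_power)
    next
      case False
      have "1 \<le> nk k powr (2 * a)" using nk_ge_1[OF False] a by (simp add: ge_one_powr_ge_zero)
      also have "\<dots> \<le> msym a k" by (rule msym_lower[OF a])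
      finally have "1 * (cmod (fc (cx ?v) k))\<^sup>2 \<le> msym a k * (cmod (fc (cx ?v) k))\<^sup>2" by (rule mult_right_mono) simp
      then show ?thesis using False by simp
    qed
  qed
qed

text \<open>The powers match homogeneity: \<open>Gf\<close> is of degree four in \<open>w\<close>,
  the norm of \<open>w\<close> of degree two, and that of its square of degree four. Poincare's
  inequality supplies the L2 parts, through \<open>nsq_square_le\<close> for the square.\<close>

lemma good_term_bounds:
  assumes s: "0 < s" "2 * s < a" and a: "a < 1"
  obtains C where "0 < C"
    "\<And>w. torus_test w \<Longrightarrow> tint w = 0 \<Longrightarrow> Nf s w \<le> C * sqrt (Gf a w)"
    "\<And>w. torus_test w \<Longrightarrow> tint w = 0 \<Longrightarrow> Nf s (\<lambda>x. (w x)\<^sup>2) \<le> C * Gf a w"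
    "\<And>w. torus_test w \<Longrightarrow> tint w = 0 \<Longrightarrow> Nf a (\<lambda>x. (w x)\<^sup>2) \<le> C * Gf a w"
proof -
  have a0: "0 < a" and s1: "s < 1" and sa: "s \<le> a" using s a by auto
  define c where "c = 2 / (1 - 4 powr (2 * s - a) :: real)"
  have c: "0 < c" using s powr_less_one[of 4 "2 * s - a"] by (simp add: c_def)
  obtain C1 where C1: "0 < C1" "\<And>u. torus_test u \<Longrightarrow> Qf s u u \<le> C1 * Qf a u u"
    by (rule Qf_mono_exponent[OF s(1) sa a], rule that)
  define C where "C = 4 * sqrt c + 4 * c + 4 / 3 + 4 / 3 * C1 + 4 / 3"
  have C: "0 < C" using c C1(1) by (simp add: C_def add_pos_pos)
  have q: "Qf s w w \<le> 2 * sqrt c * sqrt (Gf a w)" if w: "torus_test w" for w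
    using Qf_lower_order_le[OF s a w]
    unfolding c_def[symmetric] Gf_def[symmetric] real_sqrt_mult by (simp only: mult.assoc)
  have n: "nsq (cx w) \<le> 2 * sqrt c * sqrt (Gf a w)" if w: "torus_test w" "tint w = 0" for w
    using Poincare_Qf[OF s(1) s1 w] q[OF w(1)] by linarith
  have n2: "nsq (cx (\<lambda>x. (w x)\<^sup>2)) \<le> (4 * c + 4 / 3) * Gf a w" if w: "torus_test w" "tint w = 0" for w
  proof -
    have "(nsq (cx w))\<^sup>2 \<le> (2 * sqrt c * sqrt (Gf a w))\<^sup>2" by (intro power_mono n w) simp
    also have "\<dots> = 4 * c * Gf a w" using c Gf_nonneg[OF a0 a w(1)] by (simp add: power_mult_distrib)
    finally have "(nsq (cx w))\<^sup>2 \<le> 4 * c * Gf a w" .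
    then show ?thesis
      using nsq_square_le[OF a0 a w(1)] Qf_square_le[OF a0 a w(1)] by (simp add: Gf_def algebra_simps)
  qed
  show thesis
  proof (rule that[OF C])
    fix w assume w: "torus_test w" "tint w = 0"
    have G: "0 \<le> Gf a w" by (rule Gf_nonneg[OF a0 a w(1)])
    have "Nf s w \<le> 4 * sqrt c * sqrt (Gf a w)" using q[OF w(1)] n[OF w] by (simp add: Nf_def)
    also have "\<dots> \<le> C * sqrt (Gf a w)" using c C1(1) G by (intro mult_right_mono) (auto simp: C_def)
    finally show "Nf s w \<le> C * sqrt (Gf a w)" .
    have qa: "Qf a (\<lambda>x. (w x)\<^sup>2) (\<lambda>x. (w x)\<^sup>2) \<le> 4 / 3 * Gf a w"
      using Qf_square_le[OF a0 a w(1)] by (simp add: Gf_def)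
    have "Qf s (\<lambda>x. (w x)\<^sup>2) (\<lambda>x. (w x)\<^sup>2) \<le> C1 * (4 / 3 * Gf a w)"
      by (rule order_trans[OF C1(2)[OF torus_test_power[OF w(1)]] mult_left_mono[OF qa]]) (use C1(1) in simp)
    then have "Nf s (\<lambda>x. (w x)\<^sup>2) \<le> (4 * c + 4 / 3 + 4 / 3 * C1) * Gf a w"
      using n2[OF w] by (simp add: Nf_def algebra_simps)
    also have "\<dots> \<le> C * Gf a w" using c C1(1) G by (intro mult_right_mono) (auto simp: C_def)
    finally show "Nf s (\<lambda>x. (w x)\<^sup>2) \<le> C * Gf a w" .
    have "Nf a (\<lambda>x. (w x)\<^sup>2) \<le> (4 * c + 4 / 3 + 4 / 3) * Gf a w"
      using n2[OF w] qa by (simp add: Nf_def algebra_simps)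
    also have "\<dots> \<le> C * Gf a w" using c C1(1) G by (intro mult_right_mono) (auto simp: C_def)
    finally show "Nf a (\<lambda>x. (w x)\<^sup>2) \<le> C * Gf a w" .
  qed
qed

section \<open>The multiplier applied to the solution\<close>

definition Bw :: "real \<Rightarrow> (real^2 \<Rightarrow> real) \<Rightarrow> real^2 \<Rightarrow> complex" where
  "Bw a w x = (\<Sum>\<^sub>\<infinity>k. complex_of_real (msym a k) * fc (cx w) k * echar k x)"

lemma
  assumes a: "0 < a" "a < 1" and w: "torus_test w"
  shows cper_Bw: "cper (Bw a w)" and fc_Bw: "fc (Bw a w) k = complex_of_real (msym a k) * fc (cx w) k"
proof -
  obtain C where C: "0 < C" "\<And>k. msym a k \<le> C * (1 + (nk k)\<^sup>2)"
    by (rule msym_poly_bound[OF a], rule that)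
  have s: "(\<lambda>k. cmod (complex_of_real (msym a k) * fc (cx w) k)) summable_on UNIV"
  proof (rule summable_on_comparison_test[OF summable_on_cmult_right[OF torus_test_summable[OF w, of 1], of C]])
    fix k
    show "cmod (complex_of_real (msym a k) * fc (cx w) k) \<le> C * ((1 + (nk k)\<^sup>2) ^ 1 * cmod (fc (cx w) k))"
      using mult_right_mono[OF C(2)[of k], of "cmod (fc (cx w) k)"] a
      by (simp only: norm_mult norm_of_real abs_of_nonneg msym_nonneg power_one_right mult.assoc norm_ge_zero)
  qed auto
  show "cper (Bw a w)" "fc (Bw a w) k = complex_of_real (msym a k) * fc (cx w) k"
    using fc_series_cper[OF s] fc_series_fc[OF s, of k] by (simp_all only: Bw_def[abs_def])
qed

text \<open>Moving the whole multiplier to the smooth second argument turns the form into an L2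
  pairing. Additivity in \<open>u\<close> and the duality estimates become available, and of
  \<open>u\<close> only continuity and periodicity are used.\<close>

lemma Qf_Bw:
  assumes a: "0 < a" "a < 1" and u: "cper (cx u)" and w: "torus_test w"
  shows "Qf a u w = Re (ip (cx u) (Bw a w))"
proof -
  have "((\<lambda>k. Re (fc (cx u) k * cnj (fc (Bw a w) k))) has_sum Re (ip (cx u) (Bw a w))) UNIV"
    by (rule has_sum_Re[OF Parseval[OF u cper_Bw[OF a w]]])
  moreover have "Re (fc (cx u) k * cnj (fc (Bw a w) k)) = msym a k * Re (fc (cx u) k * cnj (fc (cx w) k))" for k
    unfolding fc_Bw[OF a w] by (simp add: algebra_simps)
  ultimately have "((\<lambda>k. msym a k * Re (fc (cx u) k * cnj (fc (cx w) k))) has_sum Re (ip (cx u) (Bw a w))) UNIV"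
    by (simp only:)
  then show ?thesis unfolding Qf_def by (rule infsumI)
qed

text \<open>The left side is of order 2 s + 4 a and the dissipation symbol of order 2 + 2 a, which
  is higher because s + a < 1. High frequencies are absorbed with the small factor \<eta>; the
  finitely many low ones go into the constant.\<close>

lemma symbol_interpolation:
  assumes s: "0 < s" "s + a < 1" and a: "0 < a" and \<eta>: "0 < \<eta>"
  obtains C where "0 \<le> C" "\<And>k. (1 + msym s k) * (msym a k)\<^sup>2 \<le> \<eta> * (msym a k * (2 * pi * nk k)\<^sup>2) + C"
proof -
  have a1: "a < 1" and s1: "s < 1" using s a by auto
  obtain C1 where C1: "0 < C1" "\<And>k. msym s k \<le> C1 * nk k powr (2 * s)"
    by (rule msym_upper[OF s(1) s1], rule that)
  obtain C2 where C2: "0 < C2" "\<And>k. msym a k \<le> C2 * nk k powr (2 * a)"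
    by (rule msym_upper[OF a a1], rule that)
  define c where "c = (1 + C1) * C2 / \<eta>"
  have c: "0 < c" using C1 C2 \<eta> by (simp add: c_def add_pos_pos)
  define b where "b = 2 - 2 * s - 2 * a"
  have b: "0 < b" using s by (simp add: b_def)
  \<comment> \<open>Beyond this radius the gap |k|^b between the two orders exceeds the ratio
    \<open>c\<close> of the constants.\<close>
  define R where "R = max 1 (c powr (1 / b))"
  have big: "(1 + msym s k) * (msym a k)\<^sup>2 \<le> \<eta> * (msym a k * (2 * pi * nk k)\<^sup>2)" if k: "R \<le> nk k" for k
  proof -
    have n1: "1 \<le> nk k" and nc: "c powr (1 / b) \<le> nk k" using k by (auto simp: R_def)
    have "c = (c powr (1 / b)) powr b" using c b by (simp add: powr_powr)
    also have "\<dots> \<le> nk k powr b" using nc b by (intro powr_mono2) auto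
    finally have "c * \<eta> \<le> nk k powr b * \<eta>" using \<eta> by (intro mult_right_mono) auto
    then have cb: "(1 + C1) * C2 \<le> \<eta> * nk k powr b" using \<eta> by (simp add: c_def mult.commute)
    have "1 + msym s k \<le> (1 + C1) * nk k powr (2 * s)"
      using C1(2)[of k] n1 s ge_one_powr_ge_zero[of "nk k" "2 * s"] by (simp add: algebra_simps)
    then have "(1 + msym s k) * msym a k \<le> ((1 + C1) * nk k powr (2 * s)) * (C2 * nk k powr (2 * a))"
      using C2 C1 a1 s1 by (intro mult_mono) (auto simp: msym_nonneg)
    also have "\<dots> = ((1 + C1) * C2) * (nk k powr (2 * s) * nk k powr (2 * a))" by (simp only: mult_ac)
    also have "\<dots> \<le> (\<eta> * nk k powr b) * (nk k powr (2 * s) * nk k powr (2 * a))"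
      by (rule mult_right_mono[OF cb]) simp
    also have "\<dots> = \<eta> * (nk k powr b * nk k powr (2 * s) * nk k powr (2 * a))" by (simp only: mult_ac)
    also have "nk k powr b * nk k powr (2 * s) * nk k powr (2 * a) = nk k powr 2"
      by (simp add: powr_add[symmetric] b_def)
    also have "nk k powr 2 = (nk k)\<^sup>2" using n1 by simp
    also have "\<eta> * (nk k)\<^sup>2 \<le> \<eta> * (2 * pi * nk k)\<^sup>2"
    proof -
      have "1 * nk k \<le> 2 * pi * nk k" using pi_gt3 by (intro mult_right_mono) auto
      then have "(nk k)\<^sup>2 \<le> (2 * pi * nk k)\<^sup>2" by (intro power_mono) auto
      then show ?thesis using \<eta> by (intro mult_left_mono) auto
    qed
    finally have "msym a k * ((1 + msym s k) * msym a k) \<le> msym a k * (\<eta> * (2 * pi * nk k)\<^sup>2)"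
      by (rule mult_left_mono) (simp add: msym_nonneg a1)
    then show ?thesis by (simp only: power2_eq_square mult_ac)
  qed
  define C where "C = (\<Sum>k\<in>{k. nk k < R}. (1 + msym s k) * (msym a k)\<^sup>2)"
  have nn: "0 \<le> (1 + msym s k) * (msym a k)\<^sup>2" for k by (simp add: msym_nonneg s1)
  show thesis
  proof (rule that)
    show "0 \<le> C" unfolding C_def by (intro sum_nonneg nn)
    fix k
    show "(1 + msym s k) * (msym a k)\<^sup>2 \<le> \<eta> * (msym a k * (2 * pi * nk k)\<^sup>2) + C"
    proof (cases "R \<le> nk k")
      case True
      then show ?thesis using big[OF True] \<open>0 \<le> C\<close> by linarith
    next
      case False
      then have "(1 + msym s k) * (msym a k)\<^sup>2 \<le> C"
        unfolding C_def by (intro member_le_sum finite_nk_less nn) auto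
      moreover have "0 \<le> \<eta> * (msym a k * (2 * pi * nk k)\<^sup>2)" using \<eta> by (simp add: msym_nonneg a1)
      ultimately show ?thesis by linarith
    qed
  qed
qed

text \<open>The second factor in every pairing. Since \<eta> is free, the dissipation enters with a
  coefficient as small as desired, at the price of a multiple of the L2 norm of \<open>w\<close>,
  which the good term controls sublinearly.\<close>

lemma sob_Bw:
  assumes s: "0 < s" "s + a < 1" and a: "0 < a" and \<eta>: "0 < \<eta>"
  obtains C where "0 \<le> C" "\<And>w. torus_test w \<Longrightarrow> sob s (sqrt (\<eta> * Df a w + C * nsq (cx w))) (Bw a w)"
proof -
  have a1: "a < 1" and s1: "s < 1" using s a by auto
  obtain C where C: "0 \<le> C" "\<And>k. (1 + msym s k) * (msym a k)\<^sup>2 \<le> \<eta> * (msym a k * (2 * pi * nk k)\<^sup>2) + C"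
    by (rule symbol_interpolation[OF s a \<eta>], rule that)
  have "sob s (sqrt (\<eta> * Df a w + C * nsq (cx w))) (Bw a w)" if w: "torus_test w" for w
  proof -
    have cB: "cper (Bw a w)" by (rule cper_Bw[OF a a1 w])
    have h: "((\<lambda>k. \<eta> * (msym a k * (2 * pi * nk k)\<^sup>2 * (cmod (fc (cx w) k))\<^sup>2) + C * (cmod (fc (cx w) k))\<^sup>2)
       has_sum (\<eta> * Df a w + C * nsq (cx w))) UNIV"
      by (intro has_sum_add has_sum_cmult_right Df_has_sum Parseval_nsq a a1 w torus_test_cper)
    have le: "(1 + msym s k) * (cmod (fc (Bw a w) k))\<^sup>2 \<le>
        \<eta> * (msym a k * (2 * pi * nk k)\<^sup>2 * (cmod (fc (cx w) k))\<^sup>2) + C * (cmod (fc (cx w) k))\<^sup>2" for k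
    proof -
      have "(1 + msym s k) * (cmod (fc (Bw a w) k))\<^sup>2 = ((1 + msym s k) * (msym a k)\<^sup>2) * (cmod (fc (cx w) k))\<^sup>2"
        by (simp add: fc_Bw[OF a a1 w] norm_mult power_mult_distrib)
      also have "\<dots> \<le> (\<eta> * (msym a k * (2 * pi * nk k)\<^sup>2) + C) * (cmod (fc (cx w) k))\<^sup>2"
        by (rule mult_right_mono[OF C(2)]) simp
      finally show ?thesis by (simp add: algebra_simps)
    qed
    have sm: "(\<lambda>k. msym s k * (cmod (fc (Bw a w) k))\<^sup>2) summable_on UNIV"
    proof (rule summable_on_comparison_test[OF has_sum_imp_summable[OF h]])
      fix k
      show "msym s k * (cmod (fc (Bw a w) k))\<^sup>2 \<le> \<eta> * (msym a k * (2 * pi * nk k)\<^sup>2 * (cmod (fc (cx w) k))\<^sup>2) + C * (cmod (fc (cx w) k))\<^sup>2"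
        using le[of k] zero_le_power2[of "cmod (fc (Bw a w) k)"] unfolding distrib_right mult_1_left by linarith
    qed (simp add: msym_nonneg s1)
    let ?B = "infsum (\<lambda>k. msym s k * (cmod (fc (Bw a w) k))\<^sup>2) UNIV"
    have hB: "((\<lambda>k. msym s k * (cmod (fc (Bw a w) k))\<^sup>2) has_sum ?B) UNIV" by (rule has_sum_infsum[OF sm])
    have "nsq (Bw a w) + ?B \<le> \<eta> * Df a w + C * nsq (cx w)"
    proof (rule has_sum_mono[OF has_sum_add[OF Parseval_nsq[OF cB] hB] h])
      show "(cmod (fc (Bw a w) k))\<^sup>2 + msym s k * (cmod (fc (Bw a w) k))\<^sup>2 \<le>
        \<eta> * (msym a k * (2 * pi * nk k)\<^sup>2 * (cmod (fc (cx w) k))\<^sup>2) + C * (cmod (fc (cx w) k))\<^sup>2" for k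
        using le[of k] by (simp only: distrib_right mult_1_left)
    qed
    moreover have nn: "0 \<le> \<eta> * Df a w + C * nsq (cx w)" using \<eta> C(1) Df_nonneg[OF a a1 w] by simp
    ultimately show ?thesis by (intro sobI[OF s(1) s1 cB hB]) auto
  qed
  with C(1) show thesis by (rule that)
qed


section \<open>Absorbing the lower order terms\<close>

lemma Nf_one: "0 < s \<Longrightarrow> s < 1 \<Longrightarrow> Nf s (\<lambda>x. 1) = 1"
proof -
  assume s: "0 < s" "s < 1"
  have fc1: "fc (cx (\<lambda>x. 1)) k = (if k = 0 then 1 else 0)" for k
    using fc_echar[of 0 k] unfolding echar_0(1)[abs_def] by (cases "k = 0") simp_all
  have "((\<lambda>k. msym s k * (cmod (fc (cx (\<lambda>x. 1)) k))\<^sup>2) has_sum Qf s (\<lambda>x. 1) (\<lambda>x. 1)) UNIV"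
    by (intro Qf_self s torus_test_cper torus_test_H1 torus_test_const)
  moreover have "msym s k * (cmod (fc (cx (\<lambda>x. 1)) k))\<^sup>2 = 0" for k unfolding fc1 by simp
  ultimately have "((\<lambda>k. 0) has_sum Qf s (\<lambda>x. 1) (\<lambda>x. 1)) (UNIV :: (int^2) set)" by (simp only:)
  then have "Qf s (\<lambda>x. 1) (\<lambda>x. 1) = 0" by (rule has_sum_unique[OF _ has_sum_0_simp])
  then show ?thesis using nsq_cx[of "\<lambda>x. 1"] by (simp add: Nf_def tint_const)
qed

lemma ip_sob_bound:
  assumes s: "0 < s" "s < 1" and u: "torus_test u" and z: "sob s Z z"
  shows "cmod (ip (cx u) z) \<le> sqrt (Nf s u) * Z"
proof -
  have "sqrt (nsq (cx u)) \<le> sqrt (Nf s u)" using Qf_self_nonneg[OF s u] by (simp add: Nf_def)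
  moreover have "sqrt (nsq z) \<le> Z" using z by (intro real_le_lsqrt) (auto simp: sob_def)
  ultimately have "sqrt (nsq (cx u)) * sqrt (nsq z) \<le> sqrt (Nf s u) * Z"
    using Nf_nonneg[OF s u] by (intro mult_mono) auto
  moreover have "cper z" using z by (simp add: sob_def)
  ultimately show ?thesis using ip_Cauchy_Schwarz[OF torus_test_cper[OF u], of z] by linarith
qed

text \<open>Every term is a pairing of \<open>Bw a w\<close> with a product of 1, \<open>X\<close>
  or \<open>X2\<close>, a power of \<open>w\<close> of degree at most two, and powers of
  \<open>Y\<close>. Each is bounded by a constant times Z, W1 Z or W2 Z, with W1^2 of the order of
  the root of the good term, W2^2 of the order of the good term and Z^2 bounded through
  \<open>sob_Bw\<close>. Young's inequality with suitable weights leaves half of the dissipation and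
  half of the good term.\<close>

lemma nonlinear_estimate:
  assumes dp: "dyadic_partition \<theta> \<rho>" and a: "0 < a" and s: "0 < s" "2 * s < a" "s + a < 1" "s < s'" "s' \<le> 1"
    and \<kappa>: "0 < \<kappa>" "\<kappa> < s" "0 < \<kappa>'" "\<kappa>' < s" and AK: "0 \<le> A" "0 \<le> K"
  obtains C where "0 \<le> C"
    "\<And>w X X2 Y. torus_test w \<Longrightarrow> tint w = 0 \<Longrightarrow> trigpoly (cx X) \<Longrightarrow> Cs_norm \<theta> \<rho> (- \<kappa>) (dist_of X) \<le> ennreal K \<Longrightarrow>
      trigpoly (cx X2) \<Longrightarrow> Cs_norm \<theta> \<rho> (- \<kappa>') (dist_of X2) \<le> ennreal K \<Longrightarrow> wiener s' A Y \<Longrightarrow>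
      \<bar>Qf a (\<lambda>x. 3 * w x * (Y x)\<^sup>2 + 3 * (w x)\<^sup>2 * Y x + Y x ^ 3
          + 3 * ((w x)\<^sup>2 + 2 * w x * Y x + (Y x)\<^sup>2) * X x + 3 * w x * X2 x) w\<bar>
       \<le> Df a w / 2 + Gf a w / 2 + C"
proof -
  have a1: "a < 1" and s1: "s < 1" using s a by auto
  obtain Cd1 where Cd1: "0 \<le> Cd1"
    "\<And>P K A B f g. trigpoly (cx P) \<Longrightarrow> Cs_norm \<theta> \<rho> (- \<kappa>) (dist_of P) \<le> ennreal K \<Longrightarrow> 0 \<le> K \<Longrightarrow>
      sob s A f \<Longrightarrow> sob s B g \<Longrightarrow> cmod (ip (\<lambda>x. cx P x * f x) g) \<le> Cd1 * K * A * B"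
    by (rule duality_Cs[OF dp \<kappa>(1,2)], rule that)
  obtain Cd2 where Cd2: "0 \<le> Cd2"
    "\<And>P K A B f g. trigpoly (cx P) \<Longrightarrow> Cs_norm \<theta> \<rho> (- \<kappa>') (dist_of P) \<le> ennreal K \<Longrightarrow> 0 \<le> K \<Longrightarrow>
      sob s A f \<Longrightarrow> sob s B g \<Longrightarrow> cmod (ip (\<lambda>x. cx P x * f x) g) \<le> Cd2 * K * A * B"
    by (rule duality_Cs[OF dp \<kappa>(3,4)], rule that)
  obtain Cm where Cm: "0 \<le> Cm" "\<And>A Y u. wiener s' A Y \<Longrightarrow> torus_test u \<Longrightarrow> Nf s (\<lambda>x. u x * Y x) \<le> Cm * A\<^sup>2 * Nf s u"
    by (rule Nf_mult_wiener[OF s(1,4,5)], rule that)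
  obtain Cg where Cg: "0 < Cg"
    "\<And>w. torus_test w \<Longrightarrow> tint w = 0 \<Longrightarrow> Nf s w \<le> Cg * sqrt (Gf a w)"
    "\<And>w. torus_test w \<Longrightarrow> tint w = 0 \<Longrightarrow> Nf s (\<lambda>x. (w x)\<^sup>2) \<le> Cg * Gf a w"
    by (rule good_term_bounds[OF s(1,2) a1], rule that)
  define \<mu> where "\<mu> = sqrt Cm * A"
  define L1 where "L1 = Cd1 * K"
  define L2 where "L2 = Cd2 * K"
  have \<mu>: "0 \<le> \<mu>" and L: "0 \<le> L1" "0 \<le> L2" using Cm Cd1 Cd2 AK by (simp_all add: \<mu>_def L1_def L2_def)
  \<comment> \<open>The sum of the coefficients of the seven terms, a common bound for the
    coefficients of 1, W1 and W2 after grouping.\<close>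
  define E where "E = 3 * \<mu>\<^sup>2 + 3 * \<mu> + \<mu> ^ 3 + 3 * L1 + 6 * L1 * \<mu> + 3 * L1 * \<mu>\<^sup>2 + 3 * L2"
  have E: "0 \<le> E" using \<mu> L by (simp add: E_def)
  \<comment> \<open>Young's weight: 3 comes from the square of a sum of three numbers, and the
    bracket bounds 1 + W1^2 + W2^2 by (1 + 2 Cg)(1 + G). Division by 4 H thus leaves (1 + G) /
    4.\<close>
  define H where "H = 3 * (1 + 2 * Cg)"
  have H: "0 < H" using Cg(1) by (simp add: H_def)
  \<comment> \<open>Chosen after E and H so that the dissipation inside Z^2 ends up with a
    coefficient of at most 1/2.\<close>
  define \<eta> where "\<eta> = 1 / (2 * (E\<^sup>2 * H + 1))"
  have EH: "0 \<le> E\<^sup>2 * H" using H by simp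
  have \<eta>: "0 < \<eta>" using EH by (simp add: \<eta>_def)
  have \<eta>E: "E\<^sup>2 * H * \<eta> \<le> 1 / 2" using EH by (simp add: \<eta>_def divide_simps)
  obtain Cz where Cz: "0 \<le> Cz" "\<And>w. torus_test w \<Longrightarrow> sob s (sqrt (\<eta> * Df a w + Cz * nsq (cx w))) (Bw a w)"
    by (rule sob_Bw[OF s(1,3) a \<eta>], rule that)
  \<comment> \<open>The coefficient of sqrt(G) that remains from the L2 part of Z^2; P sqrt(G) \<le>
    P^2 + G / 4 supplies the second quarter of the good term and the constant.\<close>
  define P where "P = E\<^sup>2 * H * Cz * Cg"
  have P: "0 \<le> P" using EH Cz Cg by (simp add: P_def)
  have main: "\<bar>Qf a (\<lambda>x. 3 * w x * (Y x)\<^sup>2 + 3 * (w x)\<^sup>2 * Y x + Y x ^ 3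
          + 3 * ((w x)\<^sup>2 + 2 * w x * Y x + (Y x)\<^sup>2) * X x + 3 * w x * X2 x) w\<bar>
       \<le> Df a w / 2 + Gf a w / 2 + (1 / 4 + P\<^sup>2)"
    if w: "torus_test w" "tint w = 0" and X: "trigpoly (cx X)" "Cs_norm \<theta> \<rho> (- \<kappa>) (dist_of X) \<le> ennreal K"
      and X2: "trigpoly (cx X2)" "Cs_norm \<theta> \<rho> (- \<kappa>') (dist_of X2) \<le> ennreal K" and Y: "wiener s' A Y" for w X X2 Y
  proof -
    have tY: "torus_test Y" using Y by (simp add: wiener_def)
    define z where "z = Bw a w"
    define Z where "Z = sqrt (\<eta> * Df a w + Cz * nsq (cx w))"
    have z: "sob s Z z" unfolding z_def Z_def by (rule Cz(2)[OF w(1)])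
    have cz: "cper z" and Z0: "0 \<le> Z" using z by (simp_all add: sob_def)
    define W1 where "W1 = sqrt (Nf s w)"
    define W2 where "W2 = sqrt (Nf s (\<lambda>x. (w x)\<^sup>2))"
    have W0: "0 \<le> W1" "0 \<le> W2"
      using Nf_nonneg[OF s(1) s1 w(1)] Nf_nonneg[OF s(1) s1 torus_test_power[OF w(1), of 2]] by (simp_all add: W1_def W2_def)
    have mult: "sqrt (Nf s (\<lambda>x. u x * Y x)) \<le> \<mu> * B" if u: "torus_test u" and B: "sqrt (Nf s u) \<le> B" for u B
    proof -
      have "sqrt (Nf s (\<lambda>x. u x * Y x)) \<le> sqrt (Cm * A\<^sup>2 * Nf s u)" by (intro real_sqrt_le_mono Cm(2) Y u)
      also have "\<dots> = \<mu> * sqrt (Nf s u)" using AK by (simp add: real_sqrt_mult \<mu>_def)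
      also have "\<dots> \<le> \<mu> * B" by (rule mult_left_mono[OF B \<mu>])
      finally show ?thesis .
    qed
    \<comment> \<open>Powers of \<open>Y\<close> are written as products starting from 1, so that
      repeated multiplication by \<open>Y\<close> bounds them from \<open>Nf_one\<close>, each
      factor costing \<mu>.\<close>
    let ?w2 = "\<lambda>x. (w x)\<^sup>2" and ?wY = "\<lambda>x. w x * Y x" and ?wYY = "\<lambda>x. w x * Y x * Y x" and ?w2Y = "\<lambda>x. (w x)\<^sup>2 * Y x"
      and ?Y1 = "\<lambda>x. 1 * Y x" and ?Y2 = "\<lambda>x. 1 * Y x * Y x" and ?Y3 = "\<lambda>x. 1 * Y x * Y x * Y x"
    have t: "torus_test ?w2" "torus_test ?wY" "torus_test ?wYY" "torus_test ?w2Y" "torus_test ?Y1" "torus_test ?Y2" "torus_test ?Y3"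
      by (intro torus_test_intros w(1) tY)+
    have n: "sqrt (Nf s w) \<le> W1" "sqrt (Nf s ?w2) \<le> W2" by (simp_all add: W1_def W2_def)
    have nwY: "sqrt (Nf s ?wY) \<le> \<mu> * W1" by (rule mult[OF w(1) n(1)])
    have nwYY: "sqrt (Nf s ?wYY) \<le> \<mu> * (\<mu> * W1)" by (rule mult[OF t(2) nwY])
    have nw2Y: "sqrt (Nf s ?w2Y) \<le> \<mu> * W2" by (rule mult[OF t(1) n(2)])
    have nY1: "sqrt (Nf s ?Y1) \<le> \<mu> * 1" by (rule mult[OF torus_test_const]) (simp add: Nf_one s(1) s1)
    have nY2: "sqrt (Nf s ?Y2) \<le> \<mu> * (\<mu> * 1)" by (rule mult[OF t(5) nY1])
    have nY3: "sqrt (Nf s ?Y3) \<le> \<mu> * (\<mu> * (\<mu> * 1))" by (rule mult[OF t(6) nY2])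
    have plain: "cmod (ip (cx u) z) \<le> B * Z" if u: "torus_test u" and B: "sqrt (Nf s u) \<le> B" for u B
      by (rule order_trans[OF ip_sob_bound[OF s(1) s1 u z] mult_right_mono[OF B Z0]])
    have dual1: "cmod (ip (\<lambda>x. cx X x * cx u x) z) \<le> L1 * B * Z" if u: "torus_test u" and B: "sqrt (Nf s u) \<le> B" for u B
    proof -
      have "cmod (ip (\<lambda>x. cx X x * cx u x) z) \<le> Cd1 * K * sqrt (Nf s u) * Z"
        by (rule Cd1(2)[OF X AK(2) sob_Nf[OF s(1) s1 u] z])
      also have "\<dots> \<le> L1 * B * Z" unfolding L1_def[symmetric] by (intro mult_right_mono mult_left_mono B L Z0)
      finally show ?thesis .
    qed
    have dual2: "cmod (ip (\<lambda>x. cx X2 x * cx u x) z) \<le> L2 * B * Z" if u: "torus_test u" and B: "sqrt (Nf s u) \<le> B" for u B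
    proof -
      have "cmod (ip (\<lambda>x. cx X2 x * cx u x) z) \<le> Cd2 * K * sqrt (Nf s u) * Z"
        by (rule Cd2(2)[OF X2 AK(2) sob_Nf[OF s(1) s1 u] z])
      also have "\<dots> \<le> L2 * B * Z" unfolding L2_def[symmetric] by (intro mult_right_mono mult_left_mono B L Z0)
      finally show ?thesis .
    qed
    define f1 f2 f3 g1 g2 g3 g4 where
      "f1 = cx ?wYY" and "f2 = cx ?w2Y" and "f3 = cx ?Y3" and
      "g1 = (\<lambda>x. cx X x * cx ?w2 x)" and "g2 = (\<lambda>x. cx X x * cx ?wY x)" and "g3 = (\<lambda>x. cx X x * cx ?Y2 x)" and
      "g4 = (\<lambda>x. cx X2 x * cx w x)"
    have cX: "cper (cx X)" "cper (cx X2)" by (rule trigpoly_cper[OF X(1)], rule trigpoly_cper[OF X2(1)])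
    have c: "cper f1" "cper f2" "cper f3" "cper g1" "cper g2" "cper g3" "cper g4"
      unfolding f1_def f2_def f3_def g1_def g2_def g3_def g4_def
      by (intro torus_test_cper t cper_mult cX w(1))+
    let ?F = "\<lambda>x. 3 * w x * (Y x)\<^sup>2 + 3 * (w x)\<^sup>2 * Y x + Y x ^ 3
          + 3 * ((w x)\<^sup>2 + 2 * w x * Y x + (Y x)\<^sup>2) * X x + 3 * w x * X2 x"
    have F: "cx ?F = (\<lambda>x. 3 * f1 x + (3 * f2 x + (f3 x + (3 * g1 x + (6 * g2 x + (3 * g3 x + 3 * g4 x))))))"
      unfolding f1_def f2_def f3_def g1_def g2_def g3_def g4_def
      by (rule ext) (simp add: power2_eq_square power3_eq_cube algebra_simps)
    have ct: "cper (\<lambda>x. 3 * f1 x)" "cper (\<lambda>x. 3 * f2 x)" "cper (\<lambda>x. 3 * g1 x)" "cper (\<lambda>x. 6 * g2 x)" "cper (\<lambda>x. 3 * g3 x)" "cper (\<lambda>x. 3 * g4 x)"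
      by (intro cper_mult cper_const c)+
    note c6 = cper_add[OF ct(5,6)]
    note c5 = cper_add[OF ct(4) c6]
    note c4 = cper_add[OF ct(3) c5]
    note c3 = cper_add[OF c(3) c4]
    note c2 = cper_add[OF ct(2) c3]
    have cF: "cper (cx ?F)" unfolding F by (rule cper_add[OF ct(1) c2])
    have ipF: "ip (cx ?F) z = 3 * ip f1 z + (3 * ip f2 z + (ip f3 z + (3 * ip g1 z + (6 * ip g2 z + (3 * ip g3 z + 3 * ip g4 z)))))"
      unfolding F ip_add_left[OF ct(1) c2 cz] ip_add_left[OF ct(2) c3 cz] ip_add_left[OF c(3) c4 cz]
        ip_add_left[OF ct(3) c5 cz] ip_add_left[OF ct(4) c6 cz] ip_add_left[OF ct(5,6) cz] ip_cmult_left ..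
    have tri: "cmod (3 * x1 + (3 * x2 + (x3 + (3 * y1 + (6 * y2 + (3 * y3 + 3 * y4)))))) \<le>
        3 * cmod x1 + (3 * cmod x2 + (cmod x3 + (3 * cmod y1 + (6 * cmod y2 + (3 * cmod y3 + 3 * cmod y4)))))" for x1 x2 x3 y1 y2 y3 y4
      by (intro order_trans[OF norm_triangle_ineq] add_mono) (simp_all add: norm_mult)
    have "cmod (ip (cx ?F) z) \<le> 3 * cmod (ip f1 z) + (3 * cmod (ip f2 z) + (cmod (ip f3 z) + (3 * cmod (ip g1 z) + (6 * cmod (ip g2 z) + (3 * cmod (ip g3 z) + 3 * cmod (ip g4 z))))))"
      unfolding ipF by (rule tri)
    also have "\<dots> \<le> 3 * (\<mu> * (\<mu> * W1) * Z) + (3 * (\<mu> * W2 * Z) + (\<mu> * (\<mu> * (\<mu> * 1)) * Z + (3 * (L1 * W2 * Z) + (6 * (L1 * (\<mu> * W1) * Z) + (3 * (L1 * (\<mu> * (\<mu> * 1)) * Z) + 3 * (L2 * W1 * Z))))))"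
      unfolding f1_def f2_def f3_def g1_def g2_def g3_def g4_def
      by (intro add_mono mult_left_mono plain dual1 dual2 t w(1) n nwY nwYY nw2Y nY2 nY3) simp_all
    also have "\<dots> = ((3 * \<mu>\<^sup>2 + 6 * L1 * \<mu> + 3 * L2) * W1 + (3 * \<mu> + 3 * L1) * W2 + (\<mu> ^ 3 + 3 * L1 * \<mu>\<^sup>2)) * Z"
      by (simp add: power2_eq_square power3_eq_cube algebra_simps)
    also have "\<dots> \<le> (E * W1 + E * W2 + E * 1) * Z"
    proof (rule mult_right_mono[OF _ Z0])
      have "3 * \<mu>\<^sup>2 + 6 * L1 * \<mu> + 3 * L2 \<le> E" "3 * \<mu> + 3 * L1 \<le> E" "\<mu> ^ 3 + 3 * L1 * \<mu>\<^sup>2 \<le> E * 1"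
        using \<mu> L by (simp_all add: E_def)
      then show "(3 * \<mu>\<^sup>2 + 6 * L1 * \<mu> + 3 * L2) * W1 + (3 * \<mu> + 3 * L1) * W2 + (\<mu> ^ 3 + 3 * L1 * \<mu>\<^sup>2) \<le> E * W1 + E * W2 + E * 1"
        by (intro add_mono mult_right_mono W0)
    qed
    also have "\<dots> = (1 + W1 + W2) * (E * Z)" by (simp add: algebra_simps)
    also have "\<dots> \<le> (1 + W1 + W2)\<^sup>2 / (4 * H) + H * (E * Z)\<^sup>2"
    proof -
      have "x\<^sup>2 / (4 * H) + H * y\<^sup>2 - x * y = (x - 2 * H * y)\<^sup>2 / (4 * H)" for x y
        using H by (simp add: field_simps power2_eq_square)
      moreover have "0 \<le> (x - 2 * H * y)\<^sup>2 / (4 * H)" for x y using H by simp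
      ultimately have "0 \<le> x\<^sup>2 / (4 * H) + H * y\<^sup>2 - x * y" for x y by simp
      then show ?thesis by (simp only: diff_ge_0_iff_ge)
    qed
    finally have b1: "cmod (ip (cx ?F) z) \<le> (1 + W1 + W2)\<^sup>2 / (4 * H) + H * (E * Z)\<^sup>2" .
    define G where "G = Gf a w"
    define D where "D = Df a w"
    have G0: "0 \<le> G" unfolding G_def by (rule Gf_nonneg[OF a a1 w(1)])
    have D0: "0 \<le> D" unfolding D_def by (rule Df_nonneg[OF a a1 w(1)])
    have sG: "sqrt G \<le> 1 + G"
      using G0 by (intro real_le_lsqrt) (auto simp: power2_eq_square algebra_simps)
    have W1sq: "W1\<^sup>2 \<le> Cg * sqrt G"
      using Cg(2)[OF w] Nf_nonneg[OF s(1) s1 w(1)] by (simp add: W1_def G_def)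
    have W2sq: "W2\<^sup>2 \<le> Cg * G"
      using Cg(3)[OF w] Nf_nonneg[OF s(1) s1 t(1)] by (simp add: W2_def G_def)
    have "(1 + W1 + W2)\<^sup>2 \<le> 3 * (1 + W1\<^sup>2 + W2\<^sup>2)"
    proof -
      have "3 * (1 + W1\<^sup>2 + W2\<^sup>2) - (1 + W1 + W2)\<^sup>2 = (1 - W1)\<^sup>2 + (1 - W2)\<^sup>2 + (W1 - W2)\<^sup>2"
        by (simp add: power2_eq_square algebra_simps)
      moreover have "0 \<le> (1 - W1)\<^sup>2 + (1 - W2)\<^sup>2 + (W1 - W2)\<^sup>2" by simp
      ultimately show ?thesis by linarith
    qed
    also have "\<dots> \<le> 3 * (1 + Cg * (1 + G) + Cg * G)"
    proof -
      have "Cg * sqrt G \<le> Cg * (1 + G)" using Cg(1) by (intro mult_left_mono sG) auto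
      then have "W1\<^sup>2 \<le> Cg * (1 + G)" using W1sq by linarith
      then show ?thesis using W2sq by (intro mult_left_mono add_mono) auto
    qed
    also have "\<dots> \<le> H * (1 + G)" using Cg(1) G0 by (simp add: H_def algebra_simps)
    finally have "(1 + W1 + W2)\<^sup>2 / (4 * H) \<le> H * (1 + G) / (4 * H)" using H by (intro divide_right_mono) auto
    then have b2: "(1 + W1 + W2)\<^sup>2 / (4 * H) \<le> (1 + G) / 4" using H by simp
    have nw: "nsq (cx w) \<le> Cg * sqrt G"
      using Cg(2)[OF w] Qf_self_nonneg[OF s(1) s1 w(1)] by (simp add: Nf_def G_def)
    have Zsq: "Z\<^sup>2 = \<eta> * D + Cz * nsq (cx w)"
      unfolding Z_def D_def[symmetric] using \<eta> D0 Cz(1) by (intro real_sqrt_pow2) simp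
    have "H * (E * Z)\<^sup>2 = (E\<^sup>2 * H * \<eta>) * D + (E\<^sup>2 * H * Cz) * nsq (cx w)"
      unfolding power_mult_distrib Zsq by (simp add: algebra_simps)
    also have "\<dots> \<le> 1 / 2 * D + (E\<^sup>2 * H * Cz) * (Cg * sqrt G)"
      using EH Cz(1) by (intro add_mono mult_right_mono mult_left_mono \<eta>E D0 nw) auto
    also have "(E\<^sup>2 * H * Cz) * (Cg * sqrt G) = P * sqrt G" by (simp add: P_def)
    also have "P * sqrt G \<le> P\<^sup>2 + G / 4"
    proof -
      have "0 \<le> (P - sqrt G / 2)\<^sup>2" by simp
      also have "(P - sqrt G / 2)\<^sup>2 = P\<^sup>2 + (sqrt G)\<^sup>2 / 4 - P * sqrt G" by (simp add: power2_eq_square algebra_simps)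
      finally show ?thesis using G0 by simp
    qed
    finally have b3: "H * (E * Z)\<^sup>2 \<le> 1 / 2 * D + (P\<^sup>2 + G / 4)" by simp
    have "\<bar>Qf a ?F w\<bar> \<le> cmod (ip (cx ?F) z)"
      unfolding Qf_Bw[OF a a1 cF w(1)] z_def by (rule abs_Re_le_cmod)
    also have "\<dots> \<le> (1 + G) / 4 + (1 / 2 * D + (P\<^sup>2 + G / 4))" using b1 b2 b3 by linarith
    also have "\<dots> = Df a w / 2 + Gf a w / 2 + (1 / 4 + P\<^sup>2)" by (simp add: G_def D_def field_simps)
    finally show ?thesis .
  qed
  have "0 \<le> 1 / 4 + P\<^sup>2" by simp
  then show thesis using main by (rule that)
qed

section \<open>The regularised stochastic objects\<close>

definition bandlimited :: "real \<Rightarrow> (real^2 \<Rightarrow> complex) \<Rightarrow> bool" where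
  "bandlimited R f \<longleftrightarrow> cper f \<and> (\<forall>k. R < nk k \<longrightarrow> fc f k = 0)"

lemma bandlimited_eq:
  assumes f: "bandlimited R f" and S: "finite S" "\<And>k. nk k \<le> R \<Longrightarrow> k \<in> S"
  shows "f = (\<lambda>x. \<Sum>k\<in>S. fc f k * echar k x)"
proof (rule fc_inject)
  show "cper f" using f by (simp add: bandlimited_def)
  show "cper (\<lambda>x. \<Sum>k\<in>S. fc f k * echar k x)" by (intro cper_sum cper_mult cper_const cper_echar)
  show "fc f k = fc (\<lambda>x. \<Sum>k\<in>S. fc f k * echar k x) k" for k
  proof (cases "k \<in> S")
    case False
    then have "R < nk k" using S(2)[of k] by linarith
    then show ?thesis using f False by (simp add: fc_trig[OF S(1)] bandlimited_def)
  qed (simp add: fc_trig[OF S(1)])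
qed

lemma finite_nk_le': "finite {k. nk k \<le> R}"
  by (rule finite_subset[OF _ finite_nk_less[of "R + 1"]]) auto

lemma bandlimited_trigpoly: "bandlimited R f \<Longrightarrow> trigpoly f"
  unfolding trigpoly_def using bandlimited_eq[OF _ finite_nk_le'[of R]] finite_nk_le'[of R] by blast

lemma bandlimited_trig:
  assumes "finite S" "\<And>k. k \<in> S \<Longrightarrow> nk k \<le> R"
  shows "bandlimited R (\<lambda>x. \<Sum>k\<in>S. c k * echar k x)"
  unfolding bandlimited_def
proof (intro conjI allI impI)
  show "cper (\<lambda>x. \<Sum>k\<in>S. c k * echar k x)" by (intro cper_sum cper_mult cper_const cper_echar)
  fix k assume "R < nk k"
  then have "k \<notin> S" using assms(2)[of k] by auto
  then show "fc (\<lambda>x. \<Sum>k\<in>S. c k * echar k x) k = 0" using assms(1) by (simp add: fc_trig)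
qed

lemma bandlimited_sum:
  assumes "\<And>i. i \<in> I \<Longrightarrow> bandlimited R (f i)"
  shows "bandlimited R (\<lambda>x. \<Sum>i\<in>I. f i x)"
  using assms by (simp add: bandlimited_def fc_sum cper_sum)

lemma bandlimited_add: "bandlimited R f \<Longrightarrow> bandlimited R g \<Longrightarrow> bandlimited R (\<lambda>x. f x + g x)"
  by (simp add: bandlimited_def fc_add cper_add)

lemma bandlimited_diff: "bandlimited R f \<Longrightarrow> bandlimited R g \<Longrightarrow> bandlimited R (\<lambda>x. f x - g x)"
  by (simp add: bandlimited_def fc_diff cper_diff)

lemma bandlimited_cmult: "bandlimited R f \<Longrightarrow> bandlimited R (\<lambda>x. c * f x)"
  by (simp add: bandlimited_def fc_cmult cper_mult cper_const)

lemma bandlimited_mult: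
  assumes f: "bandlimited R f" and g: "bandlimited R' g"
  shows "bandlimited (R + R') (\<lambda>x. f x * g x)"
proof -
  let ?S = "{k. nk k \<le> R}" and ?S' = "{k. nk k \<le> R'}"
  have "(\<lambda>x. f x * g x) = (\<lambda>x. \<Sum>p\<in>?S \<times> ?S'. fc f (fst p) * fc g (snd p) * echar (fst p + snd p) x)"
  proof
    fix x
    have "f x = (\<Sum>k\<in>?S. fc f k * echar k x)" "g x = (\<Sum>k\<in>?S'. fc g k * echar k x)"
      using bandlimited_eq[OF f finite_nk_le'] bandlimited_eq[OF g finite_nk_le'] by (metis (no_types, lifting) mem_Collect_eq)+
    then have "f x * g x = (\<Sum>k\<in>?S. \<Sum>l\<in>?S'. (fc f k * echar k x) * (fc g l * echar l x))"
      by (simp only: sum_product)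
    then show "f x * g x = (\<Sum>p\<in>?S \<times> ?S'. fc f (fst p) * fc g (snd p) * echar (fst p + snd p) x)"
      by (simp add: sum.cartesian_product case_prod_unfold echar_add_freq mult_ac)
  qed
  moreover have "bandlimited (R + R') (\<lambda>x. \<Sum>p\<in>?S \<times> ?S'. fc f (fst p) * fc g (snd p) * echar (fst p + snd p) x)"
  proof (rule bandlimited_sum)
    fix p assume p: "p \<in> ?S \<times> ?S'"
    have "nk (fst p + snd p) \<le> R + R'" using nk_triangle[of "fst p" "snd p"] p by auto
    then show "bandlimited (R + R') (\<lambda>x. fc f (fst p) * fc g (snd p) * echar (fst p + snd p) x)"
      using bandlimited_trig[of "{fst p + snd p}" "R + R'" "\<lambda>_. fc f (fst p) * fc g (snd p)"] by simp
  qed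
  ultimately show ?thesis by (simp only:)
qed

lemma bandlimited_Re:
  assumes f: "bandlimited R f"
  shows "bandlimited R (cx (\<lambda>x. Re (f x)))"
proof -
  have cf: "cper f" and 0: "\<And>k. R < nk k \<Longrightarrow> fc f k = 0" using f by (simp_all add: bandlimited_def)
  have "bandlimited R (\<lambda>x. cnj (f x))" unfolding bandlimited_def fc_cnj using cf 0 by (simp add: cper_cnj)
  then have "bandlimited R (\<lambda>x. (1/2) * f x + (1/2) * cnj (f x))"
    by (intro bandlimited_add bandlimited_cmult f)
  moreover have "cx (\<lambda>x. Re (f x)) = (\<lambda>x. (1/2) * f x + (1/2) * cnj (f x))"
    by (rule ext) (simp add: complex_eq_iff)
  ultimately show ?thesis by (simp only:)
qed

lemma high_cutoff_facts:
  assumes h: "high_cutoff h" and n: "1 \<le> (n::nat)"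
  shows "{k. 1 - h (norm (freq k) / real n) \<noteq> 0} \<subseteq> {k. nk k \<le> real n}"
proof
  fix k assume k: "k \<in> {k. 1 - h (norm (freq k) / real n) \<noteq> 0}"
  have "\<forall>r\<ge>1. h r = 1" using h by (simp add: high_cutoff_def)
  then have "\<not> 1 \<le> norm (freq k) / real n" using k by auto
  then show "k \<in> {k. nk k \<le> real n}" using n by (simp add: nk_def divide_simps)
qed

lemma bandlimited_Xn:
  assumes h: "high_cutoff h" and n: "1 \<le> n"
  shows "bandlimited (real n) (cx (Xn h X n \<omega> t))"
proof -
  let ?s = "\<lambda>k. 1 - h (norm (freq k) / real n)"
  have S: "finite {k. ?s k \<noteq> 0}" by (rule finite_subset[OF high_cutoff_facts[OF h n] finite_nk_le'])
  show ?thesis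
    unfolding Xn_def[abs_def] low_pass_def fmult_finite[OF S]
    by (intro bandlimited_Re bandlimited_trig S) (use high_cutoff_facts[OF h n] in auto)
qed

text \<open>A band-limited family is a fixed finite combination of smooth functions, so all spatial
  regularity follows from continuity in time of its coefficients.\<close>

lemma Ck_space_bandlimited:
  assumes u: "\<And>t. t \<in> I \<Longrightarrow> bandlimited R (cx (u t))"
    and c: "\<And>k. continuous_on I (\<lambda>t. fc (cx (u t)) k)"
  shows "Ck_space m I u"
proof -
  let ?S = "{k. nk k \<le> R}"
  have eq: "u t x = (\<Sum>k\<in>?S. Re (fc (cx (u t)) k) * cos (2 * pi * (freq k \<bullet> x)) + (- Im (fc (cx (u t)) k)) * sin (2 * pi * (freq k \<bullet> x)))" if "t \<in> I" for t x
  proof -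
    have "cx (u t) x = (\<Sum>k\<in>?S. fc (cx (u t)) k * echar k x)"
      using bandlimited_eq[OF u[OF that] finite_nk_le'] by (metis (no_types, lifting) mem_Collect_eq)
    then have "u t x = Re (\<Sum>k\<in>?S. fc (cx (u t)) k * echar k x)" by (metis Re_complex_of_real)
    then show ?thesis by (simp add: echar_def)
  qed
  have "Ck_space m I (\<lambda>t x. \<Sum>k\<in>?S. Re (fc (cx (u t)) k) * cos (2 * pi * (freq k \<bullet> x)) + (- Im (fc (cx (u t)) k)) * sin (2 * pi * (freq k \<bullet> x)))"
    by (intro Ck_space_sum Ck_space_trig continuous_intros c)
  then show ?thesis using Ck_space_cong[of I u] eq by (metis (no_types, lifting) ext)
qed

text \<open>Since the symbols sum to 1 at \<open>k\<close>, some block has a nonzero symbol there,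
  and its supremum bounds the coefficient. The constant may depend on \<open>k\<close>: the lemma
  only serves continuity of single coefficients.\<close>

lemma Cs_norm_fourier:
  assumes dp: "dyadic_partition \<theta> \<rho>"
  obtains C where "0 \<le> C"
    "\<And>d K. \<forall>k. fourier d (- k) = cnj (fourier d k) \<Longrightarrow> Cs_norm \<theta> \<rho> s d \<le> ennreal K \<Longrightarrow> 0 \<le> K \<Longrightarrow> cmod (fourier d k) \<le> C * K"
proof -
  obtain a b where ab: "0 < a" "1 \<le> b" and
    L: "\<And>m k. 0 \<le> LP_symbol \<theta> \<rho> m k" "\<And>m k. LP_symbol \<theta> \<rho> m (- k) = LP_symbol \<theta> \<rho> m k"
    "\<And>k. (\<lambda>m. LP_symbol \<theta> \<rho> m k) sums 1"
    "\<And>k. LP_symbol \<theta> \<rho> 0 k \<noteq> 0 \<Longrightarrow> nk k \<le> b"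
    "\<And>j k. LP_symbol \<theta> \<rho> (Suc j) k \<noteq> 0 \<Longrightarrow> a * 2 ^ j \<le> nk k \<and> nk k \<le> b * 2 ^ j"
    "\<And>m. finite {k. LP_symbol \<theta> \<rho> m k \<noteq> 0}"
    by (rule LP_symbol_facts[OF dp], rule that)
  have "\<exists>m. LP_symbol \<theta> \<rho> m k \<noteq> 0"
  proof (rule ccontr)
    assume "\<nexists>m. LP_symbol \<theta> \<rho> m k \<noteq> 0"
    then have "(\<lambda>m. LP_symbol \<theta> \<rho> m k) = (\<lambda>m. 0)" by auto
    then have "(\<lambda>m::nat. 0) sums (1::real)" using L(3)[of k] by simp
    from sums_unique2[OF this sums_zero] show False by simp
  qed
  then obtain m where m: "LP_symbol \<theta> \<rho> m k \<noteq> 0" ..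
  then have m0: "0 < LP_symbol \<theta> \<rho> m k" using L(1)[of m k] by simp
  define C where "C = 2 powr (- s * (real m - 1)) / LP_symbol \<theta> \<rho> m k"
  show thesis
  proof (rule that)
    show "0 \<le> C" using m0 by (simp add: C_def)
    fix d K assume d: "\<forall>k. fourier d (- k) = cnj (fourier d k)" and K: "Cs_norm \<theta> \<rho> s d \<le> ennreal K" "0 \<le> K"
    let ?D = "cx (fmult (LP_symbol \<theta> \<rho> m) d)"
    have "LP_symbol \<theta> \<rho> m k * cmod (fourier d k) = cmod (fc ?D k)"
      unfolding fc_fmult[OF L(6) L(2) d[rule_format]] using m0 by (simp add: norm_mult)
    also have "\<dots> \<le> K * 2 powr (- s * (real m - 1))"
      by (rule norm_fc_le[OF trigpoly_cper[OF trigpoly_fmult[OF L(6)]]]) (use Cs_norm_block[OF K, of m] in simp)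
    finally show "cmod (fourier d k) \<le> C * K" using m0 by (simp add: C_def field_simps)
  qed
qed

lemma fourier_diff: "fourier (\<lambda>\<phi>. u \<phi> - v \<phi>) k = fourier u k - fourier v k"
  by (simp add: fourier_def complex_eq_iff)

text \<open>\<open>CtCs_norm\<close> is infinite unless the path is continuous in the Besov norm, so
  its finiteness contains continuity in time, which passes to each Fourier coefficient.\<close>

lemma CtCs_norm_continuous:
  assumes dp: "dyadic_partition \<theta> \<rho>" and fin: "CtCs_norm \<theta> \<rho> T s (\<lambda>r. dist_of (u r)) < \<infinity>"
    and u: "\<And>t. t \<in> {0..T} \<Longrightarrow> cper (cx (u t))"
  shows "continuous_on {0..T} (\<lambda>t. fc (cx (u t)) k)"
  unfolding continuous_on_def
proof
  fix r assume r: "r \<in> {0..T}"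
  have lim: "((\<lambda>q. Cs_norm \<theta> \<rho> s (\<lambda>\<phi>. dist_of (u q) \<phi> - dist_of (u r) \<phi>)) \<longlongrightarrow> 0) (at r within {0..T})"
    using fin r unfolding CtCs_norm_def by (auto split: if_splits)
  obtain C where C: "0 \<le> C"
    "\<And>d K. \<forall>k. fourier d (- k) = cnj (fourier d k) \<Longrightarrow> Cs_norm \<theta> \<rho> s d \<le> ennreal K \<Longrightarrow> 0 \<le> K \<Longrightarrow> cmod (fourier d k) \<le> C * K"
    by (rule Cs_norm_fourier[OF dp, where s=s and k=k], rule that)
  show "((\<lambda>t. fc (cx (u t)) k) \<longlongrightarrow> fc (cx (u r)) k) (at r within {0..T})"
  proof (rule tendstoI)
    fix e :: real assume e: "0 < e"
    define K where "K = e / (2 * (C + 1))"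
    have K: "0 < K" using e C(1) by (simp add: K_def)
    have "\<forall>\<^sub>F q in at r within {0..T}. Cs_norm \<theta> \<rho> s (\<lambda>\<phi>. dist_of (u q) \<phi> - dist_of (u r) \<phi>) < ennreal K"
      by (rule order_tendstoD(2)[OF lim]) (use K in simp)
    moreover have "\<forall>\<^sub>F q in at r within {0..T}. q \<in> {0..T}" by (simp add: eventually_at_filter)
    ultimately show "\<forall>\<^sub>F q in at r within {0..T}. dist (fc (cx (u q)) k) (fc (cx (u r)) k) < e"
    proof eventually_elim
      case (elim q)
      have f: "fourier (\<lambda>\<phi>. dist_of (u q) \<phi> - dist_of (u r) \<phi>) k = fc (cx (u q)) k - fc (cx (u r)) k" for k
        unfolding fourier_diff fourier_dist_of[OF u[OF elim(2)]] fourier_dist_of[OF u[OF r]] ..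
      have "cmod (fourier (\<lambda>\<phi>. dist_of (u q) \<phi> - dist_of (u r) \<phi>) k) \<le> C * K"
      proof (rule C(2))
        show "\<forall>k. fourier (\<lambda>\<phi>. dist_of (u q) \<phi> - dist_of (u r) \<phi>) (- k) = cnj (fourier (\<lambda>\<phi>. dist_of (u q) \<phi> - dist_of (u r) \<phi>) k)"
          unfolding f complex_cnj_diff using fc_cx_uminus[of "u q"] fc_cx_uminus[of "u r"] by simp
        show "Cs_norm \<theta> \<rho> s (\<lambda>\<phi>. dist_of (u q) \<phi> - dist_of (u r) \<phi>) \<le> ennreal K" using elim(1) by (rule less_imp_le)
      qed (use K in simp)
      also have "C * K < e"
      proof -
        have "C * K \<le> (C + 1) * K" using K by (intro mult_right_mono) auto
        also have "\<dots> = e / 2" using C(1) by (simp add: K_def field_simps)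
        also have "\<dots> < e" using e by simp
        finally show ?thesis .
      qed
      finally show ?case unfolding f dist_norm .
    qed
  qed
qed

section \<open>Second moments and the Wick square\<close>

lemma gaussian_rv_square_integrable:
  assumes "prob_space M" and Z: "gaussian_rv M Z"
  shows "integrable M (\<lambda>\<omega>. (Z \<omega>)\<^sup>2)"
proof -
  interpret prob_space M by fact
  have meas[measurable]: "Z \<in> borel_measurable M" using Z by (simp add: gaussian_rv_def)
  consider c where "AE \<omega> in M. Z \<omega> = c" | \<mu> \<sigma> where "0 < \<sigma>" "distributed M lborel Z (\<lambda>x. ennreal (normal_density \<mu> \<sigma> x))"
    using Z unfolding gaussian_rv_def by blast
  then show ?thesis
  proof cases
    case 1
    have "integrable M (\<lambda>\<omega>. c\<^sup>2)" by simp
    then show ?thesis by (rule Bochner_Integration.integrable_cong_AE[THEN iffD1, rotated -1]) (use 1 in auto)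
  next
    case 2
    have "integrable lborel (\<lambda>x. normal_density \<mu> \<sigma> x * (x - \<mu>) ^ 2 + (2 * \<mu>) * (normal_density \<mu> \<sigma> x * (x - \<mu>) ^ 1) + \<mu>\<^sup>2 * (normal_density \<mu> \<sigma> x * (x - \<mu>) ^ 0))"
      by (intro Bochner_Integration.integrable_add integrable_mult_right integrable_normal_moment 2)
    also have "(\<lambda>x. normal_density \<mu> \<sigma> x * (x - \<mu>) ^ 2 + (2 * \<mu>) * (normal_density \<mu> \<sigma> x * (x - \<mu>) ^ 1) + \<mu>\<^sup>2 * (normal_density \<mu> \<sigma> x * (x - \<mu>) ^ 0)) = (\<lambda>x. normal_density \<mu> \<sigma> x * x\<^sup>2)"
      by (rule ext) (simp add: power2_eq_square algebra_simps)
    finally have "integrable lborel (\<lambda>x. normal_density \<mu> \<sigma> x * x\<^sup>2)" .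
    then show ?thesis
      using distributed_integrable[OF 2(2), of "\<lambda>x. x\<^sup>2"] by simp
  qed
qed

text \<open>One approximant at squared L2 distance below 1 suffices: it is Gaussian, hence square
  integrable, and Z^2 \<le> 2 S^2 + 2 (S - Z)^2.\<close>

lemma square_integrable_wiener_integral:
  assumes ps: "prob_space M" and wn: "white_noise M \<xi>" and W: "wiener_integral M \<xi> f Z"
  shows "Z \<in> borel_measurable M" "integrable M (\<lambda>\<omega>. (Z \<omega>)\<^sup>2)"
proof -
  show Zm[measurable]: "Z \<in> borel_measurable M" using W by (simp add: wiener_integral_def)
  obtain \<phi> where \<phi>: "\<And>m i. st_test (\<phi> m i)"
    "(\<lambda>m. \<integral>\<^sup>+\<omega>. ennreal (((\<Sum>i\<in>UNIV. \<xi> i \<omega> (\<phi> m i)) - Z \<omega>)\<^sup>2) \<partial>M) \<longlonglongrightarrow> 0"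
    using W unfolding wiener_integral_def by blast
  have "\<forall>\<^sub>F m in sequentially. (\<integral>\<^sup>+\<omega>. ennreal (((\<Sum>i\<in>UNIV. \<xi> i \<omega> (\<phi> m i)) - Z \<omega>)\<^sup>2) \<partial>M) < 1"
    by (rule order_tendstoD(2)[OF \<phi>(2)]) simp
  then obtain m where m: "(\<integral>\<^sup>+\<omega>. ennreal (((\<Sum>i\<in>UNIV. \<xi> i \<omega> (\<phi> m i)) - Z \<omega>)\<^sup>2) \<partial>M) < 1"
    unfolding eventually_sequentially by blast
  define S where "S \<omega> = (\<Sum>i\<in>UNIV. \<xi> i \<omega> (\<phi> m i))" for \<omega>
  have gf: "gaussian_family M (UNIV \<times> Collect st_test) (\<lambda>(i, \<phi>) \<omega>. \<xi> i \<omega> \<phi>)" using wn by (simp add: white_noise_def)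
  have "gaussian_rv M (\<lambda>\<omega>. \<Sum>j\<in>(\<lambda>i. (i, \<phi> m i)) ` UNIV. 1 * (\<lambda>(i, \<phi>) \<omega>. \<xi> i \<omega> \<phi>) j \<omega>)"
    by (rule gf[unfolded gaussian_family_def, rule_format, where c="\<lambda>_. 1"]) (auto simp: \<phi>(1))
  also have "(\<lambda>\<omega>. \<Sum>j\<in>(\<lambda>i. (i, \<phi> m i)) ` UNIV. 1 * (\<lambda>(i, \<phi>) \<omega>. \<xi> i \<omega> \<phi>) j \<omega>) = S"
    by (rule ext, subst sum.reindex) (auto simp: inj_on_def S_def)
  finally have gS: "gaussian_rv M S" .
  have Sm[measurable]: "S \<in> borel_measurable M" using gS by (simp add: gaussian_rv_def)
  have S2: "integrable M (\<lambda>\<omega>. (S \<omega>)\<^sup>2)" by (rule gaussian_rv_square_integrable[OF ps gS])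
  have D2: "integrable M (\<lambda>\<omega>. (S \<omega> - Z \<omega>)\<^sup>2)"
  proof (rule integrableI_bounded)
    have "(\<integral>\<^sup>+\<omega>. ennreal (norm ((S \<omega> - Z \<omega>)\<^sup>2)) \<partial>M) < 1" using m by (simp add: S_def)
    also have "(1::ennreal) < \<infinity>" by simp
    finally show "(\<integral>\<^sup>+\<omega>. ennreal (norm ((S \<omega> - Z \<omega>)\<^sup>2)) \<partial>M) < \<infinity>" .
  qed measurable
  show "integrable M (\<lambda>\<omega>. (Z \<omega>)\<^sup>2)"
  proof (rule Bochner_Integration.integrable_bound)
    show "integrable M (\<lambda>\<omega>. 2 * (S \<omega>)\<^sup>2 + 2 * (S \<omega> - Z \<omega>)\<^sup>2)" using S2 D2 by simp
    have "(Z \<omega>)\<^sup>2 \<le> 2 * (S \<omega>)\<^sup>2 + 2 * (S \<omega> - Z \<omega>)\<^sup>2" for \<omega>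
    proof -
      have "2 * (S \<omega>)\<^sup>2 + 2 * (S \<omega> - Z \<omega>)\<^sup>2 - (Z \<omega>)\<^sup>2 = (2 * S \<omega> - Z \<omega>)\<^sup>2" by (simp add: power2_eq_square algebra_simps)
      then show ?thesis using zero_le_power2[of "2 * S \<omega> - Z \<omega>"] by linarith
    qed
    then show "AE \<omega> in M. norm ((Z \<omega>)\<^sup>2) \<le> norm (2 * (S \<omega>)\<^sup>2 + 2 * (S \<omega> - Z \<omega>)\<^sup>2)" by (intro AE_I2) simp
  qed measurable
qed

lemma square_integrable_mult:
  fixes f g :: "'w \<Rightarrow> real"
  assumes [measurable]: "f \<in> borel_measurable M" "g \<in> borel_measurable M"
    and i: "integrable M (\<lambda>\<omega>. (f \<omega>)\<^sup>2)" "integrable M (\<lambda>\<omega>. (g \<omega>)\<^sup>2)"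
  shows "integrable M (\<lambda>\<omega>. f \<omega> * g \<omega>)"
proof (rule Bochner_Integration.integrable_bound)
  show "integrable M (\<lambda>\<omega>. (f \<omega>)\<^sup>2 + (g \<omega>)\<^sup>2)" using i by simp
  have "\<bar>f \<omega> * g \<omega>\<bar> \<le> (f \<omega>)\<^sup>2 + (g \<omega>)\<^sup>2" for \<omega>
  proof -
    have "2 * (\<bar>f \<omega>\<bar> * \<bar>g \<omega>\<bar>) \<le> (f \<omega>)\<^sup>2 + (g \<omega>)\<^sup>2"
      using sum_squares_bound[of "\<bar>f \<omega>\<bar>" "\<bar>g \<omega>\<bar>"] by (simp add: mult.assoc)
    moreover have "0 \<le> \<bar>f \<omega>\<bar> * \<bar>g \<omega>\<bar>" by simp
    ultimately show ?thesis unfolding abs_mult by linarith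
  qed
  then show "AE \<omega> in M. norm (f \<omega> * g \<omega>) \<le> norm ((f \<omega>)\<^sup>2 + (g \<omega>)\<^sup>2)" by (intro AE_I2) simp
qed measurable

text \<open>The expectation in the definition of the Wick square is itself a trigonometric polynomial in
  \<open>x\<close>, because the Fourier coefficients of the stochastic convolution are square integrable.\<close>

lemma bandlimited_Xn_wick2:
  assumes ps: "prob_space M" and wn: "white_noise M \<xi>" and h: "high_cutoff h" and n: "1 \<le> n"
    and X: "stochastic_convolution M \<xi> X" and t: "0 \<le> t"
  shows "bandlimited (2 * real n) (cx (Xn_wick2 M h X n \<omega> t))"
proof -
  let ?s = "\<lambda>k. 1 - h (norm (freq k) / real n)"
  \<comment> \<open>Each frequency is split into a cosine and a sine, so that the regularised field
    is a finite combination of real random variables with deterministic coefficients.\<close>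
  define S where "S = {k. ?s k \<noteq> 0} \<times> {True, False}"
  have S0: "finite {k. ?s k \<noteq> 0}" by (rule finite_subset[OF high_cutoff_facts[OF h n] finite_nk_le'])
  define b where "b p x = (if snd p then cos (2 * pi * (freq (fst p) \<bullet> x)) else sin (2 * pi * (freq (fst p) \<bullet> x)))" for p :: "(int^2) \<times> bool" and x
  define Z where "Z p \<omega> = ?s (fst p) * X t \<omega> (b p)" for p and \<omega>
  have tb: "torus_test (b p)" for p
    using torus_test_cos[of "fst p"] torus_test_sin[of "fst p"] by (cases "snd p") (simp_all add: b_def[abs_def])
  have W: "\<exists>f. wiener_integral M \<xi> f (\<lambda>\<omega>. X t \<omega> (b p))" for p
    using X t tb unfolding stochastic_convolution_def by blast
  have Zm[measurable]: "Z p \<in> borel_measurable M" and Z2: "integrable M (\<lambda>\<omega>. (Z p \<omega>)\<^sup>2)" for p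
  proof -
    obtain f where f: "wiener_integral M \<xi> f (\<lambda>\<omega>. X t \<omega> (b p))" using W by blast
    note * = square_integrable_wiener_integral[OF ps wn f]
    show "Z p \<in> borel_measurable M" unfolding Z_def[abs_def] using *(1) by measurable
    show "integrable M (\<lambda>\<omega>. (Z p \<omega>)\<^sup>2)" unfolding Z_def power_mult_distrib using *(2) by simp
  qed
  have Xn: "Xn h X n \<omega> t x = (\<Sum>p\<in>S. Z p \<omega> * b p x)" for \<omega> x
  proof -
    have "Xn h X n \<omega> t x = (\<Sum>k\<in>{k. ?s k \<noteq> 0}. Re ((complex_of_real (?s k) * fourier (X t \<omega>) k) * echar k x))"
      unfolding Xn_def low_pass_def fmult_finite[OF S0] by (simp only: Re_sum)
    also have "\<dots> = (\<Sum>k\<in>{k. ?s k \<noteq> 0}. \<Sum>j\<in>{True, False}. Z (k, j) \<omega> * b (k, j) x)"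
    proof (intro sum.cong refl)
      fix k
      have "b (k, True) = (\<lambda>x. cos (2 * pi * (freq k \<bullet> x)))" "b (k, False) = (\<lambda>x. sin (2 * pi * (freq k \<bullet> x)))"
        by (simp_all add: b_def fun_eq_iff)
      then show "Re ((complex_of_real (?s k) * fourier (X t \<omega>) k) * echar k x) = (\<Sum>j\<in>{True, False}. Z (k, j) \<omega> * b (k, j) x)"
        by (simp add: fourier_def echar_def Z_def algebra_simps)
    qed
    also have "\<dots> = (\<Sum>p\<in>S. Z p \<omega> * b p x)" unfolding S_def sum.cartesian_product
      by (simp only: case_prod_unfold prod.collapse)
    finally show ?thesis .
  qed
  \<comment> \<open>The expectation expands into finitely many covariances times products of two
    trigonometric functions. Square integrability of the \<open>Z p\<close> is what permits taking
    it termwise.\<close>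
  have E: "integral\<^sup>L M (\<lambda>\<omega>'. (Xn h X n \<omega>' t x)\<^sup>2) = (\<Sum>p\<in>S. \<Sum>q\<in>S. integral\<^sup>L M (\<lambda>\<omega>. Z p \<omega> * Z q \<omega>) * (b p x * b q x))" for x
  proof -
    have "(Xn h X n \<omega>' t x)\<^sup>2 = (\<Sum>p\<in>S. \<Sum>q\<in>S. (Z p \<omega>' * Z q \<omega>') * (b p x * b q x))" for \<omega>'
      unfolding Xn power2_eq_square sum_product by (intro sum.cong refl) (simp only: mult_ac)
    moreover have "integrable M (\<lambda>\<omega>. (Z p \<omega> * Z q \<omega>) * (b p x * b q x))" for p q
      by (intro integrable_mult_left square_integrable_mult Zm Z2)
    ultimately show ?thesis
      by (simp add: Bochner_Integration.integral_sum Bochner_Integration.integrable_sum)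
  qed
  have bb: "bandlimited (real n) (cx (b p))" if "p \<in> S" for p
  proof -
    have k: "nk (fst p) \<le> real n" using that high_cutoff_facts[OF h n] by (auto simp: S_def)
    have c: "bandlimited (real n) (\<lambda>x. d * echar (fst p) x)" for d
      using bandlimited_trig[of "{fst p}" "real n" "\<lambda>_. d"] k by simp
    have "cx (b p) = cx (\<lambda>x. Re ((if snd p then 1 else - \<i>) * echar (fst p) x))"
      by (rule ext) (simp add: b_def echar_def)
    then show ?thesis using bandlimited_Re[OF c] by (simp only:)
  qed
  have "cx (Xn_wick2 M h X n \<omega> t) = (\<lambda>x. cx (Xn h X n \<omega> t) x * cx (Xn h X n \<omega> t) x -
      (\<Sum>p\<in>S. \<Sum>q\<in>S. complex_of_real (integral\<^sup>L M (\<lambda>\<omega>. Z p \<omega> * Z q \<omega>)) * (cx (b p) x * cx (b q) x)))"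
    unfolding Xn_wick2_def E by (rule ext) (simp add: power2_eq_square)
  moreover have "bandlimited (real n + real n) (\<lambda>x. cx (Xn h X n \<omega> t) x * cx (Xn h X n \<omega> t) x -
      (\<Sum>p\<in>S. \<Sum>q\<in>S. complex_of_real (integral\<^sup>L M (\<lambda>\<omega>. Z p \<omega> * Z q \<omega>)) * (cx (b p) x * cx (b q) x)))"
    by (intro bandlimited_diff bandlimited_mult bandlimited_Xn[OF h n] bandlimited_sum bandlimited_cmult bb)
  ultimately show ?thesis by simp
qed

section \<open>Homogeneous Sobolev and Lebesgue norms\<close>

lemma nn_integral_tint:
  assumes u: "cper (cx u)" and u0: "\<And>x. 0 \<le> u x"
  shows "(\<integral>\<^sup>+x\<in>cbox 0 1. ennreal (u x) \<partial>lborel) = ennreal (tint u)"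
proof -
  have si: "set_integrable lborel (cbox 0 1) u" by (intro set_integrable_cbox_continuous cper_cxD u)
  have "(\<integral>\<^sup>+x\<in>cbox 0 1. ennreal (u x) \<partial>lborel) = (\<integral>\<^sup>+x. ennreal (indicator (cbox 0 1) x * u x) \<partial>lborel)"
    by (intro nn_integral_cong) (auto simp: indicator_def)
  also have "\<dots> = ennreal (\<integral>x. indicator (cbox 0 1) x * u x \<partial>lborel)"
    by (rule nn_integral_eq_integral) (use si u0 in \<open>auto simp: set_integrable_def\<close>)
  also have "(\<integral>x. indicator (cbox 0 1) x * u x \<partial>lborel) = tint u"
    using set_lborel_integral_cbox[OF cper_cxD[OF u], of 0 1] by (simp add: set_lebesgue_integral_def tint_def)
  finally show ?thesis .
qed

lemma torus_Lp_norm_tint: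
  assumes u: "cper (cx u)" and p: "0 < p"
  shows "torus_Lp_norm p u = ennreal (tint (\<lambda>x. \<bar>u x\<bar> powr p) powr (1 / p))"
proof -
  have c: "cper (cx (\<lambda>x. \<bar>u x\<bar> powr p))" by (rule cper_cx_powr[OF u p])
  have "(\<integral>\<^sup>+x\<in>cbox 0 1. ennreal (\<bar>u x\<bar> powr p) \<partial>lborel) = ennreal (tint (\<lambda>x. \<bar>u x\<bar> powr p))"
    by (rule nn_integral_tint[OF c]) simp
  moreover have "0 \<le> tint (\<lambda>x. \<bar>u x\<bar> powr p)" by (rule tint_nonneg[OF c]) simp
  ultimately show ?thesis by (simp add: torus_Lp_norm_def Let_def)
qed

lemma dist_of_tint: "cper (cx u) \<Longrightarrow> cper (cx v) \<Longrightarrow> dist_of u v = tint (\<lambda>x. u x * v x)"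
  unfolding dist_of_def tint_def by (intro set_lborel_integral_cbox continuous_intros cper_cxD)

lemma fmult_series:
  assumes u: "cper (cx u)" and s: "(\<lambda>k. cmod (complex_of_real (\<sigma> k) * fc (cx u) k)) summable_on UNIV"
    and even: "\<And>k. \<sigma> (- k) = \<sigma> k"
  shows "cper (cx (fmult \<sigma> (dist_of u)))" "fc (cx (fmult \<sigma> (dist_of u))) k = complex_of_real (\<sigma> k) * fc (cx u) k"
proof -
  define Z where "Z x = (\<Sum>\<^sub>\<infinity>k. complex_of_real (\<sigma> k) * fc (cx u) k * echar k x)" for x
  have cZ: "cper Z" and fZ: "fc Z k = complex_of_real (\<sigma> k) * fc (cx u) k" for k
    unfolding Z_def[abs_def] by (rule fc_series_cper[OF s], rule fc_series_fc[OF s])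
  have eq: "fmult \<sigma> (dist_of u) = (\<lambda>x. Re (Z x))"
    unfolding fmult_def[abs_def] fmult_complex_def Z_def fourier_dist_of[OF u] echar_def ..
  have r: "fc (cx (\<lambda>x. Re (Z x))) k = fc Z k" for k
  proof (rule fc_Re[OF cZ])
    show "cnj (fc Z (- k)) = fc Z k" unfolding fZ fc_cx_uminus even by simp
  qed
  show "cper (cx (fmult \<sigma> (dist_of u)))"
  proof -
    have "Re (Z (x + freq k)) = Re (Z x)" for x k by (simp only: cperD(2)[OF cZ])
    then show ?thesis unfolding eq cper_cx_iff periodic_def
      using continuous_on_Re[OF cperD(1)[OF cZ, of UNIV]] by blast
  qed
  show "fc (cx (fmult \<sigma> (dist_of u))) k = complex_of_real (\<sigma> k) * fc (cx u) k"
    unfolding eq r fZ ..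
qed

section \<open>Symbols of fractional Laplacians\<close>

definition lsym :: "real \<Rightarrow> int^2 \<Rightarrow> real" where "lsym \<gamma> k = (2 * pi * norm (freq k)) powr \<gamma>"

lemma lsym_eq: "lsym \<gamma> = (\<lambda>k. (2 * pi * norm (freq k)) powr \<gamma>)"
  by (rule ext) (rule lsym_def)

lemma lsym_uminus: "lsym \<gamma> (- k) = lsym \<gamma> k" and lsym_0: "lsym \<gamma> 0 = 0" and lsym_nonneg: "0 \<le> lsym \<gamma> k"
  by (simp_all add: lsym_def freq_uminus)

lemma lsym_nk: "lsym \<gamma> k = (2 * pi * nk k) powr \<gamma>"
  by (simp add: lsym_def nk_def)

lemma lsym_le: "\<gamma> \<le> 2 \<Longrightarrow> lsym \<gamma> k \<le> (2 * pi)\<^sup>2 * (1 + (nk k)\<^sup>2)"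
proof (cases "k = 0")
  case False
  assume g: "\<gamma> \<le> 2"
  have n: "1 \<le> 2 * pi * nk k"
  proof -
    have "1 * 1 \<le> (2 * pi) * nk k" using pi_gt3 nk_ge_1[OF False] by (intro mult_mono) auto
    then show ?thesis by simp
  qed
  have "lsym \<gamma> k \<le> (2 * pi * nk k) powr 2" unfolding lsym_nk using n g by (intro powr_mono) auto
  also have "\<dots> = (2 * pi)\<^sup>2 * (nk k)\<^sup>2" using n by (simp add: power_mult_distrib)
  also have "\<dots> \<le> (2 * pi)\<^sup>2 * (1 + (nk k)\<^sup>2)" by (intro mult_left_mono) auto
  finally show ?thesis .
qed (simp add: lsym_0)

lemma lsym_summable:
  assumes u: "torus_test u" and g: "\<gamma> \<le> 2"
  shows "(\<lambda>k. cmod (complex_of_real (lsym \<gamma> k) * fc (cx u) k)) summable_on UNIV"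
proof (rule summable_on_comparison_test[OF summable_on_cmult_right[OF torus_test_summable[OF u, of 1], of "(2 * pi)\<^sup>2"]])
  fix k
  show "cmod (complex_of_real (lsym \<gamma> k) * fc (cx u) k) \<le> (2 * pi)\<^sup>2 * ((1 + (nk k)\<^sup>2) ^ 1 * cmod (fc (cx u) k))"
    using mult_right_mono[OF lsym_le[OF g, of k], of "cmod (fc (cx u) k)"]
    by (simp only: norm_mult norm_of_real abs_of_nonneg lsym_nonneg power_one_right mult.assoc norm_ge_zero)
qed auto

text \<open>The norm is an infimum over representatives, so exhibiting one, the multiplier applied
  to \<open>w\<close>, bounds it from above. Finite partial sums of its coefficients are then
  enough, in the form in which the energy estimate delivers them.\<close>

lemma Hdot_norm_le:
  assumes w: "torus_test w" and g: "\<gamma> \<le> 2"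
    and B: "\<And>F. finite F \<Longrightarrow> (\<Sum>k\<in>F. (lsym \<gamma> k)\<^sup>2 * (cmod (fc (cx w) k))\<^sup>2) \<le> B"
  shows "(Hdot_norm \<gamma> (dist_of w))\<^sup>2 \<le> ennreal B"
proof -
  define v where "v = fmult (lsym \<gamma>) (dist_of w)"
  have cw: "cper (cx w)" by (rule torus_test_cper[OF w])
  have cv: "cper (cx v)" and fv: "\<And>k. fc (cx v) k = complex_of_real (lsym \<gamma> k) * fc (cx w) k"
    unfolding v_def using fmult_series[OF cw lsym_summable[OF w g] lsym_uminus] by blast+
  \<comment> \<open>The symbol is real, so Parseval moves it from the test function, where
    \<open>Lambda\<close> puts it, to \<open>w\<close>.\<close>
  have rep: "Lambda \<gamma> (dist_of w) \<phi> = dist_of v \<phi>" if \<phi>: "torus_test \<phi>" for \<phi>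
  proof -
    define p where "p = fmult (lsym \<gamma>) (dist_of \<phi>)"
    have c\<phi>: "cper (cx \<phi>)" by (rule torus_test_cper[OF \<phi>])
    have cp: "cper (cx p)" and fp: "\<And>k. fc (cx p) k = complex_of_real (lsym \<gamma> k) * fc (cx \<phi>) k"
      unfolding p_def using fmult_series[OF c\<phi> lsym_summable[OF \<phi> g] lsym_uminus] by blast+
    have "((\<lambda>k. fc (cx w) k * cnj (fc (cx p) k)) has_sum ip (cx w) (cx p)) UNIV" by (rule Parseval[OF cw cp])
    moreover have "((\<lambda>k. fc (cx v) k * cnj (fc (cx \<phi>) k)) has_sum ip (cx v) (cx \<phi>)) UNIV" by (rule Parseval[OF cv c\<phi>])
    moreover have "fc (cx w) k * cnj (fc (cx p) k) = fc (cx v) k * cnj (fc (cx \<phi>) k)" for k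
      unfolding fv fp by simp
    ultimately have "ip (cx w) (cx p) = ip (cx v) (cx \<phi>)" using has_sum_unique by (simp only:) 
    then have "tint (\<lambda>x. w x * p x) = tint (\<lambda>x. v x * \<phi> x)"
      unfolding ip_cx[OF cw cp] ip_cx[OF cv c\<phi>] of_real_eq_iff .
    then show ?thesis
      unfolding Lambda_def lsym_eq[symmetric] p_def[symmetric] dist_of_tint[OF cw cp] dist_of_tint[OF cv c\<phi>] .
  qed
  have vm: "v \<in> borel_measurable lborel"
    using cper_cxD[OF cv, of UNIV] by (simp add: borel_measurable_continuous_onI)
  have "Hdot_norm \<gamma> (dist_of w) \<le> torus_Lp_norm 2 v"
    unfolding Hdot_norm_def dist_L2_norm_def by (rule INF_lower) (use vm rep in auto)
  also have "torus_Lp_norm 2 v = ennreal (sqrt (nsq (cx v)))"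
  proof -
    have "(\<lambda>x. \<bar>v x\<bar> powr 2) = (\<lambda>x. (v x)\<^sup>2)" by (rule ext) simp
    then show ?thesis
      using torus_Lp_norm_tint[OF cv, of 2] nsq_nonneg[of "cx v"] by (simp add: nsq_cx powr_half_sqrt)
  qed
  finally have le: "Hdot_norm \<gamma> (dist_of w) \<le> ennreal (sqrt (nsq (cx v)))" .
  have "nsq (cx v) \<le> B"
  proof (rule has_sum_le_finite_sums[OF Parseval_nsq[OF cv]])
    fix F :: "(int^2) set" assume F: "finite F"
    show "(\<Sum>k\<in>F. (cmod (fc (cx v) k))\<^sup>2) \<le> B"
      using B[OF F] unfolding fv norm_mult power_mult_distrib by simp
  qed
  then have "ennreal (sqrt (nsq (cx v))) ^ 2 \<le> ennreal B"
    by (simp add: ennreal_power ennreal_leI)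
  then show ?thesis using power_mono[OF le, of 2] by (simp add: order_trans)
qed

text \<open>Bessel's inequality for the initial datum: with \<open>p\<close> the real part of a partial Fourier sum of
  \<open>g\<close>, the sum \<open>S\<close> of squared coefficients is \<open>\<integral> g p\<close> and \<open>\<integral> p\<^sup>2 \<le> S\<close>.\<close>

lemma Hdot_Bessel:
  assumes \<Psi>: "\<Psi> \<in> Hdot \<gamma>"
  obtains B where "\<And>F. finite F \<Longrightarrow> (\<Sum>k\<in>F. (lsym \<gamma> k)\<^sup>2 * (cmod (fourier \<Psi> k))\<^sup>2) \<le> B"
proof -
  have dist: "torus_distribution \<Psi>" and fin: "Hdot_norm \<gamma> \<Psi> < \<infinity>" using \<Psi> by (simp_all add: Hdot_def)
  obtain g where gm: "g \<in> borel_measurable lborel" and rep: "\<And>\<phi>. torus_test \<phi> \<Longrightarrow> Lambda \<gamma> \<Psi> \<phi> = dist_of g \<phi>"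
    and gL: "torus_Lp_norm 2 g < \<infinity>"
    using fin unfolding Hdot_norm_def dist_L2_norm_def INF_less_iff by blast
  have "(\<integral>\<^sup>+x\<in>cbox 0 1. ennreal (\<bar>g x\<bar> powr 2) \<partial>lborel) < \<infinity>"
    using gL unfolding torus_Lp_norm_def Let_def by (auto split: if_splits simp: less_top[symmetric])
  then have gfin: "(\<integral>\<^sup>+x. ennreal (norm (indicator (cbox 0 1) x * (g x)\<^sup>2)) \<partial>lborel) < \<infinity>"
    by (rule order.strict_trans1[rotated]) (auto intro!: nn_integral_mono simp: indicator_def)
  have [measurable]: "g \<in> borel_measurable borel" using gm by simp
  have g2: "integrable lborel (\<lambda>x. indicator (cbox 0 1) x * (g x)\<^sup>2)"
    by (rule integrableI_bounded[OF _ gfin]) measurable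
  define B where "B = (\<integral>x. indicator (cbox 0 1) x * (g x)\<^sup>2 \<partial>lborel)"
  have lin: "\<Psi> (\<lambda>x. a * \<phi> x) = a * \<Psi> \<phi>" if "torus_test \<phi>" for a \<phi>
  proof -
    have "\<Psi> (\<lambda>x. a * \<phi> x + 0 * \<phi> x) = a * \<Psi> \<phi> + 0 * \<Psi> \<phi>"
      using dist that unfolding torus_distribution_def by blast
    then show ?thesis by simp
  qed
  \<comment> \<open>A real combination of the characters at k and -k is an eigenfunction of the
    multiplier because the symbol is even. This relates the coefficients of the representative
    \<open>g\<close> to those of \<Psi>.\<close>
  have eigen: "fmult (lsym \<gamma>) (dist_of (\<lambda>x. Re (c * echar k x))) = (\<lambda>x. lsym \<gamma> k * Re (c * echar k x))"
    if t: "torus_test (\<lambda>x. Re (c * echar k x))" for c k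
  proof -
    let ?u = "\<lambda>x. Re (c * echar k x)"
    have cu: "cper (cx ?u)" by (rule torus_test_cper[OF t])
    have eq: "cx ?u = (\<lambda>x. (1/2) * c * echar k x + (1/2) * cnj c * echar (- k) x)"
      by (rule ext) (simp add: complex_eq_iff cnj_echar[symmetric] field_simps)
    have f: "fc (cx ?u) l = (1/2) * c * (if k = l then 1 else 0) + (1/2) * cnj c * (if - k = l then 1 else 0)" for l
    proof -
      have "fc (\<lambda>x. (1/2) * c * echar k x + (1/2) * cnj c * echar (- k) x) l
         = fc (\<lambda>x. (1/2) * c * echar k x) l + fc (\<lambda>x. (1/2) * cnj c * echar (- k) x) l"
        by (rule fc_add) (intro cper_mult cper_const cper_echar)+
      then show ?thesis unfolding eq fc_cmult fc_echar .
    qed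
    have sl: "complex_of_real (lsym \<gamma> l) * fc (cx ?u) l = complex_of_real (lsym \<gamma> k) * fc (cx ?u) l" for l
      unfolding f by (auto simp: lsym_uminus)
    have "(\<lambda>l. cmod (complex_of_real (lsym \<gamma> l) * fc (cx ?u) l)) summable_on UNIV"
    proof -
      define G where "G l = cmod (complex_of_real (lsym \<gamma> l) * fc (cx ?u) l)" for l
      have z: "fc (cx ?u) l = 0" if "l \<notin> {k, - k}" for l using that unfolding f by auto
      have "G l = 0" if l: "l \<notin> {k, - k}" for l unfolding G_def z[OF l] by simp
      then have "G summable_on UNIV \<longleftrightarrow> G summable_on {k, - k}"
        by (intro summable_on_cong_neutral) auto
      then show ?thesis by (simp only: G_def[symmetric]) simp
    qed
    note fm = fmult_series[OF cu this lsym_uminus]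
    have "cx (fmult (lsym \<gamma>) (dist_of ?u)) = (\<lambda>x. complex_of_real (lsym \<gamma> k) * cx ?u x)"
    proof (rule fc_inject[OF fm(1)])
      show "cper (\<lambda>x. complex_of_real (lsym \<gamma> k) * cx ?u x)" by (intro cper_mult cper_const cu)
      show "fc (cx (fmult (lsym \<gamma>) (dist_of ?u))) l = fc (\<lambda>x. complex_of_real (lsym \<gamma> k) * cx ?u x) l" for l
        unfolding fm(2) fc_cmult sl ..
    qed
    then have "complex_of_real (fmult (lsym \<gamma>) (dist_of ?u) x) = complex_of_real (lsym \<gamma> k * ?u x)" for x
      by (metis (no_types) of_real_mult)
    then show ?thesis by (intro ext) (simp only: of_real_eq_iff)
  qed
  have cosr: "(\<lambda>x. cos (2 * pi * (freq k \<bullet> x))) = (\<lambda>x. Re (1 * echar k x))" for k by (simp add: echar_def)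
  have sinr: "(\<lambda>x. sin (2 * pi * (freq k \<bullet> x))) = (\<lambda>x. Re (- \<i> * echar k x))" for k by (simp add: echar_def)
  have gcos: "dist_of g (\<lambda>x. cos (2 * pi * (freq k \<bullet> x))) = lsym \<gamma> k * \<Psi> (\<lambda>x. cos (2 * pi * (freq k \<bullet> x)))" for k
  proof -
    have "Lambda \<gamma> \<Psi> (\<lambda>x. cos (2 * pi * (freq k \<bullet> x))) = \<Psi> (\<lambda>x. lsym \<gamma> k * cos (2 * pi * (freq k \<bullet> x)))"
      unfolding Lambda_def lsym_eq[symmetric]
      using eigen[of 1 k] torus_test_cos[of k] unfolding cosr[symmetric] by (simp add: echar_def)
    then show ?thesis using rep[OF torus_test_cos[of k]] lin[OF torus_test_cos[of k]] by simp
  qed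
  have gsin: "dist_of g (\<lambda>x. sin (2 * pi * (freq k \<bullet> x))) = lsym \<gamma> k * \<Psi> (\<lambda>x. sin (2 * pi * (freq k \<bullet> x)))" for k
  proof -
    have "Lambda \<gamma> \<Psi> (\<lambda>x. sin (2 * pi * (freq k \<bullet> x))) = \<Psi> (\<lambda>x. lsym \<gamma> k * sin (2 * pi * (freq k \<bullet> x)))"
      unfolding Lambda_def lsym_eq[symmetric]
      using eigen[of "- \<i>" k] torus_test_sin[of k] unfolding sinr[symmetric] by (simp add: echar_def)
    then show ?thesis using rep[OF torus_test_sin[of k]] lin[OF torus_test_sin[of k]] by simp
  qed
  have "(\<Sum>k\<in>F. (lsym \<gamma> k)\<^sup>2 * (cmod (fourier \<Psi> k))\<^sup>2) \<le> B" if F: "finite F" for F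
  proof -
    define c where "c k = complex_of_real (lsym \<gamma> k) * fourier \<Psi> k" for k
    define S where "S = (\<Sum>k\<in>F. (cmod (c k))\<^sup>2)"
    define P where "P x = (\<Sum>k\<in>F. c k * echar k x)" for x
    define p where "p x = Re (P x)" for x
    define A where "A k = lsym \<gamma> k * \<Psi> (\<lambda>x. cos (2 * pi * (freq k \<bullet> x)))" for k
    define A' where "A' k = lsym \<gamma> k * \<Psi> (\<lambda>x. sin (2 * pi * (freq k \<bullet> x)))" for k
    have cA: "c k = Complex (A k) (- A' k)" for k by (simp add: c_def A_def A'_def fourier_def complex_eq_iff)
    have px: "p x = (\<Sum>k\<in>F. A k * cos (2 * pi * (freq k \<bullet> x)) + A' k * sin (2 * pi * (freq k \<bullet> x)))" for x
      by (simp add: p_def P_def cA echar_def)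
    have tp: "torus_test p"
      unfolding px[abs_def] by (intro torus_test_sum torus_test_add torus_test_cmult torus_test_cos torus_test_sin)
    have cp: "cper (cx p)" by (rule torus_test_cper[OF tp])
    have cP: "cper P" unfolding P_def[abs_def] by (intro cper_sum cper_mult cper_const cper_echar)
    have "nsq P = S"
    proof -
      have "((\<lambda>k. (cmod (fc P k))\<^sup>2) has_sum S) UNIV"
        unfolding S_def by (rule has_sum_finite_neutralI[OF F]) (simp_all add: P_def[abs_def] fc_trig[OF F])
      with Parseval_nsq[OF cP] show ?thesis by (rule has_sum_unique)
    qed
    have p2: "tint (\<lambda>x. (p x)\<^sup>2) \<le> S"
    proof -
      have "tint (\<lambda>x. (p x)\<^sup>2) \<le> tint (\<lambda>x. (cmod (P x))\<^sup>2)"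
      proof (rule tint_mono[OF cper_cx_power[OF cp] cper_cmod[OF cP]])
        show "(p x)\<^sup>2 \<le> (cmod (P x))\<^sup>2" for x
          unfolding p_def by (rule power2_le_iff_abs_le[THEN iffD2]) (simp_all add: abs_Re_le_cmod)
      qed
      then show ?thesis using \<open>nsq P = S\<close> by (simp add: nsq_def tint_def)
    qed
    have p2i: "integrable lborel (\<lambda>x. indicator (cbox 0 1) x * (p x)\<^sup>2)"
      and p2e: "(\<integral>x. indicator (cbox 0 1) x * (p x)\<^sup>2 \<partial>lborel) = tint (\<lambda>x. (p x)\<^sup>2)"
      using set_integrable_cbox_continuous[of 0 1 "\<lambda>x. (p x)\<^sup>2"] set_lborel_integral_cbox[of 0 1 "\<lambda>x. (p x)\<^sup>2"]
        cper_cxD[OF cper_cx_power[OF cp, of 2], of "cbox 0 1"]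
      by (simp_all add: set_integrable_def set_lebesgue_integral_def tint_def)
    have gq: "integrable lborel (\<lambda>x. indicator (cbox 0 1) x * (g x * q x))" if q: "continuous_on UNIV q" for q
    proof (rule Bochner_Integration.integrable_bound)
      have [measurable]: "q \<in> borel_measurable borel" using q by (rule borel_measurable_continuous_onI)
      have "integrable lborel (\<lambda>x. indicator (cbox 0 1) x * (q x)\<^sup>2)"
        using set_integrable_cbox_continuous[of 0 1 "\<lambda>x. (q x)\<^sup>2"] continuous_on_subset[OF q, of "cbox 0 1"]
        by (simp add: set_integrable_def continuous_on_power)
      then show "integrable lborel (\<lambda>x. indicator (cbox 0 1) x * (g x)\<^sup>2 + indicator (cbox 0 1) x * (q x)\<^sup>2)"
        by (intro Bochner_Integration.integrable_add g2)
      show "(\<lambda>x. indicator (cbox 0 1) x * (g x * q x)) \<in> borel_measurable lborel" by measurable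
      have "\<bar>g x * q x\<bar> \<le> (g x)\<^sup>2 + (q x)\<^sup>2" for x
      proof -
        have "2 * (\<bar>g x\<bar> * \<bar>q x\<bar>) \<le> (g x)\<^sup>2 + (q x)\<^sup>2"
          using sum_squares_bound[of "\<bar>g x\<bar>" "\<bar>q x\<bar>"] by (simp add: mult.assoc)
        moreover have "0 \<le> \<bar>g x\<bar> * \<bar>q x\<bar>" by simp
        ultimately show ?thesis unfolding abs_mult by linarith
      qed
      then show "AE x in lborel. norm (indicator (cbox 0 1) x * (g x * q x)) \<le>
          norm (indicator (cbox 0 1) x * (g x)\<^sup>2 + indicator (cbox 0 1) x * (q x)\<^sup>2)"
        by (intro AE_I2) (auto simp: indicator_def)
    qed
    have S_eq: "S = (\<integral>x. indicator (cbox 0 1) x * (g x * p x) \<partial>lborel)"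
    proof -
      have ic: "integrable lborel (\<lambda>x. indicator (cbox 0 1) x * (g x * cos (2 * pi * (freq k \<bullet> x))))" 
        "integrable lborel (\<lambda>x. indicator (cbox 0 1) x * (g x * sin (2 * pi * (freq k \<bullet> x))))" for k
        by (intro gq continuous_intros)+
      have ec: "(\<integral>x. indicator (cbox 0 1) x * (g x * cos (2 * pi * (freq k \<bullet> x))) \<partial>lborel) = A k"
        "(\<integral>x. indicator (cbox 0 1) x * (g x * sin (2 * pi * (freq k \<bullet> x))) \<partial>lborel) = A' k" for k
        using gcos[of k] gsin[of k] by (simp_all add: dist_of_def set_lebesgue_integral_def A_def A'_def)
      have "(\<integral>x. indicator (cbox 0 1) x * (g x * p x) \<partial>lborel) =
        (\<integral>x. (\<Sum>k\<in>F. A k * (indicator (cbox 0 1) x * (g x * cos (2 * pi * (freq k \<bullet> x)))) + A' k * (indicator (cbox 0 1) x * (g x * sin (2 * pi * (freq k \<bullet> x))))) \<partial>lborel)"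
        by (rule Bochner_Integration.integral_cong[OF refl]) (simp add: px sum_distrib_left algebra_simps)
      also have "\<dots> = (\<Sum>k\<in>F. A k * A k + A' k * A' k)"
        by (simp add: Bochner_Integration.integral_sum Bochner_Integration.integral_add Bochner_Integration.integrable_add ic ec)
      also have "\<dots> = S" unfolding S_def cA cmod_power2 by (simp add: power2_eq_square)
      finally show ?thesis by simp
    qed
    \<comment> \<open>From 2 g p \<le> g^2 + p^2 and the bound of the integral of p^2 by S one gets
      S \<le> B/2 + S/2; S is a finite sum and can be subtracted.\<close>
    also have "\<dots> \<le> (\<integral>x. (1/2) * (indicator (cbox 0 1) x * (g x)\<^sup>2) + (1/2) * (indicator (cbox 0 1) x * (p x)\<^sup>2) \<partial>lborel)"
    proof (rule Bochner_Integration.integral_mono)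
      show "integrable lborel (\<lambda>x. indicator (cbox 0 1) x * (g x * p x))" by (rule gq[OF cper_cxD[OF cp]])
      show "integrable lborel (\<lambda>x. (1/2) * (indicator (cbox 0 1) x * (g x)\<^sup>2) + (1/2) * (indicator (cbox 0 1) x * (p x)\<^sup>2))"
        by (intro Bochner_Integration.integrable_add integrable_mult_right g2 p2i)
      show "indicator (cbox 0 1) x * (g x * p x) \<le> (1/2) * (indicator (cbox 0 1) x * (g x)\<^sup>2) + (1/2) * (indicator (cbox 0 1) x * (p x)\<^sup>2)" for x
        using sum_squares_bound[of "g x" "p x"] by (simp add: indicator_def)
    qed
    also have "\<dots> = (1/2) * B + (1/2) * tint (\<lambda>x. (p x)\<^sup>2)"
    proof -
      have i1: "integrable lborel (\<lambda>x. (1/2) * (indicator (cbox 0 1) x * (g x)\<^sup>2))"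
        by (intro integrable_mult_right g2)
      have i2: "integrable lborel (\<lambda>x. (1/2) * (indicator (cbox 0 1) x * (p x)\<^sup>2))"
        by (intro integrable_mult_right p2i)
      show ?thesis unfolding Bochner_Integration.integral_add[OF i1 i2] B_def p2e[symmetric] by simp
    qed
    also have "\<dots> \<le> (1/2) * B + (1/2) * S" using p2 by simp
    finally have "S \<le> B" by simp
    then show ?thesis by (simp add: S_def c_def norm_mult power_mult_distrib)
  qed
  then show thesis by (rule that)
qed

text \<open>The critical embedding is applied to the square of \<open>w\<close>: with q = 2 / (1 -
  a) its exponent doubles to 4 / (1 - a), and the fourth power of the norm of \<open>w\<close> is
  the square of the Lq norm of its square.\<close>

lemma Lp_norm_le:
  assumes a: "0 < a" "a < 1"
  obtains C where "0 \<le> C" "\<And>w. torus_test w \<Longrightarrow> torus_Lp_norm (4 / (1 - a)) w ^ 4 \<le> ennreal (C * Nf a (\<lambda>x. (w x)\<^sup>2))"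
proof -
  define q where "q = 2 / (1 - a)"
  have q: "0 < q" using a by (simp add: q_def)
  obtain C where C: "0 \<le> C" "\<And>v. torus_test v \<Longrightarrow> tint (\<lambda>x. \<bar>v x\<bar> powr q) \<le> C * sqrt (Nf a v) powr q"
    by (rule sobolev_embedding[OF a q_def], rule that)
  have main: "torus_Lp_norm (4 / (1 - a)) w ^ 4 \<le> ennreal (C powr (1 - a) * Nf a (\<lambda>x. (w x)\<^sup>2))" if w: "torus_test w" for w
  proof -
    let ?v = "\<lambda>x. (w x)\<^sup>2"
    have tv: "torus_test ?v" by (rule torus_test_power[OF w])
    have N0: "0 \<le> Nf a ?v" by (rule Nf_nonneg[OF a tv])
    have p0: "0 < 4 / (1 - a)" using a by simp
    have pq: "\<bar>w x\<bar> powr (4 / (1 - a)) = \<bar>?v x\<bar> powr q" for x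
    proof -
      have "\<bar>w x\<bar> powr (4 / (1 - a)) = (\<bar>w x\<bar> powr 2) powr q" by (simp only: powr_powr) (simp add: q_def)
      also have "\<bar>w x\<bar> powr 2 = \<bar>?v x\<bar>" by simp
      finally show ?thesis .
    qed
    define I where "I = tint (\<lambda>x. \<bar>?v x\<bar> powr q)"
    have I0: "0 \<le> I" unfolding I_def by (rule tint_nonneg[OF cper_cx_powr[OF torus_test_cper[OF tv] q]]) simp
    have "torus_Lp_norm (4 / (1 - a)) w = ennreal (I powr (1 / (4 / (1 - a))))"
      unfolding torus_Lp_norm_tint[OF torus_test_cper[OF w] p0] pq I_def ..
    then have "torus_Lp_norm (4 / (1 - a)) w ^ 4 = ennreal ((I powr (1 / (4 / (1 - a)))) ^ 4)"
      by (simp add: ennreal_power)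
    also have "(I powr (1 / (4 / (1 - a)))) ^ 4 = I powr (1 - a)"
    proof -
      have "(I powr e) ^ 4 = I powr (e * 4)" for e by (cases "I = 0") (simp_all add: powr_power mult.commute)
      moreover have "1 / (4 / (1 - a)) * 4 = 1 - a" using a by simp
      ultimately show ?thesis by (simp only:)
    qed
    also have "I powr (1 - a) \<le> (C * sqrt (Nf a ?v) powr q) powr (1 - a)"
      using I0 C(2)[OF tv] a by (intro powr_mono2) (simp_all add: I_def)
    also have "\<dots> = C powr (1 - a) * (sqrt (Nf a ?v) powr q) powr (1 - a)" by (rule powr_mult)
    also have "(sqrt (Nf a ?v) powr q) powr (1 - a) = sqrt (Nf a ?v) powr 2"
    proof -
      have "q * (1 - a) = 2" using a by (simp add: q_def field_simps)
      then show ?thesis by (simp only: powr_powr)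
    qed
    also have "sqrt (Nf a ?v) powr 2 = Nf a ?v" using N0 by simp
    finally show ?thesis by (simp add: ennreal_leI)
  qed
  have "0 \<le> C powr (1 - a)" by simp
  then show thesis using main by (rule that)
qed

lemma Ck_space_subset: "Ck_space k I w \<Longrightarrow> J \<subseteq> I \<Longrightarrow> Ck_space k J w"
proof (induction k arbitrary: w)
  case 0
  then show ?case by (auto intro: continuous_on_subset)
next
  case (Suc k)
  have "continuous_on (J \<times> UNIV) (\<lambda>(t, x). w t x)"
    using Suc.prems by (intro continuous_on_subset[of "I \<times> UNIV" _ "J \<times> UNIV"]) auto
  then show ?case using Suc by auto
qed

lemma continuous_fc:
  assumes "continuous_on (I \<times> UNIV) (\<lambda>(t, x). u t x)"
  shows "continuous_on I (\<lambda>t. fc (cx (u t)) k)"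
  unfolding fc_def ip_def
proof (rule integral_continuous_on_param)
  have "continuous_on (I \<times> cbox 0 1) (\<lambda>(t, x). u t x)" by (rule continuous_on_subset[OF assms]) auto
  then show "continuous_on (I \<times> cbox 0 1) (\<lambda>(t, x). complex_of_real (u t x) * cnj (echar k x))"
    unfolding case_prod_unfold
    by (intro continuous_on_mult continuous_on_of_real continuous_on_cnj continuous_echar continuous_on_snd continuous_on_id)
qed

section \<open>The energy estimate\<close>

text \<open>At zero frequency this is 0 / 0 = 0, so the mean drops out of the energy; it is shown
  separately to vanish.\<close>

definition bsym :: "real \<Rightarrow> int^2 \<Rightarrow> real" where "bsym a k = msym a k / (2 * pi * nk k)\<^sup>2"

lemma bsym_nonneg: "a < 1 \<Longrightarrow> 0 \<le> bsym a k"
  by (simp add: bsym_def msym_nonneg)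

text \<open>The truncated energy satisfies a differential inequality up to an error 1, because the
  rates of change of all modes have a common summable majorant on the time interval. The error is
  the origin of 2 C + 1, and it does not involve the set of frequencies or the size of the
  solution.\<close>

lemma energy_bound:
  assumes a: "0 < a" "a < 1" and T: "0 < T"
    and sol: "smooth_solution {0..T} (\<lambda>t x. w t x ^ 3 + P t x) w"
    and P: "\<And>k. Ck_space k {0..T} P" "\<And>t. t \<in> {0..T} \<Longrightarrow> periodic (P t)"
    and w0: "tint (w 0) = 0" and C: "0 \<le> C"
    and est: "\<And>t. t \<in> {0..T} \<Longrightarrow> tint (w t) = 0 \<Longrightarrow> \<bar>Qf a (P t) (w t)\<bar> \<le> Df a (w t) / 2 + Gf a (w t) / 2 + C"
    and init: "\<And>F. finite F \<Longrightarrow> (\<Sum>k\<in>F. bsym a k * (cmod (fc (cx (w 0)) k))\<^sup>2) \<le> E0"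
  shows energy_mean_zero: "\<And>t. t \<in> {0..T} \<Longrightarrow> tint (w t) = 0"
    and energy_sup: "\<And>t F. t \<in> {0..T} \<Longrightarrow> finite F \<Longrightarrow> (\<Sum>k\<in>F. bsym a k * (cmod (fc (cx (w t)) k))\<^sup>2) \<le> E0 + (2 * C + 1) * T"
    and energy_integral: "\<And>Q. 0 \<le> Q \<Longrightarrow> (\<integral>\<^sup>+t\<in>{0..T}. ennreal (Q * (Df a (w t) + Gf a (w t))) \<partial>lborel) \<le> ennreal (Q * (E0 + (2 * C + 1) * T))"
proof -
  define F where "F t x = w t x ^ 3 + P t x" for t x
  have Ckw: "\<And>k. Ck_space k {0..T} w" and perw: "\<And>t. t \<in> {0..T} \<Longrightarrow> periodic (w t)"
    using sol by (simp_all add: smooth_solution_def)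
  have tw: "torus_test (w t)" and tP: "torus_test (P t)" if "t \<in> {0..T}" for t
    by (rule Ck_space_torus_test[OF Ckw perw[OF that] that], rule Ck_space_torus_test[OF P(1) P(2)[OF that] that])
  have CkF: "Ck_space k {0..T} F" for k
    unfolding F_def[abs_def] by (intro Ck_space_add Ck_space_power Ckw P(1))
  have tF: "torus_test (F t)" if "t \<in> {0..T}" for t
    unfolding F_def[abs_def] by (intro torus_test_add torus_test_power tw tP that)
  define W where "W k t = fc (cx (w t)) k" for k t
  define V where "V k t = fc (cx (F t)) k" for k t
  have dW: "(W k has_vector_derivative (- complex_of_real ((2 * pi * nk k) ^ 4) * W k t - complex_of_real ((2 * pi * nk k)\<^sup>2) * V k t)) (at t within {0..T})"
    if "t \<in> {0..T}" for k t
    unfolding W_def[abs_def] V_def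
  proof (rule fc_time_derivative[OF _ CkF _ that])
    show "smooth_solution {0..T} F w" using sol by (simp only: F_def[abs_def])
    show "periodic (F t)" if "t \<in> {0..T}" for t using tF[OF that] by (simp add: torus_test_def)
  qed
  \<comment> \<open>Both symbols on the right hand side vanish at zero frequency, so the mean is
    conserved and stays at its initial value 0.\<close>
  have W0: "W 0 t = 0" if t: "t \<in> {0..T}" for t
  proof -
    have d0: "(W 0 has_vector_derivative 0) (at s within {0..T})" if "s \<in> {0..T}" for s
      using dW[OF that, of 0] by simp
    obtain c where c: "\<And>s. s \<in> {0..T} \<Longrightarrow> W 0 s = c"
      by (rule has_vector_derivative_zero_constant[OF convex_real_interval(5) d0], assumption, rule that)
    have "W 0 0 = 0" using fc_cx_0[OF torus_test_cper[OF tw[of 0]]] T w0 by (simp add: W_def)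
    then show ?thesis using c[of 0] c[OF t] T by simp
  qed
  show mean: "tint (w t) = 0" if "t \<in> {0..T}" for t
    using W0[OF that] fc_cx_0[OF torus_test_cper[OF tw[OF that]]] by (simp add: W_def)
  define e where "e k t = bsym a k * (cmod (W k t))\<^sup>2" for k t
  \<comment> \<open>The rate of change of \<open>e\<close>: the denominator of \<open>bsym\<close>
    cancels two of the derivatives on each side, leaving the summands of the dissipation and of
    \<open>Qf\<close>.\<close>
  define R where "R k t = - 2 * (msym a k * (2 * pi * nk k)\<^sup>2 * (cmod (W k t))\<^sup>2) + - 2 * (msym a k * Re (V k t * cnj (W k t)))" for k t
  have de: "(e k has_vector_derivative R k t) (at t within {0..T})" if t: "t \<in> {0..T}" for k t
  proof -
    define p where "p = 2 * pi * nk k"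
    let ?W' = "- complex_of_real (p ^ 4) * W k t - complex_of_real (p\<^sup>2) * V k t"
    have d: "(W k has_vector_derivative ?W') (at t within {0..T})" using dW[OF t, of k] by (simp only: p_def)
    have dR: "((\<lambda>s. Re (W k s)) has_real_derivative Re ?W') (at t within {0..T})"
      and dI: "((\<lambda>s. Im (W k s)) has_real_derivative Im ?W') (at t within {0..T})"
      unfolding has_real_derivative_iff_has_vector_derivative
      by (rule bounded_linear.has_vector_derivative[OF bounded_linear_Re d],
          rule bounded_linear.has_vector_derivative[OF bounded_linear_Im d])
    have "((\<lambda>s. bsym a k * ((Re (W k s))\<^sup>2 + (Im (W k s))\<^sup>2)) has_real_derivative
       bsym a k * (2 * Re (W k t) * Re ?W' + 2 * Im (W k t) * Im ?W')) (at t within {0..T})"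
      by (rule derivative_eq_intros dR dI refl | simp)+
    moreover have "bsym a k * (2 * Re (W k t) * Re ?W' + 2 * Im (W k t) * Im ?W') = R k t"
    proof -
      have 1: "2 * Re (W k t) * Re ?W' + 2 * Im (W k t) * Im ?W' =
         p\<^sup>2 * (- 2 * (p\<^sup>2 * (cmod (W k t))\<^sup>2) - 2 * Re (V k t * cnj (W k t)))"
        unfolding cmod_power2 minus_complex.sel times_complex.sel uminus_complex.sel
          complex.sel complex_cnj cnj.sel Re_complex_of_real Im_complex_of_real
        by (simp add: power2_eq_square power4_eq_xxxx algebra_simps)
      have 2: "bsym a k * p\<^sup>2 = msym a k"
      proof (cases "k = 0")
        case False
        then have "p \<noteq> 0" using nk_ge_1[OF False] by (simp add: p_def)
        then show ?thesis by (simp add: bsym_def p_def)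
      qed (simp add: bsym_def)
      show ?thesis unfolding 1 mult.assoc[symmetric] 2 by (simp add: R_def p_def algebra_simps)
    qed
    moreover have "(\<lambda>s. bsym a k * ((Re (W k s))\<^sup>2 + (Im (W k s))\<^sup>2)) = e k"
      by (rule ext) (simp add: e_def cmod_power2)
    ultimately show ?thesis unfolding has_real_derivative_iff_has_vector_derivative by simp
  qed
  have contW: "continuous_on {0..T} (W k)" for k
    unfolding W_def[abs_def] by (rule continuous_fc[OF Ck_space_cont[OF Ckw]])
  have contV: "continuous_on {0..T} (V k)" for k
    unfolding V_def[abs_def] by (rule continuous_fc[OF Ck_space_cont[OF CkF]])
  have contR: "continuous_on {0..T} (R k)" for k
    unfolding R_def[abs_def] by (intro continuous_intros contW contV)
  obtain M1 where M1: "\<And>t x. t \<in> {0..T} \<Longrightarrow> \<bar>(laplacian ^^ 0) (w t) x\<bar> \<le> M1" by (rule Ck_space_bounded[where p = 0, OF Ckw perw], assumption, rule that)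
  \<comment> \<open>Four Laplacians give decay of order four in 1 + |k|^2: two powers are spent on
    the symbols in \<open>R\<close>, the other two on the summable weight of
    \<open>c\<close>.\<close>
  obtain M2 where M2: "\<And>t x. t \<in> {0..T} \<Longrightarrow> \<bar>(laplacian ^^ 4) (w t) x\<bar> \<le> M2" by (rule Ck_space_bounded[where p = 4, OF Ckw perw], assumption, rule that)
  have perF: "\<And>t. t \<in> {0..T} \<Longrightarrow> periodic (F t)" using tF by (simp add: torus_test_def)
  obtain M3 where M3: "\<And>t x. t \<in> {0..T} \<Longrightarrow> \<bar>(laplacian ^^ 0) (F t) x\<bar> \<le> M3" by (rule Ck_space_bounded[where p = 0, OF CkF perF], assumption, rule that)
  define M where "M = 2 ^ 4 * max M1 M2"
  have Wb: "(1 + (nk k)\<^sup>2) ^ 4 * cmod (W k t) \<le> M" if t: "t \<in> {0..T}" for k t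
    unfolding W_def M_def
    by (rule fc_decay[OF tw[OF t]]) (use M1[OF t] M2[OF t] in \<open>simp_all add: le_max_iff_disj\<close>)
  have Vb: "cmod (V k t) \<le> M3" if t: "t \<in> {0..T}" for k t
    unfolding V_def by (rule norm_fc_le[OF torus_test_cper[OF tF[OF t]]]) (use M3[OF t] in simp)
  have t0: "0 \<in> {0..T}" using T by simp
  have M0: "0 \<le> M"
  proof -
    have "0 \<le> (1 + (nk 0)\<^sup>2) ^ 4 * cmod (W 0 0)" by simp
    then show ?thesis using Wb[OF t0, of 0] by linarith
  qed
  have M30: "0 \<le> M3" using Vb[OF t0, of 0] norm_ge_zero[of "V 0 0"] by linarith
  obtain C1 where C1: "0 < C1" "\<And>k. msym a k \<le> C1 * (1 + (nk k)\<^sup>2)" by (rule msym_poly_bound[OF a], rule that)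
  define Cc where "Cc = 2 * (C1 * (2 * pi)\<^sup>2 * M * M) + 2 * (C1 * M3 * M)"
  define c where "c k = Cc * (1 / (1 + (nk k)\<^sup>2)\<^sup>2)" for k
  have Rc: "\<bar>R k t\<bar> \<le> c k" if t: "t \<in> {0..T}" for k t
  proof -
    define x where "x = 1 + (nk k)\<^sup>2"
    have x: "1 \<le> x" by (simp add: x_def)
    have m: "0 \<le> msym a k" "msym a k \<le> C1 * x" using C1(2)[of k] a by (simp_all add: msym_nonneg x_def)
    have nkx: "(2 * pi * nk k)\<^sup>2 \<le> (2 * pi)\<^sup>2 * x" by (simp add: x_def power_mult_distrib)
    have x4: "x ^ 4 * cmod (W k t) \<le> M" using Wb[OF t] by (simp add: x_def)
    have Wm: "cmod (W k t) \<le> M"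
    proof -
      have "1 * cmod (W k t) \<le> x ^ 4 * cmod (W k t)" using x by (intro mult_right_mono one_le_power) auto
      then show ?thesis using x4 by linarith
    qed
    have T1: "(msym a k * (2 * pi * nk k)\<^sup>2 * (cmod (W k t))\<^sup>2) * x\<^sup>2 \<le> C1 * (2 * pi)\<^sup>2 * M * M"
    proof -
      have "msym a k * (2 * pi * nk k)\<^sup>2 \<le> (C1 * x) * ((2 * pi)\<^sup>2 * x)"
        using m nkx x C1(1) by (intro mult_mono) auto
      then have "(msym a k * (2 * pi * nk k)\<^sup>2) * (cmod (W k t) * cmod (W k t)) \<le> ((C1 * x) * ((2 * pi)\<^sup>2 * x)) * (cmod (W k t) * M)"
        using x C1(1) Wm by (intro mult_mono[OF \<open>msym a k * (2 * pi * nk k)\<^sup>2 \<le> (C1 * x) * ((2 * pi)\<^sup>2 * x)\<close>] mult_left_mono) auto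
      then have "((msym a k * (2 * pi * nk k)\<^sup>2) * (cmod (W k t) * cmod (W k t))) * x\<^sup>2 \<le> (((C1 * x) * ((2 * pi)\<^sup>2 * x)) * (cmod (W k t) * M)) * x\<^sup>2"
        by (rule mult_right_mono) simp
      also have "\<dots> = (C1 * (2 * pi)\<^sup>2 * M) * (x ^ 4 * cmod (W k t))" by (simp add: power2_eq_square power4_eq_xxxx)
      also have "\<dots> \<le> (C1 * (2 * pi)\<^sup>2 * M) * M" using C1(1) M0 by (intro mult_left_mono x4) auto
      finally show ?thesis by (simp only: power2_eq_square mult.assoc)
    qed
    have T2: "\<bar>msym a k * Re (V k t * cnj (W k t))\<bar> * x\<^sup>2 \<le> C1 * M3 * M"
    proof -
      have "\<bar>Re (V k t * cnj (W k t))\<bar> \<le> cmod (V k t) * cmod (W k t)"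
        using abs_Re_le_cmod[of "V k t * cnj (W k t)"] by (simp add: norm_mult)
      also have "\<dots> \<le> M3 * cmod (W k t)" using Vb[OF t] by (intro mult_right_mono) auto
      finally have "\<bar>msym a k * Re (V k t * cnj (W k t))\<bar> \<le> (C1 * x) * (M3 * cmod (W k t))"
        unfolding abs_mult using m C1(1) x by (intro mult_mono) auto
      then have "\<bar>msym a k * Re (V k t * cnj (W k t))\<bar> * x\<^sup>2 \<le> ((C1 * x) * (M3 * cmod (W k t))) * x\<^sup>2"
        by (rule mult_right_mono) simp
      also have "\<dots> = (C1 * M3) * (x ^ 3 * cmod (W k t))" by (simp add: power2_eq_square power3_eq_cube)
      also have "\<dots> \<le> (C1 * M3) * (x ^ 4 * cmod (W k t))"
        using C1(1) M30 x by (intro mult_left_mono mult_right_mono power_increasing) auto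
      also have "\<dots> \<le> (C1 * M3) * M" using C1(1) M30 by (intro mult_left_mono x4) auto
      finally show ?thesis .
    qed
    have A0: "0 \<le> msym a k * (2 * pi * nk k)\<^sup>2 * (cmod (W k t))\<^sup>2" using m by simp
    have "\<bar>R k t\<bar> \<le> 2 * (msym a k * (2 * pi * nk k)\<^sup>2 * (cmod (W k t))\<^sup>2) + 2 * \<bar>msym a k * Re (V k t * cnj (W k t))\<bar>"
      unfolding R_def using A0 by linarith
    then have "\<bar>R k t\<bar> * x\<^sup>2 \<le> (2 * (msym a k * (2 * pi * nk k)\<^sup>2 * (cmod (W k t))\<^sup>2) + 2 * \<bar>msym a k * Re (V k t * cnj (W k t))\<bar>) * x\<^sup>2"
      by (rule mult_right_mono) simp
    also have "\<dots> = 2 * ((msym a k * (2 * pi * nk k)\<^sup>2 * (cmod (W k t))\<^sup>2) * x\<^sup>2) + 2 * (\<bar>msym a k * Re (V k t * cnj (W k t))\<bar> * x\<^sup>2)"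
      by (simp only: distrib_right mult.assoc)
    also have "\<dots> \<le> Cc" unfolding Cc_def by (intro add_mono mult_left_mono T1 T2) auto
    finally have "\<bar>R k t\<bar> * x\<^sup>2 \<le> Cc" .
    moreover have "0 < x\<^sup>2" using x by simp
    ultimately show ?thesis unfolding c_def x_def[symmetric] by (simp only: pos_le_divide_eq times_divide_eq_right mult_1_right)
  qed
  obtain ct where ct: "(c has_sum ct) UNIV"
    using summable_on_cmult_right[OF summable_lattice, of Cc] unfolding c_def[abs_def] summable_on_def by blast
  have c0: "0 \<le> c k" for k using Rc[OF t0, of k] abs_ge_zero[of "R k 0"] by linarith
  \<comment> \<open>Since \<open>c\<close> is the same for all times, one finite set of frequencies
    leaves a tail below 1 throughout the interval.\<close>
  obtain K0 where K0: "finite K0" "\<And>Y. finite Y \<Longrightarrow> K0 \<subseteq> Y \<Longrightarrow> dist (sum c Y) ct < 1"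
  proof -
    have "\<forall>\<^sub>F X in finite_subsets_at_top UNIV. dist (sum c X) ct < 1"
      using ct unfolding has_sum_def by (rule tendstoD) simp
    then show thesis unfolding eventually_finite_subsets_at_top using that by auto
  qed
  \<comment> \<open>Adding \<open>c\<close> makes all summands nonnegative, so a finite sum is at
    most the full one, and removing \<open>c\<close> again costs at most its tail, less than 1. The
    estimate of the perturbation, doubled, then consumes half of the dissipation and half of the
    good term.\<close>
  have key: "(\<Sum>k\<in>Y. R k t) \<le> - (Df a (w t) + Gf a (w t)) + (2 * C + 1)"
    if Y: "finite Y" "K0 \<subseteq> Y" and t: "t \<in> {0..T}" for Y t
  proof -
    have cF: "cper (cx (F t))" and cw: "cper (cx (w t))" by (rule torus_test_cper[OF tF[OF t]], rule torus_test_cper[OF tw[OF t]])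
    have h1: "((\<lambda>k. msym a k * (2 * pi * nk k)\<^sup>2 * (cmod (W k t))\<^sup>2) has_sum Df a (w t)) UNIV"
      unfolding W_def by (rule Df_has_sum[OF a tw[OF t]])
    have h2: "((\<lambda>k. msym a k * Re (V k t * cnj (W k t))) has_sum Qf a (F t) (w t)) UNIV"
      unfolding W_def V_def by (rule Qf_fc[OF a cF torus_test_H1[OF tF[OF t]] cw torus_test_H1[OF tw[OF t]]])
    have hR: "((\<lambda>k. R k t) has_sum (- 2 * Df a (w t) + - 2 * Qf a (F t) (w t))) UNIV"
      unfolding R_def by (intro has_sum_add has_sum_cmult_right h1 h2)
    have QF: "Qf a (F t) (w t) = Gf a (w t) + Qf a (P t) (w t)"
    proof -
      have c3: "cper (cx (\<lambda>x. w t x ^ 3))" and cP: "cper (cx (P t))"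
        by (rule torus_test_cper[OF torus_test_power[OF tw[OF t]]], rule torus_test_cper[OF tP[OF t]])
      have "cx (F t) = (\<lambda>x. cx (\<lambda>x. w t x ^ 3) x + cx (P t) x)" by (rule ext) (simp add: F_def)
      then have "ip (cx (F t)) (Bw a (w t)) = ip (cx (\<lambda>x. w t x ^ 3)) (Bw a (w t)) + ip (cx (P t)) (Bw a (w t))"
        using ip_add_left[OF c3 cP cper_Bw[OF a tw[OF t]]] by (simp only:)
      then show ?thesis
        unfolding Gf_def Qf_Bw[OF a cF tw[OF t]] Qf_Bw[OF a c3 tw[OF t]] Qf_Bw[OF a cP tw[OF t]] by simp
    qed
    have "(\<Sum>k\<in>Y. R k t + c k) \<le> (- 2 * Df a (w t) + - 2 * Qf a (F t) (w t)) + ct"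
    proof (rule finite_sum_le_has_sum[OF has_sum_add[OF hR ct] Y(1)])
      show "0 \<le> R k t + c k" for k using Rc[OF t, of k] by linarith
    qed simp
    moreover have "ct - sum c Y \<le> 1" using K0(2)[OF Y] by (simp add: dist_real_def)
    ultimately have "(\<Sum>k\<in>Y. R k t) \<le> - 2 * Df a (w t) - 2 * Qf a (F t) (w t) + 1"
      by (simp add: sum.distrib)
    moreover have "- Qf a (P t) (w t) \<le> Df a (w t) / 2 + Gf a (w t) / 2 + C"
      using est[OF t mean[OF t]] by (rule order_trans[OF abs_ge_minus_self])
    ultimately show ?thesis unfolding QF by (simp add: algebra_simps)
  qed
  have DG: "0 \<le> Df a (w t) + Gf a (w t)" if "t \<in> {0..T}" for t
    by (intro add_nonneg_nonneg Df_nonneg Gf_nonneg a tw that)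
  have FTC: "((\<lambda>s. \<Sum>k\<in>Y. R k s) has_integral ((\<Sum>k\<in>Y. e k t) - (\<Sum>k\<in>Y. e k 0))) {0..t}" if t: "t \<in> {0..T}" for Y t
  proof (rule fundamental_theorem_of_calculus)
    show "0 \<le> t" using t by simp
    fix s assume s: "s \<in> {0..t}"
    have "((\<lambda>s. \<Sum>k\<in>Y. e k s) has_vector_derivative (\<Sum>k\<in>Y. R k s)) (at s within {0..T})"
      by (rule has_vector_derivative_sum) (rule de, use s t in auto)
    then show "((\<lambda>s. \<Sum>k\<in>Y. e k s) has_vector_derivative (\<Sum>k\<in>Y. R k s)) (at s within {0..t})"
      by (rule has_vector_derivative_within_subset) (use t in auto)
  qed
  have e0: "0 \<le> e k t" for k t using a by (simp add: e_def bsym_nonneg)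
  have init': "(\<Sum>k\<in>Y. e k 0) \<le> E0" if "finite Y" for Y
    unfolding e_def W_def by (rule init[OF that])
  show "(\<Sum>k\<in>F'. bsym a k * (cmod (fc (cx (w t)) k))\<^sup>2) \<le> E0 + (2 * C + 1) * T"
    if t: "t \<in> {0..T}" and F': "finite F'" for t F'
  proof -
    let ?Y = "F' \<union> K0"
    have Y: "finite ?Y" "K0 \<subseteq> ?Y" using F' K0(1) by auto
    have "(\<Sum>k\<in>F'. e k t) \<le> (\<Sum>k\<in>?Y. e k t)" using Y e0 by (intro sum_mono2) auto
    also have "\<dots> - (\<Sum>k\<in>?Y. e k 0) \<le> (2 * C + 1) * (t - 0)"
    proof -
      have c1: "((\<lambda>s. 2 * C + 1) has_integral (2 * C + 1) * (t - 0)) {0..t}"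
        using has_integral_const_real[of "2 * C + 1" 0 t] t by (simp add: mult.commute)
      show ?thesis
      proof (rule has_integral_le[OF FTC[OF t] c1])
        fix s assume "s \<in> {0..t}"
        then have s: "s \<in> {0..T}" using t by simp
        show "(\<Sum>k\<in>?Y. R k s) \<le> 2 * C + 1" using key[OF Y s] DG[OF s] by linarith
      qed
    qed
    also have "(2 * C + 1) * (t - 0) \<le> (2 * C + 1) * T" using C t by (intro mult_left_mono) auto
    finally have "(\<Sum>k\<in>F'. e k t) \<le> E0 + (2 * C + 1) * T" using init'[OF Y(1)] by linarith
    then show ?thesis by (simp only: e_def W_def)
  qed
  show "(\<integral>\<^sup>+t\<in>{0..T}. ennreal (Q * (Df a (w t) + Gf a (w t))) \<partial>lborel) \<le> ennreal (Q * (E0 + (2 * C + 1) * T))" if Q: "0 \<le> Q" for Q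
  proof -
    \<comment> \<open>A continuous majorant of the integrand with a known integral: it is a constant
      minus the derivative of the energy truncated to \<open>K0\<close>, so the fundamental theorem
      evaluates it through initial and final energy.\<close>
    define r where "r t = Q * ((2 * C + 1) - (\<Sum>k\<in>K0. R k t))" for t
    have r: "Q * (Df a (w t) + Gf a (w t)) \<le> r t" if "t \<in> {0..T}" for t
      unfolding r_def using key[OF K0(1) subset_refl that] by (intro mult_left_mono Q) linarith
    have r0: "0 \<le> r t" if "t \<in> {0..T}" for t
      using r[OF that] mult_nonneg_nonneg[OF Q DG[OF that]] by linarith
    have cr: "continuous_on {0..T} r" unfolding r_def[abs_def] by (intro continuous_intros contR)
    have TT: "T \<in> {0..T}" using T by simp
    have "((\<lambda>s. 2 * C + 1) has_integral (2 * C + 1) * T) {0..T}"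
      using has_integral_const_real[of "2 * C + 1" 0 T] T by (simp add: mult.commute)
    then have hr: "(r has_integral Q * ((2 * C + 1) * T - ((\<Sum>k\<in>K0. e k T) - (\<Sum>k\<in>K0. e k 0)))) {0..T}"
      unfolding r_def[abs_def] by (intro has_integral_mult_right has_integral_diff FTC[OF TT])
    have si: "set_integrable lborel {0..T} r"
      unfolding set_integrable_def by (rule borel_integrable_compact[OF compact_Icc cr])
    have "(\<integral>\<^sup>+t\<in>{0..T}. ennreal (Q * (Df a (w t) + Gf a (w t))) \<partial>lborel) \<le> (\<integral>\<^sup>+t. ennreal (indicator {0..T} t *\<^sub>R r t) \<partial>lborel)"
      by (intro nn_integral_mono) (auto simp: indicator_def intro!: ennreal_leI r)
    also have "\<dots> = ennreal (\<integral>t. indicator {0..T} t *\<^sub>R r t \<partial>lborel)"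
      by (rule nn_integral_eq_integral) (use si r0 in \<open>auto simp: set_integrable_def indicator_def\<close>)
    also have "(\<integral>t. indicator {0..T} t *\<^sub>R r t \<partial>lborel) = integral {0..T} r"
      using set_borel_integral_eq_integral(2)[OF si] by (simp only: set_lebesgue_integral_def)
    also have "integral {0..T} r = Q * ((2 * C + 1) * T - ((\<Sum>k\<in>K0. e k T) - (\<Sum>k\<in>K0. e k 0)))"
      by (rule integral_unique[OF hr])
    also have "ennreal \<dots> \<le> ennreal (Q * (E0 + (2 * C + 1) * T))"
    proof (intro ennreal_leI mult_left_mono Q)
      have "0 \<le> (\<Sum>k\<in>K0. e k T)" by (intro sum_nonneg e0)
      then show "(2 * C + 1) * T - ((\<Sum>k\<in>K0. e k T) - (\<Sum>k\<in>K0. e k 0)) \<le> E0 + (2 * C + 1) * T"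
        using init'[OF K0(1)] by linarith
    qed
    finally show ?thesis .
  qed
qed

section \<open>Comparison of symbols and the initial energy\<close>

lemma high_cutoff_bounded:
  assumes h: "high_cutoff h"
  obtains H where "\<And>r. 0 \<le> r \<Longrightarrow> \<bar>1 - h r\<bar> \<le> H"
proof -
  have "continuous_on UNIV h" using h unfolding high_cutoff_def smooth_def by (metis Ck.simps(1))
  then have "continuous_on {0..1} (\<lambda>r. 1 - h r)" by (intro continuous_intros) (auto intro: continuous_on_subset)
  then have "bounded ((\<lambda>r. 1 - h r) ` {0..1})" by (intro compact_imp_bounded compact_continuous_image) auto
  then obtain H where H: "\<forall>r\<in>{0..1}. \<bar>1 - h r\<bar> \<le> H" unfolding bounded_iff by auto
  have h1: "\<forall>r\<ge>1. h r = 1" using h by (simp add: high_cutoff_def)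
  have "\<bar>1 - h r\<bar> \<le> max H 0" if "0 \<le> r" for r
    using H h1 that by (cases "r \<le> 1") (auto simp: le_max_iff_disj)
  then show thesis by (rule that)
qed

lemma fourier_uminus:
  assumes u: "torus_distribution u"
  shows "fourier u (- k) = cnj (fourier u k)"
proof -
  have "u (\<lambda>x. (- 1) * sin (2 * pi * (freq k \<bullet> x)) + 0 * sin (2 * pi * (freq k \<bullet> x))) =
     (- 1) * u (\<lambda>x. sin (2 * pi * (freq k \<bullet> x))) + 0 * u (\<lambda>x. sin (2 * pi * (freq k \<bullet> x)))"
    using u torus_test_sin unfolding torus_distribution_def by blast
  then show ?thesis by (simp add: fourier_def freq_uminus complex_eq_iff)
qed

text \<open>Both follow from the lower bound of \<open>msym\<close> by |k|^(2 a); the constant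
  accounts for the factor 2 pi in the frequencies of the fractional Laplacian. This is how the
  energy and the dissipation control the norms in the conclusion.\<close>

lemma symbol_comparison:
  assumes a: "0 < a" "a < 1"
  shows lsym_le_bsym: "(lsym (- 1 + a) k)\<^sup>2 \<le> (2 * pi) powr (2 * a) * bsym a k"
    and lsym_le_msym: "(lsym (1 + a) k)\<^sup>2 \<le> (2 * pi) powr (2 * a) * (msym a k * (2 * pi * nk k)\<^sup>2)"
proof -
  have "(lsym (- 1 + a) k)\<^sup>2 \<le> (2 * pi) powr (2 * a) * bsym a k \<and>
     (lsym (1 + a) k)\<^sup>2 \<le> (2 * pi) powr (2 * a) * (msym a k * (2 * pi * nk k)\<^sup>2)"
  proof (cases "k = 0")
    case True
    then show ?thesis by (simp add: lsym_0 bsym_def)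
  next
    case False
    define p where "p = 2 * pi * nk k"
    have p: "0 < p" using nk_ge_1[OF False] by (simp add: p_def)
    have pa: "p powr (2 * a) \<le> (2 * pi) powr (2 * a) * msym a k"
    proof -
      have "p powr (2 * a) = (2 * pi) powr (2 * a) * nk k powr (2 * a)" unfolding p_def by (rule powr_mult)
      also have "\<dots> \<le> (2 * pi) powr (2 * a) * msym a k" by (intro mult_left_mono msym_lower a) simp
      finally show ?thesis .
    qed
    have 1: "(lsym (- 1 + a) k)\<^sup>2 = p powr (2 * a) / p\<^sup>2"
    proof -
      have "(lsym (- 1 + a) k)\<^sup>2 = p powr (2 * a - 2)"
        unfolding lsym_nk p_def[symmetric] power2_eq_square powr_add[symmetric] by (simp add: algebra_simps)
      also have "\<dots> = p powr (2 * a) / p\<^sup>2" using p by (simp add: powr_diff)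
      finally show ?thesis .
    qed
    have 2: "(lsym (1 + a) k)\<^sup>2 = p powr (2 * a) * p\<^sup>2"
    proof -
      have "(lsym (1 + a) k)\<^sup>2 = p powr (2 * a + 2)"
        unfolding lsym_nk p_def[symmetric] power2_eq_square powr_add[symmetric] by (simp add: algebra_simps)
      also have "\<dots> = p powr (2 * a) * p\<^sup>2" using p by (simp add: powr_add)
      finally show ?thesis .
    qed
    have "p powr (2 * a) / p\<^sup>2 \<le> ((2 * pi) powr (2 * a) * msym a k) / p\<^sup>2" by (intro divide_right_mono pa) simp
    moreover have "p powr (2 * a) * p\<^sup>2 \<le> ((2 * pi) powr (2 * a) * msym a k) * p\<^sup>2" by (intro mult_right_mono pa) simp
    ultimately show ?thesis unfolding 1 2 bsym_def p_def[symmetric] by simp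
  qed
  then show "(lsym (- 1 + a) k)\<^sup>2 \<le> (2 * pi) powr (2 * a) * bsym a k"
    "(lsym (1 + a) k)\<^sup>2 \<le> (2 * pi) powr (2 * a) * (msym a k * (2 * pi * nk k)\<^sup>2)" by blast+
qed

lemma bsym_le_lsym:
  assumes a: "0 < a" "a < 1"
  obtains C where "0 < C" "\<And>k. bsym a k \<le> C * (lsym (- 1 + a) k)\<^sup>2"
proof -
  obtain C where C: "0 < C" "\<And>k. msym a k \<le> C * nk k powr (2 * a)" by (rule msym_upper[OF a], rule that)
  have "bsym a k \<le> C * (lsym (- 1 + a) k)\<^sup>2" for k
  proof (cases "k = 0")
    case False
    define p where "p = 2 * pi * nk k"
    have p: "0 < p" using nk_ge_1[OF False] by (simp add: p_def)
    have np: "nk k \<le> p"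
    proof -
      have "1 * nk k \<le> (2 * pi) * nk k" using pi_gt3 by (intro mult_right_mono) auto
      then show ?thesis by (simp add: p_def)
    qed
    have "msym a k \<le> C * p powr (2 * a)"
      by (rule order_trans[OF C(2)]) (use C(1) np a in \<open>auto intro!: mult_left_mono powr_mono2\<close>)
    then have "bsym a k \<le> C * p powr (2 * a) / p\<^sup>2" unfolding bsym_def p_def[symmetric] by (rule divide_right_mono) simp
    also have "\<dots> = C * p powr (2 * a - 2)" using p by (simp add: powr_diff)
    also have "p powr (2 * a - 2) = (lsym (- 1 + a) k)\<^sup>2"
      unfolding lsym_nk p_def[symmetric] power2_eq_square powr_add[symmetric] by (simp add: algebra_simps)
    finally show ?thesis .
  qed (simp add: bsym_def lsym_0)
  with C(1) show thesis by (rule that)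
qed

text \<open>The low-pass symbol takes values 1 - h with one bound for all \<open>n\<close>, so the
  initial energy is bounded by the norm of \<Psi> uniformly in \<open>n\<close>. Vanishing of the
  mean is inherited from \<Psi>.\<close>

lemma initial_energy:
  assumes h: "high_cutoff h" and a: "0 < a" "a < 1" and \<Psi>: "\<Psi> \<in> Hdot (- 1 + a)"
  obtains E0 where "\<And>n F. 1 \<le> n \<Longrightarrow> finite F \<Longrightarrow> (\<Sum>k\<in>F. bsym a k * (cmod (fc (cx (low_pass h n \<Psi>)) k))\<^sup>2) \<le> E0"
    "\<And>n. 1 \<le> n \<Longrightarrow> fc (cx (low_pass h n \<Psi>)) 0 = 0"
proof -
  obtain B where B: "\<And>F. finite F \<Longrightarrow> (\<Sum>k\<in>F. (lsym (- 1 + a) k)\<^sup>2 * (cmod (fourier \<Psi> k))\<^sup>2) \<le> B"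
    by (rule Hdot_Bessel[OF \<Psi>], rule that)
  obtain H where H: "\<And>r. 0 \<le> r \<Longrightarrow> \<bar>1 - h r\<bar> \<le> H" by (rule high_cutoff_bounded[OF h], rule that)
  obtain C where C: "0 < C" "\<And>k. bsym a k \<le> C * (lsym (- 1 + a) k)\<^sup>2" by (rule bsym_le_lsym[OF a], rule that)
  have dist: "torus_distribution \<Psi>" and F0: "fourier \<Psi> 0 = 0" using \<Psi> by (simp_all add: Hdot_def)
  have f: "fc (cx (low_pass h n \<Psi>)) k = complex_of_real (1 - h (norm (freq k) / real n)) * fourier \<Psi> k" if n: "1 \<le> n" for n k
    unfolding low_pass_def
    by (rule fc_fmult[OF finite_subset[OF high_cutoff_facts[OF h n] finite_nk_le'] _ fourier_uminus[OF dist]])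
       (simp add: freq_uminus)
  show thesis
  proof (rule that)
    fix n F assume n: "1 \<le> (n::nat)" and F: "finite (F :: (int^2) set)"
    have "(\<Sum>k\<in>F. bsym a k * (cmod (fc (cx (low_pass h n \<Psi>)) k))\<^sup>2)
       \<le> (\<Sum>k\<in>F. (C * H\<^sup>2) * ((lsym (- 1 + a) k)\<^sup>2 * (cmod (fourier \<Psi> k))\<^sup>2))"
    proof (rule sum_mono)
      fix k
      let ?r = "1 - h (norm (freq k) / real n)"
      have "?r\<^sup>2 \<le> H\<^sup>2"
      proof -
        have "\<bar>?r\<bar>\<^sup>2 \<le> H\<^sup>2" by (rule power_mono[OF H]) auto
        then show ?thesis by simp
      qed
      then have "?r\<^sup>2 * (cmod (fourier \<Psi> k))\<^sup>2 \<le> H\<^sup>2 * (cmod (fourier \<Psi> k))\<^sup>2" by (rule mult_right_mono) simp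
      then have "bsym a k * (?r\<^sup>2 * (cmod (fourier \<Psi> k))\<^sup>2) \<le> (C * (lsym (- 1 + a) k)\<^sup>2) * (H\<^sup>2 * (cmod (fourier \<Psi> k))\<^sup>2)"
        using C a by (intro mult_mono[OF _ \<open>?r\<^sup>2 * (cmod (fourier \<Psi> k))\<^sup>2 \<le> H\<^sup>2 * (cmod (fourier \<Psi> k))\<^sup>2\<close>]) (auto simp: bsym_nonneg)
      then show "bsym a k * (cmod (fc (cx (low_pass h n \<Psi>)) k))\<^sup>2 \<le> (C * H\<^sup>2) * ((lsym (- 1 + a) k)\<^sup>2 * (cmod (fourier \<Psi> k))\<^sup>2)"
        unfolding f[OF n] norm_mult power_mult_distrib norm_of_real power2_abs by (simp only: mult_ac)
    qed
    also have "\<dots> = (C * H\<^sup>2) * (\<Sum>k\<in>F. (lsym (- 1 + a) k)\<^sup>2 * (cmod (fourier \<Psi> k))\<^sup>2)" by (simp only: sum_distrib_left)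
    also have "\<dots> \<le> (C * H\<^sup>2) * B" using C(1) by (intro mult_left_mono B F) auto
    finally show "(\<Sum>k\<in>F. bsym a k * (cmod (fc (cx (low_pass h n \<Psi>)) k))\<^sup>2) \<le> (C * H\<^sup>2) * B" .
  next
    fix n assume n: "1 \<le> (n::nat)"
    show "fc (cx (low_pass h n \<Psi>)) 0 = 0" unfolding f[OF n] F0 by simp
  qed
qed

lemma CtCs_norm_le:
  assumes "CtCs_norm \<theta> \<rho> T s f \<le> ennreal K" and "t \<in> {0..T}"
  shows "Cs_norm \<theta> \<rho> s (f t) \<le> ennreal K"
proof -
  have "CtCs_norm \<theta> \<rho> T s f < \<infinity>" using assms(1) by (rule order.strict_trans1) simp
  then have "CtCs_norm \<theta> \<rho> T s f = (SUP r\<in>{0..T}. Cs_norm \<theta> \<rho> s (f r))"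
    unfolding CtCs_norm_def by (auto split: if_splits)
  moreover have "Cs_norm \<theta> \<rho> s (f t) \<le> (SUP r\<in>{0..T}. Cs_norm \<theta> \<rho> s (f r))" by (rule SUP_upper[OF assms(2)])
  ultimately show ?thesis using assms(1) by simp
qed

theorem proposition3p3:
  fixes M :: "'w measure"
    and \<xi> :: "'w noise"
    and h :: "real \<Rightarrow> real"
    and \<theta> \<rho> :: "real^2 \<Rightarrow> real"
    and X :: "real \<Rightarrow> 'w \<Rightarrow> torus_dist"
    and Y :: "nat \<Rightarrow> 'w \<Rightarrow> real \<Rightarrow> real^2 \<Rightarrow> real"
    and N :: "'w set" and \<omega> :: 'w and \<alpha> T :: real and \<Psi> :: torus_dist
  assumes "prob_space M"
    and "white_noise M \<xi>"
    and "high_cutoff h"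
    and "dyadic_partition \<theta> \<rho>"
    and "stochastic_convolution M \<xi> X"
    and "N \<in> null_sets M"
    and "\<forall>n\<ge>1. \<forall>\<omega>'\<in>space M - N. Y_solution M h X n \<omega>' (Y n \<omega>')"
    and "\<forall>\<omega>'\<in>space M - N. \<forall>t\<ge>0. \<forall>\<kappa>>0. L_sup M h \<theta> \<rho> X Y \<kappa> t \<omega>' < \<infinity>"
    and "\<omega> \<in> space M - N"
    and "0 < \<alpha>" and "\<alpha> < 1"
    and "\<Psi> \<in> Hdot (- 1 + \<alpha>)"
    and "0 < T"
  shows "\<exists>C::real. \<forall>n\<ge>1. \<forall>w. w_solution M h X Y T \<Psi> n \<omega> w \<longrightarrow>
    (SUP t\<in>{0..T}. (Hdot_norm (- 1 + \<alpha>) (dist_of (w t)))\<^sup>2)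
      + (\<integral>\<^sup>+t\<in>{0..T}. ((Hdot_norm (1 + \<alpha>) (dist_of (w t)))\<^sup>2
            + (torus_Lp_norm (4 / (1 - \<alpha>)) (w t)) ^ 4) \<partial>lborel) \<le> ennreal C"
proof -
  note ps = assms(1) and wn = assms(2) and h = assms(3) and dp = assms(4) and sc = assms(5)
    and a = assms(10,11) and \<Psi> = assms(12) and T = assms(13)
  \<comment> \<open>The product of \<alpha> and 1 - \<alpha> yields 2 s < \<alpha> and s + \<alpha>
    < 1 for all \<alpha> at once, and the divisor 4 also keeps s below 1/4.\<close>
  define s where "s = \<alpha> * (1 - \<alpha>) / 4"
  have s0: "0 < s" using a by (simp add: s_def)
  have s1: "s < \<alpha> / 2" and s2: "s < 1 - \<alpha>"
  proof -
    have "\<alpha> * (1 - \<alpha>) < \<alpha> * 1" using a by (intro mult_strict_left_mono) auto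
    moreover have "\<alpha> * (1 - \<alpha>) < 1 * (1 - \<alpha>)" using a by (intro mult_strict_right_mono) auto
    ultimately have "s * 4 < \<alpha>" "s * 4 < 1 - \<alpha>" by (simp_all add: s_def)
    then show "s < \<alpha> / 2" "s < 1 - \<alpha>" using a by auto
  qed
  have s4: "s < 1 / 4"
  proof -
    have "\<alpha> * (1 - \<alpha>) < 1 * 1" using a by (intro mult_strict_mono) auto
    then show ?thesis by (simp add: s_def)
  qed
  \<comment> \<open>With \<kappa> = s / 4 the noise has regularity -s/4, its Wick square -s/2, and
    the auxiliary solution 2 - s: the first two lose less than \<open>s\<close>, as the duality
    estimate requires.\<close>
  define K where "K = enn2real (L_sup M h \<theta> \<rho> X Y (s / 4) T \<omega>)"
  have K0: "0 \<le> K" by (simp add: K_def)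
  have LK: "L_n M h \<theta> \<rho> X Y (s / 4) n T \<omega> \<le> ennreal K" if n: "1 \<le> n" for n
  proof -
    have fin: "L_sup M h \<theta> \<rho> X Y (s / 4) T \<omega> < \<infinity>" using assms(8,9) T s0 by simp
    have "L_n M h \<theta> \<rho> X Y (s / 4) n T \<omega> \<le> L_sup M h \<theta> \<rho> X Y (s / 4) T \<omega>"
      unfolding L_sup_def by (rule SUP_upper) (use n in simp)
    also have "\<dots> = ennreal K" using fin by (simp add: K_def ennreal_enn2real)
    finally show ?thesis .
  qed
  have KX: "CtCs_norm \<theta> \<rho> T (- (s / 4)) (\<lambda>r. dist_of (Xn h X n \<omega> r)) \<le> ennreal K"
    and KX2: "CtCs_norm \<theta> \<rho> T (- (s / 2)) (\<lambda>r. dist_of (Xn_wick2 M h X n \<omega> r)) \<le> ennreal K"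
    and KY: "CtCs_norm \<theta> \<rho> T (2 - s) (\<lambda>r. dist_of (Y n \<omega> r)) \<le> ennreal K" if n: "1 \<le> n" for n
  proof -
    have e: "- 2 * (s / 4) = - (s / 2)" "2 - 4 * (s / 4) = 2 - s" by simp_all
    note L = LK[OF n, unfolded L_n_def e]
    show "CtCs_norm \<theta> \<rho> T (- (s / 4)) (\<lambda>r. dist_of (Xn h X n \<omega> r)) \<le> ennreal K"
      by (rule order_trans[OF _ L]) (simp add: add_increasing add_increasing2)
    show "CtCs_norm \<theta> \<rho> T (- (s / 2)) (\<lambda>r. dist_of (Xn_wick2 M h X n \<omega> r)) \<le> ennreal K"
      by (rule order_trans[OF _ L]) (simp add: add_increasing add_increasing2)
    show "CtCs_norm \<theta> \<rho> T (2 - s) (\<lambda>r. dist_of (Y n \<omega> r)) \<le> ennreal K"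
      by (rule order_trans[OF _ L]) (simp add: add_increasing add_increasing2)
  qed
  \<comment> \<open>The weight 2 s lies strictly above \<open>s\<close>, as multiplication needs,
    and the embedding requires 1 + 2 s < 2 - s, which holds since s < 1/4.\<close>
  obtain Cw where Cw: "0 \<le> Cw"
    "\<And>Y K. torus_test Y \<Longrightarrow> Cs_norm \<theta> \<rho> (2 - s) (dist_of Y) \<le> ennreal K \<Longrightarrow> 0 \<le> K \<Longrightarrow> wiener (2 * s) (Cw * K) Y"
    by (rule wiener_Cs[OF dp, of "2 * s" "2 - s"]) (use s0 s4 that in auto)
  define A where "A = Cw * K"
  have A0: "0 \<le> A" using Cw(1) K0 by (simp add: A_def)
  have c1: "2 * s < \<alpha>" "s + \<alpha> < 1" "s < 2 * s" "2 * s \<le> 1" "0 < s / 4" "s / 4 < s" "0 < s / 2" "s / 2 < s"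
    using s0 s1 s2 s4 by simp_all
  obtain C where C: "0 \<le> C"
    "\<And>w X X2 Y. torus_test w \<Longrightarrow> tint w = 0 \<Longrightarrow> trigpoly (cx X) \<Longrightarrow> Cs_norm \<theta> \<rho> (- (s / 4)) (dist_of X) \<le> ennreal K \<Longrightarrow>
      trigpoly (cx X2) \<Longrightarrow> Cs_norm \<theta> \<rho> (- (s / 2)) (dist_of X2) \<le> ennreal K \<Longrightarrow> wiener (2 * s) A Y \<Longrightarrow>
      \<bar>Qf \<alpha> (\<lambda>x. 3 * w x * (Y x)\<^sup>2 + 3 * (w x)\<^sup>2 * Y x + Y x ^ 3
          + 3 * ((w x)\<^sup>2 + 2 * w x * Y x + (Y x)\<^sup>2) * X x + 3 * w x * X2 x) w\<bar>
       \<le> Df \<alpha> w / 2 + Gf \<alpha> w / 2 + C"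
    by (rule nonlinear_estimate[OF dp a(1) s0 c1 A0 K0], rule that)
  obtain E0 where E0: "\<And>n F. 1 \<le> n \<Longrightarrow> finite F \<Longrightarrow> (\<Sum>k\<in>F. bsym \<alpha> k * (cmod (fc (cx (low_pass h n \<Psi>)) k))\<^sup>2) \<le> E0"
    "\<And>n. 1 \<le> n \<Longrightarrow> fc (cx (low_pass h n \<Psi>)) 0 = 0"
    by (rule initial_energy[OF h a \<Psi>], rule that)
  obtain CL where CL: "0 \<le> CL" "\<And>w. torus_test w \<Longrightarrow> torus_Lp_norm (4 / (1 - \<alpha>)) w ^ 4 \<le> ennreal (CL * Nf \<alpha> (\<lambda>x. (w x)\<^sup>2))"
    by (rule Lp_norm_le[OF a], rule that)
  obtain Cg where Cg: "0 < Cg"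
    "\<And>w. torus_test w \<Longrightarrow> tint w = 0 \<Longrightarrow> Nf \<alpha> (\<lambda>x. (w x)\<^sup>2) \<le> Cg * Gf \<alpha> w"
    by (rule good_term_bounds[OF s0 c1(1) a(2)], rule that)
  define c where "c = (2 * pi) powr (2 * \<alpha>)"
  \<comment> \<open>\<open>c\<close> converts the dissipation into the norm of order 1 + \<alpha>,
    and \<open>CL * Cg\<close> converts the good term into the Lebesgue norm; the sum serves for
    both.\<close>
  define Q where "Q = c + CL * Cg"
  define Et where "Et = E0 + (2 * C + 1) * T"
  have c0: "0 \<le> c" and Q0: "0 \<le> Q" using CL(1) Cg(1) by (simp_all add: c_def Q_def)
  have main: "(SUP t\<in>{0..T}. (Hdot_norm (- 1 + \<alpha>) (dist_of (w t)))\<^sup>2)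
      + (\<integral>\<^sup>+t\<in>{0..T}. ((Hdot_norm (1 + \<alpha>) (dist_of (w t)))\<^sup>2
            + (torus_Lp_norm (4 / (1 - \<alpha>)) (w t)) ^ 4) \<partial>lborel) \<le> ennreal (c * Et + Q * Et)"
    if n: "1 \<le> n" and w: "w_solution M h X Y T \<Psi> n \<omega> w" for n w
  proof -
    let ?Y = "Y n \<omega>" and ?X = "Xn h X n \<omega>" and ?X2 = "Xn_wick2 M h X n \<omega>"
    define P where "P t x = 3 * w t x * (?Y t x)\<^sup>2 + 3 * (w t x)\<^sup>2 * ?Y t x + ?Y t x ^ 3
          + 3 * ((w t x)\<^sup>2 + 2 * w t x * ?Y t x + (?Y t x)\<^sup>2) * ?X t x + 3 * w t x * ?X2 t x" for t x
    have "(\<lambda>t x. (w t x) ^ 3 + 3 * w t x * (Y n \<omega> t x)\<^sup>2 + 3 * (w t x)\<^sup>2 * Y n \<omega> t x + (Y n \<omega> t x) ^ 3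
          + 3 * ((w t x)\<^sup>2 + 2 * w t x * Y n \<omega> t x + (Y n \<omega> t x)\<^sup>2) * Xn h X n \<omega> t x
          + 3 * w t x * Xn_wick2 M h X n \<omega> t x) = (\<lambda>t x. w t x ^ 3 + P t x)"
      by (intro ext) (simp add: P_def)
    then have sol: "smooth_solution {0..T} (\<lambda>t x. w t x ^ 3 + P t x) w"
      and w0: "w 0 = low_pass h n \<Psi>"
      using w unfolding w_solution_def by auto
    have Ckw: "\<And>k. Ck_space k {0..T} w" and perw: "\<And>t. t \<in> {0..T} \<Longrightarrow> periodic (w t)"
      using sol by (simp_all add: smooth_solution_def)
    have "Y_solution M h X n \<omega> ?Y" using assms(7,9) n by simp
    then have CkY0: "\<And>k. Ck_space k {0..} ?Y" and perY: "\<And>t. t \<in> {0..T} \<Longrightarrow> periodic (?Y t)"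
      by (simp_all add: Y_solution_def smooth_solution_def)
    have CkY: "Ck_space k {0..T} ?Y" for k by (rule Ck_space_subset[OF CkY0]) auto
    have bX: "bandlimited (real n) (cx (?X t))" for t by (rule bandlimited_Xn[OF h n])
    have bX2: "bandlimited (2 * real n) (cx (?X2 t))" if "t \<in> {0..T}" for t
      by (rule bandlimited_Xn_wick2[OF ps wn h n sc]) (use that in simp)
    have finX: "CtCs_norm \<theta> \<rho> T (- (s / 4)) (\<lambda>r. dist_of (?X r)) < \<infinity>"
      using KX[OF n] by (rule order.strict_trans1) simp
    have finX2: "CtCs_norm \<theta> \<rho> T (- (s / 2)) (\<lambda>r. dist_of (?X2 r)) < \<infinity>"
      using KX2[OF n] by (rule order.strict_trans1) simp
    \<comment> \<open>Continuity in time of the regularised noise for the given \<omega> comes from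
      finiteness of its norm in \<open>CtCs_norm\<close>; smoothness in space comes from the band
      limit.\<close>
    have CkX: "Ck_space k {0..T} ?X" for k
      by (rule Ck_space_bandlimited[OF bX CtCs_norm_continuous[OF dp finX]]) (use bX in \<open>simp add: bandlimited_def\<close>)
    have CkX2: "Ck_space k {0..T} ?X2" for k
      by (rule Ck_space_bandlimited[OF bX2 CtCs_norm_continuous[OF dp finX2]]) (use bX2 in \<open>simp_all add: bandlimited_def\<close>)
    have perX: "periodic (?X t)" for t using bX[of t] by (simp add: bandlimited_def cper_cx_iff)
    have perX2: "periodic (?X2 t)" if "t \<in> {0..T}" for t using bX2[OF that] by (simp add: bandlimited_def cper_cx_iff)
    have CkP: "Ck_space k {0..T} P" for k
      unfolding P_def[abs_def] by (intro Ck_space_add Ck_space_mult Ck_space_power Ckw CkY CkX CkX2 Ck_space_const continuous_on_const)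
    have perP: "periodic (P t)" if t: "t \<in> {0..T}" for t
      using perw[OF t] perY[OF t] perX[of t] perX2[OF t] unfolding P_def[abs_def] periodic_def by simp
    have tw: "torus_test (w t)" and tY: "torus_test (?Y t)" if t: "t \<in> {0..T}" for t
      by (rule Ck_space_torus_test[OF Ckw perw[OF t] t], rule Ck_space_torus_test[OF CkY perY[OF t] t])
    have t0: "0 \<in> {0..T}" using T by simp
    have m0: "tint (w 0) = 0"
      using fc_cx_0[OF torus_test_cper[OF tw[OF t0]]] E0(2)[OF n] by (simp add: w0)
    have est: "\<bar>Qf \<alpha> (P t) (w t)\<bar> \<le> Df \<alpha> (w t) / 2 + Gf \<alpha> (w t) / 2 + C" if t: "t \<in> {0..T}" and m: "tint (w t) = 0" for t
    proof -
      have wY: "wiener (2 * s) A (?Y t)"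
        unfolding A_def by (rule Cw(2)[OF tY[OF t] CtCs_norm_le[OF KY[OF n] t] K0])
      show ?thesis
        unfolding P_def
        by (rule C(2)[OF tw[OF t] m bandlimited_trigpoly[OF bX] CtCs_norm_le[OF KX[OF n] t]
              bandlimited_trigpoly[OF bX2[OF t]] CtCs_norm_le[OF KX2[OF n] t] wY])
    qed
    have init: "(\<Sum>k\<in>F. bsym \<alpha> k * (cmod (fc (cx (w 0)) k))\<^sup>2) \<le> E0" if "finite F" for F
      unfolding w0 by (rule E0(1)[OF n that])
    have mean: "tint (w t) = 0" if t: "t \<in> {0..T}" for t
      by (rule energy_mean_zero[OF a T sol CkP _ m0 C(1) _ _ t]) (rule perP est init; assumption)+
    have en_sup: "(\<Sum>k\<in>F. bsym \<alpha> k * (cmod (fc (cx (w t)) k))\<^sup>2) \<le> E0 + (2 * C + 1) * T"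
      if t: "t \<in> {0..T}" and F: "finite F" for t F
      by (rule energy_sup[OF a T sol CkP _ m0 C(1) _ _ t F]) (rule perP est init; assumption)+
    have en_int: "(\<integral>\<^sup>+t\<in>{0..T}. ennreal (q * (Df \<alpha> (w t) + Gf \<alpha> (w t))) \<partial>lborel) \<le> ennreal (q * (E0 + (2 * C + 1) * T))"
      if q: "0 \<le> q" for q
      by (rule energy_integral[OF a T sol CkP _ m0 C(1) _ _ q]) (rule perP est init; assumption)+
    have sup: "(Hdot_norm (- 1 + \<alpha>) (dist_of (w t)))\<^sup>2 \<le> ennreal (c * Et)" if t: "t \<in> {0..T}" for t
    proof (rule Hdot_norm_le[OF tw[OF t]])
      show "- 1 + \<alpha> \<le> 2" using a by simp
      fix F :: "(int^2) set" assume F: "finite F"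
      have "(\<Sum>k\<in>F. (lsym (- 1 + \<alpha>) k)\<^sup>2 * (cmod (fc (cx (w t)) k))\<^sup>2) \<le> (\<Sum>k\<in>F. (c * bsym \<alpha> k) * (cmod (fc (cx (w t)) k))\<^sup>2)"
        unfolding c_def by (intro sum_mono mult_right_mono lsym_le_bsym a) simp
      also have "\<dots> = c * (\<Sum>k\<in>F. bsym \<alpha> k * (cmod (fc (cx (w t)) k))\<^sup>2)" by (simp only: sum_distrib_left mult.assoc)
      also have "\<dots> \<le> c * Et" unfolding Et_def by (rule mult_left_mono[OF en_sup[OF t F] c0])
      finally show "(\<Sum>k\<in>F. (lsym (- 1 + \<alpha>) k)\<^sup>2 * (cmod (fc (cx (w t)) k))\<^sup>2) \<le> c * Et" .
    qed
    have pt: "(Hdot_norm (1 + \<alpha>) (dist_of (w t)))\<^sup>2 + (torus_Lp_norm (4 / (1 - \<alpha>)) (w t)) ^ 4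
        \<le> ennreal (Q * (Df \<alpha> (w t) + Gf \<alpha> (w t)))" if t: "t \<in> {0..T}" for t
    proof -
      have D0: "0 \<le> Df \<alpha> (w t)" and G0: "0 \<le> Gf \<alpha> (w t)" by (rule Df_nonneg[OF a tw[OF t]], rule Gf_nonneg[OF a tw[OF t]])
      have 1: "(Hdot_norm (1 + \<alpha>) (dist_of (w t)))\<^sup>2 \<le> ennreal (c * Df \<alpha> (w t))"
      proof (rule Hdot_norm_le[OF tw[OF t]])
        show "1 + \<alpha> \<le> 2" using a by simp
        fix F :: "(int^2) set" assume F: "finite F"
        have "(\<Sum>k\<in>F. (lsym (1 + \<alpha>) k)\<^sup>2 * (cmod (fc (cx (w t)) k))\<^sup>2) \<le>
           (\<Sum>k\<in>F. (c * (msym \<alpha> k * (2 * pi * nk k)\<^sup>2)) * (cmod (fc (cx (w t)) k))\<^sup>2)"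
          unfolding c_def by (intro sum_mono mult_right_mono lsym_le_msym a) simp
        also have "\<dots> = c * (\<Sum>k\<in>F. msym \<alpha> k * (2 * pi * nk k)\<^sup>2 * (cmod (fc (cx (w t)) k))\<^sup>2)"
          by (simp only: sum_distrib_left mult.assoc)
        also have "\<dots> \<le> c * Df \<alpha> (w t)"
          using a by (intro mult_left_mono finite_sum_le_has_sum[OF Df_has_sum[OF a tw[OF t]] F] c0) (auto simp: msym_nonneg)
        finally show "(\<Sum>k\<in>F. (lsym (1 + \<alpha>) k)\<^sup>2 * (cmod (fc (cx (w t)) k))\<^sup>2) \<le> c * Df \<alpha> (w t)" .
      qed
      have "CL * Nf \<alpha> (\<lambda>x. (w t x)\<^sup>2) \<le> CL * (Cg * Gf \<alpha> (w t))"
        by (rule mult_left_mono[OF Cg(2)[OF tw[OF t] mean[OF t]] CL(1)])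
      then have 2: "(torus_Lp_norm (4 / (1 - \<alpha>)) (w t)) ^ 4 \<le> ennreal (CL * (Cg * Gf \<alpha> (w t)))"
        by (rule order_trans[OF CL(2)[OF tw[OF t]] ennreal_leI])
      have "(Hdot_norm (1 + \<alpha>) (dist_of (w t)))\<^sup>2 + (torus_Lp_norm (4 / (1 - \<alpha>)) (w t)) ^ 4
         \<le> ennreal (c * Df \<alpha> (w t)) + ennreal (CL * (Cg * Gf \<alpha> (w t)))" by (rule add_mono[OF 1 2])
      also have "\<dots> = ennreal (c * Df \<alpha> (w t) + CL * Cg * Gf \<alpha> (w t))"
        using c0 D0 G0 CL(1) Cg(1) by (simp add: ennreal_plus mult.assoc)
      also have "\<dots> \<le> ennreal (Q * (Df \<alpha> (w t) + Gf \<alpha> (w t)))"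
      proof (rule ennreal_leI)
        have "c * Df \<alpha> (w t) \<le> Q * Df \<alpha> (w t)" "CL * Cg * Gf \<alpha> (w t) \<le> Q * Gf \<alpha> (w t)"
          using c0 D0 G0 CL(1) Cg(1) by (auto intro!: mult_right_mono simp: Q_def)
        then show "c * Df \<alpha> (w t) + CL * Cg * Gf \<alpha> (w t) \<le> Q * (Df \<alpha> (w t) + Gf \<alpha> (w t))"
          by (simp add: distrib_left)
      qed
      finally show ?thesis .
    qed
    have "(SUP t\<in>{0..T}. (Hdot_norm (- 1 + \<alpha>) (dist_of (w t)))\<^sup>2) \<le> ennreal (c * Et)"
      by (rule SUP_least) (rule sup)
    moreover have "(\<integral>\<^sup>+t\<in>{0..T}. ((Hdot_norm (1 + \<alpha>) (dist_of (w t)))\<^sup>2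
            + (torus_Lp_norm (4 / (1 - \<alpha>)) (w t)) ^ 4) \<partial>lborel) \<le> ennreal (Q * Et)"
    proof -
      have "(\<integral>\<^sup>+t\<in>{0..T}. ((Hdot_norm (1 + \<alpha>) (dist_of (w t)))\<^sup>2
            + (torus_Lp_norm (4 / (1 - \<alpha>)) (w t)) ^ 4) \<partial>lborel) \<le> (\<integral>\<^sup>+t\<in>{0..T}. ennreal (Q * (Df \<alpha> (w t) + Gf \<alpha> (w t))) \<partial>lborel)"
        by (intro nn_integral_mono) (use pt in \<open>auto simp: indicator_def\<close>)
      also have "\<dots> \<le> ennreal (Q * Et)" unfolding Et_def by (rule en_int[OF Q0])
      finally show ?thesis .
    qed
    moreover have "0 \<le> Et"
    proof -
      have "0 \<le> E0" using init[of "{}"] by simp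
      then show ?thesis using C(1) T by (simp add: Et_def)
    qed
    ultimately show ?thesis
      using c0 Q0 by (subst ennreal_plus) (auto intro!: add_mono)
  qed
  show ?thesis by (rule exI[of _ "c * Et + Q * Et"]) (use main in blast)
qed

end
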